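(* Let $E$ be a finitely acting unital operator algebra, let $\mathcal F$ be a closed family of star-extendible embeddings between the operator algebras $E\otimes M_n$, $n=1,2,\dots$, and let $A_0$ and $A_0'$ belong to $\mathrm{Alglim}(\tilde{\mathcal F})$, with dimension modules $V_{\mathcal F}(A_0),V_{\mathcal F}(A_0')$ and scales $\Sigma_{\mathcal F}(A_0),\Sigma_{\mathcal F}(A_0')$ determined by their given direct systems. (1) If $\Gamma$ is a $V_{\mathcal F}$-module isomorphism from $V_{\mathcal F}(A_0)$ to $V_{\mathcal F}(A_0')$, then $A_0\otimes\mathcal K$ and $A_0'\otimes\mathcal K$ are star-extendibly isomorphic. If, moreover, $\Gamma$ gives a bijection from $\Sigma_{\mathcal F}(A_0)$ to $\Sigma_{\mathcal F}(A_0')$, then $A_0$ and $A_0'$ are star-extendibly isomorphic. (2) If $\mathcal F$ is functorial, then the converses of these assertions hold: the $V_{\mathcal F}$-module $V_{\mathcal F}(-)$ is a complete invariant for stable star-extendible isomorphism (that is, star-extendible isomorphism of $A_0\otimes\mathcal K$ and $A_0'\otimes\mathcal K$), whilst the pair $(V_{\mathcal F}(-),\Sigma_{\mathcal F}(-))$ is a complete invariant for star-extendible isomorphism.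
   Context: An operator algebra $A$ is an algebra of Hilbert space operators, given with its generated C*-algebra $C^*(A)$. A homomorphism $A\to B$ is star-extendible (and is then called a map) if it is the restriction of a *-homomorphism $C^*(A)\to C^*(B)$; a star-extendible isomorphism is an isomorphism which is the restriction of a *-isomorphism of the generated C*-algebras. $E$ is finitely acting if $C^*(E)$ is finite-dimensional. $\mathcal K$ is the algebra of compact operators on a separable Hilbert space; for the locally finite algebras $A_0$ here, $A_0\otimes\mathcal K$ is read as the algebraic limit $\bigcup_n A_0\otimes M_n$ under corner inclusions. Two maps $\phi,\psi$ into $B$ are inner unitarily equivalent if $\phi=(\mathrm{Ad}\,u)\circ\psi$ for a unitary $u$ in $B$ (in the unitisation of $B$ if $B$ is nonunital). Closed family: a family $\mathcal F$ of maps such that (i) $\mathcal F$ is closed under inner unitary conjugacy; (ii) $\mathcal F$ is closed under compositions where defined; (iii) $\mathcal F$ is matricially stable: if $\phi:A_1\to A_2$ is in $\mathcal F$ then $\phi\otimes\mathrm{id}:A_1\otimes M_n\to A_2\otimes M_n$ is in $\mathcal F$; (iv) $\mathcal F$ is sum closed: if $\phi,\psi:A_1\to A_2$ are in $\mathcal F$ then $\phi\oplus\psi:A_1\to A_2\otimes M_2$ is in $\mathcal F$; (v) $\mathcal F$ is complete with respect to the norm topology. An elementary $E$-algebra is a finite direct sum $E\otimes M_{n_1}\oplus\dots\oplus E\otimes M_{n_r}$. $\tilde{\mathcal F}$ is the family of maps between elementary $E$-algebras all of whose partial maps (from a summand of the domain to a summand of the range) belong to $\mathcal F$. $\mathrm{Alglim}(\tilde{\mathcal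 F})$ is the class of algebraic direct limits $A_0=\mathrm{alg}\varinjlim(A_k,\phi_k)$ of sequences of elementary $E$-algebras with all $\phi_k\in\tilde{\mathcal F}$. A map $E\to E\otimes M_n$ is identified, via $E=E\otimes p$ with $p$ a rank one projection, with the map $E\otimes\mathcal K\to E\otimes\mathcal K$ which it induces. $V_{\mathcal F}$ is the set of inner unitary equivalence classes $[\phi]$ of the maps on $E\otimes\mathcal K$ induced by the maps in $\mathcal F$; it is a semiring, with zero and multiplicative identity, under $[\phi]+[\psi]=[\phi\oplus\psi]$ and $[\phi][\psi]=[\phi\circ\psi]$. For an elementary $E$-algebra $B$ with $r$ summands, $V_{\mathcal F}(B)$ is the right $V_{\mathcal F}$-module which is the direct sum of $r$ copies of $V_{\mathcal F}$, viewed as the additive semigroup of inner unitary equivalence classes of maps $\psi:E\to B\otimes\mathcal K$ whose partial maps belong to $\mathcal F$, with right action $[\psi][\theta]=[\psi\circ\theta]$ (using induced maps). Its scale $\Sigma_{\mathcal F}(B)$ is the subset of classes $[\psi]$ with $\psi:E\to B$, where $B$ is identified with $B\otimes\mathbb Cp$. Each $\phi_k$ induces a $V_{\mathcal F}$-module homomorphism $\hat\phi_k:V_{\mathcal F}(A_k)\to V_{\mathcal F}(A_{k+1})$, $[\psi]\mapsto[\phi_k\circ\psi]$. The dimension module $V_{\mathcal F}(A_0)$ is the direct limit $\varinjlim(V_{\mathcal F}(A_k),\hat\phi_k)$ of additive abelian semigroups with the induced right $V_{\mathcal F}$-action, and its scale $\Sigma_{\mathcal F}(A_0)$ is the union of the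 images of the $\Sigma_{\mathcal F}(A_k)$. A $V_{\mathcal F}$-module isomorphism is an additive semigroup isomorphism commuting with the right $V_{\mathcal F}$-actions. Functorial: a closed family $\mathcal F$ is functorial if for any two direct systems $A_1\to A_2\to\cdots$ and $A_1'\to A_2'\to\cdots$ with maps in $\mathcal F$, and any star-extendible homomorphisms $A_k\to A_k'$, $A_k'\to A_{k+1}$ (crossover maps) making the diagram between the two systems commute, there are sequences $(n_k),(m_k)$ such that in the induced commuting diagram the crossover maps $A_{n_k}\to A'_{m_k}$ and $A'_{m_k}\to A_{n_{k+1}}$ all belong to $\mathcal F$.
   Formalization: F is also required to contain all zero and identity maps, and membership in F of a map into E⊗M_m must not change when E⊗M_m is viewed as a corner of a larger E⊗M_k (without this, (1) can fail); functoriality is taken for systems of elementary E-algebras with maps in F̃. *)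

theory Defs
  imports "HOL-Analysis.Analysis"
begin

section \<open>Complex Hilbert spaces and operators on them\<close>

text \<open>
  HOL-Analysis has only real inner product spaces. A complex Hilbert space is a complete one with
  a complex scalar multiplication and a sesquilinear form whose real part is the given real inner
  product; norm and topology are therefore the library's.
\<close>

class complex_hilbert = real_inner + complete_space +
  fixes scaleC :: "complex \<Rightarrow> 'a \<Rightarrow> 'a" (infixr "*\<^sub>C" 75)
    and cinner :: "'a \<Rightarrow> 'a \<Rightarrow> complex"
  assumes scaleC_add_right: "c *\<^sub>C (x + y) = c *\<^sub>C x + c *\<^sub>C y"
    and scaleC_add_left: "(c + d) *\<^sub>C x = c *\<^sub>C x + d *\<^sub>C x"
    and scaleC_scaleC: "c *\<^sub>C d *\<^sub>C x = (c * d) *\<^sub>C x"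
    and scaleR_scaleC: "r *\<^sub>R x = complex_of_real r *\<^sub>C x"
    and cinner_commute: "cinner x y = cnj (cinner y x)"
    and cinner_add_left: "cinner (x + y) z = cinner x z + cinner y z"
    and cinner_scaleC_left: "cinner (c *\<^sub>C x) y = cnj c * cinner x y"
    and inner_cinner: "inner x y = Re (cinner x y)"

instantiation complex :: complex_hilbert
begin

definition "scaleC c (x::complex) = c * x"
definition "cinner x (y::complex) = cnj x * y"

instance
  by standard (auto simp: scaleC_complex_def cinner_complex_def inner_complex_def
      algebra_simps scaleR_conv_of_real)

end

instantiation vec :: (complex_hilbert, finite) complex_hilbert
begin

definition "scaleC c (x::'a ^ 'b) = (\<chi> i. c *\<^sub>C (x $ i))"
definition "cinner x (y::'a ^ 'b) = (\<Sum>i\<in>UNIV. cinner (x $ i) (y $ i))"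

instance
proof
  fix x y :: "'a ^ 'b"
  have "cinner (x $ i) (y $ i) = cnj (cinner (y $ i) (x $ i))" for i
    by (rule cinner_commute)
  then show "cinner x y = cnj (cinner y x)"
    unfolding cinner_vec_def cnj_sum by (rule sum.cong[OF refl])
qed (auto simp: scaleC_vec_def cinner_vec_def vec_eq_iff scaleC_add_right scaleC_add_left
    scaleC_scaleC scaleR_scaleC cinner_add_left cinner_scaleC_left inner_cinner inner_vec_def
    sum.distrib sum_distrib_left)

end

definition op_scale :: "complex \<Rightarrow> ('h \<Rightarrow>\<^sub>L 'h) \<Rightarrow> ('h::complex_hilbert \<Rightarrow>\<^sub>L 'h)" where
  "op_scale c T = Blinfun (\<lambda>x. c *\<^sub>C blinfun_apply T x)"

definition op_adj :: "('h \<Rightarrow>\<^sub>L 'h) \<Rightarrow> ('h::complex_hilbert \<Rightarrow>\<^sub>L 'h)" where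
  "op_adj T = (THE S. \<forall>x y. cinner (blinfun_apply T x) y = cinner x (blinfun_apply S y))"

text \<open>The elements of \<^typ>\<open>'h \<Rightarrow>\<^sub>L 'h\<close> are real-linear, so complex linearity is a condition.\<close>

definition operator_algebra :: "('h::complex_hilbert \<Rightarrow>\<^sub>L 'h) set \<Rightarrow> bool" where
  "operator_algebra E \<longleftrightarrow>
     (\<forall>T\<in>E. \<forall>c x. blinfun_apply T (c *\<^sub>C x) = c *\<^sub>C blinfun_apply T x) \<and>
     0 \<in> E \<and> (\<forall>S\<in>E. \<forall>T\<in>E. S + T \<in> E) \<and> (\<forall>c. \<forall>T\<in>E. op_scale c T \<in> E) \<and>
     (\<forall>S\<in>E. \<forall>T\<in>E. S o\<^sub>L T \<in> E)"

definition unital_operator_algebra :: "('h::complex_hilbert \<Rightarrow>\<^sub>L 'h) set \<Rightarrow> bool" where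
  "unital_operator_algebra E \<longleftrightarrow> operator_algebra E \<and> id_blinfun \<in> E"

definition generated_cstar :: "('h::complex_hilbert \<Rightarrow>\<^sub>L 'h) set \<Rightarrow> ('h \<Rightarrow>\<^sub>L 'h) set" where
  "generated_cstar E =
     \<Inter>{B. E \<subseteq> B \<and> operator_algebra B \<and> (\<forall>T\<in>B. op_adj T \<in> B) \<and> closed B}"

text \<open>Finite dimension over the reals and over the complex numbers is the same condition.\<close>

definition finitely_acting :: "('h::complex_hilbert \<Rightarrow>\<^sub>L 'h) set \<Rightarrow> bool" where
  "finitely_acting E \<longleftrightarrow> (\<exists>S. finite S \<and> generated_cstar E \<subseteq> span S)"


section \<open>Operator algebras with their generated C*-algebras\<close>

text \<open>
  An operator algebra \<open>alg\<close> inside the C*-algebra \<open>cstar\<close> which it generates.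
\<close>

record 'a op_alg =
  alg :: "'a set"
  cstar :: "'a set"
  zeroA :: 'a
  addA :: "'a \<Rightarrow> 'a \<Rightarrow> 'a"
  mulA :: "'a \<Rightarrow> 'a \<Rightarrow> 'a"
  scaleA :: "complex \<Rightarrow> 'a \<Rightarrow> 'a"
  starA :: "'a \<Rightarrow> 'a"
  normA :: "'a \<Rightarrow> real"

definition subA :: "'a op_alg \<Rightarrow> 'a \<Rightarrow> 'a \<Rightarrow> 'a" where
  "subA A x y = addA A x (scaleA A (-1) y)"

definition star_hom :: "'a op_alg \<Rightarrow> 'b op_alg \<Rightarrow> ('a \<Rightarrow> 'b) \<Rightarrow> bool" where
  "star_hom A B \<pi> \<longleftrightarrow>
     (\<forall>x\<in>cstar A. \<pi> x \<in> cstar B \<and> \<pi> (starA A x) = starA B (\<pi> x) \<and>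
        (\<forall>c. \<pi> (scaleA A c x) = scaleA B c (\<pi> x)) \<and>
        (\<forall>y\<in>cstar A. \<pi> (addA A x y) = addA B (\<pi> x) (\<pi> y) \<and>
                      \<pi> (mulA A x y) = mulA B (\<pi> x) (\<pi> y)))"

definition extends_to :: "'a op_alg \<Rightarrow> 'b op_alg \<Rightarrow> ('a \<Rightarrow> 'b) \<Rightarrow> ('a \<Rightarrow> 'b) \<Rightarrow> bool" where
  "extends_to A B \<phi> \<pi> \<longleftrightarrow> star_hom A B \<pi> \<and> (\<forall>x\<in>alg A. \<phi> x = \<pi> x)"

text \<open>Only the values of a map on \<open>alg A\<close> are meaningful.\<close>

definition star_extendible :: "'a op_alg \<Rightarrow> 'b op_alg \<Rightarrow> ('a \<Rightarrow> 'b) \<Rightarrow> bool" where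
  "star_extendible A B \<phi> \<longleftrightarrow> \<phi> ` alg A \<subseteq> alg B \<and> (\<exists>\<pi>. extends_to A B \<phi> \<pi>)"

definition star_extendibly_isomorphic :: "'a op_alg \<Rightarrow> 'b op_alg \<Rightarrow> bool" where
  "star_extendibly_isomorphic A B \<longleftrightarrow>
     (\<exists>\<phi> \<pi>. bij_betw \<phi> (alg A) (alg B) \<and> extends_to A B \<phi> \<pi> \<and> bij_betw \<pi> (cstar A) (cstar B))"

definition is_unit :: "'a op_alg \<Rightarrow> 'a \<Rightarrow> bool" where
  "is_unit A e \<longleftrightarrow> e \<in> alg A \<and> (\<forall>x\<in>alg A. mulA A e x = x \<and> mulA A x e = x)"

text \<open>In the unitisation, \<open>(c, v)\<close> stands for \<open>c 1 + v\<close>.\<close>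

definition unit_mul :: "'a op_alg \<Rightarrow> complex \<times> 'a \<Rightarrow> complex \<times> 'a \<Rightarrow> complex \<times> 'a" where
  "unit_mul A p q = (fst p * fst q,
     addA A (addA A (scaleA A (fst p) (snd q)) (scaleA A (fst q) (snd p))) (mulA A (snd p) (snd q)))"

definition unit_star :: "'a op_alg \<Rightarrow> complex \<times> 'a \<Rightarrow> complex \<times> 'a" where
  "unit_star A p = (cnj (fst p), starA A (snd p))"

definition inner_unitarily_equivalent ::
    "'a op_alg \<Rightarrow> 'b op_alg \<Rightarrow> ('a \<Rightarrow> 'b) \<Rightarrow> ('a \<Rightarrow> 'b) \<Rightarrow> bool" where
  "inner_unitarily_equivalent A B \<phi> \<psi> \<longleftrightarrow>
     (if \<exists>e. is_unit B e
      then \<exists>u\<in>alg B. is_unit B (mulA B u (starA B u)) \<and> is_unit B (mulA B (starA B u) u) \<and>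
             (\<forall>x\<in>alg A. \<phi> x = mulA B u (mulA B (\<psi> x) (starA B u)))
      else \<exists>u. snd u \<in> alg B \<and>
             unit_mul B u (unit_star B u) = (1, zeroA B) \<and>
             unit_mul B (unit_star B u) u = (1, zeroA B) \<and>
             (\<forall>x\<in>alg A. (0, \<phi> x) = unit_mul B u (unit_mul B (0, \<psi> x) (unit_star B u))))"


section \<open>Direct limits\<close>

text \<open>
  The C*-algebra of the limit of \<open>A\<^sub>0 \<rightarrow> A\<^sub>1 \<rightarrow> \<dots>\<close> is the standard one: sequences
  \<open>x k \<in> C*(A k)\<close> modulo sequences tending to \<open>0\<close> in norm, and in there the norm closure of the
  sequences which are eventually coherent for the extended connecting maps. The algebraic limit is
  given by the sequences that are eventually coherent and eventually in \<open>A k\<close>.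
\<close>

definition star_extension :: "'a op_alg \<Rightarrow> 'b op_alg \<Rightarrow> ('a \<Rightarrow> 'b) \<Rightarrow> 'a \<Rightarrow> 'b" where
  "star_extension A B \<phi> = (SOME \<pi>. extends_to A B \<phi> \<pi>)"

definition seqs :: "(nat \<Rightarrow> 'a op_alg) \<Rightarrow> (nat \<Rightarrow> 'a) set" where
  "seqs A = {x. \<forall>k. x k \<in> cstar (A k)}"

definition seq_class :: "(nat \<Rightarrow> 'a op_alg) \<Rightarrow> (nat \<Rightarrow> 'a) \<Rightarrow> (nat \<Rightarrow> 'a) set" where
  "seq_class A x = {y \<in> seqs A. (\<lambda>k. normA (A k) (subA (A k) (x k) (y k))) \<longlonglongrightarrow> 0}"

definition coherent :: "(nat \<Rightarrow> 'a op_alg) \<Rightarrow> (nat \<Rightarrow> 'a \<Rightarrow> 'a) \<Rightarrow> (nat \<Rightarrow> 'a) set" where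
  "coherent A \<phi> = {x \<in> seqs A.
     \<forall>\<^sub>F k in sequentially. x (Suc k) = star_extension (A k) (A (Suc k)) (\<phi> k) (x k)}"

definition alg_lim :: "(nat \<Rightarrow> 'a op_alg) \<Rightarrow> (nat \<Rightarrow> 'a \<Rightarrow> 'a) \<Rightarrow> (nat \<Rightarrow> 'a) set op_alg" where
  "alg_lim A \<phi> = \<lparr>
     alg = {seq_class A x | x. x \<in> coherent A \<phi> \<and> (\<forall>\<^sub>F k in sequentially. x k \<in> alg (A k))},
     cstar = {seq_class A x | x. x \<in> seqs A \<and>
       (\<forall>\<epsilon>>0. \<exists>y\<in>coherent A \<phi>. \<forall>\<^sub>F k in sequentially. normA (A k) (subA (A k) (x k) (y k)) \<le> \<epsilon>)},
     zeroA = seq_class A (\<lambda>k. zeroA (A k)),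
     addA = (\<lambda>X Y. \<Union>x\<in>X. \<Union>y\<in>Y. seq_class A (\<lambda>k. addA (A k) (x k) (y k))),
     mulA = (\<lambda>X Y. \<Union>x\<in>X. \<Union>y\<in>Y. seq_class A (\<lambda>k. mulA (A k) (x k) (y k))),
     scaleA = (\<lambda>c X. \<Union>x\<in>X. seq_class A (\<lambda>k. scaleA (A k) c (x k))),
     starA = (\<lambda>X. \<Union>x\<in>X. seq_class A (\<lambda>k. starA (A k) (x k))),
     normA = (\<lambda>X. THE r. \<forall>x\<in>X. (\<lambda>k. normA (A k) (x k)) \<longlonglongrightarrow> r) \<rparr>"


section \<open>Elementary algebras\<close>

text \<open>
  An element \<open>x\<close> of \<open>E \<otimes> M\<^bsub>n 0\<^esub> \<oplus> \<dots> \<oplus> E \<otimes> M\<^bsub>n (r-1)\<^esub>\<close> is given by its entries \<open>x s i j\<close>,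
  with \<open>s\<close> the summand, extended by \<open>0\<close> outside the index range. Thus the corner inclusions
  \<open>E \<otimes> M\<^sub>m \<subseteq> E \<otimes> M\<^sub>n\<close> for \<open>m \<le> n\<close> are inclusions of sets. \<open>E\<close> itself is \<open>E \<otimes> M\<^sub>1\<close>. The index
  \<open>b * n + i\<close> with \<open>i < n\<close> and \<open>b < N\<close> enumerates the basis of \<open>M\<^sub>n \<otimes> M\<^sub>N\<close>, and of
  \<open>M\<^sub>n \<otimes> \<K>\<close> without the bound on \<open>b\<close>.
\<close>

type_synonym 'h elt = "nat \<Rightarrow> nat \<Rightarrow> nat \<Rightarrow> ('h \<Rightarrow>\<^sub>L 'h)"

definition entries_in :: "('h::complex_hilbert \<Rightarrow>\<^sub>L 'h) set \<Rightarrow> nat list \<Rightarrow> 'h elt set" where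
  "entries_in E ns = {x. \<forall>s i j.
     (if s < length ns \<and> i < ns ! s \<and> j < ns ! s then x s i j \<in> E else x s i j = 0)}"

text \<open>The supremum over \<open>N\<close> makes this the operator norm on a direct sum of copies of
  \<open>H \<otimes> l\<^sup>2\<close>, for elements with finitely many nonzero entries.\<close>

definition elt_norm :: "'h::complex_hilbert elt \<Rightarrow> real" where
  "elt_norm x = Sup {sqrt (\<Sum>i<N. (norm (\<Sum>j<N. blinfun_apply (x s i j) (v j)))\<^sup>2) | s N v.
     (\<Sum>j<N. (norm (v j))\<^sup>2) \<le> 1}"

definition mk_alg :: "'h elt set \<Rightarrow> 'h elt set \<Rightarrow> 'h::complex_hilbert elt op_alg" where
  "mk_alg A C = \<lparr> alg = A, cstar = C,
     zeroA = (\<lambda>s i j. 0),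
     addA = (\<lambda>x y s i j. x s i j + y s i j),
     mulA = (\<lambda>x y s i j. \<Sum>l | x s i l \<noteq> 0. x s i l o\<^sub>L y s l j),
     scaleA = (\<lambda>c x s i j. op_scale c (x s i j)),
     starA = (\<lambda>x s i j. op_adj (x s j i)),
     normA = elt_norm \<rparr>"

definition elem :: "('h::complex_hilbert \<Rightarrow>\<^sub>L 'h) set \<Rightarrow> nat list \<Rightarrow> 'h elt op_alg" where
  "elem E ns = mk_alg (entries_in E ns) (entries_in (generated_cstar E) ns)"

definition tensor_sizes :: "nat \<Rightarrow> nat list \<Rightarrow> nat list" where
  "tensor_sizes N ns = map (\<lambda>n. N * n) ns"

text \<open>
  \<open>B \<otimes> \<K>\<close> for the elementary algebra \<open>B\<close> with sizes \<open>ns\<close>. Here the component \<^const>\<open>cstar\<close> is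
  the union of the C*-algebras \<open>C*(B) \<otimes> M\<^sub>N\<close>; it is not complete, but \<^const>\<open>alg_lim\<close> completes it.
\<close>

definition stab :: "('h::complex_hilbert \<Rightarrow>\<^sub>L 'h) set \<Rightarrow> nat list \<Rightarrow> 'h elt op_alg" where
  "stab E ns = mk_alg (\<Union>N. alg (elem E (tensor_sizes N ns))) (\<Union>N. cstar (elem E (tensor_sizes N ns)))"

definition valid_sizes :: "nat list \<Rightarrow> bool" where
  "valid_sizes ns \<longleftrightarrow> ns \<noteq> [] \<and> (\<forall>n\<in>set ns. 0 < n)"

text \<open>\<open>amplify ns ms \<phi>\<close> is \<open>\<phi> \<otimes> id\<close> on \<open>B \<otimes> \<K>\<close> (hence also on each \<open>B \<otimes> M\<^sub>N\<close>) for a map \<open>\<phi>\<close> from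
  the elementary algebra \<open>B\<close> with sizes \<open>ns\<close> to the one with sizes \<open>ms\<close>: it applies \<open>\<phi>\<close> to each
  block.\<close>

definition block :: "nat list \<Rightarrow> nat \<Rightarrow> nat \<Rightarrow> 'h::complex_hilbert elt \<Rightarrow> 'h elt" where
  "block ns b c x = (\<lambda>s i j. if s < length ns \<and> i < ns ! s \<and> j < ns ! s
     then x s (b * ns ! s + i) (c * ns ! s + j) else 0)"

definition amplify ::
    "nat list \<Rightarrow> nat list \<Rightarrow> ('h elt \<Rightarrow> 'h elt) \<Rightarrow> 'h::complex_hilbert elt \<Rightarrow> 'h elt" where
  "amplify ns ms \<phi> x = (\<lambda>s i j. if s < length ms
     then \<phi> (block ns (i div ms ! s) (j div ms ! s) x) s (i mod ms ! s) (j mod ms ! s) else 0)"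

text \<open>\<open>block_sum ms x y\<close> is \<open>x \<oplus> y\<close> for \<open>x\<close> in the elementary algebra with sizes \<open>ms\<close>: the
  summand \<open>s\<close> of \<open>y\<close> is moved down the diagonal by \<open>ms ! s\<close>.\<close>

definition block_sum :: "nat list \<Rightarrow> 'h elt \<Rightarrow> 'h elt \<Rightarrow> 'h::complex_hilbert elt" where
  "block_sum ms x y = (\<lambda>s i j.
     if s < length ms \<and> i < ms ! s \<and> j < ms ! s then x s i j
     else if s < length ms \<and> ms ! s \<le> i \<and> ms ! s \<le> j then y s (i - ms ! s) (j - ms ! s)
     else 0)"

definition move_summand :: "nat \<Rightarrow> nat \<Rightarrow> 'h elt \<Rightarrow> 'h::complex_hilbert elt" where
  "move_summand s t x = (\<lambda>u. if u = t then x s else (\<lambda>i j. 0))"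

text \<open>The partial map from summand \<open>t\<close> of the domain to summand \<open>s\<close> of the range.\<close>

definition partial_map ::
    "nat \<Rightarrow> nat \<Rightarrow> ('h elt \<Rightarrow> 'h elt) \<Rightarrow> 'h elt \<Rightarrow> 'h::complex_hilbert elt" where
  "partial_map t s \<phi> = move_summand s 0 \<circ> \<phi> \<circ> move_summand 0 t"


section \<open>Closed families\<close>

text \<open>
  \<open>F n m\<close> is the set of the maps \<open>E \<otimes> M\<^sub>n \<rightarrow> E \<otimes> M\<^sub>m\<close> in the family; only \<open>n, m > 0\<close> matter.
  The first definition collects the conventions which make sense of \<open>V\<^sub>F\<close> as a semiring: the
  members are embeddings or zero maps, the zero maps and the identity maps are members (they
  represent \<open>0\<close> and \<open>1\<close> in \<open>V\<^sub>F\<close>), and whether a map into \<open>E \<otimes> M\<^sub>m\<close> belongs to the family does not change when \<open>E \<otimes> M\<^sub>m\<close>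
  is regarded as a corner of a larger \<open>E \<otimes> M\<^sub>k\<close> (maps are identified with the maps that they
  induce on \<open>E \<otimes> \<K>\<close>). Without the last one, sums of maps into \<open>E \<otimes> M\<^sub>m\<close> and \<open>E \<otimes> M\<^sub>n\<close> need not be in
  the family, nor composites of maps between elementary algebras with partial maps in the family.
\<close>

type_synonym 'h family = "nat \<Rightarrow> nat \<Rightarrow> ('h elt \<Rightarrow> 'h elt) set"

definition embedding_family :: "('h::complex_hilbert \<Rightarrow>\<^sub>L 'h) set \<Rightarrow> 'h family \<Rightarrow> bool" where
  "embedding_family E F \<longleftrightarrow>
     (\<forall>n>0. \<forall>m>0. \<forall>\<phi>\<in>F n m. star_extendible (elem E [n]) (elem E [m]) \<phi> \<and>
        (inj_on \<phi> (alg (elem E [n])) \<or> (\<forall>x\<in>alg (elem E [n]). \<phi> x = (\<lambda>s i j. 0)))) \<and>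
     (\<forall>n>0. \<forall>m>0. (\<lambda>x s i j. 0) \<in> F n m) \<and>
     (\<forall>n>0. (\<lambda>x. x) \<in> F n n) \<and>
     (\<forall>n>0. \<forall>m>0. \<forall>k\<ge>m. \<forall>\<phi>.
        \<phi> \<in> F n m \<longleftrightarrow> \<phi> \<in> F n k \<and> \<phi> ` alg (elem E [n]) \<subseteq> alg (elem E [m]))"

text \<open>Convergence of maps is uniform convergence on the unit ball.\<close>

definition maps_within ::
    "('h::complex_hilbert \<Rightarrow>\<^sub>L 'h) set \<Rightarrow> nat \<Rightarrow> nat \<Rightarrow> real \<Rightarrow> ('h elt \<Rightarrow> 'h elt) \<Rightarrow> ('h elt \<Rightarrow> 'h elt) \<Rightarrow> bool"
  where
  "maps_within E n m \<epsilon> \<phi> \<psi> \<longleftrightarrow> (\<forall>x\<in>alg (elem E [n]). normA (elem E [n]) x \<le> 1 \<longrightarrow>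
     normA (elem E [m]) (subA (elem E [m]) (\<phi> x) (\<psi> x)) \<le> \<epsilon>)"

definition norm_complete :: "('h::complex_hilbert \<Rightarrow>\<^sub>L 'h) set \<Rightarrow> 'h family \<Rightarrow> bool" where
  "norm_complete E F \<longleftrightarrow> (\<forall>n>0. \<forall>m>0. \<forall>\<phi> :: nat \<Rightarrow> 'h elt \<Rightarrow> 'h elt. (\<forall>k. \<phi> k \<in> F n m) \<and>
     (\<forall>\<epsilon>>0. \<exists>K. \<forall>k\<ge>K. \<forall>l\<ge>K. maps_within E n m \<epsilon> (\<phi> k) (\<phi> l)) \<longrightarrow>
     (\<exists>\<psi>\<in>F n m. \<forall>\<epsilon>>0. \<exists>K. \<forall>k\<ge>K. maps_within E n m \<epsilon> (\<phi> k) \<psi>))"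

definition closed_family :: "('h::complex_hilbert \<Rightarrow>\<^sub>L 'h) set \<Rightarrow> 'h family \<Rightarrow> bool" where
  "closed_family E F \<longleftrightarrow> embedding_family E F \<and>
     (\<forall>n>0. \<forall>m>0. \<forall>\<phi>\<in>F n m. \<forall>\<psi>.
        inner_unitarily_equivalent (elem E [n]) (elem E [m]) \<psi> \<phi> \<longrightarrow> \<psi> \<in> F n m) \<and>
     (\<forall>n>0. \<forall>m>0. \<forall>k>0. \<forall>\<phi>\<in>F n m. \<forall>\<psi>\<in>F m k. \<psi> \<circ> \<phi> \<in> F n k) \<and>
     (\<forall>n>0. \<forall>m>0. \<forall>k>0. \<forall>\<phi>\<in>F n m. amplify [n] [m] \<phi> \<in> F (k * n) (k * m)) \<and>
     (\<forall>n>0. \<forall>m>0. \<forall>\<phi>\<in>F n m. \<forall>\<psi>\<in>F n m. (\<lambda>x. block_sum [m] (\<phi> x) (\<psi> x)) \<in> F n (2 * m)) \<and>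
     norm_complete E F"

definition tilde_family ::
    "('h::complex_hilbert \<Rightarrow>\<^sub>L 'h) set \<Rightarrow> 'h family \<Rightarrow> nat list \<Rightarrow> nat list \<Rightarrow> ('h elt \<Rightarrow> 'h elt) set" where
  "tilde_family E F ns ms = {\<phi>. star_extendible (elem E ns) (elem E ms) \<phi> \<and>
     (\<forall>t<length ns. \<forall>s<length ms. partial_map t s \<phi> \<in> F (ns ! t) (ms ! s))}"

definition direct_system ::
    "('h::complex_hilbert \<Rightarrow>\<^sub>L 'h) set \<Rightarrow> 'h family \<Rightarrow> (nat \<Rightarrow> nat list) \<Rightarrow> (nat \<Rightarrow> 'h elt \<Rightarrow> 'h elt) \<Rightarrow> bool"
  where
  "direct_system E F ns \<phi> \<longleftrightarrow>
     (\<forall>k. valid_sizes (ns k) \<and> \<phi> k \<in> tilde_family E F (ns k) (ns (Suc k)))"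

text \<open>\<open>connecting \<phi> k l\<close> is the composite from stage \<open>k\<close> to stage \<open>l\<close>, for \<open>k \<le> l\<close>.\<close>

definition connecting :: "(nat \<Rightarrow> 'a \<Rightarrow> 'a) \<Rightarrow> nat \<Rightarrow> nat \<Rightarrow> 'a \<Rightarrow> 'a" where
  "connecting \<phi> k l = fold (\<lambda>i f. \<phi> i \<circ> f) [k..<l] id"

definition functorial :: "('h::complex_hilbert \<Rightarrow>\<^sub>L 'h) set \<Rightarrow> 'h family \<Rightarrow> bool" where
  "functorial E F \<longleftrightarrow> (\<forall>ns \<phi> ns' \<phi>' \<alpha> \<beta>.
     direct_system E F ns \<phi> \<and> direct_system E F ns' \<phi>' \<and>
     (\<forall>k. star_extendible (elem E (ns k)) (elem E (ns' k)) (\<alpha> k) \<and>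
          star_extendible (elem E (ns' k)) (elem E (ns (Suc k))) (\<beta> k) \<and>
          (\<forall>x\<in>alg (elem E (ns k)). \<beta> k (\<alpha> k x) = \<phi> k x) \<and>
          (\<forall>x\<in>alg (elem E (ns' k)). \<alpha> (Suc k) (\<beta> k x) = \<phi>' k x)) \<longrightarrow>
     (\<exists>n m. \<forall>k. n k \<le> m k \<and> m k < n (Suc k) \<and>
          connecting \<phi>' (n k) (m k) \<circ> \<alpha> (n k) \<in> tilde_family E F (ns (n k)) (ns' (m k)) \<and>
          connecting \<phi> (Suc (m k)) (n (Suc k)) \<circ> \<beta> (m k)
            \<in> tilde_family E F (ns' (m k)) (ns (n (Suc k)))))"


section \<open>Dimension modules\<close>

text \<open>
  For the elementary algebra \<open>B\<close> with sizes \<open>ns\<close>, \<open>V_elem E F ns\<close> is \<open>V\<^sub>F(B)\<close>, the set of inner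
  unitary equivalence classes of maps \<open>E \<rightarrow> B \<otimes> \<K>\<close>. Since \<open>E\<close> is finite-dimensional, such maps have range in some \<open>B \<otimes> M\<^sub>N\<close>.
  The semiring \<open>V\<^sub>F\<close> is the case \<open>B = E\<close>, that is \<open>V_elem E F [1]\<close>, with product \<open>V_act E F [1]\<close>.
\<close>

definition V_maps ::
    "('h::complex_hilbert \<Rightarrow>\<^sub>L 'h) set \<Rightarrow> 'h family \<Rightarrow> nat list \<Rightarrow> ('h elt \<Rightarrow> 'h elt) set" where
  "V_maps E F ns = (\<Union>N\<in>{0<..}. tilde_family E F [1] (tensor_sizes N ns))"

definition V_class ::
    "('h::complex_hilbert \<Rightarrow>\<^sub>L 'h) set \<Rightarrow> 'h family \<Rightarrow> nat list \<Rightarrow> ('h elt \<Rightarrow> 'h elt) \<Rightarrow> ('h elt \<Rightarrow> 'h elt) set" where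
  "V_class E F ns \<psi> =
     {\<omega> \<in> V_maps E F ns. inner_unitarily_equivalent (elem E [1]) (stab E ns) \<omega> \<psi>}"

definition V_elem ::
    "('h::complex_hilbert \<Rightarrow>\<^sub>L 'h) set \<Rightarrow> 'h family \<Rightarrow> nat list \<Rightarrow> ('h elt \<Rightarrow> 'h elt) set set" where
  "V_elem E F ns = V_class E F ns ` V_maps E F ns"

definition maps_into ::
    "('h::complex_hilbert \<Rightarrow>\<^sub>L 'h) set \<Rightarrow> nat list \<Rightarrow> ('h elt \<Rightarrow> 'h elt) \<Rightarrow> bool" where
  "maps_into E ms \<psi> \<longleftrightarrow> \<psi> ` alg (elem E [1]) \<subseteq> alg (elem E ms)"

text \<open>
  In the operations below, the representatives and an \<open>N\<close> such that their range lies in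
  \<open>B \<otimes> M\<^sub>N\<close> are arbitrary: \<open>[\<psi>] + [\<omega>] = [\<psi> \<oplus> \<omega>]\<close> and \<open>[\<psi>][\<theta>] = [(\<psi> \<otimes> id) \<circ> \<theta>]\<close>.
\<close>

definition V_add ::
    "('h::complex_hilbert \<Rightarrow>\<^sub>L 'h) set \<Rightarrow> 'h family \<Rightarrow> nat list \<Rightarrow>
     ('h elt \<Rightarrow> 'h elt) set \<Rightarrow> ('h elt \<Rightarrow> 'h elt) set \<Rightarrow> ('h elt \<Rightarrow> 'h elt) set" where
  "V_add E F ns X Y =
     \<Union>{V_class E F ns (\<lambda>x. block_sum (tensor_sizes N ns) (\<psi> x) (\<omega> x)) | N \<psi> \<omega>.
        \<psi> \<in> X \<and> \<omega> \<in> Y \<and> 0 < N \<and> maps_into E (tensor_sizes N ns) \<psi>}"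

definition V_act ::
    "('h::complex_hilbert \<Rightarrow>\<^sub>L 'h) set \<Rightarrow> 'h family \<Rightarrow> nat list \<Rightarrow>
     ('h elt \<Rightarrow> 'h elt) set \<Rightarrow> ('h elt \<Rightarrow> 'h elt) set \<Rightarrow> ('h elt \<Rightarrow> 'h elt) set" where
  "V_act E F ns X T =
     \<Union>{V_class E F ns (amplify [1] (tensor_sizes N ns) \<psi> \<circ> \<theta>) | N \<psi> \<theta>.
        \<psi> \<in> X \<and> \<theta> \<in> T \<and> 0 < N \<and> maps_into E (tensor_sizes N ns) \<psi>}"

definition scale_elem ::
    "('h::complex_hilbert \<Rightarrow>\<^sub>L 'h) set \<Rightarrow> 'h family \<Rightarrow> nat list \<Rightarrow> ('h elt \<Rightarrow> 'h elt) set set" where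
  "scale_elem E F ns = {V_class E F ns \<psi> | \<psi>. \<psi> \<in> V_maps E F ns \<and> maps_into E ns \<psi>}"

definition V_hat ::
    "('h::complex_hilbert \<Rightarrow>\<^sub>L 'h) set \<Rightarrow> 'h family \<Rightarrow> nat list \<Rightarrow> nat list \<Rightarrow>
     ('h elt \<Rightarrow> 'h elt) \<Rightarrow> ('h elt \<Rightarrow> 'h elt) set \<Rightarrow> ('h elt \<Rightarrow> 'h elt) set" where
  "V_hat E F ns ms \<phi> X = (\<Union>\<psi>\<in>X. V_class E F ms (amplify ns ms \<phi> \<circ> \<psi>))"

definition V_connecting ::
    "('h::complex_hilbert \<Rightarrow>\<^sub>L 'h) set \<Rightarrow> 'h family \<Rightarrow> (nat \<Rightarrow> nat list) \<Rightarrow> (nat \<Rightarrow> 'h elt \<Rightarrow> 'h elt) \<Rightarrow>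
     nat \<Rightarrow> nat \<Rightarrow> ('h elt \<Rightarrow> 'h elt) set \<Rightarrow> ('h elt \<Rightarrow> 'h elt) set" where
  "V_connecting E F ns \<phi> = connecting (\<lambda>k. V_hat E F (ns k) (ns (Suc k)) (\<phi> k))"

type_synonym 'h dim_elt = "(nat \<times> ('h elt \<Rightarrow> 'h elt) set) set"

text \<open>\<open>V_germ E F ns \<phi> k X\<close> is the image in the direct limit of \<open>X\<close> at stage \<open>k\<close>.\<close>

definition V_germ ::
    "('h::complex_hilbert \<Rightarrow>\<^sub>L 'h) set \<Rightarrow> 'h family \<Rightarrow> (nat \<Rightarrow> nat list) \<Rightarrow> (nat \<Rightarrow> 'h elt \<Rightarrow> 'h elt) \<Rightarrow>
     nat \<Rightarrow> ('h elt \<Rightarrow> 'h elt) set \<Rightarrow> 'h dim_elt" where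
  "V_germ E F ns \<phi> k X = {(l, Y). Y \<in> V_elem E F (ns l) \<and>
     (\<exists>m\<ge>max k l. V_connecting E F ns \<phi> k m X = V_connecting E F ns \<phi> l m Y)}"

definition dim_module ::
    "('h::complex_hilbert \<Rightarrow>\<^sub>L 'h) set \<Rightarrow> 'h family \<Rightarrow> (nat \<Rightarrow> nat list) \<Rightarrow> (nat \<Rightarrow> 'h elt \<Rightarrow> 'h elt) \<Rightarrow> 'h dim_elt set"
  where
  "dim_module E F ns \<phi> = {V_germ E F ns \<phi> k X | k X. X \<in> V_elem E F (ns k)}"

definition dim_scale ::
    "('h::complex_hilbert \<Rightarrow>\<^sub>L 'h) set \<Rightarrow> 'h family \<Rightarrow> (nat \<Rightarrow> nat list) \<Rightarrow> (nat \<Rightarrow> 'h elt \<Rightarrow> 'h elt) \<Rightarrow> 'h dim_elt set"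
  where
  "dim_scale E F ns \<phi> = {V_germ E F ns \<phi> k X | k X. X \<in> scale_elem E F (ns k)}"

definition dim_add ::
    "('h::complex_hilbert \<Rightarrow>\<^sub>L 'h) set \<Rightarrow> 'h family \<Rightarrow> (nat \<Rightarrow> nat list) \<Rightarrow> (nat \<Rightarrow> 'h elt \<Rightarrow> 'h elt) \<Rightarrow>
     'h dim_elt \<Rightarrow> 'h dim_elt \<Rightarrow> 'h dim_elt" where
  "dim_add E F ns \<phi> P Q =
     \<Union>{V_germ E F ns \<phi> k (V_add E F (ns k) X Y) | k X Y. (k, X) \<in> P \<and> (k, Y) \<in> Q}"

definition dim_act ::
    "('h::complex_hilbert \<Rightarrow>\<^sub>L 'h) set \<Rightarrow> 'h family \<Rightarrow> (nat \<Rightarrow> nat list) \<Rightarrow> (nat \<Rightarrow> 'h elt \<Rightarrow> 'h elt) \<Rightarrow>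
     'h dim_elt \<Rightarrow> ('h elt \<Rightarrow> 'h elt) set \<Rightarrow> 'h dim_elt" where
  "dim_act E F ns \<phi> P T = \<Union>{V_germ E F ns \<phi> k (V_act E F (ns k) X T) | k X. (k, X) \<in> P}"

definition module_iso ::
    "('h::complex_hilbert \<Rightarrow>\<^sub>L 'h) set \<Rightarrow> 'h family \<Rightarrow>
     (nat \<Rightarrow> nat list) \<Rightarrow> (nat \<Rightarrow> 'h elt \<Rightarrow> 'h elt) \<Rightarrow> (nat \<Rightarrow> nat list) \<Rightarrow> (nat \<Rightarrow> 'h elt \<Rightarrow> 'h elt) \<Rightarrow>
     ('h dim_elt \<Rightarrow> 'h dim_elt) \<Rightarrow> bool" where
  "module_iso E F ns \<phi> ns' \<phi>' \<Gamma> \<longleftrightarrow>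
     bij_betw \<Gamma> (dim_module E F ns \<phi>) (dim_module E F ns' \<phi>') \<and>
     (\<forall>P\<in>dim_module E F ns \<phi>. \<forall>Q\<in>dim_module E F ns \<phi>.
        \<Gamma> (dim_add E F ns \<phi> P Q) = dim_add E F ns' \<phi>' (\<Gamma> P) (\<Gamma> Q)) \<and>
     (\<forall>P\<in>dim_module E F ns \<phi>. \<forall>T\<in>V_elem E F [1].
        \<Gamma> (dim_act E F ns \<phi> P T) = dim_act E F ns' \<phi>' (\<Gamma> P) T)"


section \<open>The limit algebras\<close>

definition limit_algebra ::
    "('h::complex_hilbert \<Rightarrow>\<^sub>L 'h) set \<Rightarrow> (nat \<Rightarrow> nat list) \<Rightarrow> (nat \<Rightarrow> 'h elt \<Rightarrow> 'h elt) \<Rightarrow>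
     (nat \<Rightarrow> 'h elt) set op_alg" where
  "limit_algebra E ns \<phi> = alg_lim (\<lambda>k. elem E (ns k)) \<phi>"

text \<open>\<open>A\<^sub>0 \<otimes> \<K>\<close>, the union over \<open>N\<close> of the limits \<open>A\<^sub>0 \<otimes> M\<^sub>N\<close> of the algebras \<open>A\<^sub>k \<otimes> M\<^sub>N\<close>.\<close>

definition stable_limit_algebra ::
    "('h::complex_hilbert \<Rightarrow>\<^sub>L 'h) set \<Rightarrow> (nat \<Rightarrow> nat list) \<Rightarrow> (nat \<Rightarrow> 'h elt \<Rightarrow> 'h elt) \<Rightarrow>
     (nat \<Rightarrow> 'h elt) set op_alg" where
  "stable_limit_algebra E ns \<phi> =
     alg_lim (\<lambda>k. stab E (ns k)) (\<lambda>k. amplify (ns k) (ns (Suc k)) (\<phi> k))"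

end

theory Submission
 imports Defs
begin

text \<open>The algebra E need not be self-adjoint, so an equivalence of maps must be implemented by
  elements that lie over E together with their adjoints. All comparisons use \<open>sim\<close>,
  equivalence by such a partial isometry: it composes, adds and extends from corners without regard
  to the size of the target. Inside one matrix algebra over E it becomes unitary equivalence,
  because the elements whose adjoints also lie in the algebra form a finite-dimensional star
  algebra, where partial isometries extend to unitaries. The C*-facts behind this, contractivity of
  star-homomorphisms, isometry of injective ones and spectral projections, come from powers of
  self-adjoint matrices. The stable assertions are the unstable ones for the system of the algebras
  A_k tensored with M_(k+1): it has the same dimension module, its scale is the whole module, and
  its limit is isomorphic to A_0 tensored with K. For the converse, an isomorphism of limits always
  yields crossover maps at finite stages; functoriality serves to bring these maps into the
  family.\<close>

abbreviation ev :: "(nat => bool) => bool" (binder "EV " 10) where "ev P == eventually P sequentially"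

abbreviation lims :: "(nat => 'a::topological_space) => 'a => bool" (infix "---->" 60) where
 "X ----> L == tendsto X L sequentially"

abbreviation "ts == tensor_sizes"

text \<open>A map out of an elementary algebra is determined up to unitary equivalence by the classes of its
 restrictions to the corners \<open>E \<otimes> e\<^sub>0\<^sub>0\<close>, so module homomorphisms between the \<open>V\<^sub>F(A\<^sub>k)\<close> lift to maps; Elliott's
 intertwining argument, with the unitaries absorbed into the crossover maps, then gives the isomorphism. Finite
 dimensionality makes each crossover exact at a finite stage.\<close>

section \<open>Adjoints\<close>

lemma cinner_add_right: "cinner (x::'h::complex_hilbert) (y + z) = cinner x y + cinner x z"
 using cinner_add_left[of y z x] cinner_commute[of x "y + z"] cinner_commute[of x y] cinner_commute[of x z]
 by simp

lemma cinner_scaleC_right: "cinner (x::'h::complex_hilbert) (c *\<^sub>C y) = c * cinner x y"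
 using cinner_scaleC_left[of c y x] cinner_commute[of x "c *\<^sub>C y"] cinner_commute[of x y] by simp

lemma cinner_inner: "cinner (x::'h::complex_hilbert) y = Complex (inner x y) (inner (\<i> *\<^sub>C x) y)"
 by (simp add: complex_eq_iff inner_cinner cinner_scaleC_left)

lemma scaleC_one: "1 *\<^sub>C (x::'h::complex_hilbert) = x"
 using scaleR_scaleC[of 1 x] by simp

lemma scaleC_zero_left: "0 *\<^sub>C (x::'h::complex_hilbert) = 0"
 using scaleR_scaleC[of 0 x] by simp

lemma scaleC_minus_one: "(- 1) *\<^sub>C (x::'h::complex_hilbert) = - x"
 using scaleR_scaleC[of "-1" x] by simp

lemma scaleC_zero_right: "c *\<^sub>C (0::'h::complex_hilbert) = 0"
 using scaleC_add_right[of c "0::'h" 0] by simp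

lemma scaleC_minus_right: "c *\<^sub>C (- (x::'h::complex_hilbert)) = - (c *\<^sub>C x)"
 using scaleC_add_right[of c x "- x"] by (simp add: scaleC_zero_right minus_unique)

lemma norm_scaleC: "norm (c *\<^sub>C (x::'h::complex_hilbert)) = cmod c * norm x"
proof -
 have "(norm (c *\<^sub>C x))\<^sup>2 = Re (cinner (c *\<^sub>C x) (c *\<^sub>C x))"
  by (simp add: power2_norm_eq_inner inner_cinner)
 also have "... = Re (complex_of_real ((cmod c)\<^sup>2) * cinner x x)"
  by (simp add: cinner_scaleC_left cinner_scaleC_right complex_norm_square del: of_real_power)
    (simp add: algebra_simps power2_eq_square cmod_def)
 also have "... = (cmod c * norm x)\<^sup>2"
  by (simp add: power_mult_distrib power2_norm_eq_inner inner_cinner)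
 finally show ?thesis
  by (simp add: power2_eq_iff_nonneg)
qed

lemma bounded_linear_scaleC: "bounded_linear (%x::'h::complex_hilbert. c *\<^sub>C x)"
proof (rule bounded_linear_intro)
 fix r and x :: 'h
 show "c *\<^sub>C r *\<^sub>R x = r *\<^sub>R c *\<^sub>C x"
  by (simp add: scaleR_scaleC scaleC_scaleC mult.commute)
next
 fix x :: 'h
 show "norm (c *\<^sub>C x) <= norm x * cmod c" by (simp add: norm_scaleC)
qed (simp add: scaleC_add_right)

lemma op_scale_apply: "blinfun_apply (op_scale c T) x = c *\<^sub>C blinfun_apply T x"
proof -
 have "bounded_linear (%x. c *\<^sub>C blinfun_apply T x)"
  by (rule bounded_linear_compose[OF bounded_linear_scaleC blinfun.bounded_linear_right])
 thus ?thesis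
  by (simp add: op_scale_def bounded_linear_Blinfun_apply)
qed

text \<open>The representing vector minimises \<open>norm x ^ 2 / 2 - f x\<close>: the parallelogram
  law makes minimising sequences Cauchy, and the first variation vanishes at the minimum.\<close>

lemma riesz_representation:
 fixes f :: "'a::{real_inner, complete_space} => real"
 assumes f: "bounded_linear f"
 shows "EX z. ALL x. f x = inner z x"
proof -
 interpret f: bounded_linear f by fact
 obtain K where K: "!!x. \<bar>f x\<bar> <= norm x * K" and "K >= 0"
  using f.nonneg_bounded by auto
 define g where "g x = (norm x)\<^sup>2 / 2 - f x" for x
 define a where "a = Inf (range g)"
 have lower: "g x >= - K\<^sup>2 / 2" for x
 proof -
  have "0 <= (norm x - K)\<^sup>2" by simp
  hence "norm x * K <= (norm x)\<^sup>2 / 2 + K\<^sup>2 / 2"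
   by (simp add: power2_diff)
  thus ?thesis using K[of x] by (simp add: g_def abs_le_iff)
 qed
 hence bdd: "bdd_below (range g)" by (meson bdd_belowI2)
 have a_le: "a <= g x" for x unfolding a_def by (rule cInf_lower) (auto intro: bdd)
 have "EX x. g x < a + 1 / Suc n" for n
 proof -
  have "Inf (range g) < a + 1 / Suc n" by (simp add: a_def)
  then obtain y where "y:range g" "y < a + 1 / Suc n"
   using cInf_lessD[of "range g"] by blast
  thus ?thesis by auto
 qed
 then obtain X where X: "!!n. g (X n) < a + 1 / Suc n" by metis
 \<comment> \<open>The value at the midpoint is at least \<open>a\<close>; the parallelogram law
   turns this into a bound on the distance of two almost minimal points.\<close>
 have par: "(norm (x - y))\<^sup>2 <= 4 * (g x + g y - 2 * a)" for x y
 proof -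
  have "a <= g ((1/2) *\<^sub>R (x + y))" by (rule a_le)
  also have "... = (norm (x + y))\<^sup>2 / 8 - (f x + f y) / 2"
   unfolding g_def f.scaleR f.add norm_scaleR by (simp add: power_mult_distrib power2_eq_square)
  finally have "8 * a <= (norm (x + y))\<^sup>2 - 4 * f x - 4 * f y" by (simp add: field_simps)
  moreover have "(norm (x + y))\<^sup>2 + (norm (x - y))\<^sup>2 = 2 * (norm x)\<^sup>2 + 2 * (norm y)\<^sup>2"
   by (simp add: power2_norm_eq_inner algebra_simps inner_commute)
  ultimately show ?thesis by (simp add: g_def)
 qed
 have "Cauchy X"
 proof (rule metric_CauchyI)
  fix e :: real assume "e > 0"
  hence "0 < e\<^sup>2 / 8" by simp
  then obtain N where "1 / real (Suc N) < e\<^sup>2 / 8" using nat_approx_posE by blast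
  hence N: "8 / Suc N < e\<^sup>2" by simp
  show "EX M. ALL m>=M. ALL n>=M. dist (X m) (X n) < e"
  proof (intro exI allI impI)
   fix m n assume "N <= m" "N <= n"
   hence "1 / Suc m <= 1 / Suc N" "1 / Suc n <= 1 / Suc N" by (auto simp: frac_le)
   hence "(norm (X m - X n))\<^sup>2 < e\<^sup>2"
    using par[of "X m" "X n"] X[of m] X[of n] N by simp
   thus "dist (X m) (X n) < e"
    using \<open>e > 0\<close> by (simp add: dist_norm power2_less_imp_less)
  qed
 qed
 then obtain z where z: "X ----> z"
  by (meson Cauchy_convergent convergent_def)
 have "(%n. g (X n)) ----> g z"
  unfolding g_def by (intro tendsto_intros f.tendsto z) auto
 moreover have "(%n. a + 1 / Suc n) ----> a + 0"
  by (rule tendsto_add[OF tendsto_const LIMSEQ_Suc[OF lim_1_over_n]])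
 ultimately have gz: "g z <= a"
  using LIMSEQ_le[of "%n. g (X n)" "g z" "%n. a + 1 / Suc n" "a + 0"] X less_imp_le by simp blast
 have "f x = inner z x" for x
 proof -
  define q where "q = inner z x - f x"
  have pos: "0 <= t * q + t\<^sup>2 * ((norm x)\<^sup>2 / 2)" for t
  proof -
   have "g z <= g (z + t *\<^sub>R x)" using gz a_le order_trans by blast
   moreover have "(norm (z + t *\<^sub>R x))\<^sup>2 = (norm z)\<^sup>2 + 2 * t * inner z x + t\<^sup>2 * (norm x)\<^sup>2"
    unfolding power2_norm_eq_inner by (simp add: algebra_simps inner_commute power2_eq_square)
   ultimately show ?thesis
    by (simp add: g_def q_def f.add f.scaleR algebra_simps)
  qed
  have "q = 0"
  proof (cases "norm x = 0")
   case True
   thus ?thesis using pos[of 1] pos[of "-1"] by simp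
  next
   case False
   define c where "c = (norm x)\<^sup>2"
   have "c > 0" using False by (simp add: c_def)
   \<comment> \<open>The parameter \<open>- q / c\<close> minimises the quadratic polynomial of
     \<open>pos\<close>; its minimum is negative unless \<open>q = 0\<close>.\<close>
   have "(- q / c) * q + (- q / c)\<^sup>2 * (c / 2) = - (q\<^sup>2) / (2 * c)"
    using \<open>c > 0\<close> by (simp add: field_simps power2_eq_square)
   hence "0 <= - (q\<^sup>2) / (2 * c)" using pos[of "- q / c"] by (simp only: c_def)
   thus ?thesis using \<open>c > 0\<close> by (simp add: zero_le_divide_iff divide_le_0_iff)
  qed
  thus ?thesis by (simp add: q_def)
 qed
 thus ?thesis by blast
qed

definition clin :: "('h::complex_hilbert \<Rightarrow>\<^sub>L 'h) => bool" where
 "clin T \<longleftrightarrow> (ALL c x. blinfun_apply T (c *\<^sub>C x) = c *\<^sub>C blinfun_apply T x)"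

lemma cinner_right_cancel: "(!!x. cinner x y = cinner x z) ==> y = (z::'h::complex_hilbert)"
 using vector_eq_ldot[of y z] by (simp add: inner_cinner)

text \<open>Riesz is applied to the real inner product. Complex linearity of T then recovers the
  sesquilinear form, since the imaginary part of \<open>cinner\<close> is the real inner product
  with the first argument multiplied by i.\<close>

lemma adjoint_exists:
 assumes "clin T"
 shows "EX S. clin S & (ALL x y. cinner (blinfun_apply T x) y = cinner x (blinfun_apply S y))"
proof -
 have "EX z. ALL x. inner (blinfun_apply T x) y = inner z x" for y
  by (rule riesz_representation) (intro bounded_linear_intros)
 then obtain s where s: "!!y x. inner (blinfun_apply T x) y = inner (s y) x" by metis
 have lin: "s (x + y) = s x + s y" "s (r *\<^sub>R x) = r *\<^sub>R s x" for x y r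
 proof -
  have "inner (s (x + y)) z = inner (s x + s y) z" "inner (s (r *\<^sub>R x)) z = inner (r *\<^sub>R s x) z" for z
   by (simp_all add: inner_left_distrib flip: s) (simp_all add: inner_right_distrib)
  thus "s (x + y) = s x + s y" "s (r *\<^sub>R x) = r *\<^sub>R s x"
   using vector_eq_rdot by blast+
 qed
 have "bounded_linear s"
 proof (rule bounded_linear_intro[where K = "norm T"])
  fix x
  have "(norm (s x))\<^sup>2 = inner (blinfun_apply T (s x)) x"
   by (simp add: s power2_norm_eq_inner)
  also have "... <= norm T * norm (s x) * norm x"
   by (meson norm_blinfun norm_cauchy_schwarz norm_ge_zero mult_right_mono order_trans)
  finally have "norm (s x) * norm (s x) <= norm (s x) * (norm x * norm T)"
   by (simp add: power2_eq_square mult_ac)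
  thus "norm (s x) <= norm x * norm T"
   by (cases "norm (s x) = 0") auto
 qed (auto simp: lin)
 hence sB: "blinfun_apply (Blinfun s) = s" by (rule bounded_linear_Blinfun_apply)
 have adj: "cinner (blinfun_apply T x) y = cinner x (s y)" for x y
 proof -
  have "\<i> *\<^sub>C blinfun_apply T x = blinfun_apply T (\<i> *\<^sub>C x)"
   using assms by (simp add: clin_def)
  thus ?thesis
   by (simp add: cinner_inner[of _ y] cinner_inner[of _ "s y"] s inner_commute[of _ "s y"])
 qed
 have "s (c *\<^sub>C y) = c *\<^sub>C s y" for c y
  by (rule cinner_right_cancel) (simp add: cinner_scaleC_right flip: adj)
 thus ?thesis
  using adj sB by (intro exI[of _ "Blinfun s"]) (simp add: clin_def)
qed

lemma op_adj_eqI: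
 assumes "!!x y. cinner (blinfun_apply T x) y = cinner x (blinfun_apply S y)"
 shows "op_adj T = S"
 unfolding op_adj_def
proof (rule the_equality)
 fix S' assume "ALL x y. cinner (blinfun_apply T x) y = cinner x (blinfun_apply S' y)"
 thus "S' = S"
  using assms by - (rule blinfun_eqI, rule cinner_right_cancel, metis)
qed (use assms in blast)

lemma
 assumes "clin T"
 shows cinner_op_adj: "cinner (blinfun_apply T x) y = cinner x (blinfun_apply (op_adj T) y)"
  and clin_op_adj: "clin (op_adj T)"
proof -
 obtain S where "clin S" "!!x y. cinner (blinfun_apply T x) y = cinner x (blinfun_apply S y)"
  using adjoint_exists[OF assms] by blast
 moreover from this have "op_adj T = S" by (intro op_adj_eqI)
 ultimately show "cinner (blinfun_apply T x) y = cinner x (blinfun_apply (op_adj T) y)"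
  "clin (op_adj T)" by simp_all
qed

lemma clin_intros:
 "clin 0" "clin id_blinfun"
 "clin S ==> clin T ==> clin (S + T)"
 "clin S ==> clin T ==> clin (S o\<^sub>L T)"
 "clin S ==> clin (- S)"
 "clin S ==> clin (op_scale c S)"
 "clin S ==> clin (r *\<^sub>R S)"
by (auto simp: clin_def scaleC_zero_right blinfun.add_left scaleC_add_right op_scale_apply
  scaleC_scaleC mult.commute blinfun.scaleR_left scaleR_scaleC blinfun.minus_left scaleC_minus_right)

lemma clin_sum: "(!!i. i:I ==> clin (f i)) ==> clin (sum f I)"
 by (induction I rule: infinite_finite_induct) (auto intro: clin_intros)

lemma op_adj_zero: "op_adj 0 = 0"
 by (rule op_adj_eqI) (simp add: cinner_inner scaleC_zero_right)

lemma op_adj_id: "op_adj id_blinfun = id_blinfun"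
 by (rule op_adj_eqI) simp

lemma op_adj_op_adj: "clin T ==> op_adj (op_adj T) = T"
 proof (rule op_adj_eqI)
 fix x y assume T: "clin T"
 show "cinner (blinfun_apply (op_adj T) x) y = cinner x (blinfun_apply T y)"
  using cinner_op_adj[OF T, of y x] cinner_commute[of x "blinfun_apply T y"]
   cinner_commute[of "blinfun_apply (op_adj T) x" y] by simp
qed

lemma op_adj_add: "clin S ==> clin T ==> op_adj (S + T) = op_adj S + op_adj T"
 by (rule op_adj_eqI) (simp add: blinfun.add_left cinner_add_left cinner_add_right cinner_op_adj)

lemma op_adj_sum: "(!!i. i:I ==> clin (f i)) ==> op_adj (sum f I) = (\<Sum>i\<in>I. op_adj (f i))"
 by (induction I rule: infinite_finite_induct) (auto simp: op_adj_zero op_adj_add clin_sum)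

lemma op_adj_compose: "clin S ==> clin T ==> op_adj (S o\<^sub>L T) = op_adj T o\<^sub>L op_adj S"
 by (rule op_adj_eqI) (simp add: cinner_op_adj)

lemma op_adj_scale: "clin T ==> op_adj (op_scale c T) = op_scale (cnj c) (op_adj T)"
 by (rule op_adj_eqI)
  (simp add: op_scale_apply cinner_scaleC_left cinner_scaleC_right cinner_op_adj)

lemma op_scale_linear:
 "op_scale c (S + T) = op_scale c S + op_scale c T" "op_scale (c + d) T = op_scale c T + op_scale d T"
 "op_scale c (op_scale d T) = op_scale (c * d) T" "op_scale c 0 = 0" "op_scale 0 T = 0"
 "op_scale 1 T = T" "op_scale (- 1) T = - T" "op_scale (complex_of_real r) T = r *\<^sub>R T"
 by (auto intro!: blinfun_eqI simp: op_scale_apply blinfun.add_left blinfun.minus_left blinfun.scaleR_left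
   scaleC_add_right scaleC_add_left scaleC_scaleC scaleC_zero_left scaleC_zero_right scaleC_one
   scaleC_minus_one scaleR_scaleC)

lemma op_scale_compose:
 "op_scale c S o\<^sub>L T = op_scale c (S o\<^sub>L T)"
 "clin S ==> S o\<^sub>L op_scale c T = op_scale c (S o\<^sub>L T)"
 by (auto intro!: blinfun_eqI simp: op_scale_apply clin_def)

lemma op_scale_sum: "op_scale c (sum f I) = (\<Sum>i\<in>I. op_scale c (f i))"
 by (induction I rule: infinite_finite_induct) (auto simp: op_scale_linear)

section \<open>Finitely supported matrices of operators\<close>

text \<open>The algebraic direct sum of copies of H, indexed by summand and row. It is a pre-Hilbert
  space on which all matrices act, so that their norm is an \<open>onorm\<close>.\<close>

typedef (overloaded) 'h fvec = "{v :: nat \<times> nat => 'h::complex_hilbert. finite {k. v k ~= 0}}"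
 morphisms coord Abs_fvec
 by (rule exI[of _ "%_. 0"]) simp

setup_lifting type_definition_fvec

lemma finite_coord: "finite {k. coord v k ~= 0}"
 using coord[of v] by simp

lemma fvec_eqI: "(!!k. coord v k = coord w k) ==> v = w"
 by (metis coord_inject ext)

instantiation fvec :: (complex_hilbert) real_vector
begin

lift_definition zero_fvec :: "'a fvec" is "%_. 0" by simp
lift_definition plus_fvec :: "'a fvec => 'a fvec => 'a fvec" is "%v w k. v k + w k"
 subgoal for v w by (rule finite_subset[of _ "{k. v k ~= 0} \<union> {k. w k ~= 0}"]) auto
 done
lift_definition minus_fvec :: "'a fvec => 'a fvec => 'a fvec" is "%v w k. v k - w k"
 subgoal for v w by (rule finite_subset[of _ "{k. v k ~= 0} \<union> {k. w k ~= 0}"]) auto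
 done
lift_definition uminus_fvec :: "'a fvec => 'a fvec" is "%v k. - v k" by simp
lift_definition scaleR_fvec :: "real => 'a fvec => 'a fvec" is "%r v k. r *\<^sub>R v k"
 subgoal for r v by (rule finite_subset[of _ "{k. v k ~= 0}"]) auto
 done

instance
 by standard (auto intro!: fvec_eqI simp: plus_fvec.rep_eq minus_fvec.rep_eq uminus_fvec.rep_eq
  scaleR_fvec.rep_eq zero_fvec.rep_eq algebra_simps)

end

instantiation fvec :: (complex_hilbert) real_inner
begin

definition inner_fvec :: "'a fvec => 'a fvec => real" where
 "inner_fvec v w = (\<Sum>k | coord v k ~= 0. inner (coord v k) (coord w k))"
definition norm_fvec :: "'a fvec => real" where "norm_fvec v = sqrt (inner v v)"
definition sgn_fvec :: "'a fvec => 'a fvec" where "sgn_fvec v = v /\<^sub>R norm v"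
definition dist_fvec :: "'a fvec => 'a fvec => real" where "dist_fvec v w = norm (v - w)"
definition uniformity_fvec :: "('a fvec \<times> 'a fvec) filter" where
 "uniformity_fvec = (INF e\<in>{0<..}. principal {(x, y). dist x y < e})"
definition open_fvec :: "'a fvec set => bool" where
 "open_fvec U \<longleftrightarrow> (ALL x:U. \<forall>\<^sub>F (x', y) in uniformity. x' = x --> y:U)"

lemma inner_fvec_sum:
 assumes "finite K" "!!k. coord v k ~= 0 ==> k:K"
 shows "inner v w = (\<Sum>k\<in>K. inner (coord v k) (coord (w::'a fvec) k))"
 unfolding inner_fvec_def by (rule sum.mono_neutral_left) (use assms in auto)

instance
proof
 fix x y z :: "'a fvec" and r :: real
 let ?K = "{k. coord x k ~= 0} \<union> {k. coord y k ~= 0} \<union> {k. coord (x + y) k ~= 0}"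
 have K: "finite ?K" using finite_coord by blast
 show "inner x y = inner y x"
  by (subst (1 2) inner_fvec_sum[OF K]) (auto simp: inner_commute)
 show "inner (x + y) z = inner x z + inner y z"
  by (subst (1 2 3) inner_fvec_sum[OF K])
   (auto simp: plus_fvec.rep_eq inner_left_distrib sum.distrib)
 show "inner (r *\<^sub>R x) y = r * inner x y"
  by (subst (1 2) inner_fvec_sum[OF K]) (auto simp: scaleR_fvec.rep_eq sum_distrib_left)
 show "0 <= inner x x" by (simp add: inner_fvec_def sum_nonneg)
 have "inner x x = 0 \<longleftrightarrow> (ALL k:{k. coord x k ~= 0}. inner (coord x k) (coord x k) = 0)"
  unfolding inner_fvec_def by (rule sum_nonneg_eq_0_iff) (auto simp: finite_coord)
 thus "inner x x = 0 \<longleftrightarrow> x = 0"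
  by (auto intro: fvec_eqI simp: zero_fvec.rep_eq)
qed (auto simp: norm_fvec_def sgn_fvec_def dist_fvec_def uniformity_fvec_def open_fvec_def)

end

lemma norm_fvec_sum:
 assumes "finite K" "!!k. coord v k ~= 0 ==> k:K"
 shows "(norm v)\<^sup>2 = (\<Sum>k\<in>K. (norm (coord v k))\<^sup>2)"
 by (simp add: power2_norm_eq_inner inner_fvec_sum[OF assms])

lemma norm_coord_le: "norm (coord v k) <= norm v"
proof -
 have "(norm (coord v k))\<^sup>2 <= (\<Sum>k\<in>insert k {k. coord v k ~= 0}. (norm (coord v k))\<^sup>2)"
  by (rule member_le_sum) (auto simp: finite_coord)
 also have "... = (norm v)\<^sup>2" by (rule norm_fvec_sum[symmetric]) (auto simp: finite_coord)
 finally show ?thesis by (rule power2_le_imp_le) simp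
qed

lemma norm_le_sum_coord:
 assumes "finite K" "!!k. coord v k ~= 0 ==> k:K"
 shows "norm v <= (\<Sum>k\<in>K. norm (coord v k))"
proof -
 have "norm v = L2_set (%k. norm (coord v k)) K"
  unfolding L2_set_def by (simp flip: norm_fvec_sum[OF assms])
 thus ?thesis using L2_set_le_sum[of K "%k. norm (coord v k)"] by simp
qed

lemma sum_Times: "(\<Sum>k\<in>A \<times> B. f k) = (\<Sum>s\<in>A. \<Sum>i\<in>B. f (s, i))"
 by (simp add: sum.cartesian_product)

definition bsup :: "nat => 'h::complex_hilbert elt => bool" where
 "bsup n x \<longleftrightarrow> (ALL s i j. x s i j ~= 0 --> s < n & i < n & j < n)"

lemma bsup_mono: "bsup n x ==> n <= m ==> bsup m x"
 unfolding bsup_def by (meson order_less_le_trans)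

text \<open>As a type, the finitely supported matrices with complex-linear entries become a normed
  algebra in the sense of type classes. One type serves for all sizes because corner inclusions are
  inclusions of sets.\<close>

typedef (overloaded) 'h mat = "{x :: 'h::complex_hilbert elt.
  (EX n. bsup n x) & (ALL s i j. clin (x s i j))}"
 morphisms ent Abs_mat
 by (rule exI[of _ "%_ _ _. 0"]) (simp add: clin_intros bsup_def)

setup_lifting type_definition_mat

lemma clin_ent[simp]: "clin (ent x s i j)"
 using ent[of x] by simp

lemma ex_bounded: "EX n. bsup n (ent x)"
 using ent[of x] by simp

lemma ex_bounded2: "EX n. bsup n (ent x) & bsup n (ent y)"
 by (metis bsup_mono ex_bounded le_cases)

lemma ex_bounded3: "EX n. bsup n (ent x) & bsup n (ent y) & bsup n (ent z)"
 by (metis bsup_mono ex_bounded ex_bounded2 le_cases)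

lemma bsup_ge:
 assumes "bsup n x"
 shows "s >= n ==> x s i j = 0" "i >= n ==> x s i j = 0" "j >= n ==> x s i j = 0"
 using assms by (auto simp: bsup_def not_less[symmetric])

lemma mat_eqI: "(!!s i j. ent x s i j = ent y s i j) ==> x = y"
 by (metis ent_inject ext)

lemma sum_support:
 assumes "bsup n (x::'h::complex_hilbert elt)" "!!l. x s i l = 0 ==> f l = (0::'b::comm_monoid_add)"
 shows "(\<Sum>l | x s i l ~= 0. f l) = (\<Sum>l<n. f l)"
 by (rule sum.mono_neutral_left) (use assms in \<open>auto simp: bsup_def\<close>)

lemma compose_linear:
 fixes a b :: "'a::real_normed_vector \<Rightarrow>\<^sub>L 'a"
 shows "sum f K o\<^sub>L b = (\<Sum>k\<in>K. f k o\<^sub>L b)" "a o\<^sub>L sum f K = (\<Sum>k\<in>K. a o\<^sub>L f k)"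
  "(a o\<^sub>L b) o\<^sub>L c = a o\<^sub>L (b o\<^sub>L c)"
  "(a + c) o\<^sub>L b = (a o\<^sub>L b) + (c o\<^sub>L b)" "a o\<^sub>L (b + c) = (a o\<^sub>L b) + (a o\<^sub>L c)"
  "(r *\<^sub>R a) o\<^sub>L b = r *\<^sub>R (a o\<^sub>L b)" "a o\<^sub>L (r *\<^sub>R b) = r *\<^sub>R (a o\<^sub>L b)"
 by (auto intro!: blinfun_eqI simp: blinfun.bilinear_simps blinfun.sum_left blinfun.sum_right)

instantiation mat :: (complex_hilbert) ring
begin

lift_definition zero_mat :: "'a mat" is "%_ _ _. 0"
 by (simp add: clin_intros bsup_def)

lift_definition plus_mat :: "'a mat => 'a mat => 'a mat" is "%x y s i j. x s i j + y s i j"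
proof (intro conjI allI)
 fix x y :: "'a elt"
 assume "(EX n. bsup n x) & (ALL s i j. clin (x s i j))"
  "(EX n. bsup n y) & (ALL s i j. clin (y s i j))"
 then obtain n m where "bsup n x" "bsup m y"
  and cl: "!!s i j. clin (x s i j)" "!!s i j. clin (y s i j)" by auto
 hence "bsup (max n m) x" "bsup (max n m) y"
  by (auto intro: bsup_mono)
 hence "bsup (max n m) (%s i j. x s i j + y s i j)"
  unfolding bsup_def by (metis add.right_neutral)
 thus "EX n. bsup n (%s i j. x s i j + y s i j)" by blast
 show "clin (x s i j + y s i j)" for s i j using cl by (intro clin_intros)
qed

lift_definition uminus_mat :: "'a mat => 'a mat" is "%x s i j. - x s i j"
 by (auto simp: clin_intros bsup_def)

definition minus_mat :: "'a mat => 'a mat => 'a mat" where "minus_mat x y = x + - y"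

lift_definition times_mat :: "'a mat => 'a mat => 'a mat" is
 "%x y s i j. \<Sum>l | x s i l ~= 0. x s i l o\<^sub>L y s l j"
proof (intro conjI allI)
 fix x y :: "'a elt"
 assume "(EX n. bsup n x) & (ALL s i j. clin (x s i j))"
  "(EX n. bsup n y) & (ALL s i j. clin (y s i j))"
 then obtain n m where "bsup n x" "bsup m y"
  and cl: "!!s i j. clin (x s i j)" "!!s i j. clin (y s i j)" by auto
 hence b: "bsup (max n m) x" "bsup (max n m) y"
  by (auto intro: bsup_mono)
 have "bsup (max n m) (%s i j. \<Sum>l | x s i l ~= 0. x s i l o\<^sub>L y s l j)"
  unfolding bsup_def
 proof (intro allI impI, rule ccontr)
  fix s i j assume *: "(\<Sum>l | x s i l ~= 0. x s i l o\<^sub>L y s l j) ~= 0"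
   and "~ (s < max n m & i < max n m & j < max n m)"
  hence "x s i l o\<^sub>L y s l j = 0" for l
   using bsup_ge[OF b(1)] bsup_ge[OF b(2)] by (metis blinfun_compose_zero not_less)
  with * show False by simp
 qed
 thus "EX n. bsup n (%s i j. \<Sum>l | x s i l ~= 0. x s i l o\<^sub>L y s l j)" by blast
 show "clin (\<Sum>l | x s i l ~= 0. x s i l o\<^sub>L y s l j)" for s i j
  using cl by (intro clin_sum clin_intros)
qed

lemma ent_times:
 assumes "bsup n (ent x)"
 shows "ent (x * y) s i j = (\<Sum>l<n. ent x s i l o\<^sub>L ent y s l j)"
 unfolding times_mat.rep_eq by (rule sum_support[OF assms]) simp

instance
proof
 fix x y z :: "'a mat"
 obtain n where n: "bsup n (ent x)" "bsup n (ent y)" "bsup n (ent z)"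
  using ex_bounded3 by blast
 have n': "bsup n (ent (x * y))"
  unfolding bsup_def
 proof (intro allI impI, rule ccontr)
  fix s i j assume *: "ent (x * y) s i j ~= 0" "~ (s < n & i < n & j < n)"
  hence "ent x s i l o\<^sub>L ent y s l j = 0" for l
   using bsup_ge[OF n(1)] bsup_ge[OF n(2)] by (metis blinfun_compose_zero not_less)
  with * show False by (simp add: ent_times[OF n(1)])
 qed
 show "x * y * z = x * (y * z)"
  by (rule mat_eqI) (simp add: ent_times[OF n'] ent_times[OF n(1)] ent_times[OF n(2)] compose_linear,
    subst sum.swap, simp)
 have n'': "bsup n (ent (x + y))"
  using n(1,2) unfolding bsup_def plus_mat.rep_eq by (metis add.right_neutral)
 show "(x + y) * z = x * z + y * z"
  by (rule mat_eqI) (simp add: plus_mat.rep_eq ent_times[OF n''] ent_times[OF n(1)] ent_times[OF n(2)]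
    sum.distrib[symmetric] compose_linear)
 show "x * (y + z) = x * y + x * z"
  by (rule mat_eqI) (simp add: plus_mat.rep_eq ent_times[OF n(1)] sum.distrib[symmetric] compose_linear)
qed (auto intro!: mat_eqI simp: plus_mat.rep_eq uminus_mat.rep_eq zero_mat.rep_eq minus_mat_def algebra_simps)

end

lemma finite_nonzero_subset: "finite A ==> (!!k. k ~: A ==> f k = 0) ==> finite {k. f k ~= 0}"
 by (rule finite_subset[of _ A]) auto

lift_definition act :: "'h mat => 'h::complex_hilbert fvec => 'h fvec" is
 "%x v k. \<Sum>l | x (fst k) (snd k) l ~= 0. blinfun_apply (x (fst k) (snd k) l) (v (fst k, l))"
proof -
 fix x :: "'h elt" and v :: "nat \<times> nat => 'h"
 assume "(EX n. bsup n x) & (ALL s i j. clin (x s i j))"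
 then obtain n where n: "bsup n x" by blast
 have *: "(\<Sum>l | x (fst k) (snd k) l ~= 0. blinfun_apply (x (fst k) (snd k) l) (v (fst k, l))) = 0"
  if "k ~: {..<n} \<times> {..<n}" for k
  using that bsup_ge[OF n] by (cases k) (auto simp: not_less)
 show "finite {k. (\<Sum>l | x (fst k) (snd k) l ~= 0. blinfun_apply (x (fst k) (snd k) l) (v (fst k, l))) ~= 0}"
  by (rule finite_nonzero_subset[of "{..<n} \<times> {..<n}"], simp, erule *)
qed

lemma coord_act:
 assumes "bsup n (ent x)"
 shows "coord (act x v) (s, i) = (\<Sum>l<n. blinfun_apply (ent x s i l) (coord v (s, l)))"
 unfolding act.rep_eq fst_conv snd_conv by (rule sum_support[OF assms]) simp

lemma coord_act_ge:
 assumes "bsup n (ent x)" "coord (act x v) k ~= 0"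
 shows "k:{..<n} \<times> {..<n}"
 using assms(2) bsup_ge[OF assms(1)]
 by (cases k) (auto simp: coord_act[OF assms(1)] not_less[symmetric] sum.neutral blinfun.zero_left intro: ccontr)

lemma bounded_linear_act: "bounded_linear (act x)"
proof -
 obtain n where n: "bsup n (ent x)" using ex_bounded by blast
 show ?thesis
 proof (rule bounded_linear_intro[where K = "\<Sum>k\<in>{..<n} \<times> {..<n}. \<Sum>l<n. norm (ent x (fst k) (snd k) l)"])
  fix v w :: "'a fvec" and r :: real
  show "act x (v + w) = act x v + act x w"
  proof (rule fvec_eqI)
   fix k show "coord (act x (v + w)) k = coord (act x v + act x w) k"
    by (cases k) (simp add: plus_fvec.rep_eq coord_act[OF n] blinfun.add_right sum.distrib)
  qed
  show "act x (r *\<^sub>R v) = r *\<^sub>R act x v"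
  proof (rule fvec_eqI)
   fix k show "coord (act x (r *\<^sub>R v)) k = coord (r *\<^sub>R act x v) k"
    by (cases k) (simp add: scaleR_fvec.rep_eq coord_act[OF n] blinfun.scaleR_right scaleR_sum_right)
  qed
  have *: "norm (coord (act x v) k) <= (\<Sum>l<n. norm (ent x (fst k) (snd k) l)) * norm v" for k
  proof (cases k)
   case (Pair s i)
   have "norm (coord (act x v) k) <= (\<Sum>l<n. norm (blinfun_apply (ent x s i l) (coord v (s, l))))"
    unfolding Pair coord_act[OF n] by (rule norm_sum)
   also have "... <= (\<Sum>l<n. norm (ent x s i l) * norm v)"
    by (rule sum_mono) (meson mult_left_mono norm_blinfun norm_coord_le norm_ge_zero order_trans)
   finally show ?thesis by (simp add: Pair sum_distrib_right)
  qed
  have "norm (act x v) <= (\<Sum>k\<in>{..<n} \<times> {..<n}. norm (coord (act x v) k))"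
   by (rule norm_le_sum_coord) (use coord_act_ge[OF n] in auto)
  also have "... <= (\<Sum>k\<in>{..<n} \<times> {..<n}. (\<Sum>l<n. norm (ent x (fst k) (snd k) l)) * norm v)"
   by (rule sum_mono) (rule *)
  finally show "norm (act x v) <= norm v * (\<Sum>k\<in>{..<n} \<times> {..<n}. \<Sum>l<n. norm (ent x (fst k) (snd k) l))"
   by (simp only: sum_distrib_right mult.commute[of "norm v"])
 qed
qed

lemma act_mult: "act (x * y) v = act x (act y v)"
proof (rule fvec_eqI)
 fix k :: "nat \<times> nat" obtain s i where k: "k = (s, i)" by (cases k)
 obtain n where n: "bsup n (ent x)" "bsup n (ent y)" "bsup n (ent (x * y))"
  using ex_bounded3 by blast
 show "coord (act (x * y) v) k = coord (act x (act y v)) k"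
  by (simp add: k coord_act[OF n(1)] coord_act[OF n(2)] coord_act[OF n(3)] ent_times[OF n(1)]
    blinfun.sum_left blinfun.sum_right, subst sum.swap, simp)
qed

lemma act_add: "act (x + y) v = act x v + act y v"
proof (rule fvec_eqI)
 fix k :: "nat \<times> nat" obtain s i where k: "k = (s, i)" by (cases k)
 obtain n where n: "bsup n (ent x)" "bsup n (ent y)" "bsup n (ent (x + y))"
  using ex_bounded3 by blast
 show "coord (act (x + y) v) k = coord (act x v + act y v) k"
  by (simp add: k coord_act[OF n(1)] coord_act[OF n(2)] coord_act[OF n(3)] plus_mat.rep_eq
    plus_fvec.rep_eq blinfun.add_left sum.distrib)
qed

lift_definition single_fvec :: "nat \<times> nat => 'h => 'h::complex_hilbert fvec" is
 "%k h l. if l = k then h else 0" by (rule finite_subset[of _ "{_}"]) auto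

lemma act_eq_0:
 assumes "!!v. act x v = 0" shows "x = (0 :: 'h::complex_hilbert mat)"
proof (rule mat_eqI, rule blinfun_eqI)
 fix s i j and h :: 'h
 obtain n where n: "bsup n (ent x)" using ex_bounded by blast
 define v where "v = single_fvec (s, j) h"
 have "(\<Sum>l<n. blinfun_apply (ent x s i l) (coord v (s, l))) = 0"
  using assms[of v] coord_act[OF n, of v s i] by (simp add: zero_fvec.rep_eq)
 moreover have "(\<Sum>l<n. blinfun_apply (ent x s i l) (coord v (s, l))) =
   (\<Sum>l<n. if l = j then blinfun_apply (ent x s i j) h else 0)"
  by (rule sum.cong) (auto simp: v_def single_fvec.rep_eq blinfun.zero_right)
 ultimately have "j < n ==> blinfun_apply (ent x s i j) h = 0" by (simp)
 thus "blinfun_apply (ent x s i j) h = blinfun_apply (ent 0 s i j) h"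
  using bsup_ge(3)[OF n, of j] by (cases "j < n") (auto simp: zero_mat.rep_eq)
qed

instantiation mat :: (complex_hilbert) real_algebra
begin

lift_definition scaleR_mat :: "real => 'a mat => 'a mat" is "%r x s i j. r *\<^sub>R x s i j"
 unfolding bsup_def by (metis clin_intros(7) scaleR_zero_right)

instance
proof
 fix x y :: "'a mat" and r :: real
 obtain n where n: "bsup n (ent x)" "bsup n (ent (r *\<^sub>R x))"
  using ex_bounded2 by blast
 show "(r *\<^sub>R x) * y = r *\<^sub>R (x * y)" "x * (r *\<^sub>R y) = r *\<^sub>R (x * y)"
  by (auto intro!: mat_eqI simp: ent_times[OF n(1)] ent_times[OF n(2)] scaleR_mat.rep_eq
    scaleR_sum_right compose_linear)
qed (auto intro!: mat_eqI simp: plus_mat.rep_eq scaleR_mat.rep_eq algebra_simps)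

end

section \<open>The operator norm on matrices and the C*-identity\<close>

instantiation mat :: (complex_hilbert) real_normed_algebra
begin

definition norm_mat :: "'a mat => real" where "norm_mat x = onorm (act x)"
definition sgn_mat :: "'a mat => 'a mat" where "sgn_mat v = v /\<^sub>R norm v"
definition dist_mat :: "'a mat => 'a mat => real" where "dist_mat v w = norm (v - w)"
definition uniformity_mat :: "('a mat \<times> 'a mat) filter" where
 "uniformity_mat = (INF e\<in>{0<..}. principal {(x, y). dist x y < e})"
definition open_mat :: "'a mat set => bool" where
 "open_mat U \<longleftrightarrow> (ALL x:U. \<forall>\<^sub>F (x', y) in uniformity. x' = x --> y:U)"

lemma act_scaleR: "act (r *\<^sub>R x) v = r *\<^sub>R act (x::'a mat) v"
proof (rule fvec_eqI)
 fix k :: "nat \<times> nat" obtain s i where k: "k = (s, i)" by (cases k)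
 obtain n where n: "bsup n (ent x)" "bsup n (ent (r *\<^sub>R x))"
  using ex_bounded2 by blast
 show "coord (act (r *\<^sub>R x) v) k = coord (r *\<^sub>R act x v) k"
  by (simp add: k coord_act[OF n(1)] coord_act[OF n(2)] scaleR_mat.rep_eq
    scaleR_fvec.rep_eq blinfun.scaleR_left scaleR_sum_right)
qed

instance
proof
 fix x y :: "'a mat" and r s :: real
 show "norm x = 0 \<longleftrightarrow> x = 0"
  using act_eq_0[of x] by (auto simp: norm_mat_def onorm_eq_0[OF bounded_linear_act]
    intro!: fvec_eqI simp: act.rep_eq zero_mat.rep_eq zero_fvec.rep_eq)
 have "act (x + y) = (%v. act x v + act y v)" by (simp add: fun_eq_iff act_add)
 thus "norm (x + y) <= norm x + norm y"
  unfolding norm_mat_def by (simp add: onorm_triangle bounded_linear_act)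
 have "act (r *\<^sub>R x) = (%v. r *\<^sub>R act x v)" by (simp add: fun_eq_iff act_scaleR)
 thus "norm (r *\<^sub>R x) = \<bar>r\<bar> * norm x"
  unfolding norm_mat_def by (simp add: onorm_scaleR bounded_linear_act)
 have "act (x * y) = act x o act y" by (simp add: fun_eq_iff act_mult)
 thus "norm (x * y) <= norm x * norm y"
  unfolding norm_mat_def by (simp add: onorm_compose bounded_linear_act)
qed (auto simp: sgn_mat_def dist_mat_def uniformity_mat_def open_mat_def)

end

lift_definition star :: "'h mat => 'h::complex_hilbert mat" is "%x s i j. op_adj (x s j i)"
proof -
 fix x :: "'h elt"
 assume x: "(EX n. bsup n x) & (ALL s i j. clin (x s i j))"
 thus "(EX n. bsup n (%s i j. op_adj (x s j i))) & (ALL s i j. clin (op_adj (x s j i)))"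
  by (auto simp: bsup_def clin_op_adj op_adj_zero) (metis op_adj_zero)
qed

lift_definition cscale :: "complex => 'h mat => 'h::complex_hilbert mat" is "%c x s i j. op_scale c (x s i j)"
 by (auto simp: clin_intros bsup_def op_scale_linear) (metis op_scale_linear(4))

lemma star_simps [simp]:
 "star (star x) = x" "star (x + y) = star x + star y" "star 0 = 0"
 "star (cscale c x) = cscale (cnj c) (star x)"
 by (auto intro!: mat_eqI simp: star.rep_eq plus_mat.rep_eq op_adj_op_adj op_adj_add zero_mat.rep_eq
   op_adj_zero cscale.rep_eq op_adj_scale)

lemma star_mult [simp]: "star (x * y) = star y * star x"
proof -
 obtain n where n: "bsup n (ent x)" "bsup n (ent y)"
  "bsup n (ent (star y))"
  using ex_bounded3 by blast
 show ?thesis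
  by (rule mat_eqI) (simp add: ent_times[OF n(1)] ent_times[OF n(3)] star.rep_eq op_adj_sum
    op_adj_compose clin_intros)
qed

lemma cscale_simps [simp]:
 "cscale c (x + y) = cscale c x + cscale c y" "cscale (c + d) x = cscale c x + cscale d x"
 "cscale c (cscale d x) = cscale (c * d) x" "cscale c 0 = 0" "cscale 0 x = 0" "cscale 1 x = x"
 by (auto intro!: mat_eqI simp: cscale.rep_eq plus_mat.rep_eq op_scale_linear zero_mat.rep_eq)

lemma cscale_real: "cscale (complex_of_real r) x = r *\<^sub>R x"
 by (auto intro!: mat_eqI simp: cscale.rep_eq scaleR_mat.rep_eq op_scale_linear)

lemma cscale_minus_one: "cscale (- 1) x = - x"
 by (auto intro!: mat_eqI simp: cscale.rep_eq uminus_mat.rep_eq op_scale_linear)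

lemma cscale_mult [simp]: "cscale c x * y = cscale c (x * y)" "x * cscale c y = cscale c (x * y)"
proof -
 obtain n where n: "bsup n (ent x)" "bsup n (ent (cscale c x))"
  using ex_bounded2 by blast
 show "cscale c x * y = cscale c (x * y)" "x * cscale c y = cscale c (x * y)"
  by (auto intro!: mat_eqI simp: ent_times[OF n(1)] ent_times[OF n(2)] cscale.rep_eq op_scale_sum
    op_scale_compose)
qed

lemma star_minus [simp]: "star (- x) = - star x" "star (x - y) = star x - star y"
 using star_simps(4)[of "-1" x] star_simps(4)[of "-1" y] by (simp_all add: cscale_minus_one diff_conv_add_uminus del: add_uminus_conv_diff)

lemma star_scaleR [simp]: "star (r *\<^sub>R x) = r *\<^sub>R star x"
 using star_simps(4)[of "complex_of_real r" x] by (simp add: cscale_real)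

lemma star_sum: "star (sum f I) = (\<Sum>i\<in>I. star (f i))"
 by (induction I rule: infinite_finite_induct) auto

lemma star_eq_0 [simp]: "star x = 0 \<longleftrightarrow> x = 0"
 by (metis star_simps(1,3))

lemma inner_act: "inner (act x v) w = inner v (act (star x) w)"
proof -
 obtain n0 where n0: "bsup n0 (ent x)" "bsup n0 (ent (star x))"
  using ex_bounded2 by blast
 have "finite (fst ` {k. coord v k ~= 0} \<union> snd ` {k. coord v k ~= 0})" using finite_coord by blast
 then obtain n1 where n1: "!!k. k:fst ` {k. coord v k ~= 0} \<union> snd ` {k. coord v k ~= 0} ==> k < n1"
  by (metis finite_nat_set_iff_bounded)
 define n where "n = max n0 n1"
 have n: "bsup n (ent x)" "bsup n (ent (star x))"
  using n0 by (auto intro: bsup_mono simp: n_def)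
 have v: "coord v k ~= 0 ==> k:{..<n} \<times> {..<n}" for k
  using n1[of "fst k"] n1[of "snd k"] by (cases k) (auto simp: n_def image_iff less_max_iff_disj)
 have adj: "inner (blinfun_apply (ent x s i j) a) b = inner a (blinfun_apply (ent (star x) s j i) b)" for s i j a b
  by (simp add: inner_cinner cinner_op_adj star.rep_eq)
 have "inner (act x v) w = (\<Sum>k\<in>{..<n} \<times> {..<n}. inner (coord (act x v) k) (coord w k))"
  by (rule inner_fvec_sum) (use coord_act_ge[OF n(1)] in auto)
 also have "... = (\<Sum>s<n. \<Sum>i<n. \<Sum>l<n. inner (coord v (s, l)) (blinfun_apply (ent (star x) s l i) (coord w (s, i))))"
  by (simp add: sum_Times coord_act[OF n(1)] inner_sum_left adj)
 also have "... = (\<Sum>s<n. \<Sum>l<n. inner (coord v (s, l)) (coord (act (star x) w) (s, l)))"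
  by (rule sum.cong[OF refl], subst sum.swap, simp add: coord_act[OF n(2)] inner_sum_right)
 also have "... = inner v (act (star x) w)"
  by (subst inner_fvec_sum[of "{..<n} \<times> {..<n}"]) (use v in \<open>auto simp: sum_Times\<close>)
 finally show ?thesis .
qed

lemma norm_act: "norm (act x v) <= norm x * norm v"
 unfolding norm_mat_def by (rule onorm[OF bounded_linear_act])

lemma norm_mat_le: "(!!v. norm (act x v) <= b * norm v) ==> 0 <= b ==> norm x <= b"
 unfolding norm_mat_def by (rule onorm_bound) auto

text \<open>Cauchy-Schwarz applied to the inner product of v with \<open>act (star x * x) v\<close>
  bounds the square of \<open>norm x\<close> by \<open>norm (star x * x)\<close>. This gives
  \<open>norm x <= norm (star x)\<close>, equality by symmetry, and then the remaining inequality by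
  submultiplicativity.\<close>

lemma norm_star_mult_self: "norm (star x * x) = (norm x)\<^sup>2"
 and norm_star [simp]: "norm (star x) = norm x"
proof -
 have le: "(norm x)\<^sup>2 <= norm (star x * x)" for x :: "'a mat"
 proof -
  have "norm x <= sqrt (norm (star x * x))"
  proof (rule norm_mat_le)
   fix v
   have "(norm (act x v))\<^sup>2 = inner v (act (star x * x) v)"
    by (simp add: power2_norm_eq_inner inner_act act_mult)
   also have "... <= norm v * (norm (star x * x) * norm v)"
    by (meson mult_left_mono norm_act norm_cauchy_schwarz norm_ge_zero order_trans)
   also have "... = (sqrt (norm (star x * x)) * norm v)\<^sup>2"
    by (simp add: power_mult_distrib power2_eq_square)
   finally show "norm (act x v) <= sqrt (norm (star x * x)) * norm v"
    by (rule power2_le_imp_le) simp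
  qed simp
  thus ?thesis by (simp add: real_le_rsqrt sqrt_ge_absD)
 qed
 have le2: "norm x <= norm (star x)" for x :: "'a mat"
 proof (cases "norm x = 0")
  case False
  have "norm x * norm x <= norm (star x) * norm x"
   using le[of x] norm_mult_ineq[of "star x" x] by (simp add: power2_eq_square)
  thus ?thesis using False by (simp add: zero_less_norm_iff)
 qed simp
 show eq: "norm (star x) = norm x" using le2[of x] le2[of "star x"] by simp
 show "norm (star x * x) = (norm x)\<^sup>2"
  using le[of x] norm_mult_ineq[of "star x" x] by (simp add: eq power2_eq_square)
qed

text \<open>The supremum in \<open>elt_norm\<close> tests each summand separately with truncated
  vectors. Distinct summands act on orthogonal subspaces, so the norm of the whole matrix is the
  largest of the norms of its summands.\<close>

lemma elt_norm_ent: "elt_norm (ent x) = norm (x :: 'a::complex_hilbert mat)"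
proof -
 let ?S = "{sqrt (\<Sum>i<N. (norm (\<Sum>j<N. blinfun_apply (ent x s i j) (v j)))\<^sup>2) | s N v.
   (\<Sum>j<N. (norm (v j))\<^sup>2) <= 1}"
 obtain n where n: "bsup n (ent x)" using ex_bounded by blast
 have upper: "r <= norm x" if "r:?S" for r
  using that
 proof (elim CollectE exE conjE)
  fix s N v
  assume r: "r = sqrt (\<Sum>i<N. (norm (\<Sum>j<N. blinfun_apply (ent x s i j) (v j)))\<^sup>2)"
   and v: "(\<Sum>j<N. (norm (v j))\<^sup>2) <= 1"
  define M where "M = max n N"
  have M: "bsup M (ent x)" using bsup_mono[OF n] by (simp add: M_def)
  define w where "w = Abs_fvec (%k. if fst k = s & snd k < N then v (snd k) else 0)"
  have w: "coord w k = (if fst k = s & snd k < N then v (snd k) else 0)" for k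
   unfolding w_def by (subst Abs_fvec_inverse)
    (auto intro: finite_subset[of _ "{s} \<times> {..<N}"])
  have "(norm w)\<^sup>2 = (\<Sum>k\<in>{s} \<times> {..<N}. (norm (coord w k))\<^sup>2)"
   by (rule norm_fvec_sum) (auto simp: w split: if_splits)
  also have "... = (\<Sum>j<N. (norm (v j))\<^sup>2)"
   by (simp add: sum_Times w)
  finally have "norm w <= 1" using v abs_square_le_1[of "norm w"] by simp
  have "(\<Sum>j<N. blinfun_apply (ent x s i j) (v j)) = coord (act x w) (s, i)" for i
   unfolding coord_act[OF M]
   by (rule sum.mono_neutral_cong_left) (auto simp: M_def w blinfun.zero_right)
  hence "(\<Sum>i<N. (norm (\<Sum>j<N. blinfun_apply (ent x s i j) (v j)))\<^sup>2) =
   (\<Sum>k\<in>{s} \<times> {..<N}. (norm (coord (act x w) k))\<^sup>2)"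
   by (simp add: sum_Times)
  also have "... <= (\<Sum>k\<in>{s} \<times> {..<N} \<union> {..<M} \<times> {..<M}. (norm (coord (act x w) k))\<^sup>2)"
   by (rule sum_mono2) auto
  also have "... = (norm (act x w))\<^sup>2"
   by (rule norm_fvec_sum[symmetric]) (use coord_act_ge[OF M] in auto)
  also have "... <= (norm x)\<^sup>2"
   using norm_act[of x w] \<open>norm w <= 1\<close>
   by (intro power_mono) (auto intro: order_trans[OF _ mult_left_le])
  finally show ?thesis by (simp add: r real_le_lsqrt)
 qed
 have bdd: "bdd_above ?S" using upper by (meson bdd_above.I)
 define m where "m = Sup ?S"
 have "0:?S"
  by (rule CollectI, rule exI[of _ 0], rule exI[of _ 0], rule exI[of _ "%_. 0"]) simp
 hence ne: "?S ~= {}" by blast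
 have le: "m <= norm x" unfolding m_def using ne upper by (rule cSup_least)
 note \<open>0:?S\<close>
 hence "0 <= m" unfolding m_def using bdd by (rule cSup_upper)
 \<comment> \<open>Homogeneity extends the defining bound from the unit ball to all vectors; the
   zero vector is treated apart. These bounds are later added up over the summands
   \<open>s\<close>.\<close>
 have row: "(\<Sum>i<N. (norm (\<Sum>j<N. blinfun_apply (ent x s i j) (v j)))\<^sup>2) <= m\<^sup>2 * (\<Sum>j<N. (norm (v j))\<^sup>2)" for s N v
 proof (cases "(\<Sum>j<N. (norm (v j))\<^sup>2) = 0")
  case True
  hence "v j = 0" if "j < N" for j
   using that by (simp add: sum_nonneg_eq_0_iff)
  thus ?thesis by (simp add: blinfun.zero_right)
 next
  case False
  define c where "c = sqrt (\<Sum>j<N. (norm (v j))\<^sup>2)"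
  have "(\<Sum>j<N. (norm (v j))\<^sup>2) > 0" using False sum_nonneg[of "{..<N}" "%j. (norm (v j))\<^sup>2"] by simp
  hence c: "c > 0" "c\<^sup>2 = (\<Sum>j<N. (norm (v j))\<^sup>2)" by (auto simp: c_def)
  have "(norm (a /\<^sub>R c))\<^sup>2 = inverse (c\<^sup>2) * (norm a)\<^sup>2" for a :: 'a
   by (simp add: power_mult_distrib power_inverse)
  hence sc: "(\<Sum>i\<in>I. (norm (f i /\<^sub>R c))\<^sup>2) = inverse (c\<^sup>2) * (\<Sum>i\<in>I. (norm (f i))\<^sup>2)"
   for f :: "nat => 'a" and I by (simp add: sum_distrib_left)
  have "(\<Sum>j<N. (norm (v j /\<^sub>R c))\<^sup>2) <= 1" unfolding sc c(2)[symmetric] using c(1) by simp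
  hence "sqrt (\<Sum>i<N. (norm (\<Sum>j<N. blinfun_apply (ent x s i j) (v j /\<^sub>R c)))\<^sup>2) <= m"
   unfolding m_def by (intro cSup_upper bdd CollectI exI conjI) (rule refl)
  hence "(\<Sum>i<N. (norm (\<Sum>j<N. blinfun_apply (ent x s i j) (v j /\<^sub>R c)))\<^sup>2) <= m\<^sup>2"
   using sqrt_le_D by blast
  hence "inverse (c\<^sup>2) * (\<Sum>i<N. (norm (\<Sum>j<N. blinfun_apply (ent x s i j) (v j)))\<^sup>2) <= m\<^sup>2"
   by (simp only: blinfun.scaleR_right sc flip: scaleR_sum_right)
  thus ?thesis using c(1) by (simp add: field_simps flip: c(2))
 qed
 have "norm x <= m"
 proof (rule norm_mat_le)
  fix v :: "'a fvec"
  have "finite (fst ` {k. coord v k ~= 0} \<union> snd ` {k. coord v k ~= 0})" using finite_coord by blast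
  then obtain n1 where n1: "!!k. k:fst ` {k. coord v k ~= 0} \<union> snd ` {k. coord v k ~= 0} ==> k < n1"
   by (metis finite_nat_set_iff_bounded)
  define M where "M = max n n1"
  have M: "bsup M (ent x)" using bsup_mono[OF n] by (simp add: M_def)
  have v: "coord v k ~= 0 ==> k:{..<M} \<times> {..<M}" for k
   using n1[of "fst k"] n1[of "snd k"] by (cases k) (auto simp: M_def image_iff less_max_iff_disj)
  have "(norm (act x v))\<^sup>2 = (\<Sum>k\<in>{..<M} \<times> {..<M}. (norm (coord (act x v) k))\<^sup>2)"
   by (rule norm_fvec_sum) (use coord_act_ge[OF M] in auto)
  also have "... = (\<Sum>s<M. \<Sum>i<M. (norm (\<Sum>j<M. blinfun_apply (ent x s i j) (coord v (s, j))))\<^sup>2)"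
   by (simp add: sum_Times coord_act[OF M])
  also have "... <= (\<Sum>s<M. m\<^sup>2 * (\<Sum>j<M. (norm (coord v (s, j)))\<^sup>2))"
   by (rule sum_mono) (rule row)
  also have "... = m\<^sup>2 * (\<Sum>k\<in>{..<M} \<times> {..<M}. (norm (coord v k))\<^sup>2)"
   by (simp add: sum_distrib_left sum_Times)
  also have "... = (m * norm v)\<^sup>2"
   by (subst norm_fvec_sum[of "{..<M} \<times> {..<M}" v, symmetric]) (use v in \<open>auto simp: power_mult_distrib\<close>)
  finally show "norm (act x v) <= m * norm v"
   by (rule power2_le_imp_le) (simp add: \<open>0 <= m\<close>)
 qed fact
 with le show ?thesis by (simp add: elt_norm_def m_def)
qed

section \<open>Finite-dimensional subspaces of normed spaces\<close>

definition fin_dim :: "'a::real_vector set => bool" where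
 "fin_dim S \<longleftrightarrow> subspace S & (EX B. finite B & S <= span B)"

lemma fin_dim_basis:
 assumes "fin_dim S"
 obtains B where "finite B" "independent B" "B <= S" "span B = S"
proof -
 obtain C where C: "finite C" "S <= span C" using assms by (auto simp: fin_dim_def)
 obtain B where B: "B <= S" "independent B" "S <= span B"
  using maximal_independent_subset by blast
 have "finite B" using independent_span_bound[OF C(1) B(2)] B(1) C(2) by blast
 moreover have "span B = S"
  using B assms span_minimal[of B S] by (auto simp: fin_dim_def)
 ultimately show ?thesis using that B by blast
qed

lemma fin_dim_subspace: "fin_dim S ==> T <= S ==> subspace T ==> fin_dim T"
 by (auto simp: fin_dim_def)

lemma span_finite_coeffs:
 assumes "finite B" "x:span B" obtains a where "x = (\<Sum>b\<in>B. a b *\<^sub>R b)"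
 using assms by (auto simp: span_finite)

lemma csubseq_coeffs:
 fixes a :: "nat => 'b => real"
 assumes "finite B" "!!n b. b:B ==> \<bar>a n b\<bar> <= M"
 shows "EX r l. strict_mono r & (ALL b:B. (%n. a (r n) b) ----> l b)"
 using assms
proof (induction B rule: finite_induct)
 case empty
 show ?case by (rule exI[of _ id]) (simp add: strict_mono_def)
next
 case (insert b B)
 then obtain r l where r: "strict_mono (r::nat=>nat)" "!!b. b:B ==> (%n. a (r n) b) ----> l b"
  by (meson insertI2)
 have "bounded (range (%n. a (r n) b))"
  using insert.prems by (auto simp: bounded_iff)
 then obtain l' s where s: "strict_mono (s::nat=>nat)" "((%n. a (r n) b) o s) ----> l'"
  using bounded_imp_convergent_subsequence by blast
 have "(%n. a ((r o s) n) c) ----> (l(b := l')) c" if "c:insert b B" for c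
 proof (cases "c = b")
  case True thus ?thesis using s(2) by (simp add: comp_def)
 next
  case False
  thus ?thesis using that LIMSEQ_subseq_LIMSEQ[OF r(2) s(1), of c] by (auto simp: comp_def)
 qed
 thus ?case using strict_mono_o[OF r(1) s(1)] by blast
qed

text \<open>If coefficients are bounded by the norm, a bounded sequence has a subsequence along
  which all coefficients converge. The bound is a hypothesis here because the induction for
  \<open>coeffs_bound\<close> uses this lemma for the smaller basis.\<close>

lemma closed_span_coeffs:
 assumes "finite B" "c > 0" "!!a b. b:B ==> \<bar>a b\<bar> * c <= norm (\<Sum>b\<in>B. a b *\<^sub>R (b::'a::real_normed_vector))"
  and X: "!!n. X n:span B" "!!n. norm (X n) <= M"
 shows "EX r x. strict_mono (r::nat=>nat) & x:span B & (X o r) ----> x"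
proof -
 have "EX a. X n = (\<Sum>b\<in>B. a b *\<^sub>R b)" for n using X(1) assms(1) span_finite_coeffs by metis
 then obtain a where a: "!!n. X n = (\<Sum>b\<in>B. a n b *\<^sub>R b)" by metis
 have "\<bar>a n b\<bar> <= M / c" if "b:B" for n b
  using assms(3)[OF that, of "a n"] X(2)[of n] assms(2) by (simp add: a pos_le_divide_eq)
 then obtain r l where r: "strict_mono (r::nat=>nat)" "!!b. b:B ==> (%n. a (r n) b) ----> l b"
  using csubseq_coeffs[OF assms(1)] by metis
 have "(X o r) ----> (\<Sum>b\<in>B. l b *\<^sub>R b)"
  unfolding comp_def a by (intro tendsto_sum tendsto_scaleR r tendsto_const)
 moreover have "(\<Sum>b\<in>B. l b *\<^sub>R b):span B" by (intro span_sum span_scale span_base)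
 ultimately show ?thesis using r(1) by blast
qed

text \<open>Induction on the basis. By sequential compactness the span of the old vectors contains
  its limits, so a new independent vector has a positive distance \<open>d\<close> from it.\<close>

lemma coeffs_bound:
 fixes B :: "'a::real_normed_vector set"
 assumes "finite B" "independent B"
 shows "EX c>0. ALL a. ALL b:B. \<bar>a b\<bar> * c <= norm (\<Sum>b\<in>B. a b *\<^sub>R b)"
 using assms
proof (induction B rule: finite_induct)
 case empty
 show ?case by (intro exI[of _ 1]) simp
next
 case (insert b B)
 have "independent B" using insert.prems by (meson independent_mono subset_insertI)
 then obtain c where c: "c > 0" "!!a b. b:B ==> \<bar>a b\<bar> * c <= norm (\<Sum>b\<in>B. a b *\<^sub>R b)"
  using insert.IH by metis
 have bB: "b ~: span B" using insert.prems insert.hyps by (simp add: independent_insert)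
 have "EX d>0. ALL y:span B. d <= norm (b - y)"
 proof (rule ccontr)
  assume "~ ?thesis"
  hence "ALL n. EX y:span B. norm (b - y) < 1 / Suc n" by (metis not_le of_nat_0_less_iff zero_less_Suc zero_less_divide_1_iff)
  then obtain X where X: "!!n. X n:span B" "!!n. norm (b - X n) < 1 / Suc n" by metis
  have nX: "norm (X n) <= norm b + 1" for n
  proof -
   have "1 / real (Suc n) <= 1" by simp
   thus ?thesis using X(2)[of n] norm_triangle_ineq4[of b "b - X n"] by (simp only: diff_diff_eq2 add_diff_cancel_left')
  qed
  have "EX r x. strict_mono (r::nat=>nat) & x:span B & (X o r) ----> x"
   by (rule closed_span_coeffs[where c = c and M = "norm b + 1"]) (use insert.hyps(1) c X(1) nX in auto)
  then obtain r x where r: "strict_mono (r::nat=>nat)" "x:span B" "(X o r) ----> x"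
   by blast
  have "(%n. norm (X n - b)) ----> 0"
   by (rule tendsto_sandwich[OF _ _ tendsto_const LIMSEQ_Suc[OF lim_1_over_n]])
    (use X(2) less_imp_le in \<open>auto simp: norm_minus_commute intro!: always_eventually\<close>)
  hence "X ----> b" by (simp add: LIM_zero_iff tendsto_norm_zero_iff)
  hence "x = b" using r LIMSEQ_subseq_LIMSEQ LIMSEQ_unique by blast
  thus False using r bB by simp
 qed
 then obtain d where d: "d > 0" "!!y. y:span B ==> d <= norm (b - y)" by blast
 \<comment> \<open>The coefficient of \<open>b\<close> is controlled by \<open>d\<close>. The others
   are controlled by \<open>c\<close> after the term of \<open>b\<close> is removed, and that term
   has norm at most \<open>norm v / d * norm b\<close>.\<close>
 define c' where "c' = min d (c / (1 + norm b / d))"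
 have pos: "1 + norm b / d > 0" using d(1) by (simp add: add_pos_nonneg)
 have "\<bar>a e\<bar> * c' <= norm (\<Sum>b\<in>insert b B. a b *\<^sub>R b)" if "e:insert b B" for a e
 proof -
  define y where "y = (\<Sum>b\<in>B. a b *\<^sub>R b)"
  define v where "v = a b *\<^sub>R b + y"
  have v: "(\<Sum>b\<in>insert b B. a b *\<^sub>R b) = v" using insert.hyps by (simp add: v_def y_def)
  have y: "y:span B" unfolding y_def by (intro span_sum span_scale span_base)
  have 1: "\<bar>a b\<bar> * d <= norm v"
  proof (cases "a b = 0")
   case False
   have "d <= norm (b - (- 1 / a b) *\<^sub>R y)" by (intro d(2) span_scale y)
   hence "\<bar>a b\<bar> * d <= norm (a b *\<^sub>R (b - (- 1 / a b) *\<^sub>R y))"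
    by (simp add: mult_left_mono)
   also have "a b *\<^sub>R (b - (- 1 / a b) *\<^sub>R y) = v" using False by (simp add: v_def algebra_simps)
   finally show ?thesis .
  qed simp
  show ?thesis
  proof (cases "e = b")
   case True
   have "\<bar>a b\<bar> * c' <= \<bar>a b\<bar> * d" by (simp add: c'_def mult_left_mono)
   thus ?thesis using 1 True unfolding v by simp
  next
   case False
   hence "\<bar>a e\<bar> * c <= norm y" using c(2)[of e a] that by (simp add: y_def)
   also have "... <= norm v + \<bar>a b\<bar> * norm b"
    using norm_triangle_ineq4[of v "a b *\<^sub>R b"] by (simp add: v_def)
   also have "\<bar>a b\<bar> * norm b <= norm v / d * norm b"
    using 1 d(1) by (intro mult_right_mono) (auto simp: pos_le_divide_eq)
   finally have "\<bar>a e\<bar> * c <= norm v * (1 + norm b / d)" by (simp add: algebra_simps)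
   hence "\<bar>a e\<bar> * (c / (1 + norm b / d)) <= norm v"
    using pos by (simp add: pos_divide_le_eq)
   moreover have "\<bar>a e\<bar> * c' <= \<bar>a e\<bar> * (c / (1 + norm b / d))" by (intro mult_left_mono) (simp_all add: c'_def)
   ultimately show ?thesis unfolding v by linarith
  qed
 qed
 moreover have "c' > 0" using d c pos by (simp add: c'_def)
 ultimately show ?case by blast
qed

lemma fin_dim_csubseq:
 fixes X :: "nat => 'a::real_normed_vector"
 assumes "fin_dim S" "!!n. X n:S" "!!n. norm (X n) <= M"
 shows "EX r x. strict_mono (r::nat=>nat) & x:S & (X o r) ----> x"
proof -
 obtain B where B: "finite B" "independent B" "span B = S" using fin_dim_basis[OF assms(1)] by blast
 obtain c where "c > 0" "!!a b. b:B ==> \<bar>a b\<bar> * c <= norm (\<Sum>b\<in>B. a b *\<^sub>R b)"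
  using coeffs_bound[OF B(1,2)] by blast
 hence "EX r x. strict_mono (r::nat=>nat) & x:span B & (X o r) ----> x"
  by (rule closed_span_coeffs[where c = c and M = M, OF B(1)]) (use assms(2,3) B(3) in auto)
 thus ?thesis using B(3) by simp
qed

lemma fin_dim_closed:
 assumes "fin_dim (S :: 'a::real_normed_vector set)" shows "closed S"
 unfolding closed_sequential_limits
proof (intro allI impI)
 fix X l assume X: "(ALL n. X n:S) & X ----> l"
 then obtain M where "!!n. norm (X n) <= M"
  using convergent_imp_Bseq[of X] by (auto simp: convergent_def Bseq_def)
 then obtain r x where "strict_mono (r::nat=>nat)" "x:S" "(X o r) ----> x"
  using fin_dim_csubseq[OF assms, of X M] X by blast
 thus "l:S" using X LIMSEQ_subseq_LIMSEQ LIMSEQ_unique by blast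
qed

lemma linear_on_sum:
 fixes f :: "'a::real_vector => 'b::real_vector"
 assumes "subspace S" "!!x y. x:S ==> y:S ==> f (x + y) = f x + f y"
  "!!x r. x:S ==> f (r *\<^sub>R x) = r *\<^sub>R f x" "!!b. b:B ==> g b:S"
 shows "f (\<Sum>b\<in>B. g b) = (\<Sum>b\<in>B. f (g b))"
proof -
 have f0: "f 0 = 0" using assms(3)[of 0 0] subspace_0[OF assms(1)] by simp
 show ?thesis using assms(4)
  by (induction B rule: infinite_finite_induct) (auto simp: f0 assms(2) subspace_sum[OF assms(1)])
qed

lemma linear_on_combination:
 fixes f :: "'a::real_vector => 'b::real_vector"
 assumes "subspace S" "!!x y. x:S ==> y:S ==> f (x + y) = f x + f y"
  "!!x r. x:S ==> f (r *\<^sub>R x) = r *\<^sub>R f x" "B <= S"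
 shows "f (\<Sum>b\<in>B. a b *\<^sub>R b) = (\<Sum>b\<in>B. a b *\<^sub>R f b)"
proof -
 have "f (\<Sum>b\<in>B. a b *\<^sub>R b) = (\<Sum>b\<in>B. f (a b *\<^sub>R b))"
  by (rule linear_on_sum[OF assms(1-3)]) (use assms(1,4) subspace_scale in blast)+
 also have "... = (\<Sum>b\<in>B. a b *\<^sub>R f b)"
  by (rule sum.cong) (use assms(3,4) in auto)
 finally show ?thesis .
qed

lemma fin_dim_linear_bounded:
 fixes f :: "'a::real_normed_vector => 'b::real_normed_vector"
 assumes "fin_dim S" "!!x y. x:S ==> y:S ==> f (x + y) = f x + f y"
  "!!x r. x:S ==> f (r *\<^sub>R x) = r *\<^sub>R f x"
 shows "EX K>=0. ALL x:S. norm (f x) <= K * norm x"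
proof -
 obtain B where B: "finite B" "independent B" "B <= S" "span B = S" using fin_dim_basis[OF assms(1)] by blast
 have S: "subspace S" using assms(1) by (simp add: fin_dim_def)
 obtain c where c: "c > 0" "!!a b. b:B ==> \<bar>a b\<bar> * c <= norm (\<Sum>b\<in>B. a b *\<^sub>R b)"
  using coeffs_bound[OF B(1,2)] by blast
 have "norm (f x) <= ((\<Sum>b\<in>B. norm (f b)) / c) * norm x" if "x:S" for x
 proof -
  obtain a where a: "x = (\<Sum>b\<in>B. a b *\<^sub>R b)" by (rule span_finite_coeffs[OF B(1), of x]) (use \<open>x:S\<close> B(4) in simp)
  have "f x = (\<Sum>b\<in>B. a b *\<^sub>R f b)"
   unfolding a by (rule linear_on_combination[OF S assms(2,3) B(3)])
  hence "norm (f x) <= (\<Sum>b\<in>B. \<bar>a b\<bar> * norm (f b))"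
   using norm_sum[of "%b. a b *\<^sub>R f b" B] by simp
  also have "... <= (\<Sum>b\<in>B. (norm x / c) * norm (f b))"
   using c by (intro sum_mono mult_right_mono) (auto simp: a pos_le_divide_eq)
  also have "... = ((\<Sum>b\<in>B. norm (f b)) / c) * norm x"
   by (simp add: sum_distrib_left sum_divide_distrib mult.commute)
  finally show ?thesis .
 qed
 moreover have "(\<Sum>b\<in>B. norm (f b)) / c >= 0" using c by (simp add: sum_nonneg)
 ultimately show ?thesis by blast
qed

lemma fin_dim_image:
 fixes f :: "'a::real_vector => 'b::real_vector"
 assumes "fin_dim S" "!!x y. x:S ==> y:S ==> f (x + y) = f x + f y"
  "!!x r. x:S ==> f (r *\<^sub>R x) = r *\<^sub>R f x"
 shows "fin_dim (f ` S)"
proof -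
 obtain B where B: "finite B" "independent B" "B <= S" "span B = S" using fin_dim_basis[OF assms(1)] by blast
 have S: "subspace S" using assms(1) by (simp add: fin_dim_def)
 have "f x:span (f ` B)" if "x:S" for x
 proof -
  obtain a where a: "x = (\<Sum>b\<in>B. a b *\<^sub>R b)" by (rule span_finite_coeffs[OF B(1), of x]) (use \<open>x:S\<close> B(4) in simp)
  have "f x = (\<Sum>b\<in>B. a b *\<^sub>R f b)"
   unfolding a by (rule linear_on_combination[OF S assms(2,3) B(3)])
  thus ?thesis by (auto intro: span_sum span_scale span_base)
 qed
 moreover have "subspace (f ` S)"
  unfolding subspace_def using S assms(2,3)
  by (auto simp: image_iff) (metis subspace_0 scaleR_zero_left, metis subspace_add, metis subspace_scale)
 ultimately show ?thesis using B(1) unfolding fin_dim_def by blast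
qed

lemma fin_dim_dim_less:
 assumes "fin_dim S" "subspace T" "subspace U" "T <= U" "U <= S" "u:U" "u ~: T"
 shows "dim T < dim U"
proof -
 have "fin_dim T" "fin_dim U" using fin_dim_subspace[OF assms(1)] assms by auto
 then obtain B C where B: "finite B" "independent B" "B <= T" "span B = T"
  and C: "finite C" "independent C" "C <= U" "span C = U" by (meson fin_dim_basis)
 have "independent (insert u B)" using B assms by (auto simp: independent_insert)
 moreover have "insert u B <= span C" using B C assms by auto
 ultimately have "card (insert u B) <= card C" using independent_span_bound[OF C(1)] by blast
 moreover have "u ~: B" using assms B span_base by blast
 moreover have "dim T = card B" "dim U = card C" using B C by (metis dim_span_eq_card_independent)+
 ultimately show ?thesis using B by simp
qed

text \<open>The image of a basis stays independent, so the image has full dimension, whereas a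
  proper subspace has smaller dimension. This replaces inverses and complements by a dimension
  count.\<close>

lemma fin_dim_injective_surjective:
 assumes "fin_dim S" "linear f" "f ` S <= S" "!!x. x:S ==> f x = 0 ==> x = 0"
 shows "f ` S = S"
proof -
 obtain B where B: "finite B" "independent B" "B <= S" "span B = S" using fin_dim_basis[OF assms(1)] by blast
 have S: "subspace S" using assms(1) by (simp add: fin_dim_def)
 have inj: "inj_on f S"
  unfolding inj_on_def using assms(2,4) S by (metis eq_iff_diff_eq_0 linear_diff subspace_diff)
 hence ind: "independent (f ` B)"
  using linear_independent_injective_image[OF assms(2) B(2)] B(4) by simp
 have card: "card (f ` B) = card B" using inj B(3) by (meson card_image inj_on_subset)
 have sub: "subspace (f ` S)" by (rule linear_subspace_image[OF assms(2) S])
 show ?thesis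
 proof (rule ccontr)
  assume "f ` S ~= S"
  then obtain u where u: "u:S" "u ~: f ` S" using assms(3) by blast
  have less: "dim (f ` S) < dim S"
   by (rule fin_dim_dim_less[OF assms(1) sub S assms(3) order_refl u])
  obtain C where C: "finite C" "independent C" "C <= f ` S" "span C = f ` S"
   using fin_dim_basis[OF fin_dim_subspace[OF assms(1,3) sub]] by blast
  have "card (f ` B) <= card C"
   using independent_span_bound[OF C(1) ind] C(4) B(3) by blast
  moreover have "dim (f ` S) = card C" "dim S = card B" using B C by (metis dim_span_eq_card_independent)+
  ultimately show False using less card by simp
 qed
qed

lemma fin_dim_dim_le:
 assumes "fin_dim S" "subspace T" "T <= S" shows "dim T <= dim S"
proof (cases "T = S")
 case False
 then obtain u where "u:S" "u ~: T" using assms by blast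
 thus ?thesis using fin_dim_dim_less[OF assms(1,2), of S u] assms by (auto simp: fin_dim_def)
qed simp

section \<open>Finite-dimensional star-algebras of matrices\<close>

definition star_alg :: "'h::complex_hilbert mat set => bool" where
 "star_alg D \<longleftrightarrow> fin_dim D & (ALL x:D. star x:D & (ALL y:D. x * y:D))"

lemma star_algD:
 assumes "star_alg D"
 shows "fin_dim D" "subspace D" "0:D" "x:D ==> star x:D" "x:D ==> y:D ==> x * y:D"
  "x:D ==> y:D ==> x + y:D" "x:D ==> y:D ==> x - y:D" "x:D ==> r *\<^sub>R x:D"
 using assms unfolding star_alg_def fin_dim_def
 by (auto simp: subspace_0 subspace_add subspace_diff subspace_scale)

section \<open>Star-homomorphisms, their contractivity and isometry, and partial isometries\<close>

definition shom :: "'h::complex_hilbert mat set => ('h mat => 'h mat) => bool" where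
 "shom S f \<longleftrightarrow> (ALL x:S. f (star x) = star (f x) & (ALL c. f (cscale c x) = cscale c (f x)) \<and>
   (ALL y:S. f (x + y) = f x + f y & f (x * y) = f x * f y))"

lemma shomD:
 assumes "shom S f" "x:S"
 shows "f (star x) = star (f x)" "f (cscale c x) = cscale c (f x)" "f (r *\<^sub>R x) = r *\<^sub>R f x"
  "y:S ==> f (x + y) = f x + f y" "y:S ==> f (x * y) = f x * f y"
  "f (- x) = - f x" "f 0 = 0"
proof -
 show *: "f (cscale c x) = cscale c (f x)" for c using assms by (simp add: shom_def)
 show "f (r *\<^sub>R x) = r *\<^sub>R f x" "f (- x) = - f x" "f 0 = 0"
  using *[of "complex_of_real r"] *[of "-1"] *[of 0] by (simp_all add: cscale_real cscale_minus_one)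
qed (use assms in \<open>auto simp: shom_def\<close>)

lemma shom_subset: "shom S f ==> T <= S ==> shom T f"
 by (auto simp: shom_def subset_iff)

lemma mult_star_self_eq_0: "star x * x = 0 \<longleftrightarrow> x = 0"
 using norm_star_mult_self[of x] by auto

text \<open>The algebra of matrices has no unit, hence the shift of the exponent.\<close>

definition mpow :: "'h::complex_hilbert mat => nat => 'h mat" where
 "mpow y n = ((*) y ^^ n) y"

lemma mpow_simps [simp]: "mpow y 0 = y" "mpow y (Suc n) = y * mpow y n"
 by (simp_all add: mpow_def)

lemma mpow_add: "mpow y m * mpow y n = mpow y (Suc (m + n))"
 by (induction m) (simp_all add: mult.assoc)

lemma star_mpow: "star y = y ==> star (mpow y n) = mpow y n"
 using mpow_add[of y _ 0] by (induction n) auto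

lemma mpow_in: "star_alg D ==> y:D ==> mpow y n:D"
 by (induction n) (auto simp: star_algD)

lemma norm_mpow_le: "norm (mpow y n) <= norm y ^ Suc n"
proof (induction n)
 case (Suc n)
 show ?case
  using norm_mult_ineq[of y "mpow y n"] mult_left_mono[OF Suc, of "norm y"] by simp
qed simp

text \<open>By the C*-identity, squaring a self-adjoint element squares its norm. With the shifted
  exponent the power \<open>2 ^ k\<close> is \<open>mpow y (2 ^ k - 1)\<close>.\<close>

lemma norm_mpow_self_adjoint:
 assumes "star y = y"
 shows "norm (mpow y (2 ^ k - 1)) = norm y ^ (2 ^ k)"
proof (induction k)
 case (Suc k)
 have "Suc ((2 ^ k - 1) + (2 ^ k - 1)) = 2 ^ Suc k - (1::nat)"
  using one_le_power[of "2::nat" k] by (simp only: power_Suc) linarith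
 hence "norm (mpow y (2 ^ Suc k - 1)) = norm (star (mpow y (2 ^ k - 1)) * mpow y (2 ^ k - 1))"
  by (simp only: star_mpow[OF assms] mpow_add)
 thus ?case by (simp only: norm_star_mult_self Suc power_mult[symmetric] power_Suc mult.commute)
qed simp

text \<open>Every power is a factor of some power with exponent \<open>2 ^ k\<close>, whose norm is
  1, and the complementary factor has norm at most 1.\<close>

lemma norm_mpow_eq_1:
 assumes "star y = y" "norm y = 1"
 shows "norm (mpow y n) = 1"
proof (rule antisym)
 show "norm (mpow y n) <= 1" using norm_mpow_le[of y n] assms by simp
 define k where "k = Suc (Suc (Suc n))"
 have "Suc n < 2 ^ k - (1::nat)" using less_exp[of k] unfolding k_def by linarith
 hence "2 ^ k - 1 = Suc (n + (2 ^ k - 1 - Suc n))" by simp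
 hence "mpow y (2 ^ k - 1) = mpow y n * mpow y (2 ^ k - 1 - Suc n)" unfolding mpow_add by (rule arg_cong)
 hence "1 <= norm (mpow y n) * norm (mpow y (2 ^ k - 1 - Suc n))"
  using norm_mpow_self_adjoint[OF assms(1), of k] norm_mult_ineq[of "mpow y n" "mpow y (2 ^ k - 1 - Suc n)"] assms(2)
  by simp
 also have "... <= norm (mpow y n) * 1"
  using norm_mpow_le[of y "2 ^ k - 1 - Suc n"] assms by (intro mult_left_mono) auto
 finally show "1 <= norm (mpow y n)" by simp
qed

lemma shom_mpow: "star_alg D ==> shom D f ==> y:D ==> f (mpow y n) = mpow (f y) n"
 by (induction n) (auto simp: shomD mpow_in)

text \<open>On a finite-dimensional space f is bounded by some K. If f increased the norm of x, the
  quotient \<open>q > 1\<close> for \<open>y = star x * x\<close> would satisfy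
  \<open>q ^ (2 ^ k) <= K\<close> for every k, by the norm formula for powers of self-adjoint
  elements.\<close>

lemma shom_contractive:
 assumes "star_alg D" "shom D f" "x:D"
 shows "norm (f x) <= norm x"
proof (rule ccontr)
 assume "~ ?thesis"
 hence less: "norm x < norm (f x)" by simp
 have "x ~= 0" using less shomD(7)[OF assms(2,3)] by auto
 define y where "y = star x * x"
 have y: "y:D" "star y = y" using assms by (auto simp: y_def star_algD)
 have fy: "f y = star (f x) * f x" using assms by (simp add: y_def shomD star_algD)
 obtain K where K: "!!z. z:D ==> norm (f z) <= K * norm z" "K >= 0"
  using fin_dim_linear_bounded[of D f] star_algD[OF assms(1)] shomD[OF assms(2)] by metis
 have ny: "norm y = (norm x)\<^sup>2" "norm (f y) = (norm (f x))\<^sup>2"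
  by (simp_all add: y_def norm_star_mult_self fy[unfolded y_def])
 define q where "q = norm (f y) / norm y"
 have pos: "norm y > 0" using \<open>x ~= 0\<close> by (simp add: ny)
 have "q > 1" using less pos by (simp add: q_def ny power_strict_mono)
 obtain k where k: "K < q ^ k" using real_arch_pow[OF \<open>q > 1\<close>] by blast
 have "norm (f y) ^ (2 ^ k) <= K * norm y ^ (2 ^ k)"
  using K(1)[OF mpow_in[OF assms(1) y(1)], of "2 ^ k - 1"]
   norm_mpow_self_adjoint[of "f y" k] by (simp del: One_nat_def add: shom_mpow[OF assms(1,2) y(1)] norm_mpow_self_adjoint[OF y(2)] fy)
 hence "q ^ (2 ^ k) <= K" using pos by (simp add: q_def power_divide pos_divide_le_eq)
 moreover have "q ^ k <= q ^ (2 ^ k)" using \<open>q > 1\<close> by (intro power_increasing) (auto simp: less_imp_le)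
 ultimately show False using k by simp
qed

lemma tendsto_act: "X ----> x ==> (%n. act (X n) v) ----> act x v"
proof -
 assume "X ----> x"
 hence "(%n. norm (X n - x) * norm v) ----> 0 * norm v"
  by (intro tendsto_mult tendsto_const) (simp add: LIM_zero_iff tendsto_norm_zero_iff)
 moreover have "norm (act (X n) v - act x v) <= norm (X n - x) * norm v" for n
  using norm_act[of "X n - x" v] act_add[of "X n - x" x v] by simp
 ultimately have "(%n. act (X n) v - act x v) ----> 0"
  by - (rule Lim_null_comparison[of _ "%n. norm (X n - x) * norm v"], rule always_eventually, rule allI, simp_all)
 thus ?thesis by (simp add: LIM_zero_iff)
qed

lemma tendsto_star: "X ----> x ==> (%n. star (X n)) ----> star x"
proof -
 assume "X ----> x"
 hence "(%n. norm (star (X n - x))) ----> 0"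
  by (simp only: norm_star tendsto_norm_zero_iff LIM_zero_iff)
 thus ?thesis by (simp add: tendsto_norm_zero_iff LIM_zero_iff)
qed

text \<open>Polarisation at \<open>act g w + w\<close>: self-adjointness makes the two mixed terms
  equal, and each is the squared norm of \<open>act g w\<close>.\<close>

lemma self_adjoint_eq_0:
 assumes "star g = g" "!!v. inner v (act g v) = 0"
 shows "g = 0"
proof (rule act_eq_0)
 fix w
 have "inner (act g w) (act g w) = 0"
 proof -
  let ?v = "act g w"
  have "inner (?v + w) (act g (?v + w)) = 0" by (rule assms(2))
  hence "inner ?v (act g w) + inner w (act g ?v) = 0"
   using assms(2)[of ?v] assms(2)[of w]
   by (simp add: linear_add[OF bounded_linear.linear[OF bounded_linear_act]] inner_add_left inner_add_right)
  moreover have "inner w (act g ?v) = inner ?v ?v"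
   using inner_act[of g w ?v] by (simp add: assms(1))
  ultimately show ?thesis by simp
 qed
 thus "act g w = 0" by simp
qed

text \<open>The powers of the positive contraction \<open>y = star x * x\<close> decrease strongly, so that any cluster point of them
 is the spectral projection of \<open>y\<close> for the eigenvalue 1.\<close>

lemma top_projection:
 assumes D: "star_alg D" and "star x * x:D" "norm x = 1"
 shows "EX e:D. star e = e & e * e = e & e ~= 0 & star x * x * e = e"
proof -
 define y where "y = star x * x"
 have y: "y:D" "star y = y" "norm y = 1" using assms by (auto simp: y_def norm_star_mult_self)
 have bd: "norm (mpow y n) = 1" for n using norm_mpow_eq_1 y by blast
 obtain r e where r: "strict_mono (r::nat=>nat)" and e: "e:D" "(mpow y o r) ----> e"
  using fin_dim_csubseq[OF star_algD(1)[OF D], of "mpow y" 1] mpow_in[OF D y(1)] bd by auto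
 have lim: "(%n. mpow y (r n)) ----> e" using e(2) by (simp add: comp_def)
 have se: "star e = e"
  using tendsto_star[OF lim] lim unfolding star_mpow[OF y(2)] by (rule LIMSEQ_unique)
 have ne: "norm e = 1"
  using tendsto_norm[OF lim] by (simp add: bd LIMSEQ_const_iff)
 have lim2: "(%n. y * mpow y (r n)) ----> y * e" "(%n. mpow y (r n) * y) ----> e * y"
  by (intro tendsto_mult lim tendsto_const)+
 have comm: "mpow y n * y = y * mpow y n" for n
  using mpow_add[of y n 0] by simp
 have ey: "e * y = y * e" by (rule LIMSEQ_unique[OF lim2(2)[unfolded comm] lim2(1)])
 \<comment> \<open>The moments \<open>c k\<close> of v are squared norms, alternately of
   \<open>u j\<close> and of \<open>act x (u j)\<close>. As x and its adjoint are contractions the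
   moments decrease and converge, so the powers along \<open>r\<close> and the same powers
   multiplied by y give one and the same limit.\<close>
 have c: "inner v (act e v) = inner v (act (y * e) v)" for v
 proof -
  define u where "u k = (act y ^^ k) v" for k
  define c where "c k = inner v (u k)" for k
  have adj: "inner (act y a) b = inner a (act y b)" for a b using inner_act[of y a b] y(2) by simp
  have uu: "inner (u i) (u j) = c (i + j)" for i j
  proof (induction i arbitrary: j)
   case 0 show ?case by (simp add: c_def u_def)
  next
   case (Suc i)
   have "inner (u (Suc i)) (u j) = inner (u i) (u (Suc j))" by (simp add: u_def adj)
   thus ?case using Suc[of "Suc j"] by simp
  qed
  have yx: "act y a = act (star x) (act x a)" for a by (simp add: y_def act_mult)
  have even: "c (2 * j) = (norm (u j))\<^sup>2" for j
   using uu[of j j] by (simp add: power2_norm_eq_inner mult_2)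
  have odd: "c (Suc (2 * j)) = (norm (act x (u j)))\<^sup>2" for j
  proof -
   have "c (Suc (2 * j)) = inner (u j) (act y (u j))"
    using uu[of j "Suc j"] by (simp add: u_def mult_2)
   also have "... = (norm (act x (u j)))\<^sup>2"
    using inner_act[of x "u j" "act x (u j)"] by (simp add: yx power2_norm_eq_inner)
   finally show ?thesis .
  qed
  have le: "norm (act x a) <= norm a" "norm (act (star x) a) <= norm a" for a
   using norm_act[of x a] norm_act[of "star x" a] assms(3) by simp_all
  have dec: "c (Suc k) <= c k" for k
  proof (cases "even k")
   case True
   then obtain j where j: "k = 2 * j" by (elim evenE)
   show ?thesis unfolding j even odd by (rule power_mono[OF le(1)]) simp
  next
   case False
   then obtain j where j: "k = Suc (2 * j)" by (metis oddE Suc_eq_plus1)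
   have "c (Suc k) = (norm (u (Suc j)))\<^sup>2" using even[of "Suc j"] j by simp
   also have "u (Suc j) = act (star x) (act x (u j))" by (simp add: u_def yx)
   finally show ?thesis unfolding j odd by (simp add: power_mono le(2))
  qed
  have nonneg: "c k >= 0" for k
  proof (cases "even k")
   case True thus ?thesis using even by (auto elim!: evenE)
  next
   case False thus ?thesis using odd by (auto elim!: oddE)
  qed
  obtain L where L: "c ----> L"
   by (rule decseq_convergent[of c 0]) (use dec nonneg in \<open>auto simp: decseq_Suc_iff\<close>)
  have act_mpow: "act (mpow y n) v = u (Suc n)" for n
   by (induction n) (auto simp: u_def act_mult)
  have "(%n. inner v (act (mpow y (r n)) v)) ----> inner v (act e v)"
   by (intro tendsto_inner tendsto_const tendsto_act lim)
  hence "(%n. c (Suc (r n))) ----> inner v (act e v)" by (simp add: act_mpow c_def)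
  moreover have "(%n. c (Suc (r n))) ----> L"
   using LIMSEQ_subseq_LIMSEQ[OF LIMSEQ_Suc[OF L] r] by (simp add: comp_def)
  ultimately have 1: "inner v (act e v) = L" by (rule LIMSEQ_unique)
  have "act (y * mpow y n) v = u (Suc (Suc n))" for n
   by (simp add: act_mult act_mpow u_def)
  moreover have "(%n. inner v (act (y * mpow y (r n)) v)) ----> inner v (act (y * e) v)"
   by (intro tendsto_inner tendsto_const tendsto_act lim2)
  ultimately have "(%n. c (Suc (Suc (r n)))) ----> inner v (act (y * e) v)" by (simp add: c_def)
  moreover have "(%n. c (Suc (Suc (r n)))) ----> L"
   using LIMSEQ_subseq_LIMSEQ[OF LIMSEQ_Suc[OF LIMSEQ_Suc[OF L]] r] by (simp add: comp_def)
  ultimately have 2: "inner v (act (y * e) v) = L" by (rule LIMSEQ_unique)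
  show ?thesis using 1 2 by simp
 qed
 have "y * e - e = 0"
 proof (rule self_adjoint_eq_0)
  show "star (y * e - e) = y * e - e" by (simp add: se y(2) ey)
  show "inner v (act (y * e - e) v) = 0" for v
   using c[of v] act_add[of "y * e - e" e v] by (simp add: inner_add_right)
 qed
 hence ye: "y * e = e" by simp
 hence "mpow y n * e = e" for n by (induction n) (auto simp: mult.assoc)
 hence "(%n. e) ----> e * e" using tendsto_mult[OF lim tendsto_const[of e]] by simp
 hence "e * e = e" by (simp add: LIMSEQ_const_iff)
 thus ?thesis using e(1) se ne ye by (intro bexI[of _ e]) (auto simp: y_def)
qed

text \<open>Normalise x to z and take a projection e with \<open>star z * z * e = e\<close>. Its
  image is nonzero and satisfies \<open>f e = star (f z) * f z * f e\<close>, which forces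
  \<open>norm (f z) >= 1\<close>.\<close>

lemma shom_isometric:
 assumes D: "star_alg D" and f: "shom D f" and inj: "!!x. x:D ==> f x = 0 ==> x = 0" and x: "x:D"
 shows "norm (f x) = norm x"
proof (cases "x = 0")
 case True thus ?thesis using shomD(7)[OF f x] by simp
next
 case False
 define z where "z = x /\<^sub>R norm x"
 have z: "z:D" "norm z = 1" using x False by (auto simp: z_def star_algD[OF D])
 then obtain e where e: "e:D" "star e = e" "e * e = e" "e ~= 0" "star z * z * e = e"
  using top_projection[OF D, of z] by (auto simp: star_algD[OF D])
 have "f e = star (f z) * f z * f e"
  using shomD(5)[OF f, of "star z * z" e] shomD(5)[OF f, of "star z" z] shomD(1)[OF f z(1)] e z star_algD[OF D]
  by simp
 hence "norm (f e) <= norm (star (f z) * f z) * norm (f e)" using norm_mult_ineq by metis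
 moreover have "norm (f e) > 0" using inj e by auto
 ultimately have "1 <= (norm (f z))\<^sup>2" by (simp add: norm_star_mult_self)
 hence "1 <= norm (f z)" using power2_le_imp_le[of 1 "norm (f z)"] by simp
 moreover have "norm (f z) = norm (f x) / norm x"
  using shomD(3)[OF f x] by (simp add: z_def divide_inverse mult.commute)
 ultimately have "norm x <= norm (f x)" using False by (simp add: le_divide_eq)
 thus ?thesis using shom_contractive[OF D f x] by simp
qed

text \<open>For the normalised z and the projection e of \<open>top_projection\<close>,
  \<open>v = z * e\<close> is a partial isometry with initial projection e. The factorisations
  through x and \<open>star x\<close> show that its final and initial projections lie under any
  projections that fix x from the left and from the right.\<close>

lemma exists_partial_isometry:
 assumes D: "star_alg D" and "x:D" "x ~= 0"
 shows "EX v:D. EX w:D. EX u:D. v ~= 0 & v = x * w & star v * v = star x * u & v * (star v * v) = v"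
proof -
 define z where "z = x /\<^sub>R norm x"
 have z: "z:D" "norm z = 1" using assms by (auto simp: z_def star_algD)
 then obtain e where e: "e:D" "star e = e" "e * e = e" "e ~= 0" "star z * z * e = e"
  using top_projection[OF D, of z] by (auto simp: star_algD[OF D])
 define v where "v = z * e"
 have vv: "star v * v = e" using e by (simp add: v_def mult.assoc)
 have "v = x * (e /\<^sub>R norm x)" by (simp add: v_def z_def)
 moreover have "e = star x * (z * e /\<^sub>R norm x)" using e(5) by (simp add: z_def mult.assoc)
 moreover have "v * (star v * v) = v" unfolding vv by (simp add: v_def e mult.assoc)
 moreover have "v ~= 0" using vv e by auto
 moreover have "v:D" "e /\<^sub>R norm x:D" "z * e /\<^sub>R norm x:D"
  using z e star_algD[OF D] by (auto simp: v_def)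
 ultimately show ?thesis unfolding vv[symmetric] by blast
qed

text \<open>Finite-dimensionality makes left multiplication by \<open>star W\<close> surjective on the left ideal \<open>{x. x * P = x}\<close>.\<close>

lemma no_complement:
 assumes D: "star_alg D" and p: "p:D" "!!x. x:D ==> p * x = x" "!!x. x:D ==> x * p = x"
  and W: "W:D" "W * star W * W = W"
  and none: "!!d. d:D ==> (p - W * star W) * d * (p - star W * W) = 0"
 shows "p - star W * W = 0"
proof -
 define P where "P = p - star W * W"
 have PD: "P:D" using W(1) p(1) by (simp add: P_def star_algD[OF D])
 have sW: "star W:D" "star W * W * star W = star W"
  using star_algD(4)[OF D W(1)] arg_cong[OF W(2), of star] by (simp_all add: mult.assoc)
 have PP: "P * P = P"
 proof -
  have "P * P = p * p - p * (star W * W) - (star W * W) * p + star W * W * star W * W"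
   by (simp add: P_def algebra_simps mult.assoc)
  thus ?thesis using p sW W star_algD(5)[OF D sW(1) W(1)] by (simp add: P_def)
 qed
 define S where "S = {x:D. x * P = x}"
 have sub: "subspace S" unfolding subspace_def S_def
  using star_algD[OF D] by (auto simp: algebra_simps)
 have S: "fin_dim S" using fin_dim_subspace[OF star_algD(1)[OF D] _ sub] by (auto simp: S_def)
 have WW: "W * (star W * x) = x" if "x:S" for x
 proof -
  have x: "x:D" "x * P = x" using that by (auto simp: S_def)
  have "(p - W * star W) * (x * P) = 0" using none[OF x(1)] by (simp add: P_def mult.assoc)
  thus ?thesis using x p(2)[of x] by (simp add: left_diff_distrib mult.assoc)
 qed
 have "((*) (star W)) ` S = S"
 proof (rule fin_dim_injective_surjective[OF S])
  show "linear ((*) (star W))" by (intro linearI) (auto simp: algebra_simps)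
  show "(*) (star W) ` S <= S" using sW star_algD[OF D] by (auto simp: S_def mult.assoc)
  show "x = 0" if "x:S" "star W * x = 0" for x using WW[OF that(1)] that(2) by simp
 qed
 moreover have "P:S" using PD PP by (simp add: S_def)
 \<comment> \<open>As P lies in the image of multiplication by \<open>star W\<close>, it is fixed by
   the initial projection \<open>star W * W\<close>; by its definition it is also annihilated by
   it.\<close>
 ultimately obtain x where x: "x:S" "P = star W * x" by blast
 have "star W * W * P = P" using sW(2) x(2) by (simp add: mult.assoc[symmetric])
 moreover have "star W * W * P = 0"
  using p(3)[OF star_algD(5)[OF D sW(1) W(1)]] sW(2) by (simp add: P_def right_diff_distrib mult.assoc[symmetric])
 ultimately show ?thesis by (simp add: P_def)
qed

text \<open>Take an extension W of W0 for which the right ideal \<open>R W\<close> of its initial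
  projection has maximal dimension. If the complements P and Q of its initial and final projections
  were linked by a nonzero \<open>Q * d * P\<close>, a partial isometry obtained from that product
  could be added to W. So they are not linked, and \<open>no_complement\<close> makes both
  vanish.\<close>

lemma partial_isometry_extends:
 assumes D: "star_alg D" and p: "p:D" "!!x. x:D ==> p * x = x" "!!x. x:D ==> x * p = x"
  and W0: "W0:D" "W0 * star W0 * W0 = W0"
 shows "EX U:D. star U * U = p & U * star U = p & U * (star W0 * W0) = W0"
proof -
 define f where "f = star W0 * W0"
 define S where "S = {W:D. W * star W * W = W & W * f = W0 & star W * W * f = f}"
 define R where "R W = {x:D. star W * W * x = x}" for W
 have subR: "subspace (R W)" for W unfolding subspace_def R_def
  using star_algD[OF D] by (auto simp: algebra_simps)
 have dimR: "dim (R W) <= dim D" for W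
  by (rule fin_dim_dim_le[OF star_algD(1)[OF D] subR]) (auto simp: R_def)
 have "W0:S" using W0 by (simp add: S_def f_def mult.assoc)
 then obtain W where W: "W:S" and max: "!!W'. W':S ==> dim (R W') <= dim (R W)"
  using ex_has_greatest_nat[of "%W. W:S" W0 "%W. dim (R W)" "Suc (dim D)"] dimR by (metis less_Suc_eq_le)
 have WD: "W:D" "W * star W * W = W" "W * f = W0" "star W * W * f = f" using W by (auto simp: S_def)
 have sW: "star W:D" "star W * W * star W = star W"
  using star_algD(4)[OF D WD(1)] arg_cong[OF WD(2), of star] by (simp_all add: mult.assoc)
 define P where "P = p - star W * W"
 define Q where "Q = p - W * star W"
 have pp: "star p = p"
 proof -
  have a: "p * star p = star p" by (rule p(2)[OF star_algD(4)[OF D p(1)]])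
  have "star (p * star p) = p * star p" by simp
  thus ?thesis unfolding a by simp
 qed
 have PQ: "P:D" "Q:D" using p(1) WD(1) sW(1) star_algD[OF D] by (auto simp: P_def Q_def)
 have none: "Q * d * P = 0" if d: "d:D" for d
 proof (rule ccontr)
  assume "Q * d * P ~= 0"
  then obtain v w u where v: "v:D" "v ~= 0" and w: "w:D" "v = Q * d * P * w"
   and u: "u:D" "star v * v = star (Q * d * P) * u" and vvv: "v * (star v * v) = v"
   using exists_partial_isometry[OF D, of "Q * d * P"] d PQ star_algD(5)[OF D] by metis
  define e where "e = star v * v"
  have se: "star e = e" by (simp add: e_def)
  have "P * P = p * p - p * (star W * W) - (star W * W) * p + star W * W * star W * W"
   "Q * Q = p * p - p * (W * star W) - (W * star W) * p + W * star W * W * star W"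
   by (simp_all add: P_def Q_def algebra_simps mult.assoc)
  hence "P * P = P" "Q * Q = Q"
   using p sW WD(2) star_algD(5)[OF D sW(1) WD(1)] star_algD(5)[OF D WD(1) sW(1)] by (simp_all add: P_def Q_def)
  have sPQ: "star P = P" "star Q = Q" by (simp_all add: P_def Q_def pp)
  have Pe: "P * e = e"
   unfolding e_def u(2) by (simp add: sPQ mult.assoc[symmetric] \<open>P * P = P\<close>)
  have Qv: "Q * v = v"
   unfolding w(2) by (simp add: mult.assoc[symmetric] \<open>Q * Q = Q\<close>)
  have WP: "W * P = 0" "star W * Q = 0"
   using p(3)[OF WD(1)] p(3)[OF sW(1)] WD(2) sW(2)
   by (simp_all add: P_def Q_def right_diff_distrib mult.assoc[symmetric])
  have We: "W * e = 0" using arg_cong[OF Pe, of "(*) W"] WP(1) by (simp add: mult.assoc[symmetric])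
  have eW: "e * star W = 0" using arg_cong[OF We, of star] by (simp add: se)
  have ve: "v * e = v" using vvv by (simp add: e_def)
  have vW: "v * star W = 0" using arg_cong[OF ve, of "%z. z * star W"] eW by (simp add: mult.assoc)
  have Wv: "W * star v = 0" using arg_cong[OF vW, of star] by simp
  have sWv: "star W * v = 0" using arg_cong[OF Qv, of "(*) (star W)"] WP(2) by (simp add: mult.assoc[symmetric])
  have svW: "star v * W = 0" using arg_cong[OF sWv, of star] by simp
  \<comment> \<open>The initial projection of v lies under P and its final projection under Q, so
    all mixed products vanish and the sum is again a partial isometry.\<close>
  define W' where "W' = W + v"
  have g: "star W' * W' = star W * W + e"
   by (simp add: W'_def algebra_simps sWv svW e_def)
  have gf: "star W * W * f = f" by (rule WD(4))
  have ef: "e * f = 0" "v * f = 0"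
   using arg_cong[OF gf, of "(*) e"] arg_cong[OF gf, of "(*) v"] eW vW by (simp_all add: mult.assoc[symmetric])
  have "W' * star W' * W' = W * star W * W + W * e + v * star W * W + v * e"
   unfolding mult.assoc[of W'] g by (simp add: W'_def algebra_simps mult.assoc)
  hence "W' * star W' * W' = W'" using WD(2) by (simp add: We vW ve W'_def mult.assoc)
  moreover have "W' * f = W0" by (simp add: W'_def algebra_simps WD(3) ef)
  moreover have "star W' * W' * f = f" unfolding g distrib_right by (simp add: ef gf)
  ultimately have "W':S" using WD(1) v(1) star_algD(6)[OF D] by (simp add: S_def W'_def)
  have "e ~= 0" using v(2) mult_star_self_eq_0[of v] by (simp add: e_def)
  have ge: "star W * W * e = 0" by (simp add: mult.assoc We)
  have "dim (R W) < dim (R W')"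
  proof (rule fin_dim_dim_less[OF star_algD(1)[OF D] subR subR])
   have "e * (star W * W * x) = 0" for x by (simp add: mult.assoc[symmetric] eW)
   thus "R W <= R W'" unfolding R_def g by (auto simp: distrib_right) (metis add.right_neutral)
   show "R W' <= D" by (auto simp: R_def)
   have "e * e = e" using ve by (simp add: e_def mult.assoc)
   thus "e:R W'" using ge v(1) star_algD[OF D] by (simp add: R_def g distrib_right e_def)
   show "e ~: R W" using ge \<open>e ~= 0\<close> by (simp add: R_def)
  qed
  thus False using max[OF \<open>W':S\<close>] by simp
 qed
 have 1: "p - star W * W = 0"
  by (rule no_complement[OF D p]) (use WD none in \<open>auto simp: P_def Q_def\<close>)
 \<comment> \<open>Taking adjoints exchanges P and Q, so the same criterion applies to
   \<open>star W\<close>.\<close>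
 have "p - star (star W) * star W = 0"
 proof (rule no_complement[OF D p])
  fix d assume d: "d:D"
  have "Q * star d * P = 0" using none star_algD(4)[OF D d] by blast
  from arg_cong[OF this, of star] show "(p - star W * star (star W)) * d * (p - star (star W) * star W) = 0"
   by (simp add: P_def Q_def pp mult.assoc)
 qed (use sW in auto)
 thus ?thesis using 1 WD by (intro bexI[of _ W]) (auto simp: f_def)
qed

text \<open>The dimensions are bounded, so one member has maximal dimension. In this form finite
  dimensionality turns a stage for each element into one stage for all elements.\<close>

lemma increasing_subspaces_stabilise:
 assumes "fin_dim S" "!!l. subspace (K l)" "!!l. K l <= S" "!!l. K l <= K (Suc l)"
 shows "EX l0. ALL l. K l <= K l0"
proof -
 obtain l0 where l0: "!!l. dim (K l) <= dim (K l0)"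
  using ex_has_greatest_nat[of "%_. True" 0 "%l. dim (K l)" "Suc (dim S)"] fin_dim_dim_le[OF assms(1-3)]
  by (metis less_Suc_eq_le)
 have mono: "K i <= K j" if "i <= j" for i j using that assms(4) by (simp add: lift_Suc_mono_le)
 have "K l <= K l0" for l
 proof (rule ccontr)
  assume "~ K l <= K l0"
  then obtain u where u: "u:K l" "u ~: K l0" by blast
  hence "u:K (max l l0)" using mono[of l "max l l0"] by auto
  hence "dim (K l0) < dim (K (max l l0))"
   using fin_dim_dim_less[OF assms(1) assms(2) assms(2) mono[of l0 "max l l0"] assms(3)] u by simp
  thus False using l0[of "max l l0"] by simp
 qed
 thus ?thesis by blast
qed

section \<open>Matrices over an operator algebra\<close>

text \<open>It places the complex-linear operators among the closed algebras whose intersection is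
  the generated C*-algebra, so that every element of the latter is complex linear.\<close>

lemma closed_clin: "closed {T :: 'h::complex_hilbert \<Rightarrow>\<^sub>L 'h. clin T}"
proof -
 have "continuous_on UNIV (%T :: 'h \<Rightarrow>\<^sub>L 'h. c *\<^sub>C blinfun_apply T x)" for c x
  by (rule continuous_on_compose2[of UNIV "%y. c *\<^sub>C y"])
   (auto intro!: linear_continuous_on bounded_linear_scaleC bounded_linear_intros)
 moreover have "continuous_on UNIV (%T :: 'h \<Rightarrow>\<^sub>L 'h. blinfun_apply T x)" for x
  by (intro linear_continuous_on bounded_linear_intros)
 ultimately show ?thesis unfolding clin_def
  by (intro closed_Collect_all closed_Collect_eq)
qed

definition sgl :: "nat => nat => nat => ('h::complex_hilbert \<Rightarrow>\<^sub>L 'h) => 'h mat" where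
 "sgl s i j T = Abs_mat (%s' i' j'. if s' = s & i' = i & j' = j then T else 0)"

lemma ent_sgl: "clin T ==> ent (sgl s i j T) s' i' j' = (if s' = s & i' = i & j' = j then T else 0)"
proof -
 assume T: "clin T"
 have "bsup (Suc (max s (max i j))) (%s' i' j'. if s' = s & i' = i & j' = j then T else 0)"
  by (auto simp: bsup_def)
 thus ?thesis unfolding sgl_def
  by (subst Abs_mat_inverse) (use T clin_intros(1) in auto)
qed

lemma ent_0 [simp]: "ent 0 s i j = 0" by (simp add: zero_mat.rep_eq)
lemma ent_add [simp]: "ent (x + y) s i j = ent x s i j + ent y s i j" by (simp add: plus_mat.rep_eq)
lemma ent_star [simp]: "ent (star x) s i j = op_adj (ent x s j i)" by (simp add: star.rep_eq)
lemma ent_cscale [simp]: "ent (cscale c x) s i j = op_scale c (ent x s i j)" by (simp add: cscale.rep_eq)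
lemma ent_sum: "ent (sum f I) s i j = (\<Sum>k\<in>I. ent (f k) s i j)"
 by (induction I rule: infinite_finite_induct) auto

lemma ent_times_single:
 assumes "!!l. l ~= k ==> ent x s i l = 0 | ent y s l j = 0"
 shows "ent (x * y) s i j = ent x s i k o\<^sub>L ent y s k j"
proof -
 obtain n where n: "bsup n (ent x)" using ex_bounded by blast
 define m where "m = max n (Suc k)"
 have m: "bsup m (ent x)" by (rule bsup_mono[OF n]) (simp add: m_def)
 have "ent (x * y) s i j = (\<Sum>l<m. if l = k then ent x s i k o\<^sub>L ent y s k j else 0)"
  unfolding ent_times[OF m]
 proof (rule sum.cong[OF refl])
  fix l
  show "ent x s i l o\<^sub>L ent y s l j = (if l = k then ent x s i k o\<^sub>L ent y s k j else 0)"
   using assms[of l] by auto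
 qed
 moreover have "k < m" by (simp add: m_def)
 ultimately show ?thesis by simp
qed

lemma ent_times_zero:
 assumes "!!l. ent x s i l = 0 | ent y s l j = 0"
 shows "ent (x * y) s i j = 0"
proof -
 have "ent (x * y) s i j = ent x s i 0 o\<^sub>L ent y s 0 j" by (rule ent_times_single) (rule assms)
 thus ?thesis using assms[of 0] by (elim disjE) simp_all
qed

lemma sgl_mult:
 assumes "clin S" "clin T"
 shows "sgl s i j S * sgl s' i' j' T = (if s = s' & j = i' then sgl s i j' (S o\<^sub>L T) else 0)"
proof (rule mat_eqI)
 fix a b c
 note ent = ent_sgl[OF assms(1)] ent_sgl[OF assms(2)] ent_sgl[OF clin_intros(4)[OF assms]]
 show "ent (sgl s i j S * sgl s' i' j' T) a b c = ent (if s = s' & j = i' then sgl s i j' (S o\<^sub>L T) else 0) a b c"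
  by (subst ent_times_single[of j]) (auto simp: ent)
qed

lemma star_sgl: "clin T ==> star (sgl s i j T) = sgl s j i (op_adj T)"
 by (rule mat_eqI) (auto simp: ent_sgl clin_op_adj op_adj_zero)

lemma sgl_add: "clin S ==> clin T ==> sgl s i j (S + T) = sgl s i j S + sgl s i j T"
 by (rule mat_eqI) (auto simp: ent_sgl clin_intros)

lemma sgl_scale: "clin T ==> sgl s i j (op_scale c T) = cscale c (sgl s i j T)"
 by (rule mat_eqI) (auto simp: ent_sgl clin_intros op_scale_linear)

lemma sgl_zero [simp]: "sgl s i j 0 = 0"
 by (rule mat_eqI) (auto simp: ent_sgl clin_intros)

lemma mat_eq_sum_sgl:
 assumes "finite I" "!!s i j. ent x s i j ~= 0 ==> (s, i, j):I"
 shows "x = (\<Sum>(s, i, j)\<in>I. sgl s i j (ent x s i j))"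
proof (rule mat_eqI)
 fix s i j
 have "ent (\<Sum>(s, i, j)\<in>I. sgl s i j (ent x s i j)) s i j
   = (\<Sum>k\<in>I. if k = (s, i, j) then ent x s i j else 0)"
  unfolding ent_sum by (rule sum.cong) (auto simp: ent_sgl split: prod.splits)
 thus "ent x s i j = ent (\<Sum>(s, i, j)\<in>I. sgl s i j (ent x s i j)) s i j"
  using assms(2)[of s i j] by (auto simp: sum.delta[OF assms(1)])
qed

abbreviation pos_in :: "nat list => nat => nat => bool" where
 "pos_in ns s i == s < length ns & i < ns ! s"

definition positions :: "nat list => (nat \<times> nat) set" where
 "positions ns = {(s, i). pos_in ns s i}"

lemma positions_iff [simp]: "(s, i):positions ns \<longleftrightarrow> pos_in ns s i"
 by (simp add: positions_def)

lemma finite_positions [simp]: "finite (positions ns)"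
proof -
 have "positions ns <= (SIGMA s:{..<length ns}. {..<ns ! s})" by (auto simp: positions_def)
 thus ?thesis by (rule finite_subset) auto
qed

definition triples :: "nat list => (nat \<times> nat \<times> nat) set" where
 "triples ns = {(s, i, j). pos_in ns s i & pos_in ns s j}"

lemma triples_iff [simp]: "(s, i, j):triples ns \<longleftrightarrow> pos_in ns s i & pos_in ns s j"
 by (simp add: triples_def)

lemma finite_triples [simp]: "finite (triples ns)"
proof -
 have "triples ns <= (SIGMA s:{..<length ns}. {..<ns ! s} \<times> {..<ns ! s})" by (auto simp: triples_def)
 thus ?thesis by (rule finite_subset) auto
qed

text \<open>The 0-1 matrix that sends the basis vector \<open>i\<close> of summand \<open>s\<close> to the vector \<open>f s i\<close>, for \<open>(s, i):I\<close>.\<close>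

definition pmat :: "(nat \<times> nat) set => (nat => nat => nat) => 'h::complex_hilbert mat" where
 "pmat I f = (\<Sum>(s, i)\<in>I. sgl s (f s i) i id_blinfun)"

lemma ent_pmat:
 assumes "finite I"
 shows "ent (pmat I f) s i j = (if (s, j):I & i = f s j then id_blinfun else 0)"
proof -
 have "ent (pmat I f) s i j = (\<Sum>k\<in>I. if k = (s, j) then (if i = f s j then id_blinfun else 0) else 0)"
  unfolding pmat_def ent_sum
  by (rule sum.cong) (auto simp: ent_sgl clin_intros split: prod.splits)
 thus ?thesis by (auto simp: sum.delta[OF assms])
qed

lemma ent_times_pmat:
 assumes "finite I"
 shows "ent (x * pmat I f) s i j = (if (s, j):I then ent x s i (f s j) else 0)"
proof (cases "(s, j):I")
 case True
 thus ?thesis by (subst ent_times_single[of "f s j"]) (auto simp: ent_pmat[OF assms] blinfun_eqI)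
qed (subst ent_times_zero, auto simp: ent_pmat[OF assms])

lemma ent_star_pmat_times:
 assumes "finite I"
 shows "ent (star (pmat I f) * x) s i j = (if (s, i):I then ent x s (f s i) j else 0)"
proof -
 have "star (pmat I f) * x = star (star x * pmat I f)" by simp
 hence "ent (star (pmat I f) * x) s i j = op_adj (ent (star x * pmat I f) s j i)"
  by (simp only: ent_star)
 thus ?thesis by (simp add: ent_times_pmat[OF assms] op_adj_op_adj op_adj_zero)
qed

definition unitm :: "nat list => 'h::complex_hilbert mat" where
 "unitm ns = pmat (positions ns) (%s i. i)"

abbreviation "u1 == unitm [1]"

lemma ent_unitm: "ent (unitm ns) s i j = (if pos_in ns s j & i = j then id_blinfun else 0)"
 by (auto simp: unitm_def ent_pmat)

lemma star_unitm [simp]: "star (unitm ns) = unitm ns"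
 by (rule mat_eqI) (auto simp: ent_unitm op_adj_id op_adj_zero)

lemma ent_times_unitm: "ent (x * unitm ns) s i j = (if pos_in ns s j then ent x s i j else 0)"
 by (auto simp: unitm_def ent_times_pmat)

lemma ent_unitm_times: "ent (unitm ns * x) s i j = (if pos_in ns s i then ent x s i j else 0)"
 using ent_star_pmat_times[of "positions ns" "%s i. i" x s i j]
 by (auto simp flip: unitm_def)

lemma unitm_idem [simp]: "unitm ns * unitm ns = unitm ns"
 by (rule mat_eqI) (auto simp: ent_unitm_times ent_unitm)

lemma compose_id [simp]: "id_blinfun o\<^sub>L T = T" "T o\<^sub>L id_blinfun = T"
 by (simp_all add: blinfun_eqI)

lemma less_mult_mono: "i < N * n ==> N <= M ==> i < M * (n::nat)"
 by (meson mult_le_mono1 order_less_le_trans)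

definition full :: "('h::complex_hilbert \<Rightarrow>\<^sub>L 'h) set => 'h mat set" where
 "full K = {x. ALL s i j. ent x s i j:K}"

definition mats :: "('h::complex_hilbert \<Rightarrow>\<^sub>L 'h) set => nat list => 'h mat set" where
 "mats K ns = {x:full K. ALL s i j. ent x s i j ~= 0 --> pos_in ns s i & pos_in ns s j}"

text \<open>For every elementary algebra B with r summands this is B tensored with the finite
  matrices of all sizes: in the union over all multiples the individual sizes of B
  disappear.\<close>

definition upto :: "('h::complex_hilbert \<Rightarrow>\<^sub>L 'h) set => nat => 'h mat set" where
 "upto K r = {x:full K. ALL s i j. r <= s --> ent x s i j = 0}"

text \<open>Compression by the unit replaces the conditions on indices, so closure properties of
  \<open>mats\<close> become ring identities.\<close>

lemma mats_iff: "x:mats K ns \<longleftrightarrow> x:full K & unitm ns * x = x & x * unitm ns = x"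
proof -
 have a: "unitm ns * x = x \<longleftrightarrow> (ALL s i j. ent x s i j ~= 0 --> pos_in ns s i)"
  by (metis ent_unitm_times mat_eqI)
 have b: "x * unitm ns = x \<longleftrightarrow> (ALL s i j. ent x s i j ~= 0 --> pos_in ns s j)"
  by (metis ent_times_unitm mat_eqI)
 show ?thesis unfolding mats_def a b by blast
qed

lemma unitm_mats [simp]: "x:mats K ns ==> unitm ns * x = x" "x:mats K ns ==> x * unitm ns = x"
 by (simp_all add: mats_iff)

lemma mats_full: "x:mats K ns ==> x:full K" by (simp add: mats_def)

lemma mats_upto: "x:mats K ns ==> x:upto K (length ns)"
 unfolding mats_def upto_def by (auto simp: not_less[symmetric])

lemma upto_full: "x:upto K r ==> x:full K" by (simp add: upto_def)

lemma full_mono: "K <= L ==> full K <= full L" by (auto simp: full_def)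
lemma mats_mono: "K <= L ==> mats K ns <= mats L ns" by (auto simp: mats_def full_def)
lemma upto_mono: "K <= L ==> upto K r <= upto L r" by (auto simp: upto_def full_def)

lemma pos_in_tensor: "pos_in (ts N ns) s i \<longleftrightarrow> s < length ns & i < N * ns ! s"
 by (auto simp: tensor_sizes_def)

lemma length_tensor [simp]: "length (ts N ns) = length ns" by (simp add: tensor_sizes_def)

lemma mats_tensor_mono: "N <= M ==> mats K (ts N ns) <= mats K (ts M ns)"
 unfolding mats_def pos_in_tensor by (blast intro: less_mult_mono)

lemma upto_tensor:
 assumes "x:upto K (length ns)" "valid_sizes ns"
 shows "EX N>0. x:mats K (ts N ns)"
proof -
 obtain n where n: "bsup n (ent x)" using ex_bounded by blast
 have "x:mats K (ts (Suc n) ns)"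
  unfolding mats_def pos_in_tensor
 proof (intro CollectI conjI allI impI)
  show "x:full K" using assms by (simp add: upto_def)
  fix s i j assume *: "ent x s i j ~= 0"
  thus s: "s < length ns" "s < length ns" using assms by (auto simp: upto_def not_le[symmetric])
  have "0 < ns ! s" using s assms(2) by (simp add: valid_sizes_def)
  hence le: "Suc n * 1 <= Suc n * ns ! s" by (intro mult_le_mono2) simp
  have ij: "i < n" "j < n" using * n unfolding bsup_def by blast+
  show "i < Suc n * ns ! s" "j < Suc n * ns ! s"
   by (rule order_less_le_trans[OF _ le], use ij in simp)+
 qed
 thus ?thesis by blast
qed

text \<open>The closure properties shared by an operator algebra and by the C*-algebra that it generates.\<close>

locale opr =
 fixes K :: "('h::complex_hilbert \<Rightarrow>\<^sub>L 'h) set"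
 assumes clin: "T:K ==> clin T"
  and zero: "0:K" and one: "id_blinfun:K"
  and add: "S:K ==> T:K ==> S + T:K"
  and scale: "T:K ==> op_scale c T:K"
  and comp: "S:K ==> T:K ==> S o\<^sub>L T:K"
begin

lemma sum_in: "(!!i. i:I ==> f i:K) ==> sum f I:K"
 by (induction I rule: infinite_finite_induct) (auto simp: zero add)

lemma full_closed:
 "0:full K" "x:full K ==> y:full K ==> x + y:full K" "x:full K ==> cscale c x:full K"
 "x:full K ==> y:full K ==> x * y:full K"
proof -
 assume "x:full K" "y:full K"
 thus "x * y:full K" using ex_bounded[of x]
  by (auto simp: full_def ent_times intro!: sum_in comp)
qed (auto simp: full_def zero add scale)

lemma full_closed2: "x:full K ==> - x:full K" "x:full K ==> r *\<^sub>R x:full K"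
 "x:full K ==> y:full K ==> x - y:full K"
 using full_closed(3)[of x "-1"] full_closed(3)[of x "complex_of_real r"] full_closed(2)[of x "- y"]
  full_closed(3)[of y "-1"] by (auto simp: cscale_minus_one cscale_real)

lemma full_sum: "(!!i. i:I ==> f i:full K) ==> sum f I:full K"
 by (induction I rule: infinite_finite_induct) (auto simp: full_closed)

lemma sgl_full: "T:K ==> sgl s i j T:full K"
 by (simp add: full_def ent_sgl clin zero)

lemma sgl_mats: "T:K ==> pos_in ns s i ==> pos_in ns s j ==> sgl s i j T:mats K ns"
 by (auto simp: mats_def sgl_full ent_sgl clin)

lemma pmat_full: "finite I ==> pmat I f:full K" "finite I ==> star (pmat I f):full K"
 by (auto simp: full_def ent_pmat zero one op_adj_id op_adj_zero)

lemma unitm_in: "unitm ns:mats K ns"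
 by (auto simp: mats_def full_def ent_unitm zero one)

lemma mats_closed:
 "0:mats K ns" "x:mats K ns ==> y:mats K ns ==> x + y:mats K ns"
 "x:mats K ns ==> cscale c x:mats K ns"
 "x:mats K ns ==> y:mats K ns ==> x * y:mats K ns"
 "x:mats K ns ==> z:full K ==> y:mats K ns ==> x * z * y:mats K ns"
 "x:mats K ns ==> - x:mats K ns" "x:mats K ns ==> r *\<^sub>R x:mats K ns"
 "x:mats K ns ==> y:mats K ns ==> x - y:mats K ns"
 unfolding mats_iff
 by (auto simp: full_closed full_closed2 distrib_left distrib_right left_diff_distrib right_diff_distrib mult.assoc)
  (simp_all add: mult.assoc[symmetric])

lemma upto_closed:
 "0:upto K r" "x:upto K r ==> y:upto K r ==> x + y:upto K r"
 "x:upto K r ==> cscale c x:upto K r"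
 "x:upto K r ==> y:full K ==> x * y:upto K r"
 "y:full K ==> x:upto K r ==> y * x:upto K r"
 "x:upto K r ==> - x:upto K r"
proof -
 assume *: "x:upto K r" "y:full K"
 show "x * y:upto K r" "y * x:upto K r" unfolding upto_def
 proof (safe)
  show "x * y:full K" "y * x:full K" using * by (auto simp: full_closed upto_def)
  fix s i j
  assume "r <= s"
  hence "ent x s i j = 0" for i j using * by (simp add: upto_def)
  thus "ent (x * y) s i j = 0" "ent (y * x) s i j = 0" by (auto intro: ent_times_zero)
 qed
qed (auto simp: upto_def full_closed full_closed2 op_scale_linear uminus_mat.rep_eq)

lemma mats_induct [consumes 1, case_names sgl zero add]:
 assumes "x:mats K ns"
  and "!!s i j T. T:K ==> pos_in ns s i ==> pos_in ns s j ==> P (sgl s i j T)"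
  and "P 0" and "!!x y. x:mats K ns ==> y:mats K ns ==> P x ==> P y ==> P (x + y)"
 shows "P x"
proof -
 have "(\<Sum>(s, i, j)\<in>J. sgl s i j (ent x s i j)):mats K ns & P (\<Sum>(s, i, j)\<in>J. sgl s i j (ent x s i j))"
  if "finite J" "J <= triples ns" for J
  using that
 proof (induction J rule: finite_induct)
  case empty
  thus ?case using assms(3) mats_closed(1) by simp
 next
  case (insert k J)
  obtain s i j where k: "k = (s, i, j)" by (cases k)
  have "ent x s i j:K" "pos_in ns s i" "pos_in ns s j"
   using assms(1) insert.prems k by (auto simp: mats_def full_def)
  hence "sgl s i j (ent x s i j):mats K ns" "P (sgl s i j (ent x s i j))"
   using sgl_mats assms(2) by auto
  thus ?case using insert k assms(4) mats_closed(2) by auto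
 qed
 hence sum: "P (\<Sum>(s, i, j)\<in>triples ns. sgl s i j (ent x s i j))" by simp
 have eq: "x = (\<Sum>(s, i, j)\<in>triples ns. sgl s i j (ent x s i j))"
  by (rule mat_eq_sum_sgl) (use assms(1) in \<open>auto simp: mats_def\<close>)
 show ?thesis by (rule ssubst[of x _ P, OF eq]) (rule sum)
qed

lemma entries_in_eq: "entries_in K ns = ent ` mats K ns"
proof (intro set_eqI iffI)
 fix x assume x: "x:entries_in K ns"
 hence K: "x s i j:K" and z: "x s i j ~= 0 ==> pos_in ns s i & pos_in ns s j" for s i j
  using zero by (auto simp: entries_in_def split: if_splits) metis+
 define n where "n = length ns + sum_list ns"
 have "bsup n x" unfolding bsup_def
 proof (intro allI impI)
  fix s i j assume "x s i j ~= 0"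
  hence p: "pos_in ns s i" "pos_in ns s j" using z by blast+
  hence "ns ! s <= sum_list ns" by (simp add: elem_le_sum_list)
  thus "s < n & i < n & j < n" using p by (auto simp: n_def)
 qed
 hence "ent (Abs_mat x) = x" by (subst Abs_mat_inverse) (use K clin in blast)+
 thus "x:ent ` mats K ns" using K z by (intro image_eqI[of _ _ "Abs_mat x"]) (auto simp: mats_def full_def)
next
 fix x assume "x:ent ` mats K ns"
 thus "x:entries_in K ns" by (auto simp: entries_in_def mats_def full_def) metis+
qed

end

section \<open>The algebra E, its generated C*-algebra, and equivalence by partial
  isometries\<close>

locale fin_acting =
 fixes E :: "('h::complex_hilbert \<Rightarrow>\<^sub>L 'h) set"
 assumes unital_E: "unital_operator_algebra E" and fin_E: "finitely_acting E"
begin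

abbreviation CE :: "('h \<Rightarrow>\<^sub>L 'h) set" where "CE == generated_cstar E"

lemma CE_member: "T:CE \<longleftrightarrow> (ALL B. E <= B & operator_algebra B & (ALL T:B. op_adj T:B) & closed B --> T:B)"
 by (auto simp: generated_cstar_def)

lemma CE_clin: "T:CE ==> clin T"
proof -
 have "operator_algebra {T :: 'h \<Rightarrow>\<^sub>L 'h. clin T}"
  by (auto simp: operator_algebra_def clin_intros) (simp add: clin_def)
 moreover have "E <= {T. clin T}"
  using unital_E by (auto simp: unital_operator_algebra_def operator_algebra_def clin_def)
 moreover assume "T:CE"
 ultimately show "clin T"
  using closed_clin clin_op_adj unfolding CE_member by (metis (mono_tags, lifting) mem_Collect_eq)
qed

lemma E_sub_CE: "E <= CE" by (auto simp: CE_member)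

sublocale E: opr E
 using unital_E by unfold_locales (auto simp: unital_operator_algebra_def operator_algebra_def clin_def)

sublocale CE: opr CE
proof
 show "id_blinfun:CE" "0:CE" using E_sub_CE E.one E.zero by auto
qed (auto simp: CE_clin CE_member operator_algebra_def)

lemma CE_adj: "T:CE ==> op_adj T:CE" by (auto simp: CE_member)

lemma real_subspace:
 assumes "0:K" "!!S T. S:K ==> T:K ==> S + T:K" "!!c T. T:K ==> op_scale c T:K"
 shows "subspace K"
 unfolding subspace_def using assms by (metis op_scale_linear(8))

lemma fin_dim_CE: "fin_dim CE"
 using fin_E CE.zero CE.add CE.scale unfolding fin_dim_def finitely_acting_def by (blast intro: real_subspace)

text \<open>The generated C*-algebra is an intersection of closed algebras, so an induction over the
  algebraic operations also requires the set of good elements to be closed. It is, being a subspace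
  of a finite-dimensional space.\<close>

lemma CE_induct [consumes 1, case_names base add scale comp adj]:
 assumes "T:CE"
  and "!!T. T:E ==> P T" "!!S T. S:CE ==> T:CE ==> P S ==> P T ==> P (S + T)"
  "!!c T. T:CE ==> P T ==> P (op_scale c T)"
  "!!S T. S:CE ==> T:CE ==> P S ==> P T ==> P (S o\<^sub>L T)"
  "!!T. T:CE ==> P T ==> P (op_adj T)"
 shows "P T"
proof -
 define B where "B = {T:CE. P T}"
 have "subspace B"
  using assms(2-4) CE.zero CE.add CE.scale E.zero unfolding B_def by (intro real_subspace) auto
 hence "fin_dim B" by (rule fin_dim_subspace[OF fin_dim_CE, rotated]) (auto simp: B_def)
 hence "closed B" by (rule fin_dim_closed)
 moreover have "operator_algebra B"
  unfolding operator_algebra_def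
 proof (intro conjI ballI allI)
  show "0:B" using CE.zero assms(2)[OF E.zero] by (simp add: B_def)
  fix T assume T: "T:B"
  thus "blinfun_apply T (c *\<^sub>C x) = c *\<^sub>C blinfun_apply T x" for c x
   using CE.clin[of T] by (simp add: B_def clin_def)
  show "op_scale c T:B" for c using T CE.scale assms(4) by (simp add: B_def)
  fix S assume S: "S:B"
  show "T o\<^sub>L S:B" "T + S:B" using S T CE.comp CE.add assms(3,5) by (simp_all add: B_def)
 qed
 moreover have "E <= B" using E_sub_CE assms(2) by (auto simp: B_def)
 moreover have "ALL T:B. op_adj T:B" using CE_adj assms(6) by (auto simp: B_def)
 ultimately have "T:B" using assms(1) unfolding CE_member by blast
 thus ?thesis by (simp add: B_def)
qed

abbreviation A :: "nat list => 'h mat set" where "A == mats E"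
abbreviation C :: "nat list => 'h mat set" where "C == mats CE"

lemma A_sub_C: "A ns <= C ns" by (rule mats_mono[OF E_sub_CE])
lemma fullE_sub: "full E <= full CE" by (rule full_mono[OF E_sub_CE])

lemma star_full: "x:full CE ==> star x:full CE" by (auto simp: full_def CE_adj)

lemma star_C: "x:C ns ==> star x:C ns"
 using star_full unfolding mats_iff by auto (metis star_mult star_unitm)+

lemma star_alg_C: "star_alg (C ns)"
proof -
 obtain B where B: "finite B" "B <= CE" "span B = CE" using fin_dim_basis[OF fin_dim_CE] by metis
 let ?G = "(%((s, i, j), b). sgl s i j b) ` (triples ns \<times> B)"
 have "x:span ?G" if "x:C ns" for x
  using that
 proof (induction x rule: CE.mats_induct)
  case (sgl s i j T)
  have "T:span B" using sgl B by simp
  hence "clin T & sgl s i j T:span ?G"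
  proof (induction T rule: span_induct_alt)
   case base
   show ?case by (simp add: span_zero clin_intros)
  next
   case (step r S T)
   have S: "clin S" using step B CE.clin by blast
   hence "sgl s i j (r *\<^sub>R S + T) = r *\<^sub>R sgl s i j S + sgl s i j T"
    using step sgl_scale[OF S, of s i j "complex_of_real r"]
    by (simp add: sgl_add clin_intros op_scale_linear cscale_real)
   moreover have "sgl s i j S:span ?G"
    using step sgl by (intro span_base image_eqI[of _ _ "((s, i, j), S)"]) auto
   ultimately show ?case using step S by (auto intro: span_add span_scale clin_intros)
  qed
  thus ?case by blast
 qed (auto intro: span_add span_zero)
 moreover have "finite ?G" using B by simp
 moreover have "subspace (C ns)" by (simp add: subspace_def CE.mats_closed)
 ultimately show ?thesis
  unfolding star_alg_def fin_dim_def by (auto intro: star_C CE.mats_closed(4))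
qed

lemma shom_sum:
 assumes "shom (C ns) f" "!!k. k:I ==> x k:C ns"
 shows "f (\<Sum>k\<in>I. x k) = (\<Sum>k\<in>I. f (x k))"
 by (rule linear_on_sum[where S = "C ns"]) (simp_all add: star_algD(2)[OF star_alg_C] shomD[OF assms(1)] assms(2))

lemma fin_dim_A: "fin_dim (A ns)"
proof (rule fin_dim_subspace[OF star_algD(1)[OF star_alg_C] A_sub_C])
 show "subspace (A ns)" by (simp add: subspace_def E.mats_closed)
qed

text \<open>A star-homomorphism is determined by its values on \<open>A ns\<close>, which generates \<open>C ns\<close>.\<close>

lemma C_generated:
 assumes "x:C ns"
  and base: "!!x. x:A ns ==> P x"
  and add: "!!x y. x:C ns ==> y:C ns ==> P x ==> P y ==> P (x + y)"
  and scale: "!!c x. x:C ns ==> P x ==> P (cscale c x)"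
  and mult: "!!x y. x:C ns ==> y:C ns ==> P x ==> P y ==> P (x * y)"
  and star: "!!x. x:C ns ==> P x ==> P (star x)"
 shows "P x"
 using assms(1)
proof (induction x rule: CE.mats_induct)
 case (sgl s i j T)
 from sgl(1) have "ALL i j. pos_in ns s i --> pos_in ns s j --> P (sgl s i j T)"
 proof (induction T rule: CE_induct)
  case (base T)
  thus ?case using assms(2) E.sgl_mats by blast
 next
  case (add S T)
  thus ?case using assms(3) CE.sgl_mats by (simp add: sgl_add CE.clin)
 next
  case (scale c T)
  thus ?case using assms(4) CE.sgl_mats by (simp add: sgl_scale CE.clin)
 next
  case (comp S T)
  show ?case
  proof (intro allI impI)
   fix i j assume ij: "pos_in ns s i" "pos_in ns s j"
   have "P (sgl s i i S * sgl s i j T)" using comp ij assms(5) CE.sgl_mats by blast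
   thus "P (sgl s i j (S o\<^sub>L T))" using comp by (simp add: sgl_mult CE.clin)
  qed
 next
  case (adj T)
  show ?case
  proof (intro allI impI)
   fix i j assume ij: "pos_in ns s i" "pos_in ns s j"
   have "P (star (sgl s j i T))" using adj ij assms(6) CE.sgl_mats by blast
   thus "P (sgl s i j (op_adj T))" using adj by (simp add: star_sgl CE.clin)
  qed
 qed
 thus ?case using sgl by blast
qed (use base E.mats_closed(1) add in auto)

lemma shom_unique:
 assumes "shom (C ns) f" "shom (C ns) g" "!!x. x:A ns ==> f x = g x" "x:C ns"
 shows "f x = g x"
 using assms(4) by (rule C_generated) (use assms in \<open>auto simp: shomD\<close>)

text \<open>The homomorphism is given on the C*-algebra \<open>C ns\<close>, with no size prescribed
  for its target: the range is bounded anyway by the image of the unit. This allows maps into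
  different corners to be compared.\<close>

definition hom :: "nat list => ('h mat => 'h mat) => bool" where
 "hom ns f \<longleftrightarrow> shom (C ns) f & f ` C ns <= full CE & f ` A ns <= full E"

lemma homD:
 assumes "hom ns f"
 shows "shom (C ns) f" "x:C ns ==> f x:full CE" "x:A ns ==> f x:full E"
  "x:A ns ==> f x:full CE"
 using assms fullE_sub unfolding hom_def by auto

text \<open>The image of the unit lies in \<open>A ms\<close> and is a two-sided unit for the whole
  range, also on the generated C*-algebra.\<close>

lemma hom_range:
 assumes "hom ns f" "f ` A ns <= A ms" "x:C ns"
 shows "f x:C ms"
proof -
 have 1: "f (unitm ns):A ms" using assms(2) E.unitm_in by blast
 have u: "unitm ns:C ns" by (rule CE.unitm_in)
 have "f x = f (unitm ns) * f x" "f x = f x * f (unitm ns)"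
  using shomD(5)[OF homD(1)[OF assms(1)] u assms(3)] shomD(5)[OF homD(1)[OF assms(1)] assms(3) u] assms(3) by simp_all
 hence "unitm ms * f x = f x" "f x * unitm ms = f x"
  using unitm_mats[OF 1] by (metis (no_types) mult.assoc)+
 thus ?thesis using homD(2)[OF assms(1,3)] unfolding mats_iff by blast
qed

text \<open>Only the effect of \<open>w\<close> on the values of f on S is constrained, not w
  itself, so that equivalence on a mere corner makes sense. The condition on \<open>star w\<close>
  is there because E may fail to be self-adjoint.\<close>

definition sim :: "'h mat set => ('h mat => 'h mat) => ('h mat => 'h mat) => bool" where
 "sim S f g \<longleftrightarrow> (EX w:full E. star w:full E \<and>
   (ALL x:S. star w * w * f x = f x & f x * (star w * w) = f x & g x = w * f x * star w))"

lemma sim_sym: assumes "sim S f g" shows "sim S g f"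
proof -
 obtain w where w: "w:full E" "star w:full E"
  "!!x. x:S ==> star w * w * f x = f x" "!!x. x:S ==> f x * (star w * w) = f x"
  "!!x. x:S ==> g x = w * f x * star w"
  using assms by (auto simp: sim_def)
 have "w * star w * g x = g x" "g x * (w * star w) = g x" "f x = star w * g x * w" if "x:S" for x
 proof -
  have "w * star w * g x = w * (star w * w * f x) * star w" using w(5)[OF that] by (simp add: mult.assoc)
  thus "w * star w * g x = g x" using w(3,5)[OF that] by simp
  have "g x * (w * star w) = w * (f x * (star w * w)) * star w" using w(5)[OF that] by (simp add: mult.assoc)
  thus "g x * (w * star w) = g x" using w(4,5)[OF that] by simp
  have "star w * g x * w = star w * w * f x * (star w * w)" using w(5)[OF that] by (simp add: mult.assoc)
  thus "f x = star w * g x * w" using w(3,4)[OF that] by simp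
 qed
 thus ?thesis unfolding sim_def using w(1,2) by (intro bexI[of _ "star w"]) auto
qed

lemma sim_trans: assumes "sim S f g" "sim S g h" shows "sim S f h"
proof -
 obtain w where w: "w:full E" "star w:full E"
  "!!x. x:S ==> star w * w * f x = f x" "!!x. x:S ==> f x * (star w * w) = f x"
  "!!x. x:S ==> g x = w * f x * star w"
  using assms by (auto simp: sim_def)
 obtain v where v: "v:full E" "star v:full E"
  "!!x. x:S ==> star v * v * g x = g x" "!!x. x:S ==> g x * (star v * v) = g x"
  "!!x. x:S ==> h x = v * g x * star v"
  using assms by (auto simp: sim_def)
 have "star (v * w) * (v * w) * f x = f x" "f x * (star (v * w) * (v * w)) = f x"
  "h x = (v * w) * f x * star (v * w)" if "x:S" for x
 proof -
  note e = w(3,4,5)[OF that] v(3,4,5)[OF that]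
  have wf: "w * f x = g x * w"
   using e by (simp add: mult.assoc)
  have fw: "f x * star w = star w * g x"
   using e by (simp add: mult.assoc[symmetric])
  have "star (v * w) * (v * w) * f x = star w * (star v * v * g x) * w"
   by (simp add: mult.assoc wf)
  also have "... = star w * (w * f x)" unfolding e(4) by (simp add: mult.assoc wf)
  finally show "star (v * w) * (v * w) * f x = f x" using e by (simp add: mult.assoc)
  have "f x * (star (v * w) * (v * w)) = star w * (g x * (star v * v)) * w"
   by (simp add: mult.assoc[symmetric] fw)
  also have "... = f x * star w * w" unfolding e(5) by (simp add: fw)
  finally show "f x * (star (v * w) * (v * w)) = f x" using e by (simp add: mult.assoc)
  show "h x = (v * w) * f x * star (v * w)" using e by (simp add: mult.assoc)
 qed
 thus ?thesis unfolding sim_def using w(1,2) v(1,2) E.full_closed(4)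
  by (intro bexI[of _ "v * w"]) auto
qed

lemma sim_comp: "sim S f g ==> h ` T <= S ==> sim T (f o h) (g o h)"
 unfolding sim_def image_subset_iff by (elim bexE conjE, rule bexI, rule conjI, assumption) simp_all

lemma sim_cong: "sim S f g ==> (!!x. x:S ==> f x = f' x) ==> (!!x. x:S ==> g x = g' x) ==> sim S f' g'"
 unfolding sim_def by simp

lemma sim_refl: assumes "!!x. x:S ==> f x:A ms" shows "sim S f f"
 unfolding sim_def
 by (rule bexI[of _ "unitm ms"]) (use unitm_mats(1)[OF assms] unitm_mats(2)[OF assms] mats_full[OF E.unitm_in] in auto)

lemma hom_unit:
 assumes "hom ns f"
 shows "f (unitm ns):full E" "star (f (unitm ns)) = f (unitm ns)" "f (unitm ns) * f (unitm ns) = f (unitm ns)"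
  "x:C ns ==> f (unitm ns) * f x = f x" "x:C ns ==> f x * f (unitm ns) = f x"
  "x:A ns ==> f (unitm ns) * f x = f x" "x:A ns ==> f x * f (unitm ns) = f x"
proof -
 have u: "unitm ns:C ns" "unitm ns:A ns" by (rule CE.unitm_in E.unitm_in)+
 show *: "f (unitm ns) * f x = f x" "f x * f (unitm ns) = f x" if "x:C ns" for x
  using shomD(5)[OF homD(1)[OF assms] u(1) that] shomD(5)[OF homD(1)[OF assms] that u(1)] that by simp_all
 show "f (unitm ns):full E" using homD(3)[OF assms u(2)] .
 show "star (f (unitm ns)) = f (unitm ns)" using shomD(1)[OF homD(1)[OF assms] u(1)] by simp
 show "f (unitm ns) * f (unitm ns) = f (unitm ns)" using *[OF u(1)] by simp
 show "x:A ns ==> f (unitm ns) * f x = f x" "x:A ns ==> f x * f (unitm ns) = f x"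
  using * A_sub_C by blast+
qed

text \<open>Cutting w down by the image of the unit turns it into a genuine partial isometry whose
  initial projection is that image.\<close>

lemma sim_hom_partial_isometry:
 assumes f: "hom ns f" and s: "sim (A ns) f g"
 obtains w where "w:full E" "star w:full E" "star w * w = f (unitm ns)"
  "!!x. x:A ns ==> g x = w * f x * star w" "w * f (unitm ns) = w"
proof -
 obtain w where w: "w:full E" "star w:full E"
  "!!x. x:A ns ==> star w * w * f x = f x" "!!x. x:A ns ==> f x * (star w * w) = f x"
  "!!x. x:A ns ==> g x = w * f x * star w"
  using s by (auto simp: sim_def)
 define p where "p = f (unitm ns)"
 have p: "p:full E" "star p = p" "p * p = p" "star w * w * p = p"
  using hom_unit[OF f] w(3)[OF E.unitm_in] by (auto simp: p_def)
 have "star (w * p) * (w * p) = p * (star w * w * p)" by (simp add: p mult.assoc)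
 hence 1: "star (w * p) * (w * p) = p" using p by simp
 have 2: "g x = (w * p) * f x * star (w * p)" if "x:A ns" for x
 proof -
  have "(w * p) * f x * star (w * p) = w * (p * f x * p) * star w" by (simp add: p mult.assoc)
  thus ?thesis using hom_unit(6,7)[OF f that] w(5)[OF that] by (simp add: p_def)
 qed
 show ?thesis
  by (rule that[of "w * p"]) (use 1 2 p w E.full_closed(4) in \<open>auto simp: p_def mult.assoc\<close>)
qed

text \<open>With orthogonal ranges on both sides, the sum of the two partial isometries works: their
  final projections are orthogonal, which kills \<open>star w * v\<close>, and their initial ones
  are orthogonal, which kills \<open>w * f' x\<close> and \<open>v * f x\<close>.\<close>

lemma sim_add:
 assumes f: "hom ns f" "hom ns f'" and s: "sim (A ns) f g" "sim (A ns) f' g'"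
  and g: "hom ns g" "hom ns g'"
  and orth: "f (unitm ns) * f' (unitm ns) = 0" "g (unitm ns) * g' (unitm ns) = 0"
 shows "sim (A ns) (%x. f x + f' x) (%x. g x + g' x)"
proof -
 let ?u = "unitm ns"
 obtain w where w: "w:full E" "star w:full E" "star w * w = f ?u"
  "!!x. x:A ns ==> g x = w * f x * star w" "w * f ?u = w"
  using sim_hom_partial_isometry[OF f(1) s(1)] by metis
 obtain v where v: "v:full E" "star v:full E" "star v * v = f' ?u"
  "!!x. x:A ns ==> g' x = v * f' x * star v" "v * f' ?u = v"
  using sim_hom_partial_isometry[OF f(2) s(2)] by metis
 have gw: "g ?u * w = w" "g' ?u * v = v"
  using w v w(4)[OF E.unitm_in] v(4)[OF E.unitm_in] by (simp_all add: mult.assoc)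
 note u = hom_unit[OF f(1)] hom_unit[OF f(2)] hom_unit[OF g(1)] hom_unit[OF g(2)]
 have orth': "f' ?u * f ?u = 0" "g' ?u * g ?u = 0"
  using arg_cong[OF orth(1), of star] arg_cong[OF orth(2), of star] u by simp_all
 have swv: "star w * v = 0" "star v * w = 0"
 proof -
  have "star w * v = star (g ?u * w) * (g' ?u * v)" by (simp only: gw)
  also have "... = star w * (g ?u * g' ?u) * v" using u by (simp add: mult.assoc)
  finally show "star w * v = 0" by (simp add: orth)
  hence "star (star w * v) = star 0" by (rule arg_cong)
  thus "star v * w = 0" by simp
 qed
 have ff: "f x * f' ?u = 0" "f' x * f ?u = 0" "f ?u * f' x = 0" "f' ?u * f x = 0" if "x:A ns" for x
 proof -
  have "f x * f' ?u = f x * (f ?u * f' ?u)" "f' x * f ?u = f' x * (f' ?u * f ?u)"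
   "f ?u * f' x = f ?u * f' ?u * f' x" "f' ?u * f x = f' ?u * f ?u * f x"
   using u(6,7,13,14)[OF that] by (simp_all add: mult.assoc[symmetric], simp_all add: mult.assoc)
  thus "f x * f' ?u = 0" "f' x * f ?u = 0" "f ?u * f' x = 0" "f' ?u * f x = 0"
   by (simp_all add: orth orth')
 qed
 have wf': "w * f' x = 0" "v * f x = 0" "f x * star v = 0" "f' x * star w = 0" if "x:A ns" for x
 proof -
  have "w * (f ?u * f' x) = w * f' x" "v * (f' ?u * f x) = v * f x"
   using w(5) v(5) by (simp_all add: mult.assoc[symmetric])
  thus "w * f' x = 0" "v * f x = 0" using ff(3,4)[OF that] by simp_all
  have "star v = f' ?u * star v" "star w = f ?u * star w"
   using arg_cong[OF v(5), of star] arg_cong[OF w(5), of star] u by simp_all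
  hence "f x * star v = f x * f' ?u * star v" "f' x * star w = f' x * f ?u * star w"
   by (simp_all add: mult.assoc)
  thus "f x * star v = 0" "f' x * star w = 0" using ff(1,2)[OF that] by simp_all
 qed
 have ww: "star (w + v) * (w + v) = f ?u + f' ?u"
  using w(3) v(3) swv by (simp add: algebra_simps)
 show ?thesis unfolding sim_def
 proof (rule bexI[of _ "w + v"], intro conjI ballI)
  show "w + v:full E" "star (w + v):full E" using w v E.full_closed(2) by auto
  fix x assume x: "x:A ns"
  show "star (w + v) * (w + v) * (f x + f' x) = f x + f' x"
   "(f x + f' x) * (star (w + v) * (w + v)) = f x + f' x"
   unfolding ww using u(6,7,13,14)[OF x] ff[OF x] by (simp_all add: algebra_simps)
  show "g x + g' x = (w + v) * (f x + f' x) * star (w + v)"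
   using w(4)[OF x] v(4)[OF x] wf'[OF x] by (simp add: algebra_simps)
 qed
qed

text \<open>Homomorphisms out of a matrix algebra are determined up to equivalence by their restrictions to the
 corners \<open>E \<otimes> e\<^sub>0\<^sub>0\<close>: conjugate the partial isometries on the corners by matrix units and add them up.\<close>

lemma sim_of_corners:
 assumes f: "hom ns f" and g: "hom ns g"
  and corner: "!!t. t < length ns ==> 0 < ns ! t ==> sim ((%a. sgl t 0 0 a) ` E) f g"
 shows "sim (A ns) f g"
proof -
 define e where "e t i j = sgl t i j (id_blinfun :: 'h \<Rightarrow>\<^sub>L 'h)" for t i j
 have eA: "e t i j:A ns" if "pos_in ns t i" "pos_in ns t j" for t i j
  using that by (auto simp: e_def intro: E.sgl_mats E.one)
 hence eC: "e t i j:C ns" if "pos_in ns t i" "pos_in ns t j" for t i j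
  using that A_sub_C by blast
 have ee: "e t i j * e t' i' j' = (if t = t' & j = i' then e t i j' else 0)" for t i j t' i' j'
  by (simp add: e_def sgl_mult clin_intros)
 have se: "star (e t i j) = e t j i" for t i j
  by (simp add: e_def star_sgl clin_intros op_adj_id)
 define Q where "Q t u \<longleftrightarrow> u:full E & star u:full E & (ALL a:E. star u * u * f (sgl t 0 0 a) = f (sgl t 0 0 a) \<and>
   f (sgl t 0 0 a) * (star u * u) = f (sgl t 0 0 a) & g (sgl t 0 0 a) = u * f (sgl t 0 0 a) * star u)" for t u
 have "EX u. t < length ns --> 0 < ns ! t --> Q t u" for t
  using corner[of t] unfolding sim_def Q_def by fastforce
 then obtain u where uQ: "!!t. t < length ns ==> 0 < ns ! t ==> Q t (u t)" by metis
 have u: "t < length ns ==> 0 < ns ! t ==> u t:full E"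
  "t < length ns ==> 0 < ns ! t ==> star (u t):full E"
  "t < length ns ==> 0 < ns ! t ==> a:E ==> star (u t) * u t * f (sgl t 0 0 a) = f (sgl t 0 0 a)"
  "t < length ns ==> 0 < ns ! t ==> a:E ==> f (sgl t 0 0 a) * (star (u t) * u t) = f (sgl t 0 0 a)"
  "t < length ns ==> 0 < ns ! t ==> a:E ==> g (sgl t 0 0 a) = u t * f (sgl t 0 0 a) * star (u t)"
  for t a using uQ[of t] by (auto simp: Q_def)
 let ?J = "positions ns"
 have J: "t < length ns" "0 < ns ! t" "pos_in ns t 0" "pos_in ns t j" if "(t, j):?J" for t j
  using that by (auto simp: positions_def)
 note fm = shomD(5)[OF homD(1)[OF f]] and gm = shomD(5)[OF homD(1)[OF g]]
 note fs = shomD(1)[OF homD(1)[OF f]] and gs = shomD(1)[OF homD(1)[OF g]]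
 \<comment> \<open>The corner isometry \<open>u t\<close> is carried to the diagonal position j of
   summand t by the images of matrix units, under g on the left and under f on the right.\<close>
 define w where "w k = g (e (fst k) (snd k) 0) * u (fst k) * f (e (fst k) 0 (snd k))" for k
 have f00: "star (u t) * u t * f (e t 0 0) = f (e t 0 0)" "f (e t 0 0) * (star (u t) * u t) = f (e t 0 0)"
  "g (e t 0 0) = u t * f (e t 0 0) * star (u t)" if "t < length ns" "0 < ns ! t" for t
  using u(3-5)[OF that E.one] by (simp_all add: e_def)
 have f00a: "star (u t) * (u t * (f (e t 0 0) * z)) = f (e t 0 0) * z"
  "f (e t 0 0) * (star (u t) * (u t * z)) = f (e t 0 0) * z"
  if "t < length ns" "0 < ns ! t" for t z
  using arg_cong[OF f00(1)[OF that], of "%y. y * z"] arg_cong[OF f00(2)[OF that], of "%y. y * z"]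
  by (simp_all add: mult.assoc)
 have sw: "star (w k) = f (e (fst k) (snd k) 0) * star (u (fst k)) * g (e (fst k) 0 (snd k))" if "k:?J" for k
  using J[of "fst k" "snd k"] that eC by (simp add: w_def mult.assoc se flip: fs gs)
 have f0: "f 0 = 0" "g 0 = 0"
  using shomD(7)[OF homD(1)[OF f] CE.mats_closed(1)] shomD(7)[OF homD(1)[OF g] CE.mats_closed(1)] by auto
 have sww: "star (w k) * w l = (if k = l then f (e (fst k) (snd k) (snd k)) else 0)" if "k:?J" "l:?J" for k l
 proof -
  obtain t i t' j where k: "k = (t, i)" "l = (t', j)" by (cases k, cases l)
  note Jk = J[OF that(1)[unfolded k]] J[OF that(2)[unfolded k]]
  have "star (w k) * w l = f (e t i 0) * star (u t) * (g (e t 0 i) * g (e t' j 0)) * u t' * f (e t' 0 j)"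
   unfolding sw[OF that(1)] by (simp add: w_def k mult.assoc)
  also have "g (e t 0 i) * g (e t' j 0) = g (if t = t' & i = j then e t 0 0 else 0)"
   using Jk eC by (simp add: ee flip: gm)
  finally have *: "star (w k) * w l = f (e t i 0) * star (u t) * g (if t = t' & i = j then e t 0 0 else 0) * u t' * f (e t' 0 j)" .
  show ?thesis
  proof (cases "k = l")
   case True
   hence "star (w k) * w l = f (e t i 0) * (f (e t 0 0) * f (e t 0 i))"
    using * Jk f00(3) f00a by (simp add: k mult.assoc)
   also have "... = f (e t i 0 * (e t 0 0 * e t 0 i))" using Jk eC CE.mats_closed(4) by (simp add: fm)
   finally show ?thesis using True by (simp add: ee k)
  next
   case False
   thus ?thesis using * f0 by (auto simp: k)
  qed
 qed
 have wsw: "w k * star (w l) = (if k = l then g (e (fst k) (snd k) (snd k)) else 0)" if "k:?J" "l:?J" for k l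
 proof -
  obtain t i t' j where k: "k = (t, i)" "l = (t', j)" by (cases k, cases l)
  note Jk = J[OF that(1)[unfolded k]] J[OF that(2)[unfolded k]]
  have "w k * star (w l) = g (e t i 0) * u t * (f (e t 0 i) * f (e t' j 0)) * star (u t') * g (e t' 0 j)"
   unfolding sw[OF that(2)] by (simp add: w_def k mult.assoc)
  also have "f (e t 0 i) * f (e t' j 0) = f (if t = t' & i = j then e t 0 0 else 0)"
   using Jk eC by (simp add: ee flip: fm)
  finally have *: "w k * star (w l) = g (e t i 0) * u t * f (if t = t' & i = j then e t 0 0 else 0) * star (u t') * g (e t' 0 j)" .
  show ?thesis
  proof (cases "k = l")
   case True
   hence "w k * star (w l) = g (e t i 0) * g (e t 0 0) * g (e t 0 i)"
    using * Jk f00 by (simp add: k mult.assoc)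
   also have "... = g (e t i 0 * e t 0 0 * e t 0 i)" using Jk eC CE.mats_closed(4) by (simp add: gm)
   finally show ?thesis using True by (simp add: ee k)
  next
   case False
   thus ?thesis using * f0 by (auto simp: k)
  qed
 qed
 define W where "W = (\<Sum>k\<in>?J. w k)"
 have unit: "unitm ns = (\<Sum>k\<in>?J. e (fst k) (snd k) (snd k))"
  by (simp add: unitm_def pmat_def e_def case_prod_unfold)
 have eJ: "e (fst k) (snd k) (snd k):C ns" "e (fst k) (snd k) 0:A ns" "e (fst k) 0 (snd k):A ns"
  "fst k < length ns" "0 < ns ! fst k" if "k:?J" for k
  using J[of "fst k" "snd k"] that eA eC by simp_all
 have fsum: "f (\<Sum>k\<in>?J. e (fst k) (snd k) (snd k)) = (\<Sum>k\<in>?J. f (e (fst k) (snd k) (snd k)))"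
  by (rule shom_sum[OF homD(1)[OF f] eJ(1)])
 have gsum: "g (\<Sum>k\<in>?J. e (fst k) (snd k) (snd k)) = (\<Sum>k\<in>?J. g (e (fst k) (snd k) (snd k)))"
  by (rule shom_sum[OF homD(1)[OF g] eJ(1)])
 have "star W * W = (\<Sum>k\<in>?J. \<Sum>l\<in>?J. star (w k) * w l)"
  by (simp add: W_def star_sum sum_product)
 also have "... = (\<Sum>k\<in>?J. \<Sum>l\<in>?J. if k = l then f (e (fst k) (snd k) (snd k)) else 0)"
  by (intro sum.cong refl) (rule sww)
 also have "... = f (unitm ns)" by (simp add: unit fsum)
 finally have WW: "star W * W = f (unitm ns)" .
 have "W * star W = (\<Sum>k\<in>?J. \<Sum>l\<in>?J. w k * star (w l))"
  by (simp add: W_def star_sum sum_product)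
 also have "... = (\<Sum>k\<in>?J. \<Sum>l\<in>?J. if k = l then g (e (fst k) (snd k) (snd k)) else 0)"
  by (intro sum.cong refl) (rule wsw)
 also have "... = g (unitm ns)" by (simp add: unit gsum)
 finally have WW': "W * star W = g (unitm ns)" .
 \<comment> \<open>The two support projections of W are now the images of the unit, so it remains to
   see that W intertwines f and g. For an elementary matrix exactly one summand of W survives on
   either side, and the two terms agree by the relation on the corner.\<close>
 have inter: "g x * W = W * f x" if "x:A ns" for x
  using that
 proof (induction x rule: E.mats_induct)
  case (sgl t i j a)
  have aC: "sgl t i' j' a:C ns" if "pos_in ns t i'" "pos_in ns t j'" for i' j'
   using sgl(1) E_sub_CE that CE.sgl_mats by blast
  have ea: "e t' i' j' * sgl t i j a = (if t = t' & j' = i then sgl t i' j a else 0)" for t' i' j' i j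
   using E.clin[OF sgl(1)] by (auto simp: e_def sgl_mult clin_intros)
  have ae: "sgl t i j a * e t' i' j' = (if t = t' & j = i' then sgl t i j' a else 0)" for t' i' j' i j
   using E.clin[OF sgl(1)] by (auto simp: e_def sgl_mult clin_intros)
  have pos: "pos_in ns t 0" "0 < ns ! t" "t < length ns" using sgl by auto
  have "W * f (sgl t i j a) = (\<Sum>k\<in>?J. if k = (t, i) then g (e t i 0) * u t * f (sgl t 0 j a) else 0)"
   unfolding W_def sum_distrib_right
  proof (rule sum.cong[OF refl])
   fix k assume kJ: "k:?J"
   obtain t' i' where k: "k = (t', i')" by (cases k)
   have "w k * f (sgl t i j a) = g (e t' i' 0) * u t' * f (e t' 0 i' * sgl t i j a)"
    using J[OF kJ[unfolded k]] eC aC sgl by (simp add: w_def k fm mult.assoc)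
   thus "w k * f (sgl t i j a) = (if k = (t, i) then g (e t i 0) * u t * f (sgl t 0 j a) else 0)"
    by (auto simp: ea k f0)
  qed
  also have "... = g (e t i 0) * u t * f (sgl t 0 j a)"
   using sgl by (simp add: sum.delta)
  finally have 1: "W * f (sgl t i j a) = g (e t i 0) * u t * f (sgl t 0 j a)" .
  have "g (sgl t i j a) * W = (\<Sum>k\<in>?J. if k = (t, j) then g (sgl t i 0 a) * u t * f (e t 0 j) else 0)"
   unfolding W_def sum_distrib_left
  proof (rule sum.cong[OF refl])
   fix k assume kJ: "k:?J"
   obtain t' i' where k: "k = (t', i')" by (cases k)
   have "g (sgl t i j a) * w k = g (sgl t i j a * e t' i' 0) * u t' * f (e t' 0 i')"
    using J[OF kJ[unfolded k]] eC aC sgl by (simp add: w_def k gm mult.assoc)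
   thus "g (sgl t i j a) * w k = (if k = (t, j) then g (sgl t i 0 a) * u t * f (e t 0 j) else 0)"
    by (auto simp: ae k f0)
  qed
  also have "... = g (sgl t i 0 a) * u t * f (e t 0 j)"
   using sgl by (simp add: sum.delta)
  also have "g (sgl t i 0 a) = g (e t i 0) * g (sgl t 0 0 a)"
   using aC eC pos sgl by (simp add: ea flip: gm)
  also have "g (e t i 0) * g (sgl t 0 0 a) * u t * f (e t 0 j)
    = g (e t i 0) * u t * (f (sgl t 0 0 a) * (star (u t) * u t)) * f (e t 0 j)"
   using u(5)[OF pos(3,2) sgl(1)] by (simp add: mult.assoc)
  also have "... = g (e t i 0) * u t * (f (sgl t 0 0 a) * f (e t 0 j))"
   using u(4)[OF pos(3,2) sgl(1)] by (simp add: mult.assoc)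
  also have "f (sgl t 0 0 a) * f (e t 0 j) = f (sgl t 0 j a)"
   using aC eC pos sgl by (simp add: ae flip: fm)
  finally show ?case using 1 by simp
 next
  case zero
  thus ?case by (simp add: f0)
 next
  case (add x y)
  hence "x:C ns" "y:C ns" using A_sub_C by auto
  thus ?case using add shomD(4)[OF homD(1)[OF f]] shomD(4)[OF homD(1)[OF g]] by (simp add: algebra_simps)
 qed
 show ?thesis unfolding sim_def
 proof (rule bexI[of _ W], intro conjI ballI)
  show "W:full E" unfolding W_def w_def
   by (intro E.full_sum E.full_closed(4) u(1) homD(3)[OF f] homD(3)[OF g] eJ)
  have "star W = (\<Sum>k\<in>?J. f (e (fst k) (snd k) 0) * star (u (fst k)) * g (e (fst k) 0 (snd k)))"
   unfolding W_def star_sum by (rule sum.cong[OF refl sw])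
  thus "star W:full E"
   by (simp only:) (intro E.full_sum E.full_closed(4) u(2) homD(3)[OF f] homD(3)[OF g] eJ)
  fix x assume x: "x:A ns"
  show "star W * W * f x = f x" "f x * (star W * W) = f x"
   unfolding WW using hom_unit(6,7)[OF f x] by auto
  have "W * f x * star W = g x * (W * star W)" by (simp add: inter[OF x, symmetric] mult.assoc)
  thus "g x = W * f x * star W" unfolding WW' using hom_unit(7)[OF g x] by simp
 qed
qed

end

section \<open>Translation of the operations on elements\<close>

definition mlift :: "('h elt => 'h elt) => 'h mat => 'h::complex_hilbert mat" where
 "mlift ph x = Abs_mat (ph (ent x))"

definition elift :: "('h mat => 'h mat) => 'h elt => 'h::complex_hilbert elt" where
 "elift f y = ent (f (Abs_mat y))"

lemma elift_ent [simp]: "elift f (ent x) = ent (f x)"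
 by (simp add: elift_def ent_inverse)

lemma mk_alg_simps [simp]:
 "alg (mk_alg X Y) = X" "cstar (mk_alg X Y) = Y"
 "zeroA (mk_alg X Y) = ent 0"
 "addA (mk_alg X Y) (ent x) (ent y) = ent (x + y)"
 "mulA (mk_alg X Y) (ent x) (ent y) = ent (x * y)"
 "scaleA (mk_alg X Y) c (ent x) = ent (cscale c x)"
 "starA (mk_alg X Y) (ent x) = ent (star x)"
 "normA (mk_alg X Y) (ent x) = norm x"
 "subA (mk_alg X Y) (ent x) (ent y) = ent (x - y)"
proof -
 show 1: "addA (mk_alg X Y) (ent x) (ent y) = ent (x + y)" "scaleA (mk_alg X Y) c (ent x) = ent (cscale c x)" for x y c
  by (simp_all add: mk_alg_def plus_mat.rep_eq cscale.rep_eq)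
 show "subA (mk_alg X Y) (ent x) (ent y) = ent (x - y)"
  by (simp only: subA_def 1 cscale_minus_one add_uminus_conv_diff)
qed (simp_all add: mk_alg_def zero_mat.rep_eq times_mat.rep_eq star.rep_eq elt_norm_ent)

lemma star_hom_elift:
 assumes "!!x. x:S ==> f x:T" "shom S f"
 shows "star_hom (mk_alg X (ent ` S)) (mk_alg Y (ent ` T)) (elift f)"
 unfolding star_hom_def using assms(1) shomD[OF assms(2)] by auto

lemma star_hom_cong:
 assumes "star_hom (mk_alg X (ent ` S)) (mk_alg Y (ent ` T)) \<pi>"
 shows "shom S (mlift \<pi>)" "x:S ==> \<pi> (ent x) = ent (mlift \<pi> x)" "x:S ==> mlift \<pi> x:T"
proof -
 have *: "\<pi> (ent x) = ent (mlift \<pi> x) & mlift \<pi> x:T" if "x:S" for x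
  using assms that unfolding star_hom_def mlift_def by (fastforce simp: ent_inverse)
 thus "x:S ==> \<pi> (ent x) = ent (mlift \<pi> x)" "x:S ==> mlift \<pi> x:T" by blast+
 show "shom S (mlift \<pi>)" unfolding shom_def
 proof (intro ballI conjI allI)
  fix x assume x: "x:S"
  have a: "\<pi> (starA (mk_alg X (ent ` S)) (ent x)) = starA (mk_alg Y (ent ` T)) (\<pi> (ent x))"
   "\<pi> (scaleA (mk_alg X (ent ` S)) c (ent x)) = scaleA (mk_alg Y (ent ` T)) c (\<pi> (ent x))" for c
   using assms x unfolding star_hom_def by (simp_all del: mk_alg_simps(3-9))
  show "mlift \<pi> (star x) = star (mlift \<pi> x)" "mlift \<pi> (cscale c x) = cscale c (mlift \<pi> x)" for c
   using a *[OF x] by (simp_all add: mlift_def[of _ "star x"] mlift_def[of _ "cscale c x"] ent_inverse)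
  fix y assume y: "y:S"
  have b: "\<pi> (addA (mk_alg X (ent ` S)) (ent x) (ent y)) = addA (mk_alg Y (ent ` T)) (\<pi> (ent x)) (\<pi> (ent y))"
   "\<pi> (mulA (mk_alg X (ent ` S)) (ent x) (ent y)) = mulA (mk_alg Y (ent ` T)) (\<pi> (ent x)) (\<pi> (ent y))"
   using assms x y unfolding star_hom_def by (simp_all del: mk_alg_simps(3-9))
  show "mlift \<pi> (x + y) = mlift \<pi> x + mlift \<pi> y" "mlift \<pi> (x * y) = mlift \<pi> x * mlift \<pi> y"
   using b *[OF x] *[OF y] by (simp_all add: mlift_def[of _ "x + y"] mlift_def[of _ "x * y"] ent_inverse)
 qed
qed

text \<open>The isometries that identify \<open>B \<otimes> M\<^sub>N\<close> with \<open>N \<times> N\<close> blocks over \<open>B\<close>.\<close>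

definition shift :: "nat list => nat => 'h::complex_hilbert mat" where
 "shift ns b = pmat (positions ns) (%s i. b * ns ! s + i)"

lemma valid_sizesD: "valid_sizes ns ==> s < length ns ==> 0 < ns ! s"
 by (simp add: valid_sizes_def)

lemma nth_tensor [simp]: "s < length ns ==> ts N ns ! s = N * ns ! s"
 by (simp add: tensor_sizes_def)

lemma ent_star_shift_times:
 "ent (star (shift ns b) * x) s i j = (if pos_in ns s i then ent x s (b * ns ! s + i) j else 0)"
 by (auto simp: shift_def ent_star_pmat_times)

lemma ent_times_shift:
 "ent (x * shift ns b) s i j = (if pos_in ns s j then ent x s i (b * ns ! s + j) else 0)"
 by (auto simp: shift_def ent_times_pmat)

lemma ent_shift_times:
 assumes "valid_sizes ns"
 shows "ent (shift ns b * x) s i j =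
  (if s < length ns & i div ns ! s = b then ent x s (i mod ns ! s) j else 0)"
proof (cases "s < length ns")
 case True
 have pos: "0 < ns ! s" using valid_sizesD[OF assms True] .
 have eq: "ent (shift ns b) s i l = (if l < ns ! s & i = b * ns ! s + l then id_blinfun else 0)" for l
  using True by (simp add: shift_def ent_pmat)
 have *: "l < ns ! s & i = b * ns ! s + l \<longleftrightarrow> i div ns ! s = b & l = i mod ns ! s" for l
 proof
  assume "l < ns ! s & i = b * ns ! s + l"
  thus "i div ns ! s = b & l = i mod ns ! s" by (simp add: add.commute[of _ l])
 next
  assume "i div ns ! s = b & l = i mod ns ! s"
  thus "l < ns ! s & i = b * ns ! s + l" using pos div_mult_mod_eq[of i "ns ! s"] by auto
 qed
 have "ent (shift ns b * x) s i j = ent (shift ns b) s i (i mod ns ! s) o\<^sub>L ent x s (i mod ns ! s) j"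
  by (rule ent_times_single) (auto simp: eq *)
 thus ?thesis using True by (simp add: eq *)
next
 case False
 thus ?thesis by (subst ent_times_zero) (auto simp: shift_def ent_pmat)
qed

lemma ent_times_star_shift:
 assumes "valid_sizes ns"
 shows "ent (x * star (shift ns b)) s i j =
  (if s < length ns & j div ns ! s = b then ent x s i (j mod ns ! s) else 0)"
proof -
 have "x * star (shift ns b) = star (shift ns b * star x)" by simp
 hence "ent (x * star (shift ns b)) s i j = op_adj (ent (shift ns b * star x) s j i)"
  by (simp only: ent_star)
 thus ?thesis by (simp add: ent_shift_times[OF assms] op_adj_op_adj op_adj_zero)
qed

lemma shift_unitm: "shift ns c * unitm ns = shift ns c" "unitm ns * star (shift ns c) = star (shift ns c)"
proof -
 show 1: "shift ns c * unitm ns = shift ns c"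
  by (rule mat_eqI) (auto simp: ent_times_unitm shift_def ent_pmat)
 thus "unitm ns * star (shift ns c) = star (shift ns c)"
  using arg_cong[OF 1, of star] by simp
qed

lemma star_shift_shift:
 assumes "valid_sizes ns"
 shows "star (shift ns b) * shift ns c = (if b = c then unitm ns else 0)"
proof (rule mat_eqI)
 fix s i j
 have d: "(b * n + i) div n = b" "(b * n + i) mod n = i" if "i < n" for n :: nat
  using that by (simp_all add: add.commute[of _ i])
 have "star (shift ns b) * shift ns c = star (shift ns b) * (shift ns c * unitm ns)"
  by (simp only: shift_unitm)
 thus "ent (star (shift ns b) * shift ns c) s i j = ent (if b = c then unitm ns else 0) s i j"
  by (rule ssubst) (auto simp: ent_star_shift_times ent_shift_times[OF assms] d ent_unitm)
qed

lemma shift_0: "shift ns 0 = unitm ns" by (simp add: shift_def unitm_def)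

lemma sum_shift_star_shift:
 assumes "valid_sizes ns"
 shows "(\<Sum>b<N. shift ns b * star (shift ns b)) = unitm (ts N ns)"
proof (rule mat_eqI)
 fix s i j
 have validS: "s < length ns ==> 0 < ns ! s" by (rule valid_sizesD[OF assms])
 have "ent (shift ns b * star (shift ns b) :: 'a mat) s i j = (if b = i div ns ! s then
   (if s < length ns & i = j then id_blinfun else 0) else 0)" for b
 proof -
  have "(shift ns b * star (shift ns b) :: 'a mat) = shift ns b * (unitm ns * star (shift ns b))" by (simp only: shift_unitm)
  from this have "ent (shift ns b * star (shift ns b) :: 'a mat) s i j = (if s < length ns & i div ns ! s = b & j div ns ! s = b
    & i mod ns ! s = j mod ns ! s then id_blinfun else 0)"
   by (rule ssubst)
    (use validS in \<open>auto simp: ent_shift_times[OF assms] ent_times_star_shift[OF assms] ent_unitm\<close>)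
  moreover have "i div ns ! s = j div ns ! s & i mod ns ! s = j mod ns ! s \<longleftrightarrow> i = j"
   by (metis div_mult_mod_eq)
  ultimately show ?thesis by auto
 qed
 hence "ent (\<Sum>b<N. shift ns b * star (shift ns b)) s i j =
   (if i div ns ! s < N & s < length ns & i = j then id_blinfun else (0 :: 'a \<Rightarrow>\<^sub>L 'a))"
  by (auto simp: ent_sum)
 also have "... = (ent (unitm (ts N ns)) s i j :: 'a \<Rightarrow>\<^sub>L 'a)"
  using valid_sizesD[OF assms, of s]
  by (auto simp: ent_unitm pos_in_tensor div_less_iff_less_mult)
 finally show "ent (\<Sum>b<N. shift ns b * star (shift ns b)) s i j = (ent (unitm (ts N ns)) s i j :: 'a \<Rightarrow>\<^sub>L 'a)" .
qed

lemma (in opr) shift_full: "shift ns b:full K" "star (shift ns b):full K"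
 by (simp_all add: shift_def pmat_full)

context fin_acting
begin

lemma elem_eq: "elem E ns = mk_alg (ent ` A ns) (ent ` C ns)"
 by (simp add: elem_def E.entries_in_eq CE.entries_in_eq)

lemma elem_simps:
 "alg (elem E ns) = ent ` A ns" "cstar (elem E ns) = ent ` C ns"
 "mulA (elem E ns) (ent x) (ent y) = ent (x * y)" "starA (elem E ns) (ent x) = ent (star x)"
 by (simp_all add: elem_eq)

lemma Union_mats_tensor:
 assumes "valid_sizes ns"
 shows "(\<Union>N. mats K (ts N ns)) = upto K (length ns)"
proof
 show "(\<Union>N. mats K (ts N ns)) <= upto K (length ns)"
  using mats_upto[of _ K "ts _ ns"] by auto
 show "upto K (length ns) <= (\<Union>N. mats K (ts N ns))"
  using upto_tensor[OF _ assms] by blast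
qed

lemma stab_eq:
 assumes "valid_sizes ns"
 shows "stab E ns = mk_alg (ent ` upto E (length ns)) (ent ` upto CE (length ns))"
 by (simp add: stab_def elem_eq image_UN[symmetric] Union_mats_tensor[OF assms])

text \<open>It links maps on entry functions with maps on matrices: f is the star-extension on all
  of \<open>C ns\<close>, and \<open>ph\<close> agrees with it where a map has meaningful
  values.\<close>

definition rep_by :: "nat list => ('h mat => 'h mat) => ('h elt => 'h elt) => bool" where
 "rep_by ns f ph \<longleftrightarrow> hom ns f & (ALL x:A ns. ph (ent x) = ent (f x))"

lemma star_extendible_iff:
 "star_extendible (elem E ns) (elem E ms) ph \<longleftrightarrow> (EX f. rep_by ns f ph & f ` A ns <= A ms)"
proof
 assume "star_extendible (elem E ns) (elem E ms) ph"
 then obtain \<pi> where \<pi>: "star_hom (elem E ns) (elem E ms) \<pi>" "!!x. x:A ns ==> ph (ent x) = \<pi> (ent x)"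
  and ph: "ph ` ent ` A ns <= ent ` A ms"
  by (auto simp: star_extendible_def extends_to_def elem_eq)
 note h = star_hom_cong[OF \<pi>(1)[unfolded elem_eq]]
 have eq: "ph (ent x) = ent (mlift \<pi> x)" if "x:A ns" for x
  using \<pi>(2)[OF that] h(2)[of x] A_sub_C that by auto
 have "mlift \<pi> x:A ms" if "x:A ns" for x
 proof -
  have "ent (mlift \<pi> x):ent ` A ms" unfolding eq[OF that, symmetric] using ph that by blast
  thus ?thesis by (auto simp: ent_inject)
 qed
 moreover from this have "hom ns (mlift \<pi>)"
  using h(1,3) mats_full unfolding hom_def by fastforce
 ultimately show "EX f. rep_by ns f ph & f ` A ns <= A ms"
  using eq unfolding rep_by_def by blast
next
 assume "EX f. rep_by ns f ph & f ` A ns <= A ms"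
 then obtain f where f: "hom ns f" "!!x. x:A ns ==> ph (ent x) = ent (f x)" "f ` A ns <= A ms"
  unfolding rep_by_def by blast
 have "star_hom (elem E ns) (elem E ms) (elift f)"
  unfolding elem_eq by (rule star_hom_elift) (use hom_range[OF f(1,3)] homD(1)[OF f(1)] in auto)
 thus "star_extendible (elem E ns) (elem E ms) ph"
  unfolding star_extendible_def extends_to_def elem_eq
  using f(2,3) by (auto intro!: exI[of _ "elift f"])
qed

section \<open>Unitary equivalence\<close>

text \<open>The initial and final projections of the partial isometry are images of the unit, hence
  in \<open>A ms\<close>; so the partial isometry and its adjoint lie there too. The elements with
  this property form a finite-dimensional star algebra, in which it extends to a unitary.\<close>

lemma sim_unitary:
 assumes f: "hom ks f" "f ` A ks <= A ms" and g: "g ` A ks <= A ms" and s: "sim (A ks) f g"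
 shows "EX U:A ms. star U:A ms & star U * U = unitm ms & U * star U = unitm ms \<and>
  (ALL x:A ks. g x = U * f x * star U)"
proof -
 let ?u = "unitm ks"
 obtain w where w: "w:full E" "star w:full E" "star w * w = f ?u"
  "!!x. x:A ks ==> g x = w * f x * star w" "w * f ?u = w"
  using sim_hom_partial_isometry[OF f(1) s] by metis
 have u: "f ?u:A ms" "g ?u:A ms" using f(2) g E.unitm_in by blast+
 have gu: "g ?u = w * star w" using w(4)[OF E.unitm_in] w(5) by simp
 have www: "w * star w * w = w" using w(3,5) by (simp add: mult.assoc)
 have l: "unitm ms * w = w"
 proof -
  have "unitm ms * w = unitm ms * g ?u * w" using www gu by (simp add: mult.assoc)
  thus ?thesis using unitm_mats(1)[OF u(2)] www gu by simp
 qed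
 have r: "w * unitm ms = w"
 proof -
  have "w * unitm ms = w * (f ?u * unitm ms)" using w(5) by (simp add: mult.assoc[symmetric])
  thus ?thesis using unitm_mats(2)[OF u(1)] w(5) by simp
 qed
 have wA: "w:A ms" unfolding mats_iff using w(1) l r by blast
 have swA: "star w:A ms" unfolding mats_iff
  using w(2) arg_cong[OF l, of star] arg_cong[OF r, of star] by simp
 define D where "D = {x:A ms. star x:A ms}"
 have "subspace D" by (simp add: subspace_def D_def E.mats_closed)
 hence "fin_dim D" by (rule fin_dim_subspace[OF fin_dim_A, rotated]) (auto simp: D_def)
 hence D: "star_alg D" unfolding star_alg_def by (auto simp: D_def E.mats_closed(4))
 have uD: "unitm ms:D" by (simp add: D_def E.unitm_in)
 have "EX U:D. star U * U = unitm ms & U * star U = unitm ms & U * (star w * w) = w"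
  by (rule partial_isometry_extends[OF D uD]) (use wA swA www in \<open>auto simp: D_def\<close>)
 then obtain U where U: "U:D" "star U * U = unitm ms" "U * star U = unitm ms" "U * f ?u = w"
  unfolding w(3) by blast
 have "g x = U * f x * star U" if "x:A ks" for x
 proof -
  have "g x = U * (f ?u * f x * f ?u) * star U"
   using w(4)[OF that] hom_unit(2)[OF f(1)] unfolding U(4)[symmetric] by (simp add: mult.assoc)
  thus ?thesis using hom_unit(6,7)[OF f(1) that] by simp
 qed
 thus ?thesis using U by (auto simp: D_def)
qed

lemma is_unit_elem: "is_unit (elem E ms) e \<longleftrightarrow> e = ent (unitm ms)"
proof
 assume "is_unit (elem E ms) e"
 then obtain y where y: "e = ent y" "y:A ms" "!!x. x:A ms ==> ent (y * x) = ent x"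
  by (auto simp: is_unit_def elem_eq)
 have "y = y * unitm ms" using unitm_mats(2)[OF y(2)] by simp
 also have "... = unitm ms" using y(3)[OF E.unitm_in] by (simp add: ent_inject)
 finally show "e = ent (unitm ms)" using y(1) by simp
next
 assume "e = ent (unitm ms)"
 thus "is_unit (elem E ms) e"
  using E.unitm_in by (auto simp: is_unit_def elem_eq)
qed

lemma inner_unitarily_equivalent_elem:
 assumes f: "rep_by ks f ph" "f ` A ks <= A ms" and g: "rep_by ks g ps" "g ` A ks <= A ms"
 shows "inner_unitarily_equivalent (elem E ks) (elem E ms) ps ph \<longleftrightarrow> sim (A ks) f g"
proof -
 have f': "hom ks f" "!!x. x:A ks ==> ph (ent x) = ent (f x)"
  and g': "hom ks g" "!!x. x:A ks ==> ps (ent x) = ent (g x)"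
  using f g by (auto simp: rep_by_def)
 have "inner_unitarily_equivalent (elem E ks) (elem E ms) ps ph \<longleftrightarrow>
   (EX U:A ms. U * star U = unitm ms & star U * U = unitm ms & (ALL x:A ks. g x = U * (f x * star U)))"
  by (simp add: inner_unitarily_equivalent_def elem_simps is_unit_elem ent_inject f'(2) g'(2))
 also have "... \<longleftrightarrow> sim (A ks) f g"
 proof
  assume "EX U:A ms. U * star U = unitm ms & star U * U = unitm ms & (ALL x:A ks. g x = U * (f x * star U))"
  then obtain U where U: "U:A ms" "U * star U = unitm ms" "star U * U = unitm ms"
   "!!x. x:A ks ==> g x = U * (f x * star U)" by blast
  \<comment> \<open>In a finite-dimensional algebra the inverse of \<open>U\<close> lies in the algebra.\<close>
  have "((*) U) ` A ms = A ms"
  proof (rule fin_dim_injective_surjective[OF fin_dim_A])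
   show "linear ((*) U)" by (intro linearI) (auto simp: algebra_simps)
   show "(*) U ` A ms <= A ms" using U(1) E.mats_closed(4) by auto
   fix x assume x: "x:A ms" "U * x = 0"
   have "x = star U * U * x" using U(3) unitm_mats(1)[OF x(1)] by simp
   thus "x = 0" using x(2) by (simp add: mult.assoc)
  qed
  then obtain x where x: "x:A ms" "unitm ms = U * x" using E.unitm_in by blast
  have "star U * unitm ms = star U" using arg_cong[OF unitm_mats(1)[OF U(1)], of star] by simp
  hence "star U = star U * U * x" using x(2) by (simp add: mult.assoc)
  hence "star U = x" using U(3) unitm_mats(1)[OF x(1)] by simp
  hence "star U:full E" using mats_full x(1) by blast
  thus "sim (A ks) f g" unfolding sim_def
  proof (intro bexI[of _ U] conjI ballI)
   fix y assume y: "y:A ks"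
   hence "f y:A ms" using f(2) by blast
   thus "star U * U * f y = f y" "f y * (star U * U) = f y" by (simp_all add: U(3))
   show "g y = U * f y * star U" using U(4)[OF y] by (simp add: mult.assoc)
  qed (use mats_full U(1) in auto)
 next
  assume "sim (A ks) f g"
  from sim_unitary[OF f'(1) f(2) g(2) this]
  show "EX U:A ms. U * star U = unitm ms & star U * U = unitm ms & (ALL x:A ks. g x = U * (f x * star U))"
   by (simp add: mult.assoc) (elim bexE conjE, rule bexI, simp_all)
 qed
 finally show ?thesis .
qed

text \<open>The image of the unit has finite support, and it cuts out the whole range.\<close>

lemma hom_into_mats:
 assumes f: "hom ks f" "f ` A ks <= upto E (length ns)" and "valid_sizes ns"
 shows "EX N>0. f ` A ks <= A (ts N ns)"
proof -
 obtain N where N: "N > 0" "f (unitm ks):A (ts N ns)"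
  using upto_tensor[OF _ assms(3)] f(2) E.unitm_in by blast
 have "f x:A (ts N ns)" if "x:A ks" for x
 proof -
  have "f x = f (unitm ks) * f x * f (unitm ks)" using hom_unit(6,7)[OF f(1) that] by simp
  moreover have "f x:full E" using homD(3)[OF f(1) that] .
  ultimately show ?thesis using E.mats_closed(5)[OF N(2) _ N(2)] by metis
 qed
 thus ?thesis using N(1) by blast
qed

lemma image_mats_tensor_mono: "f ` S <= mats K (ts N ns) ==> N <= M ==> f ` S <= mats K (ts M ns)"
 using mats_tensor_mono by blast

text \<open>The unitary now lies in the unitisation, as a scalar c plus an element v. In a size that
  contains v and both ranges it compresses to the unitary \<open>c p + v\<close>, where p is the
  unit of that size; conversely a unitary U of a finite size gives
  \<open>1 + (U - p)\<close>.\<close>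

lemma inner_unitarily_equivalent_stab:
 assumes f: "rep_by ks f ph" "f ` A ks <= upto E (length ns)"
  and g: "rep_by ks g ps" "g ` A ks <= upto E (length ns)"
  and ns: "valid_sizes ns"
 shows "inner_unitarily_equivalent (elem E ks) (stab E ns) ps ph \<longleftrightarrow> sim (A ks) f g"
proof (cases "id_blinfun = (0 :: 'h \<Rightarrow>\<^sub>L 'h)")
 \<comment> \<open>On the zero Hilbert space all elements coincide and even the stabilisation is
   unital, so the other branch of the definition applies.\<close>
 case True
 have T: "T = 0" for T :: "'h \<Rightarrow>\<^sub>L 'h"
  using compose_id(1)[of T] unfolding True by simp
 have elt: "x = y" for x y :: "'h elt" using T by (intro ext) metis
 have mat: "x = y" for x y :: "'h mat" using T by (intro mat_eqI) metis
 have "sim (A ks) f g" unfolding sim_def by (rule bexI[of _ 0]) (use mat E.full_closed(1) in auto)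
 moreover have "inner_unitarily_equivalent (elem E ks) (stab E ns) ps ph"
 proof -
  have z: "ent 0:alg (stab E ns)" by (simp add: stab_eq[OF ns] E.upto_closed(1))
  hence "is_unit (stab E ns) e" for e unfolding is_unit_def using elt by metis
  thus ?thesis unfolding inner_unitarily_equivalent_def using z elt by metis
 qed
 ultimately show ?thesis by simp
next
 case False
 have len: "0 < length ns" using ns by (simp add: valid_sizes_def)
 \<comment> \<open>A unit would have finite support, and the diagonal matrix unit at a position
   beyond that support contradicts it.\<close>
 have no_unit: "~ (EX e. is_unit (stab E ns) e)"
 proof
  assume "EX e. is_unit (stab E ns) e"
  then obtain e where e: "e:upto E (length ns)" "!!x. x:upto E (length ns) ==> e * x = x"
   by (auto simp: is_unit_def stab_eq[OF ns] ent_inject)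
  obtain n where n: "bsup n (ent e)" using ex_bounded by blast
  define x where "x = sgl 0 n n (id_blinfun :: 'h \<Rightarrow>\<^sub>L 'h)"
  have x: "ent x s i j = (if s = 0 & i = n & j = n then id_blinfun else 0)" for s i j
   by (simp add: x_def ent_sgl clin_intros)
  have "x:upto E (length ns)" using len
   by (auto simp: upto_def x) (simp_all add: x_def E.sgl_full E.one)
  hence "e * x = x" by (rule e(2))
  moreover have "ent (e * x) 0 n n = 0"
   by (rule ent_times_zero) (use bsup_ge[OF n] in auto)
  ultimately show False using False by (simp add: x)
 qed
 have f': "hom ks f" "!!x. x:A ks ==> ph (ent x) = ent (f x)"
  and g': "hom ks g" "!!x. x:A ks ==> ps (ent x) = ent (g x)"
  using f g by (auto simp: rep_by_def)
 \<comment> \<open>The two unitarity relations and the conjugation formula of the unitisation,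
   written out for the pair of c and v.\<close>
 let ?P = "%c v. c * cnj c = 1 & cscale c (star v) + cscale (cnj c) v + v * star v = 0
   & cscale (cnj c) v + cscale c (star v) + star v * v = 0 \<and>
   (ALL x:A ks. g x = cscale c (cscale (cnj c) (f x) + f x * star v) + v * (cscale (cnj c) (f x) + f x * star v))"
 have "inner_unitarily_equivalent (elem E ks) (stab E ns) ps ph \<longleftrightarrow>
  (EX c. EX v:upto E (length ns). ?P c v)"
 proof -
  have split: "(EX u::complex \<times> 'h elt. snd u:ent ` S & Q u) \<longleftrightarrow> (EX c. EX v:S. Q (c, ent v))" for S Q
   by auto
  have zs: "scaleA (mk_alg X Y) 0 (ent y) = ent 0" "addA (mk_alg X Y) (ent 0) (ent y) = ent y"
   "addA (mk_alg X Y) (ent y) (ent 0) = ent y" for X Y :: "'h elt set" and y by simp_all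
  show ?thesis
   unfolding inner_unitarily_equivalent_def if_not_P[OF no_unit]
   by (simp add: stab_eq[OF ns] split unit_mul_def unit_star_def ent_inject elem_eq f' g' mult.commute
     del: ex_simps) (simp add: conj_commute conj_left_commute mult.commute cong: conj_cong)
 qed
 also have "... \<longleftrightarrow> sim (A ks) f g"
 proof
  assume "EX c. EX v:upto E (length ns). ?P c v"
  then obtain c v where v: "v:upto E (length ns)" and P: "?P c v" by blast
  obtain N1 where N1: "N1 > 0" "f ` A ks <= A (ts N1 ns)"
   using hom_into_mats[OF f'(1) f(2) ns] by blast
  obtain N2 where N2: "N2 > 0" "g ` A ks <= A (ts N2 ns)"
   using hom_into_mats[OF g'(1) g(2) ns] by blast
  obtain N3 where N3: "N3 > 0" "v:A (ts N3 ns)" using upto_tensor[OF v ns] by blast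
  define N where "N = max N1 (max N2 N3)"
  let ?p = "unitm (ts N ns)"
  have fN: "f x:A (ts N ns)" if "x:A ks" for x
   using image_mats_tensor_mono[OF N1(2), of N] that by (auto simp: N_def)
  have vN: "v:A (ts N ns)"
  proof -
   have "N3 <= N" by (simp add: N_def)
   thus ?thesis using mats_tensor_mono N3(2) by blast
  qed
  have pA: "?p:A (ts N ns)" by (rule E.unitm_in)
  define U where "U = cscale c ?p + v"
  have UA: "U:A (ts N ns)" unfolding U_def using vN pA by (intro E.mats_closed)
  have pv1: "?p * v = v" "v * ?p = v" by (rule unitm_mats[OF vN])+
  have "?p * star v = star (v * ?p)" "star v * ?p = star (?p * v)" by simp_all
  hence pv: "?p * v = v" "v * ?p = v" "?p * star v = star v" "star v * ?p = star v"
   unfolding pv1 by simp_all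
  have "U * star U = cscale (c * cnj c) ?p + (cscale c (star v) + cscale (cnj c) v + v * star v)"
   "star U * U = cscale (c * cnj c) ?p + (cscale (cnj c) v + cscale c (star v) + star v * v)"
   by (simp_all add: U_def algebra_simps pv)
  hence UU: "U * star U = ?p" "star U * U = ?p" using P by simp_all
  have gU: "g x = U * (f x * star U)" if "x:A ks" for x
  proof -
   have "g x = cscale c (cscale (cnj c) (f x) + f x * star v) + v * (cscale (cnj c) (f x) + f x * star v)"
    using P that by blast
   moreover have "f x * star U = cscale (cnj c) (f x) + f x * star v"
    using unitm_mats(2)[OF fN[OF that]] by (simp add: U_def algebra_simps)
   moreover have "?p * (cscale (cnj c) (f x) + f x * star v) = cscale (cnj c) (f x) + f x * star v"
    using unitm_mats(1)[OF fN[OF that]] by (simp add: distrib_left mult.assoc[symmetric])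
   ultimately show ?thesis by (simp add: U_def distrib_right)
  qed
  have 1: "inner_unitarily_equivalent (elem E ks) (elem E (ts N ns)) ps ph"
   unfolding inner_unitarily_equivalent_def is_unit_elem
   by (auto simp: elem_eq f' g' gU intro!: bexI[of _ U] UA) (simp_all add: UU)
  show "sim (A ks) f g"
   by (rule inner_unitarily_equivalent_elem[OF f(1) _ g(1), THEN iffD1, OF _ _ 1])
    (use image_mats_tensor_mono[OF N1(2), of N] image_mats_tensor_mono[OF N2(2), of N] in \<open>auto simp: N_def\<close>)
 next
  assume s: "sim (A ks) f g"
  obtain N1 where N1: "N1 > 0" "f ` A ks <= A (ts N1 ns)"
   using hom_into_mats[OF f'(1) f(2) ns] by blast
  obtain N2 where N2: "N2 > 0" "g ` A ks <= A (ts N2 ns)"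
   using hom_into_mats[OF g'(1) g(2) ns] by blast
  define N where "N = max N1 N2"
  let ?p = "unitm (ts N ns)"
  have fN: "f ` A ks <= A (ts N ns)" and gN: "g ` A ks <= A (ts N ns)"
   using image_mats_tensor_mono[OF N1(2), of N] image_mats_tensor_mono[OF N2(2), of N] by (auto simp: N_def)
  obtain U where U: "U:A (ts N ns)" "star U:A (ts N ns)" "star U * U = ?p" "U * star U = ?p"
   "!!x. x:A ks ==> g x = U * f x * star U"
   using sim_unitary[OF f'(1) fN gN s] by blast
  define v where "v = U - ?p"
  have vA: "v:A (ts N ns)" unfolding v_def using U(1) E.unitm_in by (rule E.mats_closed)
  have v: "v:upto E (length ns)" using mats_upto[OF vA] by simp
  note pU = unitm_mats[OF U(1)] unitm_mats[OF U(2)]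
  have sv: "star v = star U - ?p" by (simp add: v_def)
  have "v * star v = ?p - U - star U + ?p" "star v * v = ?p - star U - U + ?p"
   unfolding sv unfolding v_def left_diff_distrib right_diff_distrib U(3,4) pU by simp_all
  hence 1: "star v + v + v * star v = 0" "v + star v + star v * v = 0"
   unfolding sv unfolding v_def by simp_all
  have 2: "g x = f x + f x * star v + v * (f x + f x * star v)" if "x:A ks" for x
  proof -
   have fx: "f x:A (ts N ns)" using fN that by blast
   have a: "f x + f x * star v = f x * star U"
    unfolding sv right_diff_distrib unitm_mats(2)[OF fx] by simp
   have "?p * (f x * star U) = f x * star U"
    unfolding mult.assoc[symmetric] unitm_mats(1)[OF fx] ..
   thus ?thesis unfolding a U(5)[OF that] by (simp add: v_def left_diff_distrib mult.assoc)
  qed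
  have "?P 1 v" using 1 2 by simp
  thus "EX c. EX v:upto E (length ns). ?P c v" using v by blast
 qed
 finally show ?thesis .
qed

section \<open>Amplifications\<close>

definition chom :: "nat => nat => ('h mat => 'h mat) => bool" where
 "chom r r' g \<longleftrightarrow> shom (upto CE r) g & g ` upto CE r <= upto CE r' \<and>
   g ` upto E r <= upto E r'"

lemma chomD:
 assumes "chom r r' g"
 shows "shom (upto CE r) g" "x:upto CE r ==> g x:upto CE r'"
  "x:upto E r ==> g x:upto E r'"
 using assms unfolding chom_def by auto

lemma C_upto: "x:C ns ==> x:upto CE (length ns)" by (rule mats_upto)

lemma chom_hom:
 assumes "chom r r' g" "length ns = r"
 shows "hom ns g"
 unfolding hom_def
proof (intro conjI)
 show "shom (C ns) g" by (rule shom_subset[OF chomD(1)[OF assms(1)]]) (use mats_upto assms(2) in auto)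
 show "g ` C ns <= full CE" "g ` A ns <= full E"
  using chomD(2,3)[OF assms(1)] mats_upto[of _ _ ns] assms(2) upto_full by (auto, fast+)
qed

definition amp :: "nat list => nat list => ('h mat => 'h mat) => 'h mat => 'h mat" where
 "amp ns ms f x = Abs_mat (amplify ns ms (elift f) (ent x))"

text \<open>The first N times N blocks of an amplification, written as a sum in the matrix algebra.
  On elements of size N it coincides with \<open>amp\<close>, and in this form products and adjoints
  can be computed.\<close>

definition amp_upto :: "nat => nat list => nat list => ('h mat => 'h mat) => 'h mat => 'h mat" where
 "amp_upto N ns ms f x =
   (\<Sum>b<N. \<Sum>c<N. shift ms b * f (star (shift ns b) * x * shift ns c) * star (shift ms c))"

lemma block_ent: "block ns b c (ent x) = ent (star (shift ns b) * x * shift ns c)"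
 by (intro ext) (auto simp: block_def ent_star_shift_times ent_times_shift)

lemma block_mats: "x:upto E (length ns) ==> star (shift ns b) * x * shift ns c:A ns"
 "x:upto CE (length ns) ==> star (shift ns b) * x * shift ns c:C ns"
proof -
 have *: "ent (star (shift ns b) * x * shift ns c) s i j ~= 0 --> pos_in ns s i & pos_in ns s j" for s i j
  by (auto simp: ent_star_shift_times ent_times_shift)
 assume "x:upto E (length ns)"
 hence "star (shift ns b) * x * shift ns c:full E"
  by (intro E.full_closed(4) E.shift_full upto_full)
 thus "star (shift ns b) * x * shift ns c:A ns" using * by (simp add: mats_def)
next
 have *: "ent (star (shift ns b) * x * shift ns c) s i j ~= 0 --> pos_in ns s i & pos_in ns s j" for s i j
  by (auto simp: ent_star_shift_times ent_times_shift)
 assume "x:upto CE (length ns)"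
 hence "star (shift ns b) * x * shift ns c:full CE"
  by (intro CE.full_closed(4) CE.shift_full upto_full)
 thus "star (shift ns b) * x * shift ns c:C ns" using * by (simp add: mats_def)
qed

lemma ent_amp_upto:
 assumes f: "shom (C ns) f" "f ` C ns <= C ms" and ms: "valid_sizes ms"
  and x: "x:C (ts N ns)"
 shows "ent (amp_upto N ns ms f x) = amplify ns ms (elift f) (ent x)"
proof (intro ext)
 fix s i j
 have xu: "x:upto CE (length ns)" using C_upto[OF x] by simp
 let ?z = "%b c. star (shift ns b) * x * shift ns c"
 have fz: "f (?z b c):C ms" for b c using block_mats(2)[OF xu] f(2) by blast
 have trm: "ent (shift ms b * f (?z b c) * star (shift ms c)) s i j =
   (if c = j div ms ! s then (if b = i div ms ! s then (if s < length ms then ent (f (?z b c)) s (i mod ms ! s) (j mod ms ! s) else 0) else 0) else 0)" for b c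
  by (auto simp: ent_times_star_shift[OF ms] ent_shift_times[OF ms])
 have "ent (amp_upto N ns ms f x) s i j = (if i div ms ! s < N & j div ms ! s < N & s < length ms then
   ent (f (?z (i div ms ! s) (j div ms ! s))) s (i mod ms ! s) (j mod ms ! s) else 0)"
  unfolding amp_upto_def ent_sum trm by (cases "j div ms ! s < N") simp_all
 also have "... = (if s < length ms then ent (f (?z (i div ms ! s) (j div ms ! s))) s (i mod ms ! s) (j mod ms ! s) else 0)"
 proof (cases "i div ms ! s < N & j div ms ! s < N")
  \<comment> \<open>A block of x outside the first N rows or columns of blocks is zero, and f maps
    it to zero.\<close>
  case False
  have "?z (i div ms ! s) (j div ms ! s) = 0"
  proof (rule mat_eqI)
   fix t k l
   show "ent (?z (i div ms ! s) (j div ms ! s)) t k l = ent 0 t k l"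
   proof (rule ccontr)
    assume "ent (?z (i div ms ! s) (j div ms ! s)) t k l ~= ent 0 t k l"
    hence p: "pos_in ns t k" "pos_in ns t l"
     and nz: "ent x t (i div ms ! s * ns ! t + k) (j div ms ! s * ns ! t + l) ~= 0"
     by (auto simp: ent_star_shift_times ent_times_shift split: if_splits)
    have "i div ms ! s * ns ! t + k < N * ns ! t" "j div ms ! s * ns ! t + l < N * ns ! t"
     using nz x unfolding mats_def pos_in_tensor by blast+
    hence "i div ms ! s * ns ! t < N * ns ! t" "j div ms ! s * ns ! t < N * ns ! t" by linarith+
    thus False using False by simp
   qed
  qed
  moreover have "f 0 = 0" by (rule shomD(7)[OF f(1) CE.mats_closed(1)])
  ultimately show ?thesis using False by simp
 qed simp
 also have "... = amplify ns ms (elift f) (ent x) s i j"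
  by (simp add: amplify_def block_ent)
 finally show "ent (amp_upto N ns ms f x) s i j = amplify ns ms (elift f) (ent x) s i j" .
qed

lemma amp_eq_amp_upto:
 assumes "shom (C ns) f" "f ` C ns <= C ms" "valid_sizes ms" "x:C (ts N ns)"
 shows "amp ns ms f x = amp_upto N ns ms f x"
 unfolding amp_def ent_amp_upto[OF assms, symmetric] by (rule ent_inverse)

lemma ent_amp:
 assumes "shom (C ns) f" "f ` C ns <= C ms" "valid_sizes ms" "valid_sizes ns" "x:upto CE (length ns)"
 shows "ent (amp ns ms f x) = amplify ns ms (elift f) (ent x)"
proof -
 obtain N where "x:C (ts N ns)" using upto_tensor[OF assms(5,4)] by blast
 from ent_amp_upto[OF assms(1-3) this] amp_eq_amp_upto[OF assms(1-3) this] show ?thesis by simp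
qed

lemma upto_common:
 assumes "valid_sizes ns" "x:upto K (length ns)" "y:upto K (length ns)"
 shows "EX N. x:mats K (ts N ns) & y:mats K (ts N ns)"
proof -
 obtain N M where "x:mats K (ts N ns)" "y:mats K (ts M ns)"
  using upto_tensor[OF _ assms(1)] assms(2,3) by blast
 thus ?thesis using mats_tensor_mono[of N "max N M" K ns] mats_tensor_mono[of M "max N M" K ns] by auto
qed

lemma shift_mats:
 assumes "y:mats K ms" "b < N" "c < N" "opr K"
 shows "shift ms b * y * star (shift ms c):mats K (ts N ms)"
proof -
 interpret opr K by fact
 have lt: "a * n + k < N * n" if "a < N" "k < n" for a n k :: nat
 proof -
  have "Suc a * n <= N * n" using that by (intro mult_le_mono1) simp
  thus ?thesis using that by simp
 qed
 have l: "unitm (ts N ms) * shift ms a = shift ms a" if "a < N" for a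
  by (rule mat_eqI) (use lt that in \<open>auto simp: ent_unitm_times pos_in_tensor shift_def ent_pmat\<close>)
 have r: "star (shift ms c) * unitm (ts N ms) = star (shift ms c)"
  using arg_cong[OF l[OF assms(3)], of star] by simp
 show ?thesis unfolding mats_iff
 proof (intro conjI)
  show "shift ms b * y * star (shift ms c):full K"
   using mats_full[OF assms(1)] by (intro full_closed shift_full)
  show "unitm (ts N ms) * (shift ms b * y * star (shift ms c)) = shift ms b * y * star (shift ms c)"
   by (simp add: mult.assoc[symmetric] l[OF assms(2)])
  show "shift ms b * y * star (shift ms c) * unitm (ts N ms) = shift ms b * y * star (shift ms c)"
   by (simp add: mult.assoc r)
 qed
qed

lemma amp_mats:
 assumes f: "shom (C ns) f" "f ` C ns <= C ms" "f ` A ns <= A ms" and ms: "valid_sizes ms"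
 shows "x:C (ts N ns) ==> amp ns ms f x:C (ts N ms)"
  "x:A (ts N ns) ==> amp ns ms f x:A (ts N ms)"
proof -
 assume x: "x:C (ts N ns)"
 have xu: "x:upto CE (length ns)" using C_upto[OF x] by simp
 have "shift ms b * f (star (shift ns b) * x * shift ns c) * star (shift ms c):C (ts N ms)" if "b < N" "c < N" for b c
  by (rule shift_mats[OF _ that]) (use f(2) block_mats(2)[OF xu] CE.opr_axioms in auto)
 thus "amp ns ms f x:C (ts N ms)"
  unfolding amp_eq_amp_upto[OF f(1,2) ms x] amp_upto_def
  by (intro subspace_sum star_algD(2)[OF star_alg_C]) auto
next
 assume x: "x:A (ts N ns)"
 hence xC: "x:C (ts N ns)" using A_sub_C by blast
 have xu: "x:upto E (length ns)" using mats_upto[OF x] by simp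
 have "shift ms b * f (star (shift ns b) * x * shift ns c) * star (shift ms c):A (ts N ms)" if "b < N" "c < N" for b c
  by (rule shift_mats[OF _ that]) (use f(3) block_mats(1)[OF xu] E.opr_axioms in auto)
 thus "amp ns ms f x:A (ts N ms)"
  unfolding amp_eq_amp_upto[OF f(1,2) ms xC] amp_upto_def
  by (intro subspace_sum) (use fin_dim_A fin_dim_def in auto)
qed

lemma chom_amp:
 assumes f: "shom (C ns) f" "f ` C ns <= C ms" "f ` A ns <= A ms" and ms: "valid_sizes ms" and ns: "valid_sizes ns"
 shows "chom (length ns) (length ms) (amp ns ms f)"
 unfolding chom_def
proof (intro conjI)
 note amp = amp_eq_amp_upto[OF f(1,2) ms]
 note z = block_mats(2)
 have f0: "f 0 = 0" by (rule shomD(7)[OF f(1) CE.mats_closed(1)])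
 show "shom (upto CE (length ns)) (amp ns ms f)"
  unfolding shom_def
 proof (intro ballI conjI allI)
  fix x assume x: "x:upto CE (length ns)"
  then obtain N where N: "x:C (ts N ns)" using upto_tensor[OF x ns] by blast
  have "star (amp_upto N ns ms f x) =
   (\<Sum>b<N. \<Sum>c<N. shift ms c * star (f (star (shift ns b) * x * shift ns c)) * star (shift ms b))"
   by (simp add: amp_upto_def star_sum mult.assoc)
  also have "... = (\<Sum>c<N. \<Sum>b<N. shift ms c * f (star (shift ns c) * star x * shift ns b) * star (shift ms b))"
  proof -
   have fs: "f (star (shift ns c) * (star x * shift ns b)) = star (f (star (shift ns b) * (x * shift ns c)))" for b c
    using shomD(1)[OF f(1) z[OF x, of b c]] by (simp add: mult.assoc)
   show ?thesis by (subst sum.swap) (simp add: mult.assoc fs)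
  qed
  also have "... = amp_upto N ns ms f (star x)" by (simp add: amp_upto_def)
  finally show "amp ns ms f (star x) = star (amp ns ms f x)"
   by (simp add: amp[OF N] amp[OF star_C[OF N]])
  show "amp ns ms f (cscale c x) = cscale c (amp ns ms f x)" for c
  proof -
   have cs: "cscale c (sum h I) = (\<Sum>k\<in>I. cscale c (h k))" for h :: "nat => 'h mat" and I
    by (induction I rule: infinite_finite_induct) auto
   show ?thesis
    by (simp add: amp[OF N] amp[OF CE.mats_closed(3)[OF N]] amp_upto_def cs shomD(2)[OF f(1) z[OF x]])
  qed
  fix y assume y: "y:upto CE (length ns)"
  obtain N where N: "x:C (ts N ns)" "y:C (ts N ns)"
   using upto_common[OF ns x y] by blast
  show "amp ns ms f (x + y) = amp ns ms f x + amp ns ms f y"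
   by (simp add: amp[OF N(1)] amp[OF N(2)] amp[OF CE.mats_closed(2)[OF N]] amp_upto_def distrib_left distrib_right
     shomD(4)[OF f(1) z[OF x] z[OF y]] sum.distrib)
  define F where "F b c = f (star (shift ns b) * x * shift ns c)" for b c
  define G where "G b c = f (star (shift ns b) * y * shift ns c)" for b c
  have FC: "F b c:C ms" "G b c:C ms" for b c using f(2) z[OF x] z[OF y] by (auto simp: F_def G_def)
  have mid: "shift ms b * F b c * star (shift ms c) * (shift ms d * G d e * star (shift ms e)) =
    (if d = c then shift ms b * (F b c * G c e) * star (shift ms e) else 0)" for b c d e
  proof -
   have "shift ms b * F b c * star (shift ms c) * (shift ms d * G d e * star (shift ms e)) =
    shift ms b * F b c * (star (shift ms c) * shift ms d) * G d e * star (shift ms e)"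
    by (simp add: mult.assoc)
   thus ?thesis
    using unitm_mats(2)[OF FC(1)] by (auto simp: star_shift_shift[OF ms] mult.assoc) (metis mult.assoc)
  qed
  \<comment> \<open>The range projections of the first N shifts add up to the unit of size N, which
    can be inserted between x and y; additivity of f then collects the blocks of the
    product.\<close>
  have sumFG: "(\<Sum>c<N. F b c * G c e) = f (star (shift ns b) * (x * y) * shift ns e)" for b e
  proof -
   have "(\<Sum>c<N. F b c * G c e) = (\<Sum>c<N. f (star (shift ns b) * x * shift ns c * (star (shift ns c) * y * shift ns e)))"
    by (simp add: F_def G_def shomD(5)[OF f(1) z[OF x] z[OF y]])
   also have "... = f (\<Sum>c<N. star (shift ns b) * x * shift ns c * (star (shift ns c) * y * shift ns e))"
    by (rule shom_sum[OF f(1), symmetric]) (intro CE.mats_closed(4) z[OF x] z[OF y])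
   also have "(\<Sum>c<N. star (shift ns b) * x * shift ns c * (star (shift ns c) * y * shift ns e))
     = star (shift ns b) * (x * (\<Sum>c<N. shift ns c * star (shift ns c)) * y) * shift ns e"
    by (simp add: sum_distrib_left sum_distrib_right mult.assoc)
   also have "x * (\<Sum>c<N. shift ns c * star (shift ns c)) * y = x * y"
    using unitm_mats(2)[OF N(1)] by (simp add: sum_shift_star_shift[OF ns])
   finally show ?thesis .
  qed
  have "amp_upto N ns ms f x * amp_upto N ns ms f y =
   (\<Sum>b<N. \<Sum>d<N. \<Sum>c<N. \<Sum>e<N. shift ms b * F b c * star (shift ms c) * (shift ms d * G d e * star (shift ms e)))"
   by (simp add: amp_upto_def F_def G_def sum_product)
  also have "... = (\<Sum>b<N. \<Sum>d<N. \<Sum>c<N. if d = c then \<Sum>e<N. shift ms b * (F b c * G c e) * star (shift ms e) else 0)"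
   by (simp only: mid) (rule sum.cong[OF refl], rule sum.cong[OF refl], rule sum.cong[OF refl], simp)
  also have "... = (\<Sum>b<N. \<Sum>c<N. \<Sum>e<N. shift ms b * (F b c * G c e) * star (shift ms e))"
   by (rule sum.cong[OF refl], rule sum.cong[OF refl]) simp
  also have "... = (\<Sum>b<N. \<Sum>e<N. shift ms b * (\<Sum>c<N. F b c * G c e) * star (shift ms e))"
   by (rule sum.cong[OF refl], subst sum.swap) (simp add: sum_distrib_left sum_distrib_right)
  also have "... = amp_upto N ns ms f (x * y)" unfolding sumFG amp_upto_def ..
  finally show "amp ns ms f (x * y) = amp ns ms f x * amp ns ms f y"
   by (simp add: amp[OF N(1)] amp[OF N(2)] amp[OF CE.mats_closed(4)[OF N]])
 qed
 show "amp ns ms f ` upto CE (length ns) <= upto CE (length ms)"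
 proof
  fix y assume "y:amp ns ms f ` upto CE (length ns)"
  then obtain x where x: "x:upto CE (length ns)" "y = amp ns ms f x" by blast
  obtain N where "x:C (ts N ns)" using upto_tensor[OF x(1) ns] by blast
  from mats_upto[OF amp_mats(1)[OF f ms this]] show "y:upto CE (length ms)" by (simp add: x(2))
 qed
 show "amp ns ms f ` upto E (length ns) <= upto E (length ms)"
 proof
  fix y assume "y:amp ns ms f ` upto E (length ns)"
  then obtain x where x: "x:upto E (length ns)" "y = amp ns ms f x" by blast
  obtain N where "x:A (ts N ns)" using upto_tensor[OF x(1) ns] by blast
  from mats_upto[OF amp_mats(2)[OF f ms this]] show "y:upto E (length ms)" by (simp add: x(2))
 qed
qed

text \<open>For N = 1 only the block at position 00 is left, and the shift by no block is the
  unit.\<close>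

lemma amp_extends:
 assumes f: "shom (C ns) f" "f ` C ns <= C ms" and ms: "valid_sizes ms" and x: "x:C ns"
 shows "amp ns ms f x = f x"
proof -
 have t1: "ts 1 ns = ns" by (simp add: tensor_sizes_def)
 have fx: "f x:C ms" using f(2) x by blast
 have "amp ns ms f x = amp_upto 1 ns ms f x" by (rule amp_eq_amp_upto[OF f ms]) (simp add: t1 x del: One_nat_def)
 thus ?thesis using unitm_mats[OF x] unitm_mats[OF fx] by (simp add: amp_upto_def shift_0)
qed

end

section \<open>The maps of a closed family\<close>

declare One_nat_def [simp del]

lift_definition mv :: "nat => nat => 'h mat => 'h::complex_hilbert mat" is move_summand
proof -
 fix s t and x :: "'h elt"
 assume x: "(EX n. bsup n x) & (ALL s i j. clin (x s i j))"
 then obtain n where n: "bsup n x" by blast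
 have "bsup (max n (Suc t)) (move_summand s t x)"
  using bsup_mono[OF n, of "max n (Suc t)"]
  by (auto simp: bsup_def move_summand_def less_max_iff_disj)
 thus "(EX n. bsup n (move_summand s t x)) & (ALL u i j. clin (move_summand s t x u i j))"
  using x by (auto simp: move_summand_def clin_intros)
qed

lemma ent_mv: "ent (mv s t x) u i j = (if u = t then ent x s i j else 0)"
 by (simp add: mv.rep_eq move_summand_def)

lemma shom_mv: "shom S (mv s t)"
proof -
 have m: "mv s t (x * y) = mv s t x * mv s t y" for x y :: "'a mat"
 proof (rule mat_eqI)
  fix u i j
  obtain n where n: "bsup n (ent x)" "bsup n (ent (mv s t x))" using ex_bounded2 by blast
  show "ent (mv s t (x * y)) u i j = ent (mv s t x * mv s t y) u i j"
   by (simp add: ent_mv ent_times[OF n(1)] ent_times[OF n(2)])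
 qed
 show ?thesis unfolding shom_def
  by (auto simp: m intro!: mat_eqI) (auto simp: ent_mv op_adj_zero op_scale_linear)
qed

lemma mv_simps [simp]:
 "mv s t (x + y) = mv s t x + mv s t y" "mv s t (x * y) = mv s t x * mv s t y"
 "mv s t (star x) = star (mv s t x)" "mv s t 0 = 0" "mv s t (cscale c x) = cscale c (mv s t x)"
 using shomD[OF shom_mv[of UNIV s t]] by auto

lemma mv_mv: "mv t u (mv s t' x) = (if t = t' then mv s u x else 0)"
 by (rule mat_eqI) (auto simp: ent_mv)

lemma mv_sgl: "clin T ==> mv s t (sgl s i j T) = sgl t i j T"
 by (rule mat_eqI) (auto simp: ent_mv ent_sgl)

lemma (in opr) mv_full: "x:full K ==> mv s t x:full K"
 by (auto simp: full_def ent_mv zero)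

lemma mv_upto: "opr K ==> x:full K ==> t < r ==> mv s t x:upto K r"
 using opr.mv_full by (fastforce simp: upto_def ent_mv)

lemma upto_sum_mv:
 assumes "x:upto K r"
 shows "x = (\<Sum>t<r. mv 0 t (mv t 0 x))"
proof (rule mat_eqI)
 fix u i j
 have "ent (\<Sum>t<r. mv 0 t (mv t 0 x)) u i j = (\<Sum>t<r. if u = t then ent x t i j else 0)"
  by (simp add: ent_sum ent_mv)
 also have "... = (if u < r then ent x u i j else 0)" by (simp add: sum.delta)
 also have "... = ent x u i j" using assms by (auto simp: upto_def)
 finally show "ent x u i j = ent (\<Sum>t<r. mv 0 t (mv t 0 x)) u i j" by simp
qed

lemma valid_sizes_one: "valid_sizes [1]" "0 < n ==> valid_sizes [n]" by (simp_all add: valid_sizes_def)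

lemma tensor_one: "ts N [n] = [N * n]" by (simp add: tensor_sizes_def)

lemma mats_single: "x:mats K [n] ==> x:upto K 1"
 using mats_upto[of x K "[n]"] by (simp add: One_nat_def)

lemma mats_single_iff:
 "x:mats K [n] \<longleftrightarrow> x:full K & (ALL s i j. ent x s i j ~= 0 --> s = 0 & i < n & j < n)"
proof -
 have "pos_in [n] s i \<longleftrightarrow> s = 0 & i < n" for s i by (cases s) auto
 thus ?thesis unfolding mats_def mem_Collect_eq by (simp only:) blast
qed

lemma mats_single_mono: "n <= m ==> mats K [n] <= mats K [m]"
 unfolding mats_single_iff subset_iff by (meson order_less_le_trans)

lemma mv_0_0: "x:upto K 1 ==> mv 0 0 x = x"
 by (rule mat_eqI) (auto simp: ent_mv upto_def)

section \<open>The family as a set of maps into E tensored with K\<close>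

locale closed_fam = fin_acting E for E :: "('h::complex_hilbert \<Rightarrow>\<^sub>L 'h) set" +
 fixes F :: "'h family"
 assumes closed_F: "closed_family E F"
begin

lemma F_embedding: "embedding_family E F" using closed_F by (simp add: closed_family_def)

lemma F_zero: "0 < n ==> 0 < m ==> (%x s i j. 0):F n m"
 using F_embedding by (simp add: embedding_family_def)
lemma F_id: "0 < n ==> (%x. x):F n n"
 using F_embedding by (simp add: embedding_family_def)
lemma F_corner: "0 < n ==> 0 < m ==> m <= k ==>
  ph:F n m \<longleftrightarrow> ph:F n k & ph ` alg (elem E [n]) <= alg (elem E [m])"
 by (rule F_embedding[unfolded embedding_family_def, THEN conjunct2, THEN conjunct2, THEN conjunct2, rule_format])

lemmas closed_F_parts = closed_F[unfolded closed_family_def, THEN conjunct2]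

lemma F_conj: "0 < n ==> 0 < m ==> ph:F n m ==>
  inner_unitarily_equivalent (elem E [n]) (elem E [m]) ps ph ==> ps:F n m"
 by (rule closed_F_parts[THEN conjunct1, rule_format])
lemma F_comp: "0 < n ==> 0 < m ==> 0 < k ==> ph:F n m ==> ps:F m k ==> ps o ph:F n k"
 by (rule closed_F_parts[THEN conjunct2, THEN conjunct1, rule_format])
lemma F_amplify: "0 < n ==> 0 < m ==> 0 < k ==> ph:F n m ==> amplify [n] [m] ph:F (k * n) (k * m)"
 by (rule closed_F_parts[THEN conjunct2, THEN conjunct2, THEN conjunct1, rule_format])
lemma F_block_sum: "0 < n ==> 0 < m ==> ph:F n m ==> ps:F n m ==>
  (%x. block_sum [m] (ph x) (ps x)):F n (2 * m)"
 by (rule closed_F_parts[THEN conjunct2, THEN conjunct2, THEN conjunct2, THEN conjunct1, rule_format])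

lemma rep_by_elift: "hom ns f ==> rep_by ns f (elift f)"
 by (simp add: rep_by_def)

text \<open>By the corner convention both maps may be regarded as maps into the larger of the two
  targets, where \<open>sim\<close> is inner unitary equivalence and the family is closed under it.
  So membership is invariant even when the targets differ in size.\<close>

lemma F_sim:
 assumes nm: "0 < n" "0 < m" and ph: "ph:F n m" "rep_by [n] f ph" "f ` A [n] <= A [m]"
  and k: "0 < k" and ps: "rep_by [n] g ps" "g ` A [n] <= A [k]" and s: "sim (A [n]) f g"
 shows "ps:F n k"
proof -
 define M where "M = max m k"
 have M: "m <= M" "k <= M" "0 < M" using nm by (auto simp: M_def)
 have fM: "f ` A [n] <= A [M]" and gM: "g ` A [n] <= A [M]"
  by (rule subset_trans[OF ph(3) mats_single_mono[OF M(1)]])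
   (rule subset_trans[OF ps(2) mats_single_mono[OF M(2)]])
 have "ph:F n M" by (rule F_corner[OF nm M(1), THEN iffD1, THEN conjunct1, OF ph(1)])
 moreover have "inner_unitarily_equivalent (elem E [n]) (elem E [M]) ps ph"
  by (rule inner_unitarily_equivalent_elem[OF ph(2) fM ps(1) gM, THEN iffD2, OF s])
 ultimately have "ps:F n M" by (rule F_conj[OF nm(1) M(3)])
 moreover have "ps ` alg (elem E [n]) <= alg (elem E [k])"
  unfolding elem_simps
 proof (intro image_subsetI, elim imageE)
  fix y x assume x: "y = ent x" "x:A [n]"
  hence "ps y = ent (g x)" using ps(1) by (simp add: rep_by_def)
  thus "ps y:ent ` A [k]" using ps(2) x(2) by blast
 qed
 ultimately show ?thesis by (rule F_corner[OF nm(1) k M(2), THEN iffD2, OF conjI])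
qed

text \<open>The maps from E to E tensored with K that the family induces, freed from the size of the
  target.\<close>

definition FM :: "('h mat => 'h mat) set" where
 "FM = {f. hom [1] f & (EX m>0. f ` A [1] <= A [m] & elift f:F 1 m)}"

lemma FM_hom: "f:FM ==> hom [1] f" by (simp add: FM_def)

lemma FM_mono:
 assumes "f:FM"
 obtains m where "0 < m" "!!k. m <= k ==> f ` A [1] <= A [k] & elift f:F 1 k"
proof -
 obtain m where m: "0 < m" "f ` A [1] <= A [m]" "elift f:F 1 m" using assms by (auto simp: FM_def)
 show ?thesis
 proof (rule that[OF m(1)])
  fix k assume k: "m <= k"
  have "elift f:F 1 k"
   by (rule F_corner[OF _ m(1) k, THEN iffD1, THEN conjunct1, OF _ m(3)]) simp
  thus "f ` A [1] <= A [k] & elift f:F 1 k"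
   using subset_trans[OF m(2) mats_single_mono[OF k]] by simp
 qed
qed

lemma hom_into_single:
 assumes "hom ks f" "!!x. x:A ks ==> f x:upto E 1"
 shows "EX N>0. f ` A ks <= A [N]"
proof -
 have "EX N>0. f ` A ks <= A (ts N [1])"
  by (rule hom_into_mats[OF assms(1) _ valid_sizes_one(1)]) (use assms(2) in \<open>auto simp: One_nat_def\<close>)
 thus ?thesis by (simp add: tensor_one)
qed

lemma FM_sim:
 assumes f: "f:FM" and g: "hom [1] g" "!!x. x:A [1] ==> g x:upto E 1" and s: "sim (A [1]) f g"
 shows "g:FM"
proof -
 obtain m where m: "0 < m" "f ` A [1] <= A [m]" "elift f:F 1 m" using f by (auto simp: FM_def)
 obtain k where k: "0 < k" "g ` A [1] <= A [k]" using hom_into_single[OF g] by blast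
 have "elift g:F 1 k"
  by (rule F_sim[OF _ m(1,3) rep_by_elift[OF FM_hom[OF f]] m(2) k(1) rep_by_elift[OF g(1)] k(2) s]) simp
 thus ?thesis using k g(1) by (auto simp: FM_def)
qed

lemma hom_cong:
 assumes "hom ns f" "!!x. x:C ns ==> f x = g x" shows "hom ns g"
proof -
 have "shom (C ns) g" unfolding shom_def
 proof (intro ballI conjI allI)
  fix x y c assume x: "x:C ns"
  note h = shomD[OF homD(1)[OF assms(1)] x]
  show "g (star x) = star (g x)" "g (cscale c x) = cscale c (g x)"
   using h(1) h(2)[of c] by (simp_all add: assms(2)[symmetric] x star_C CE.mats_closed(3))
  assume y: "y:C ns"
  show "g (x + y) = g x + g y" "g (x * y) = g x * g y"
   using h(4)[OF y] h(5)[OF y] x y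
   by (simp_all add: assms(2)[symmetric] CE.mats_closed(2) CE.mats_closed(4))
 qed
 moreover have "g ` C ns <= full CE" "g ` A ns <= full E"
  using homD(2,3)[OF assms(1)] assms(2) A_sub_C by (auto simp: subset_iff)
 ultimately show ?thesis by (simp add: hom_def)
qed

lemma FM_zero: "(%x. 0):FM"
proof -
 have "hom [1] (%x. 0)" by (auto simp: hom_def shom_def E.full_closed CE.full_closed)
 moreover have "elift (%x. 0 :: 'h mat) = (%x s i j. 0)" by (auto simp: elift_def fun_eq_iff)
 ultimately show ?thesis using F_zero[of 1 1] E.mats_closed(1) by (auto simp: FM_def intro!: exI[of _ 1])
qed

lemma hom_add:
 assumes "hom ns f" "hom ns g" "f (unitm ns) * g (unitm ns) = 0"
 shows "hom ns (%x. f x + g x)"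
proof -
 note uf = hom_unit[OF assms(1)] and ug = hom_unit[OF assms(2)]
 have o2: "g (unitm ns) * f (unitm ns) = 0"
  using arg_cong[OF assms(3), of star] uf(2) ug(2) by simp
 have fg: "f x * g y = 0" "g x * f y = 0" if "x:C ns" "y:C ns" for x y
 proof -
  have "f x * g y = f x * (f (unitm ns) * g (unitm ns)) * g y"
   using uf(5)[OF that(1)] ug(4)[OF that(2)] by (simp add: mult.assoc[symmetric]) (simp add: mult.assoc)
  thus "f x * g y = 0" by (simp add: assms(3))
  have "g x * f y = g x * (g (unitm ns) * f (unitm ns)) * f y"
   using ug(5)[OF that(1)] uf(4)[OF that(2)] by (simp add: mult.assoc[symmetric]) (simp add: mult.assoc)
  thus "g x * f y = 0" by (simp add: o2)
 qed
 have "shom (C ns) (%x. f x + g x)" unfolding shom_def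
  using shomD[OF homD(1)[OF assms(1)]] shomD[OF homD(1)[OF assms(2)]]
  by (auto simp: algebra_simps fg)
 thus ?thesis
  using homD(2,3)[OF assms(1)] homD(2,3)[OF assms(2)] E.full_closed(2) CE.full_closed(2)
  by (auto simp: hom_def)
qed

lemma hom_conj:
 assumes "hom ns f" "w:full E" "star w:full E" "!!x. x:C ns ==> f x * (star w * w) = f x"
 shows "hom ns (%x. w * f x * star w)"
proof -
 have wC: "w:full CE" "star w:full CE" using assms(2,3) fullE_sub by auto
 have "shom (C ns) (%x. w * f x * star w)" unfolding shom_def
 proof (intro ballI conjI allI)
  fix x y c assume x: "x:C ns"
  note h = shomD[OF homD(1)[OF assms(1)] x]
  show "w * f (star x) * star w = star (w * f x * star w)" "w * f (cscale c x) * star w = cscale c (w * f x * star w)"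
   by (simp_all add: h mult.assoc)
  assume y: "y:C ns"
  show "w * f (x + y) * star w = w * f x * star w + w * f y * star w"
   by (simp add: h(4)[OF y] algebra_simps)
  have "w * f x * star w * (w * f y * star w) = w * (f x * (star w * w)) * f y * star w"
   by (simp add: mult.assoc)
  also have "... = w * f (x * y) * star w" unfolding assms(4)[OF x] h(5)[OF y] by (simp add: mult.assoc)
  finally show "w * f (x * y) * star w = w * f x * star w * (w * f y * star w)" by simp
 qed
 thus ?thesis unfolding hom_def
  using homD(2,3)[OF assms(1)] assms(2,3) wC E.full_closed(4) CE.full_closed(4) by auto
qed

lemma block_sum_ent:
 assumes "x:C [m]" "y:C [m]" "0 < m"
 shows "block_sum [m] (ent x) (ent y) = ent (x + shift [m] 1 * y * star (shift [m] 1))"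
proof (intro ext)
 fix s i j
 have y: "ent y s k l = 0" if "m <= k | m <= l" for k l
  using that assms(2) unfolding mats_single_iff by (meson not_less)
 have x: "ent x s k l = 0" if "m <= k | m <= l | s ~= 0" for k l
  using that assms(1) unfolding mats_single_iff by (meson not_less)
 have d: "k div m = 1 & k mod m = k - m" if "m <= k" "k < 2 * m" for k
  using that by (simp add: div_nat_eqI mod_if)
 have d2: "k div m ~= 1" if "2 * m <= k | k < m" for k
  using that assms(3) div_le_mono[of "2 * m" k m] by auto
 have e: "ent (x + shift [m] 1 * y * star (shift [m] 1)) s i j = ent x s i j +
  (if s = 0 & i div m = 1 & j div m = 1 then ent y s (i mod m) (j mod m) else 0)"
  by (cases s) (auto simp: ent_times_star_shift[OF valid_sizes_one(2)[OF assms(3)]]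
    ent_shift_times[OF valid_sizes_one(2)[OF assms(3)]])
 consider "i < m | j < m | s ~= 0" | "m <= i" "m <= j" "s = 0" "2 * m <= i | 2 * m <= j"
  | "m <= i" "m <= j" "s = 0" "i < 2 * m" "j < 2 * m" by linarith
 thus "block_sum [m] (ent x) (ent y) s i j = ent (x + shift [m] 1 * y * star (shift [m] 1)) s i j"
 proof cases
  case 1
  hence "~ (s = 0 & i div m = 1 & j div m = 1)" using d2[of i] d2[of j] by auto
  moreover have "~ (m <= i & m <= j & s = 0)" using 1 by auto
  ultimately show ?thesis using x[of i j] unfolding e by (auto simp: block_sum_def)
 next
  case 2
  hence "~ (s = 0 & i div m = 1 & j div m = 1)" using d2[of i] d2[of j] by auto
  moreover have "ent y s (i - m) (j - m) = 0" using 2 by (intro y) auto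
  ultimately show ?thesis using 2 x[of i j] unfolding e by (auto simp: block_sum_def)
 next
  case 3
  thus ?thesis using d[of i] d[of j] x[of i j] unfolding e by (auto simp: block_sum_def)
 qed
qed

lemma hom_range_single: "hom ks f ==> f ` A ks <= A [m] ==> x:C ks ==> f x:C [m]"
 by (rule hom_range)

text \<open>Sum closure of the family concerns block diagonal sums. The map g is equivalent to its
  copy g' moved down by one block, and \<open>sim_add\<close> compares the block sum with the given
  sum of orthogonal maps.\<close>

lemma FM_add:
 assumes f: "f:FM" and g: "g:FM" and orth: "f u1 * g u1 = 0"
 shows "(%x. f x + g x):FM"
proof -
 obtain m1 where m1: "0 < m1" "!!k. m1 <= k ==> f ` A [1] <= A [k] & elift f:F 1 k" using FM_mono[OF f] by blast
 obtain m2 where m2: "0 < m2" "!!k. m2 <= k ==> g ` A [1] <= A [k] & elift g:F 1 k" using FM_mono[OF g] by blast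
 define m where "m = max m1 m2"
 have m: "0 < m" "m1 <= m" "m2 <= m" using m1(1) by (auto simp: m_def)
 have fm: "f ` A [1] <= A [m]" "elift f:F 1 m" and gm: "g ` A [1] <= A [m]" "elift g:F 1 m"
  using m1(2)[OF m(2)] m2(2)[OF m(3)] by auto
 note hf = FM_hom[OF f] and hg = FM_hom[OF g]
 note v = valid_sizes_one(2)[OF m(1)]
 define w where "w = (shift [m] 1 :: 'h mat)"
 have wE: "w:full E" "star w:full E" unfolding w_def by (rule E.shift_full)+
 have ww: "star w * w = unitm [m]" unfolding w_def by (simp add: star_shift_shift[OF v])
 have gC: "g x:C [m]" "f x:C [m]" if "x:C [1]" for x
  using hom_range_single[OF hg gm(1) that] hom_range_single[OF hf fm(1) that] .
 have gu: "unitm [m] * g x = g x" "g x * unitm [m] = g x" if "x:C [1]" for x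
  by (rule unitm_mats[OF gC(1)[OF that]])+
 define g' where "g' x = w * g x * star w" for x
 have hg': "hom [1] g'" unfolding g'_def
  by (rule hom_conj[OF hg wE]) (use gu ww in simp)
 have sg: "sim (A [1]) g g'" unfolding sim_def g'_def
  by (rule bexI[of _ w]) (use wE ww gu A_sub_C in auto)
 have fw: "f u1 * w = 0"
 proof -
  have "f u1 * w = f u1 * (unitm [m] * w)"
   using unitm_mats(2)[OF gC(2)[OF CE.unitm_in]] by (simp add: mult.assoc[symmetric])
  also have "unitm [m] * w = 0"
   using star_shift_shift[OF v, of 0 1] by (simp add: w_def shift_0)
  finally show ?thesis by simp
 qed
 have orth': "f u1 * g' u1 = 0"
  by (simp add: g'_def mult.assoc[symmetric] fw)
 have sf: "sim (A [1]) f f" by (rule sim_refl[of _ _ "[m]"]) (use fm in auto)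
 have s: "sim (A [1]) (%x. f x + g' x) (%x. f x + g x)"
  by (rule sim_add[OF hf hg' sf sim_sym[OF sg] hf hg orth' orth])
 have hsum: "hom [1] (%x. f x + g x)" by (rule hom_add[OF hf hg orth])
 have hsum': "hom [1] (%x. f x + g' x)" by (rule hom_add[OF hf hg' orth'])
 have rng: "f x + g' x:A [2 * m]" if "x:A [1]" for x
 proof -
  have gx: "g x:A [m]" "f x:A [m]" using that fm gm by auto
  have "w * g x * star w:mats E (ts 2 [m])"
   unfolding w_def by (rule shift_mats[OF gx(1) _ _ E.opr_axioms]) simp_all
  moreover have "f x:A [2 * m]" using mats_single_mono[of m "2 * m" E] gx(2) by auto
  ultimately show ?thesis unfolding g'_def by (intro E.mats_closed(2)) (simp_all add: tensor_one)
 qed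
 have "(%x. block_sum [m] (elift f x) (elift g x)):F 1 (2 * m)"
  using F_block_sum[of 1 m] m(1) fm(2) gm(2) by simp
 moreover have "rep_by [1] (%x. f x + g' x) (%x. block_sum [m] (elift f x) (elift g x))"
  unfolding rep_by_def
 proof (intro conjI ballI hsum')
  fix x assume "x:A [1]"
  hence "x:C [1]" using A_sub_C by blast
  thus "block_sum [m] (elift f (ent x)) (elift g (ent x)) = ent (f x + g' x)"
   using block_sum_ent[OF gC(2) gC(1) m(1)] by (simp add: g'_def w_def)
 qed
 moreover have "(%x. f x + g x) ` A [1] <= A [m]"
 proof (rule image_subsetI)
  fix x assume "x:A [1]"
  hence "f x:A [m]" "g x:A [m]" using fm(1) gm(1) by blast+
  thus "f x + g x:A [m]" by (rule E.mats_closed(2))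
 qed
 ultimately have "elift (%x. f x + g x):F 1 m"
  using m(1) rng s
  by (intro F_sim[OF _ _ _ _ _ _ rep_by_elift[OF hsum], where m = "2 * m" and f = "%x. f x + g' x"]) auto
 thus ?thesis
  using m(1) hsum \<open>(%x. f x + g x) ` A [1] <= A [m]\<close> by (auto simp: FM_def)
qed

lemma FM_sum:
 fixes r :: nat
 assumes "!!t. t < r ==> f t:FM"
  and "!!t t'. t < r ==> t' < r ==> t ~= t' ==> f t u1 * f t' u1 = 0"
 shows "(%x. \<Sum>t<r. f t x):FM"
 using assms
proof (induction r)
 case 0
 thus ?case using FM_zero by simp
next
 case (Suc r)
 have "(%x. (\<Sum>t<r. f t x) + f r x):FM"
 proof (rule FM_add)
  show "(%x. \<Sum>t<r. f t x):FM" using Suc by simp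
  show "f r:FM" using Suc by simp
  show "(\<Sum>t<r. f t u1) * f r u1 = 0"
   unfolding sum_distrib_right by (rule sum.neutral) (use Suc.prems(2) in auto)
 qed
 thus ?case by simp
qed

text \<open>On the corner, h equals the amplification of its own restriction to E; hence the two are
  equivalent on every matrix size. The amplification composed with th is in the family by matricial
  stability and closure under composition.\<close>

lemma chom_FM:
 assumes h: "chom 1 1 h" and hF: "h:FM" and th: "th:FM"
 shows "(%x. h (th x)):FM"
proof -
 obtain m where m: "0 < m" "h ` A [1] <= A [m]" "elift h:F 1 m" using hF by (auto simp: FM_def)
 obtain k where k: "0 < k" "th ` A [1] <= A [k]" "elift th:F 1 k" using th by (auto simp: FM_def)
 note hh = FM_hom[OF hF] and hth = FM_hom[OF th]
 note v = valid_sizes_one(2)[OF m(1)]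
 have hC: "h ` C [1] <= C [m]" using hom_range[OF hh m(2)] by blast
 define a where "a = amp [1] [m] h"
 have ca: "chom 1 1 a"
  using chom_amp[OF homD(1)[OF hh] hC m(2) v valid_sizes_one(1)] by (simp add: a_def One_nat_def)
 have len1: "length [n] = 1" for n :: nat by simp
 have "sim (A [k]) h a"
 proof (rule sim_of_corners[OF chom_hom[OF h len1] chom_hom[OF ca len1]])
  fix t assume "t < length [k]"
  hence t: "t = 0" by simp
  have eq: "a (sgl 0 0 0 b) = h (sgl 0 0 0 b)" "h (sgl 0 0 0 b):A [m]" if "b:E" for b
  proof -
   have bA: "sgl 0 0 0 b:A [1]" by (rule E.sgl_mats[OF that]) simp_all
   thus "h (sgl 0 0 0 b):A [m]" using m(2) by blast
   show "a (sgl 0 0 0 b) = h (sgl 0 0 0 b)" unfolding a_def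
    by (rule amp_extends[OF homD(1)[OF hh] hC v]) (use bA A_sub_C in auto)
  qed
  have "sim (sgl 0 0 0 ` E) h h" by (rule sim_refl[of _ _ "[m]"]) (use eq(2) in auto)
  thus "sim (sgl t 0 0 ` E) h a" unfolding t by (rule sim_cong) (use eq(1) in auto)
 qed
 hence s: "sim (A [1]) (%x. h (th x)) (%x. a (th x))"
  using sim_comp[of "A [k]" h a th "A [1]"] k(2) by (simp add: comp_def)
 have thC: "th x:C [k]" if "x:C [1]" for x by (rule hom_range[OF hth k(2) that])
 have comp: "hom [1] (%x. g (th x))" if g: "chom 1 1 g" for g
  unfolding hom_def
 proof (intro conjI)
  note hg = chom_hom[OF g len1, of k]
  show "shom (C [1]) (%x. g (th x))" unfolding shom_def
   using shomD[OF homD(1)[OF hth]] shomD[OF homD(1)[OF hg]] thC by simp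
  show "(%x. g (th x)) ` C [1] <= full CE" "(%x. g (th x)) ` A [1] <= full E"
   using homD(2,3)[OF hg] thC k(2) by auto
 qed
 have aA: "a ` A [k] <= A [k * m]"
  using amp_mats(2)[OF homD(1)[OF hh] hC m(2) v, of _ k] by (auto simp: tensor_one a_def)
 have "amplify [1] [m] (elift h) o elift th:F 1 (k * m)"
  using F_comp[of 1 k "k * m", OF _ _ _ k(3)] F_amplify[of 1 m k, OF _ _ _ m(3)] k(1) m(1) by simp
 moreover have "rep_by [1] (%x. a (th x)) (amplify [1] [m] (elift h) o elift th)"
  unfolding rep_by_def
 proof (intro conjI ballI comp[OF ca])
  fix x assume x: "x:A [1]"
  hence "th x:upto CE (length [1])" using thC A_sub_C C_upto[of _ "[k]"] by auto
  from ent_amp[OF homD(1)[OF hh] hC v valid_sizes_one(1) this]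
  show "(amplify [1] [m] (elift h) o elift th) (ent x) = ent (a (th x))" by (simp add: a_def)
 qed
 moreover have "(%x. a (th x)) ` A [1] <= A [k * m]" using aA k(2) by auto
 ultimately have "(%x. a (th x)):FM"
  using k(1) m(1) comp[OF ca]
  unfolding FM_def mem_Collect_eq
  by (intro conjI exI[of _ "k * m"] F_sim[OF _ _ _ _ _ _ rep_by_elift[OF comp[OF ca]], where m = "k * m"
     and f = "%x. a (th x)"] sim_refl[of "A [1]" "%x. a (th x)" "[k * m]"]) auto
 moreover have "h (th x):upto E 1" if "x:A [1]" for x
  using chomD(3)[OF h, of "th x"] mats_single[of "th x" E k] k(2) that by auto
 ultimately show ?thesis using FM_sim[OF _ comp[OF h] _ sim_sym[OF s]] by blast
qed

text \<open>\<open>T1\<close> consists of the maps from \<open>E\<close> to a finite direct sum of copies of \<open>E \<otimes> \<K>\<close> with components in the family.\<close>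

definition T1 :: "('h mat => 'h mat) set" where
 "T1 = {f. hom [1] f & (ALL s. (%x. mv s 0 (f x)):FM)}"

lemma T1_hom: "f:T1 ==> hom [1] f" by (simp add: T1_def)
lemma T1_FM: "f:T1 ==> (%x. mv s 0 (f x)):FM" by (simp add: T1_def)

lemma hom_mv:
 assumes "hom ns f" shows "hom ns (%x. mv s t (f x))"
 unfolding hom_def
proof (intro conjI)
 show "shom (C ns) (%x. mv s t (f x))" unfolding shom_def
  using shomD[OF homD(1)[OF assms]] by simp
 show "(%x. mv s t (f x)) ` C ns <= full CE" "(%x. mv s t (f x)) ` A ns <= full E"
  using homD(2,3)[OF assms] E.mv_full CE.mv_full by auto
qed

lemma mv_0_upto: "x:full K ==> opr K ==> mv s 0 x:upto K 1"
 by (rule mv_upto) auto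

lemma sim_mv:
 assumes "sim S f g" shows "sim S (%x. mv s t (f x)) (%x. mv s t (g x))"
proof -
 obtain w where w: "w:full E" "star w:full E"
  "!!x. x:S ==> star w * w * f x = f x" "!!x. x:S ==> f x * (star w * w) = f x"
  "!!x. x:S ==> g x = w * f x * star w"
  using assms by (auto simp: sim_def)
 let ?m = "mv s t"
 have "star (?m w) * ?m w * ?m (f x) = ?m (f x)" "?m (f x) * (star (?m w) * ?m w) = ?m (f x)"
  "?m (g x) = ?m w * ?m (f x) * star (?m w)" if "x:S" for x
  using arg_cong[OF w(3)[OF that], of ?m] arg_cong[OF w(4)[OF that], of ?m] arg_cong[OF w(5)[OF that], of ?m]
  by simp_all
 moreover have "?m w:full E" "star (?m w):full E"
  using E.mv_full[OF w(1)] E.mv_full[OF w(2), of s t] by simp_all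
 ultimately show ?thesis unfolding sim_def by blast
qed

lemma T1_sim:
 assumes "f:T1" "hom [1] g" "sim (A [1]) f g"
 shows "g:T1"
proof -
 have "(%x. mv s 0 (g x)):FM" for s
  by (rule FM_sim[OF T1_FM[OF assms(1), of s] hom_mv[OF assms(2)] mv_0_upto sim_mv[OF assms(3)]])
   (use homD(3)[OF assms(2)] E.opr_axioms in auto)
 thus ?thesis using assms(2) by (simp add: T1_def)
qed

lemma T1_add:
 assumes "f:T1" "g:T1" "f u1 * g u1 = 0"
 shows "(%x. f x + g x):T1"
proof -
 have "(%x. mv s 0 (f x) + mv s 0 (g x)):FM" for s
  by (rule FM_add[OF T1_FM[OF assms(1)] T1_FM[OF assms(2)]]) (simp add: assms(3) flip: mv_simps(2))
 thus ?thesis using hom_add[OF T1_hom[OF assms(1)] T1_hom[OF assms(2)] assms(3)] by (simp add: T1_def)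
qed

lemma hom_id: "hom ns (%x. x)"
 by (auto simp: hom_def shom_def mats_full)

lemma T1_zero: "(%x. 0):T1"
 using FM_zero FM_hom[OF FM_zero] by (simp add: T1_def)

lemma T1_mv: "mv 0 t:T1"
proof -
 have hid: "hom [1] (%x. mv 0 t x)" by (rule hom_mv[OF hom_id])
 have eq: "mv s 0 (mv 0 t x) = (if s = t then x else 0)" if "x:C [1]" for s x
  using mv_0_0[OF mats_single[OF that]] by (simp add: mv_mv)
 have idF: "(%x. x):FM"
 proof -
  have "elift (%x. x :: 'h mat):F 1 1"
   by (rule F_sim[OF _ _ F_id _ _ _ rep_by_elift[OF hom_id], where f = "%x. x"])
    (auto simp: rep_by_def hom_id intro: sim_refl[of _ _ "[1]"])
  thus ?thesis by (auto simp: FM_def hom_id intro!: exI[of _ 1])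
 qed
 have "(%x. mv s 0 (mv 0 t x)):FM" for s
 proof (cases "s = t")
  case True
  have "sim (A [1]) (%x. x) (%x. mv s 0 (mv 0 t x))"
   by (rule sim_cong[OF sim_refl[of "A [1]" "%x. x" "[1]"]]) (use eq[OF A_sub_C[THEN subsetD]] True in auto)
  thus ?thesis
   by (intro FM_sim[OF idF hom_mv[OF hid] mv_0_upto]) (use homD(3)[OF hid] E.opr_axioms in auto)
 next
  case False
  hence "mv s 0 (mv 0 t x) = 0" for x :: "'h mat" by (simp add: mv_mv)
  thus ?thesis using FM_zero by simp
 qed
 thus ?thesis using hid by (simp add: T1_def)
qed

text \<open>The morphisms that act on classes by composition: star-homomorphisms of stabilisations
  whose restrictions to the corners of the summands have components in the family.\<close>

definition smap :: "nat => nat => ('h mat => 'h mat) => bool" where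
 "smap r r' g \<longleftrightarrow> chom r r' g & (ALL t<r. (%x. g (mv 0 t x)):T1)"

lemma smap_chom: "smap r r' g ==> chom r r' g" by (simp add: smap_def)

lemma hom_range_upto:
 assumes f: "hom ks f" "f ` A ks <= upto E r" and x: "x:C ks"
 shows "f x:upto CE r"
proof -
 have u: "f (unitm ks):upto CE r" using f(2) E.unitm_in upto_mono[OF E_sub_CE] by blast
 have "f x = f (unitm ks) * f x" using hom_unit(4)[OF f(1) x] by simp
 thus ?thesis using CE.upto_closed(4)[OF u homD(2)[OF f(1) x]] by simp
qed

lemma chom_comp_hom:
 assumes g: "chom r r' g" and f: "hom ks f" "f ` A ks <= upto E r"
 shows "hom ks (%x. g (f x))"
 unfolding hom_def
proof (intro conjI)
 note fC = hom_range_upto[OF f]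
 show "shom (C ks) (%x. g (f x))" unfolding shom_def
  using shomD[OF homD(1)[OF f(1)]] shomD[OF chomD(1)[OF g]] fC by simp
 show "(%x. g (f x)) ` C ks <= full CE" "(%x. g (f x)) ` A ks <= full E"
  using chomD(2,3)[OF g] fC f(2) upto_full by (auto simp: subset_iff) (blast intro: upto_full)+
qed

text \<open>A component of the composite is the sum, over the summands t, of a component of g
  applied to a component of ps. Each term is in the family by \<open>chom_FM\<close>, and the terms
  are orthogonal since g carries distinct summands to orthogonal elements.\<close>

lemma T1_comp:
 assumes g: "smap r r' g" and ps: "ps:T1" "ps ` A [1] <= upto E r"
 shows "(%x. g (ps x)):T1"
proof -
 note cg = smap_chom[OF g] and hps = T1_hom[OF ps(1)]
 have psC: "ps x:upto CE r" if "x:C [1]" for x by (rule hom_range_upto[OF hps ps(2) that])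
 have hg: "hom [1] (%x. g (ps x))" by (rule chom_comp_hom[OF cg hps ps(2)])
 have "(%x. mv s 0 (g (ps x))):FM" for s
 proof -
  define h where "h t x = mv s 0 (g (mv 0 t x))" for t x
  define th where "th t x = mv t 0 (ps x)" for t x
  have hF: "h t:FM" if "t < r" for t
   using T1_FM[of "%x. g (mv 0 t x)" s] g that by (simp add: smap_def h_def[abs_def])
  have thF: "th t:FM" for t using T1_FM[OF ps(1)] by (simp add: th_def[abs_def])
  have upC: "mv 0 t y:upto CE r" if "t < r" "y:full CE" for t y
   by (rule mv_upto[OF CE.opr_axioms that(2,1)])
  have upE: "mv 0 t y:upto E r" if "t < r" "y:full E" for t y
   by (rule mv_upto[OF E.opr_axioms that(2,1)])
  have ch: "chom 1 1 (h t)" if "t < r" for t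
   unfolding chom_def
  proof (intro conjI)
   have up: "mv 0 t y:upto CE r" if "y:upto CE 1" for y
    using upC[OF \<open>t < r\<close> upto_full[OF that]] .
   show "shom (upto CE 1) (h t)" unfolding shom_def h_def
    using shomD[OF chomD(1)[OF cg] up] up by simp
   show "h t ` upto CE 1 <= upto CE 1"
    unfolding h_def using mv_0_upto[OF upto_full[OF chomD(2)[OF cg up]] CE.opr_axioms] by auto
   show "h t ` upto E 1 <= upto E 1"
    unfolding h_def
    using mv_0_upto[OF upto_full[OF chomD(3)[OF cg upE[OF that upto_full]]] E.opr_axioms] by auto
  qed
  have F1: "(%x. h t (th t x)):FM" if "t < r" for t
   by (rule chom_FM[OF ch[OF that] hF[OF that] thF])
  have u: "unitm [1]:C [1]" by (rule CE.unitm_in)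
  have orth: "h t (th t u1) * h t' (th t' u1) = 0" if "t < r" "t' < r" "t ~= t'" for t t'
  proof -
   have fu: "ps u1:full CE" using upto_full[OF psC[OF u]] .
   have a: "mv 0 t (mv t 0 (ps u1)):upto CE r" if "t < r" for t
    using upC[OF that CE.mv_full[OF fu]] .
   have "mv 0 t (mv t 0 (ps u1)) * mv 0 t' (mv t' 0 (ps u1)) = 0"
   proof (rule mat_eqI)
    fix i j k
    show "ent (mv 0 t (mv t 0 (ps u1)) * mv 0 t' (mv t' 0 (ps u1))) i j k = ent 0 i j k"
     using that(3) by (subst ent_times_zero) (auto simp: ent_mv)
   qed
   hence "g (mv 0 t (mv t 0 (ps u1))) * g (mv 0 t' (mv t' 0 (ps u1))) = 0"
    using shomD(5)[OF chomD(1)[OF cg] a[OF that(1)] a[OF that(2)]] shomD(7)[OF chomD(1)[OF cg] a[OF that(1)]] by simp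
   thus ?thesis unfolding h_def th_def by (simp flip: mv_simps(2))
  qed
  have sumF: "(%x. \<Sum>t<r. h t (th t x)):FM" by (rule FM_sum[OF F1 orth])
  have eq: "mv s 0 (g (ps x)) = (\<Sum>t<r. h t (th t x))" if "x:C [1]" for x
  proof -
   have "(\<Sum>t<n. mv 0 t (mv t 0 (ps x))):upto CE r & mv s 0 (g (\<Sum>t<n. mv 0 t (mv t 0 (ps x)))) = (\<Sum>t<n. h t (th t x))" if "n <= r" for n
    using that
   proof (induction n)
    case 0
    thus ?case using shomD(7)[OF chomD(1)[OF cg] CE.upto_closed(1)] by (simp add: CE.upto_closed(1))
   next
    case (Suc n)
    have a: "mv 0 n (mv n 0 (ps x)):upto CE r"
     using upC[OF _ CE.mv_full[OF upto_full[OF psC[OF \<open>x:C [1]\<close>]]]] Suc.prems by simp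
    thus ?case
     using Suc shomD(4)[OF chomD(1)[OF cg]] CE.upto_closed(2) by (simp add: h_def th_def)
   qed
   from this[of r] upto_sum_mv[OF psC[OF that]] show ?thesis by simp
  qed
  obtain N where N: "(%x. \<Sum>t<r. h t (th t x)) ` A [1] <= A [N]" using sumF by (auto simp: FM_def)
  have s: "sim (A [1]) (%x. \<Sum>t<r. h t (th t x)) (%x. mv s 0 (g (ps x)))"
   by (rule sim_cong[OF sim_refl[of "A [1]" "%x. \<Sum>t<r. h t (th t x)" "[N]"]])
    (use N eq[OF A_sub_C[THEN subsetD]] in auto)
  show ?thesis
   by (rule FM_sim[OF sumF hom_mv[OF hg] mv_0_upto])
    (use homD(3)[OF hg] E.opr_axioms s in auto)
 qed
 thus ?thesis using hg by (simp add: T1_def)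
qed

end

section \<open>Elementary algebras and the semigroups \<open>V\<^sub>F(B)\<close>\<close>

lemma mv_mats:
 assumes "opr K" "x:mats K [ns ! t]" "t < length ns"
 shows "mv 0 t x:mats K ns"
proof -
 have "x:full K" "!!s i j. ent x s i j ~= 0 ==> s = 0 & i < ns ! t & j < ns ! t"
  using assms(2) unfolding mats_single_iff by blast+
 thus ?thesis
  using assms(3) opr.mv_full[OF assms(1)] unfolding mats_def by (auto simp: ent_mv split: if_splits)
qed

lemma mv_mats_back:
 assumes "opr K" "x:mats K ns" "t < length ns"
 shows "mv t 0 x:mats K [ns ! t]"
 unfolding mats_single_iff
proof (intro conjI allI impI)
 show "mv t 0 x:full K" using opr.mv_full[OF assms(1) mats_full[OF assms(2)]] .
 fix s i j assume "ent (mv t 0 x) s i j ~= 0"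
 hence "s = 0 & ent x t i j ~= 0" by (simp add: ent_mv split: if_splits)
 thus "s = 0" "i < ns ! t" "j < ns ! t" using assms(2) unfolding mats_def by blast+
qed

lemma valid_tensor: "valid_sizes ns ==> 0 < N ==> valid_sizes (ts N ns)"
 by (auto simp: valid_sizes_def tensor_sizes_def)

lemma Union_constant: "S ~= {} ==> (!!Z. Z:S ==> Z = c) ==> \<Union>S = c"
 by auto

lemma ent_pmat_offset_times:
 assumes "finite I"
 shows "ent (pmat I (%s i. a s + i) * y) s i j =
  (if a s <= i & (s, i - a s):I then ent y s (i - a s) j else 0)"
proof -
 have "ent (pmat I (%s i. a s + i) * y) s i j = ent (pmat I (%s i. a s + i)) s i (i - a s) o\<^sub>L ent y s (i - a s) j"
  by (rule ent_times_single) (auto simp: ent_pmat[OF assms])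
 thus ?thesis by (auto simp: ent_pmat[OF assms])
qed

lemma ent_times_star_pmat_offset:
 assumes "finite I"
 shows "ent (y * star (pmat I (%s i. a s + i))) s i j =
  (if a s <= j & (s, j - a s):I then ent y s i (j - a s) else 0)"
proof -
 have "y * star (pmat I (%s i. a s + i)) = star (pmat I (%s i. a s + i) * star y)" by simp
 hence "ent (y * star (pmat I (%s i. a s + i))) s i j = op_adj (ent (pmat I (%s i. a s + i) * star y) s j i)"
  by (simp only: ent_star)
 thus ?thesis by (simp add: ent_pmat_offset_times[OF assms] op_adj_op_adj op_adj_zero)
qed

text \<open>The isometry that moves an algebra with sizes ks beyond one with sizes ms. Unlike
  \<open>shift\<close> it allows the two sizes to differ, as they do for the ranges of two unrelated
  maps.\<close>

definition offset :: "nat list => nat list => 'h::complex_hilbert mat" where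
 "offset ms ks = pmat (positions ks) (%s i. ms ! s + i)"

lemma star_offset_offset: "star (offset ms ks) * offset ms ks = unitm ks"
 by (rule mat_eqI) (auto simp: offset_def ent_star_pmat_times ent_pmat ent_unitm)

lemma times_offset:
 assumes "x:mats K ms" "length ks = length ms" shows "x * offset ms ks = 0"
proof (rule mat_eqI)
 fix s i j
 have "ent x s i (ms ! s + j) = 0" using assms(1) unfolding mats_def by (auto intro: ccontr)
 thus "ent (x * offset ms ks) s i j = ent 0 s i j" by (simp add: offset_def ent_times_pmat)
qed

lemma block_sum_offset:
 assumes "x:mats K ms" "y:mats L ks" "length ks = length ms"
 shows "block_sum ms (ent x) (ent y) = ent (x + offset ms ks * y * star (offset ms ks))"
proof (intro ext)
 fix s i j
 have x: "ent x s i j = 0" if "~ (pos_in ms s i & pos_in ms s j)" using assms(1) that unfolding mats_def by blast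
 have y: "ent y s k l = 0" if "~ (pos_in ks s k & pos_in ks s l)" for k l
  using assms(2) that unfolding mats_def by blast
 have e: "ent (offset ms ks * y * star (offset ms ks)) s i j =
   (if ms ! s <= i & ms ! s <= j then ent y s (i - ms ! s) (j - ms ! s) else 0)"
  using y[of "i - ms ! s" "j - ms ! s"]
  by (auto simp: offset_def ent_times_star_pmat_offset ent_pmat_offset_times)
 show "block_sum ms (ent x) (ent y) s i j = ent (x + offset ms ks * y * star (offset ms ks)) s i j"
  unfolding ent_add e using x y[of "i - ms ! s" "j - ms ! s"] assms(3)
  by (auto simp: block_sum_def)
qed

lemma (in opr) offset_full: "offset ms ks:full K" "star (offset ms ks):full K"
 by (simp_all add: offset_def pmat_full)

lemma offset_upto:
 assumes "opr K" "y:upto K r"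
 shows "offset ms ks * y * star (offset ms ks):upto K r"
proof -
 interpret opr K by fact
 show ?thesis using upto_closed(4)[OF upto_closed(5)[OF offset_full(1) assms(2)] offset_full(2)] .
qed

context fin_acting
begin

lemma hom_sim_refl: "hom ks f ==> sim (A ks) f f"
 unfolding sim_def
 by (rule bexI[of _ "f (unitm ks)"]) (simp_all add: hom_unit)

lemma hom_comp_mv:
 assumes "hom ns f" "t < length ns" "n <= ns ! t" shows "hom [n] (%x. f (mv 0 t x))"
proof -
 have c: "mv 0 t x:C ns" if "x:C [n]" for x
  using mv_mats[OF CE.opr_axioms _ assms(2)] mats_single_mono[OF assms(3)] that by blast
 have a: "mv 0 t x:A ns" if "x:A [n]" for x
  using mv_mats[OF E.opr_axioms _ assms(2)] mats_single_mono[OF assms(3)] that by blast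
 have "shom (C [n]) (%x. f (mv 0 t x))" unfolding shom_def
  using shomD[OF homD(1)[OF assms(1)] c] c by simp
 thus ?thesis using homD(2)[OF assms(1) c] homD(3)[OF assms(1) a] by (auto simp: hom_def)
qed

lemma sgl_A1: "a:E ==> sgl 0 0 0 a:A [1]"
 by (rule E.sgl_mats) simp_all

lemma sim_of_corners':
 assumes f: "hom ns f" and g: "hom ns g"
  and corner: "!!t. t < length ns ==> 0 < ns ! t ==> sim (A [1]) (%x. f (mv 0 t x)) (%x. g (mv 0 t x))"
 shows "sim (A ns) f g"
proof (rule sim_of_corners[OF f g])
 fix t assume t: "t < length ns" "0 < ns ! t"
 obtain w where w: "w:full E" "star w:full E"
  "!!x. x:A [1] ==> star w * w * f (mv 0 t x) = f (mv 0 t x)"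
  "!!x. x:A [1] ==> f (mv 0 t x) * (star w * w) = f (mv 0 t x)"
  "!!x. x:A [1] ==> g (mv 0 t x) = w * f (mv 0 t x) * star w"
  using corner[OF t] by (auto simp: sim_def)
 have eq: "sgl t 0 0 a = mv 0 t (sgl 0 0 0 a)" if "a:E" for a
  using mv_sgl[OF E.clin[OF that]] by simp
 show "sim (sgl t 0 0 ` E) f g" unfolding sim_def
  by (rule bexI[OF _ w(1)]) (use w(2) w(3-5)[OF sgl_A1] eq in auto)
qed

lemma amp_corner:
 assumes f: "hom ns f" "f ` A ns <= A ms" and ms: "valid_sizes ms" and ns: "valid_sizes ns" and t: "t < length ns"
  and x: "x:C [1]"
 shows "amp ns ms f (mv 0 t x) = f (mv 0 t x)"
proof -
 have n: "1 <= ns ! t" using valid_sizesD[OF ns t] by simp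
 have "mv 0 t x:C ns"
  using mv_mats[OF CE.opr_axioms _ t] mats_single_mono[OF n] x by blast
 thus ?thesis using amp_extends[OF homD(1)[OF f(1)] _ ms] hom_range[OF f] by blast
qed

lemma amp_chom:
 assumes f: "hom ns f" "f ` A ns <= A ms" and ms: "valid_sizes ms" and ns: "valid_sizes ns"
 shows "chom (length ns) (length ms) (amp ns ms f)"
 using chom_amp[OF homD(1)[OF f(1)] _ f(2) ms ns] hom_range[OF f] by blast

lemma sim_amp:
 assumes f: "hom ns f" "f ` A ns <= A ms" and ms: "valid_sizes ms" and ns: "valid_sizes ns"
  and h: "hom ks h" "length ks = length ns" and s: "!!t. t < length ns ==> sim (A [1]) (%x. f (mv 0 t x)) (%x. h (mv 0 t x))"
 shows "sim (A ks) (amp ns ms f) h"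
proof (rule sim_of_corners'[OF chom_hom[OF amp_chom[OF f ms ns] h(2)] h(1)])
 fix t assume "t < length ks"
 hence t: "t < length ns" using h(2) by simp
 show "sim (A [1]) (%x. amp ns ms f (mv 0 t x)) (%x. h (mv 0 t x))"
  by (rule sim_cong[OF s[OF t]]) (use amp_corner[OF f ms ns t A_sub_C[THEN subsetD]] in auto)
qed

lemma amplify_cong:
 assumes "!!z. z:A ns ==> ph (ent z) = ent (f z)" "y:upto E (length ns)"
 shows "amplify ns ms ph (ent y) = amplify ns ms (elift f) (ent y)"
 unfolding amplify_def block_ent
 by (intro ext) (simp add: assms(1)[OF block_mats(1)[OF assms(2)]])

lemma rep_by_amplify:
 assumes f: "rep_by ns f ph" "f ` A ns <= A ms" and ms: "valid_sizes ms" and ns: "valid_sizes ns"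
  and h: "rep_by ks h ps" "h ` A ks <= upto E (length ns)"
 shows "rep_by ks (%x. amp ns ms f (h x)) (amplify ns ms ph o ps)"
 unfolding rep_by_def
proof (intro conjI ballI)
 have f': "hom ns f" "!!z. z:A ns ==> ph (ent z) = ent (f z)"
  and h': "hom ks h" "!!z. z:A ks ==> ps (ent z) = ent (h z)" using f h by (auto simp: rep_by_def)
 show "hom ks (%x. amp ns ms f (h x))"
 proof -
  note g = amp_chom[OF f'(1) f(2) ms ns]
  have fC: "h x:upto CE (length ns)" if "x:C ks" for x
  proof -
   have u: "h (unitm ks):upto CE (length ns)"
    using h(2) E.unitm_in upto_mono[OF E_sub_CE] by blast
   have "h x = h (unitm ks) * h x" using hom_unit(4)[OF h'(1) that] by simp
   thus ?thesis using CE.upto_closed(4)[OF u homD(2)[OF h'(1) that]] by simp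
  qed
  have "shom (C ks) (%x. amp ns ms f (h x))" unfolding shom_def
   using shomD[OF homD(1)[OF h'(1)]] shomD[OF chomD(1)[OF g]] fC by simp
  moreover have "(%x. amp ns ms f (h x)) ` C ks <= full CE"
   using upto_full[OF chomD(2)[OF g fC]] by blast
  moreover have "(%x. amp ns ms f (h x)) ` A ks <= full E"
   using upto_full[OF chomD(3)[OF g]] h(2) by blast
  ultimately show ?thesis by (simp add: hom_def)
 qed
 fix x assume x: "x:A ks"
 hence hx: "h x:upto E (length ns)" using h(2) by blast
 have hC: "h x:upto CE (length ns)" using hx upto_mono[OF E_sub_CE] by blast
 have fC: "f ` C ns <= C ms" using hom_range[OF f'(1) f(2)] by blast
 show "(amplify ns ms ph o ps) (ent x) = ent (amp ns ms f (h x))"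
  using h'(2)[OF x] amplify_cong[of ns ph f "h x" ms, OF f'(2) hx] ent_amp[OF homD(1)[OF f'(1)] fC ms ns hC] by simp
qed

end

section \<open>Classes of maps and the operations on them\<close>

context closed_fam
begin

text \<open>\<open>tilde_family\<close> tests partial maps on whole matrix summands, the right-hand
  side only on their corners. Passing to a corner is composition with a corner inclusion; in the
  other direction the partial map is equivalent to the amplification of its restriction to the
  corner.\<close>

lemma tilde_iff:
 assumes ns: "valid_sizes ns" and ms: "valid_sizes ms"
 shows "ph:tilde_family E F ns ms \<longleftrightarrow>
  (EX f. rep_by ns f ph & f ` A ns <= A ms & (ALL t<length ns. (%x. f (mv 0 t x)):T1))"
proof -
 have pm: "partial_map t s ph (ent x) = ent (mv s 0 (f (mv 0 t x)))"
  if "rep_by ns f ph" "t < length ns" "x:A [ns ! t]" for f t s x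
 proof -
  have "mv 0 t x:A ns" by (rule mv_mats[OF E.opr_axioms that(3,2)])
  thus ?thesis using that(1) by (simp add: partial_map_def rep_by_def flip: mv.rep_eq)
 qed
 show ?thesis
 proof
  assume L: "ph:tilde_family E F ns ms"
  then obtain f where f: "rep_by ns f ph" "f ` A ns <= A ms"
   using star_extendible_iff by (auto simp: tilde_family_def)
  have hf: "hom ns f" using f(1) by (simp add: rep_by_def)
  have "(%x. f (mv 0 t x)):T1" if t: "t < length ns" for t
  proof -
   have n: "1 <= ns ! t" "0 < ns ! t" using valid_sizesD[OF ns t] by simp_all
   have h1: "hom [1] (%x. f (mv 0 t x))" by (rule hom_comp_mv[OF hf t n(1)])
   have fA: "f (mv 0 t x):A ms" if "x:A [1]" for x
    using mv_mats[OF E.opr_axioms _ t] mats_single_mono[OF n(1)] that f(2) by blast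
   have "(%x. mv s 0 (f (mv 0 t x))):FM" for s
   proof (cases "s < length ms")
    case True
    let ?q = "%x. mv s 0 (f (mv 0 t x))"
    have m: "0 < ms ! s" using valid_sizesD[OF ms True] .
    \<comment> \<open>The inclusion of E as a corner is the identity of E regarded as a map into a
      larger target.\<close>
    have "(%x. x):F 1 (ns ! t)"
     by (rule F_corner[OF _ _ n(1), THEN iffD1, THEN conjunct1]) (simp_all add: F_id)
    moreover have "partial_map t s ph:F (ns ! t) (ms ! s)"
     using L t True by (simp add: tilde_family_def)
    ultimately have F1: "partial_map t s ph o (%x. x):F 1 (ms ! s)"
     by (intro F_comp[OF _ n(2) m]) simp_all
    have hq: "hom [1] ?q" by (rule hom_mv[OF h1])
    have qA: "?q ` A [1] <= A [ms ! s]" using mv_mats_back[OF E.opr_axioms fA True] by blast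
    have r: "rep_by [1] ?q (partial_map t s ph o (%x. x))"
     unfolding rep_by_def
     using hq pm[OF f(1) t] mats_single_mono[OF n(1)] by auto
    have "elift ?q:F 1 (ms ! s)"
     by (rule F_sim[OF _ m F1 r qA m rep_by_elift[OF hq] qA hom_sim_refl[OF hq]]) simp
    thus ?thesis using hq qA m unfolding FM_def by blast
   next
    \<comment> \<open>Beyond the summands of the range the component is the zero map, which belongs
      to the family.\<close>
    case False
    have z: "mv s 0 (f (mv 0 t x)) = 0" if "x:A [1]" for x
    proof (rule mat_eqI)
     fix i j k
     have "ent (f (mv 0 t x)) s j k = 0" using fA[OF that] False unfolding mats_def by blast
     thus "ent (mv s 0 (f (mv 0 t x))) i j k = ent 0 i j k" by (simp add: ent_mv)
    qed
    have s0: "sim (A [1]) (%x. 0) (%x. mv s 0 (f (mv 0 t x)))"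
     by (rule sim_cong[OF hom_sim_refl[OF FM_hom[OF FM_zero]]]) (simp_all add: z)
    show ?thesis
     by (rule FM_sim[OF FM_zero hom_mv[OF h1] mv_0_upto[OF homD(3)[OF h1] E.opr_axioms] s0])
   qed
   thus ?thesis using h1 by (simp add: T1_def)
  qed
  thus "EX f. rep_by ns f ph & f ` A ns <= A ms & (ALL t<length ns. (%x. f (mv 0 t x)):T1)"
   using f by blast
 next
  assume "EX f. rep_by ns f ph & f ` A ns <= A ms & (ALL t<length ns. (%x. f (mv 0 t x)):T1)"
  then obtain f where f: "rep_by ns f ph" "f ` A ns <= A ms"
   and T: "!!t. t < length ns ==> (%x. f (mv 0 t x)):T1" by blast
  have hf: "hom ns f" using f(1) by (simp add: rep_by_def)
  have "partial_map t s ph:F (ns ! t) (ms ! s)" if t: "t < length ns" and s: "s < length ms" for t s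
  proof -
   let ?q = "%x. mv s 0 (f (mv 0 t x))"
   let ?n = "ns ! t"
   have n: "1 <= ?n" "0 < ?n" using valid_sizesD[OF ns t] by simp_all
   have m: "0 < ms ! s" using valid_sizesD[OF ms s] .
   have qF: "?q:FM" by (rule T1_FM[OF T[OF t]])
   then obtain m' where m': "0 < m'" "?q ` A [1] <= A [m']" "elift ?q:F 1 m'" by (auto simp: FM_def)
   have h1: "hom [1] ?q" by (rule FM_hom[OF qF])
   have hn: "hom [?n] ?q" by (rule hom_mv[OF hom_comp_mv[OF hf t order_refl]])
   have v: "valid_sizes [m']" "valid_sizes [1]" using valid_sizes_one m'(1) by simp_all
   have "amplify [1] [m'] (elift ?q):F (?n * 1) (?n * m')"
    by (rule F_amplify[OF _ m'(1) n(2) m'(3)]) simp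
   hence Fa: "amplify [1] [m'] (elift ?q):F ?n (?n * m')" by simp
   have ca: "chom 1 1 (amp [1] [m'] ?q)" using amp_chom[OF h1 m'(2) v] by (simp add: One_nat_def)
   have ha: "hom [?n] (amp [1] [m'] ?q)" by (rule chom_hom[OF ca]) (simp add: One_nat_def)
   have qC: "?q ` C [1] <= C [m']" using hom_range[OF h1 m'(2)] by blast
   have ra: "rep_by [?n] (amp [1] [m'] ?q) (amplify [1] [m'] (elift ?q))"
    unfolding rep_by_def
   proof (intro conjI ballI ha)
    fix x assume "x:A [?n]"
    hence "x:upto CE 1" using mats_single A_sub_C by blast
    thus "amplify [1] [m'] (elift ?q) (ent x) = ent (amp [1] [m'] ?q x)"
     by (intro ent_amp[OF homD(1)[OF h1] qC v, symmetric]) (simp add: One_nat_def)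
   qed
   have aA: "amp [1] [m'] ?q ` A [?n] <= A [?n * m']"
    using amp_mats(2)[OF homD(1)[OF h1] qC m'(2) v(1), of _ ?n] by (auto simp: tensor_one)
   have sim: "sim (A [?n]) (amp [1] [m'] ?q) ?q"
   proof (rule sim_amp[OF h1 m'(2) v hn])
    fix t' assume "t' < length [1::nat]"
    hence "t' = 0" by simp
    have "sim (A [1]) (%x. ?q (mv 0 0 x)) (%x. ?q (mv 0 0 x))"
     by (rule sim_cong[OF hom_sim_refl[OF h1]]) (simp_all add: mv_0_0[OF mats_single])
    thus "sim (A [1]) (%x. ?q (mv 0 t' x)) (%x. ?q (mv 0 t' x))" using \<open>t' = 0\<close> by simp
   qed simp
   have qA: "?q ` A [?n] <= A [ms ! s]"
    using mv_mats_back[OF E.opr_axioms _ s] f(2) mv_mats[OF E.opr_axioms _ t] by blast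
   have rq: "rep_by [?n] ?q (partial_map t s ph)"
    unfolding rep_by_def using hn pm[OF f(1) t] by blast
   show ?thesis
    by (rule F_sim[OF n(2) _ Fa ra aA m rq qA sim]) (use n(2) m'(1) in simp)
  qed
  thus "ph:tilde_family E F ns ms"
   using f star_extendible_iff by (auto simp: tilde_family_def)
 qed
qed

text \<open>Representatives for the elements of the semigroup of any elementary algebra with r
  summands.\<close>

definition TV :: "nat => ('h mat => 'h mat) set" where
 "TV r = {ps:T1. ps ` A [1] <= upto E r}"

lemma TV_hom: "ps:TV r ==> hom [1] ps" by (simp add: TV_def T1_hom)
lemma TV_T1: "ps:TV r ==> ps:T1" by (simp add: TV_def)
lemma TV_upto: "ps:TV r ==> ps ` A [1] <= upto E r" by (simp add: TV_def)
lemma TV_refl: "ps:TV r ==> sim (A [1]) ps ps" by (rule hom_sim_refl[OF TV_hom])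

lemma TV_cong:
 assumes "ps:TV r" "hom [1] ka" "!!x. x:A [1] ==> ps x = ka x" shows "ka:TV r"
proof -
 have "sim (A [1]) ps ka" by (rule sim_cong[OF TV_refl[OF assms(1)]]) (simp_all add: assms(3))
 hence "ka:T1" by (rule T1_sim[OF TV_T1[OF assms(1)] assms(2)])
 moreover have "ka ` A [1] <= upto E r" using TV_upto[OF assms(1)] assms(3) by (simp add: image_subset_iff)
 ultimately show ?thesis by (simp add: TV_def)
qed

lemma V_maps_iff:
 assumes ns: "valid_sizes ns"
 shows "ph:V_maps E F ns \<longleftrightarrow> (EX ps:TV (length ns). rep_by [1] ps ph)"
proof
 assume "ph:V_maps E F ns"
 then obtain N where N: "0 < N" "ph:tilde_family E F [1] (ts N ns)" by (auto simp: V_maps_def)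
 then obtain f where f: "rep_by [1] f ph" "f ` A [1] <= A (ts N ns)" "(%x. f (mv 0 0 x)):T1"
  unfolding tilde_iff[OF valid_sizes_one(1) valid_tensor[OF ns N(1)]] by (auto simp: One_nat_def)
 have hf: "hom [1] f" using f(1) by (simp add: rep_by_def)
 have "sim (A [1]) (%x. f (mv 0 0 x)) f"
  by (rule sim_cong[OF hom_sim_refl[OF hf]]) (simp_all add: mv_0_0[OF mats_single])
 hence "f:T1" by (rule T1_sim[OF f(3) hf])
 moreover have "f ` A [1] <= upto E (length ns)"
  using f(2) mats_upto[of _ E "ts N ns"] by auto
 ultimately show "EX ps:TV (length ns). rep_by [1] ps ph" using f(1) by (auto simp: TV_def)
next
 assume "EX ps:TV (length ns). rep_by [1] ps ph"
 then obtain f where f: "f:TV (length ns)" "rep_by [1] f ph" by blast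
 have hf: "hom [1] f" by (rule TV_hom[OF f(1)])
 obtain N where N: "0 < N" "f ` A [1] <= A (ts N ns)"
  using hom_into_mats[OF hf TV_upto[OF f(1)] ns] by blast
 have s0: "sim (A [1]) f (%x. f (mv 0 0 x))"
  by (rule sim_cong[OF hom_sim_refl[OF hf]]) (simp_all add: mv_0_0[OF mats_single])
 have "(%x. f (mv 0 0 x)):T1"
  by (rule T1_sim[OF TV_T1[OF f(1)] hom_comp_mv[OF hf] s0]) simp_all
 hence "ph:tilde_family E F [1] (ts N ns)"
  unfolding tilde_iff[OF valid_sizes_one(1) valid_tensor[OF ns N(1)]] using f(2) N(2)
  by (intro exI[of _ f]) simp
 thus "ph:V_maps E F ns" using N(1) by (auto simp: V_maps_def)
qed

text \<open>The classes depend on \<open>ns\<close> only through its length, because \<open>B \<otimes> \<K>\<close> does.\<close>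

definition vc :: "nat => ('h mat => 'h mat) => ('h elt => 'h elt) set" where
 "vc r ps = {om. EX ka:TV r. rep_by [1] ka om & sim (A [1]) ps ka}"

lemma V_class_eq:
 assumes ns: "valid_sizes ns" and ps: "ps:TV (length ns)" "rep_by [1] ps ph"
 shows "V_class E F ns ph = vc (length ns) ps"
proof (intro set_eqI iffI)
 fix om assume "om:V_class E F ns ph"
 hence om: "om:V_maps E F ns" "inner_unitarily_equivalent (elem E [1]) (stab E ns) om ph"
  by (simp_all add: V_class_def)
 then obtain ka where ka: "ka:TV (length ns)" "rep_by [1] ka om" using V_maps_iff[OF ns] by blast
 have "sim (A [1]) ps ka"
  by (rule inner_unitarily_equivalent_stab[OF ps(2) TV_upto[OF ps(1)] ka(2) TV_upto[OF ka(1)] ns, THEN iffD1, OF om(2)])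
 thus "om:vc (length ns) ps" using ka by (auto simp: vc_def)
next
 fix om assume "om:vc (length ns) ps"
 then obtain ka where ka: "ka:TV (length ns)" "rep_by [1] ka om" "sim (A [1]) ps ka" by (auto simp: vc_def)
 have "inner_unitarily_equivalent (elem E [1]) (stab E ns) om ph"
  by (rule inner_unitarily_equivalent_stab[OF ps(2) TV_upto[OF ps(1)] ka(2) TV_upto[OF ka(1)] ns, THEN iffD2, OF ka(3)])
 moreover have "om:V_maps E F ns" using V_maps_iff[OF ns] ka(1,2) by blast
 ultimately show "om:V_class E F ns ph" by (simp add: V_class_def)
qed

lemma vc_self: "ps:TV r ==> elift ps:vc r ps"
 unfolding vc_def mem_Collect_eq
 by (rule bexI[of _ ps]) (simp_all add: rep_by_elift TV_hom TV_refl)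

lemma vc_cong: "sim (A [1]) ps ka ==> vc r ps = vc r ka"
 unfolding vc_def using sim_trans sim_sym by blast

lemma vc_eq_iff:
 assumes "ps:TV r" "ka:TV r" shows "vc r ps = vc r ka \<longleftrightarrow> sim (A [1]) ps ka"
proof
 assume "vc r ps = vc r ka"
 hence "elift ka:vc r ps" using vc_self[OF assms(2)] by simp
 then obtain ka' where ka': "rep_by [1] ka' (elift ka)" "sim (A [1]) ps ka'" by (auto simp: vc_def)
 have "ka' x = ka x" if "x:A [1]" for x
  using ka'(1) that by (simp add: rep_by_def ent_inject)
 thus "sim (A [1]) ps ka" by (intro sim_cong[OF ka'(2)]) simp_all
qed (rule vc_cong)

lemma V_elem_eq: assumes "valid_sizes ns" shows "V_elem E F ns = vc (length ns) ` TV (length ns)"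
proof (intro set_eqI iffI)
 fix X assume "X:V_elem E F ns"
 then obtain ph where ph: "ph:V_maps E F ns" "X = V_class E F ns ph" by (auto simp: V_elem_def)
 then obtain ps where "ps:TV (length ns)" "rep_by [1] ps ph" using V_maps_iff[OF assms] by blast
 thus "X:vc (length ns) ` TV (length ns)" using V_class_eq[OF assms] ph(2) by blast
next
 fix X assume "X:vc (length ns) ` TV (length ns)"
 then obtain ps where ps: "ps:TV (length ns)" "X = vc (length ns) ps" by blast
 have r: "rep_by [1] ps (elift ps)" by (rule rep_by_elift[OF TV_hom[OF ps(1)]])
 hence "elift ps:V_maps E F ns" using V_maps_iff[OF assms] ps(1) by blast
 thus "X:V_elem E F ns" unfolding V_elem_def using V_class_eq[OF assms ps(1) r] ps(2) by blast
qed

lemma vc_memberE: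
 assumes "ps0:vc r ps"
 obtains ps1 where "ps1:TV r" "rep_by [1] ps1 ps0" "sim (A [1]) ps ps1"
 using assms by (auto simp: vc_def)

lemma maps_into_iff:
 assumes "rep_by [1] ps ph" shows "maps_into E ms ph \<longleftrightarrow> ps ` A [1] <= A ms"
proof -
 have "ph ` ent ` A [1] = ent ` ps ` A [1]"
  using assms by (simp add: rep_by_def image_image)
 moreover have "inj (ent :: 'h mat => _)" by (rule injI) (simp add: ent_inject)
 ultimately show ?thesis unfolding maps_into_def elem_simps(1) by (simp add: inj_image_subset_iff)
qed

lemma TV_add:
 assumes "ps:TV r" "om:TV r" "ps u1 * om u1 = 0"
 shows "(%x. ps x + om x):TV r"
 using T1_add[OF TV_T1[OF assms(1)] TV_T1[OF assms(2)] assms(3)] TV_upto[OF assms(1)] TV_upto[OF assms(2)]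
  E.upto_closed(2) by (simp add: TV_def image_subset_iff)

text \<open>The union in \<open>V_add\<close> has a single member: a block sum is ps1 plus a copy of
  om1 moved beyond its range, and \<open>sim_add\<close> makes this equivalent to every sum of
  orthogonal representatives. Thus addition of classes becomes pointwise addition.\<close>

lemma V_add_vc:
 assumes ns: "valid_sizes ns" "r = length ns" and ps: "ps:TV r" and om: "om:TV r"
  and ps': "ps':TV r" "sim (A [1]) ps ps'" and om': "om':TV r" "sim (A [1]) om om'"
  and orth: "ps' u1 * om' u1 = 0"
 shows "V_add E F ns (vc r ps) (vc r om) = vc r (%x. ps' x + om' x)"
 unfolding V_add_def
proof (rule Union_constant)
 obtain N where N: "0 < N" "ps ` A [1] <= A (ts N ns)"
  using hom_into_mats[OF TV_hom[OF ps] _ ns(1)] TV_upto[OF ps] ns(2) by blast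
 hence "maps_into E (ts N ns) (elift ps)"
  using maps_into_iff[OF rep_by_elift[OF TV_hom[OF ps]]] by blast
 thus "{V_class E F ns (%x. block_sum (ts N ns) (ps' x) (om' x)) |N ps' om'.
   ps':vc r ps & om':vc r om & 0 < N & maps_into E (ts N ns) ps'} ~= {}"
  using vc_self[OF ps] vc_self[OF om] N(1) by blast
next
 fix Z
 assume "Z:{V_class E F ns (%x. block_sum (ts N ns) (ps' x) (om' x)) |N ps' om'.
   ps':vc r ps & om':vc r om & 0 < N & maps_into E (ts N ns) ps'}"
 then obtain N ps0 om0 where Z: "Z = V_class E F ns (%x. block_sum (ts N ns) (ps0 x) (om0 x))"
  and m: "ps0:vc r ps" "om0:vc r om" "0 < N" "maps_into E (ts N ns) ps0" by blast
 obtain ps1 where ps1: "ps1:TV r" "rep_by [1] ps1 ps0" "sim (A [1]) ps ps1" using vc_memberE[OF m(1)] .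
 obtain om1 where om1: "om1:TV r" "rep_by [1] om1 om0" "sim (A [1]) om om1" using vc_memberE[OF m(2)] .
 note h1 = TV_hom[OF ps1(1)] and k1 = TV_hom[OF om1(1)]
 have p: "ps1 ` A [1] <= A (ts N ns)" using maps_into_iff[OF ps1(2)] m(4) by blast
 obtain M where M: "0 < M" "om1 ` A [1] <= A (ts M ns)"
  using hom_into_mats[OF k1 _ ns(1)] TV_upto[OF om1(1)] ns(2) by blast
 let ?ms = "ts N ns" and ?ks = "ts M ns"
 define w where "w = (offset ?ms ?ks :: 'h mat)"
 have w: "w:full E" "star w:full E" "star w * w = unitm ?ks"
  unfolding w_def by (rule E.offset_full star_offset_offset)+
 have omC: "om1 x:C ?ks" if "x:C [1]" for x by (rule hom_range[OF k1 M(2) that])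
 define om2 where "om2 x = w * om1 x * star w" for x
 have k2: "hom [1] om2" unfolding om2_def[abs_def]
  by (rule hom_conj[OF k1 w(1,2)]) (simp add: w(3) unitm_mats(2)[OF omC])
 have s2: "sim (A [1]) om1 om2" unfolding sim_def om2_def
  by (rule bexI[OF _ w(1)]) (simp add: w(2,3) unitm_mats[OF omC[OF A_sub_C[THEN subsetD]]])
 have "om2 ` A [1] <= upto E r"
  unfolding om2_def w_def using offset_upto[OF E.opr_axioms] TV_upto[OF om1(1)] by blast
 hence om2: "om2:TV r" using T1_sim[OF TV_T1[OF om1(1)] k2 s2] by (simp add: TV_def)
 have pu: "ps1 u1:A ?ms" using p E.unitm_in by blast
 have o2: "ps1 u1 * om2 u1 = 0"
  unfolding om2_def w_def mult.assoc[symmetric] by (subst times_offset[OF pu]) simp_all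
 have t: "(%x. ps1 x + om2 x):TV r" by (rule TV_add[OF ps1(1) om2 o2])
 have rep: "rep_by [1] (%x. ps1 x + om2 x) (%x. block_sum ?ms (ps0 x) (om0 x))"
  unfolding rep_by_def
 proof (intro conjI ballI TV_hom[OF t])
  fix x assume x: "x:A [1]"
  have "ps1 x:A ?ms" "om1 x:A ?ks" using x p M(2) by blast+
  from block_sum_offset[OF this] show "block_sum ?ms (ps0 (ent x)) (om0 (ent x)) = ent (ps1 x + om2 x)"
   using ps1(2) om1(2) x by (simp add: rep_by_def om2_def w_def)
 qed
 have "sim (A [1]) (%x. ps1 x + om2 x) (%x. ps' x + om' x)"
  by (rule sim_add[OF h1 k2 sim_trans[OF sim_sym[OF ps1(3)] ps'(2)]
   sim_trans[OF sim_sym[OF s2] sim_trans[OF sim_sym[OF om1(3)] om'(2)]]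
   TV_hom[OF ps'(1)] TV_hom[OF om'(1)] o2 orth])
 hence "vc r (%x. ps1 x + om2 x) = vc r (%x. ps' x + om' x)" by (rule vc_cong)
 thus "Z = vc r (%x. ps' x + om' x)"
  unfolding Z using V_class_eq[OF ns(1) t[unfolded ns(2)] rep] ns(2) by simp
qed

text \<open>The range of ps has finite size, so conjugation by an \<open>offset\<close> moves om
  beyond it without leaving its class.\<close>

lemma TV_orthogonal:
 assumes ns: "valid_sizes ns" "r = length ns" and ps: "ps:TV r" and om: "om:TV r"
 shows "EX om':TV r. sim (A [1]) om om' & ps u1 * om' u1 = 0"
proof -
 obtain N where N: "0 < N" "ps ` A [1] <= A (ts N ns)"
  using hom_into_mats[OF TV_hom[OF ps] _ ns(1)] TV_upto[OF ps] ns(2) by blast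
 obtain M where M: "0 < M" "om ` A [1] <= A (ts M ns)"
  using hom_into_mats[OF TV_hom[OF om] _ ns(1)] TV_upto[OF om] ns(2) by blast
 let ?ms = "ts N ns" and ?ks = "ts M ns"
 note k1 = TV_hom[OF om]
 define w where "w = (offset ?ms ?ks :: 'h mat)"
 have w: "w:full E" "star w:full E" "star w * w = unitm ?ks"
  unfolding w_def by (rule E.offset_full star_offset_offset)+
 have omC: "om x:C ?ks" if "x:C [1]" for x by (rule hom_range[OF k1 M(2) that])
 define om2 where "om2 x = w * om x * star w" for x
 have k2: "hom [1] om2" unfolding om2_def[abs_def]
  by (rule hom_conj[OF k1 w(1,2)]) (simp add: w(3) unitm_mats(2)[OF omC])
 have s2: "sim (A [1]) om om2" unfolding sim_def om2_def
  by (rule bexI[OF _ w(1)]) (simp add: w(2,3) unitm_mats[OF omC[OF A_sub_C[THEN subsetD]]])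
 have "om2 ` A [1] <= upto E r"
  unfolding om2_def w_def using offset_upto[OF E.opr_axioms] TV_upto[OF om] by blast
 hence om2: "om2:TV r" using T1_sim[OF TV_T1[OF om] k2 s2] by (simp add: TV_def)
 have pu: "ps u1:A ?ms" using N(2) E.unitm_in by blast
 have "ps u1 * om2 u1 = 0"
  unfolding om2_def w_def mult.assoc[symmetric] by (subst times_offset[OF pu]) simp_all
 thus ?thesis using om2 s2 by blast
qed

lemma TV_comp:
 assumes "smap r r' g" "ps:TV r" shows "(%x. g (ps x)):TV r'"
 using T1_comp[OF assms(1) TV_T1[OF assms(2)] TV_upto[OF assms(2)]]
  chomD(3)[OF smap_chom[OF assms(1)]] TV_upto[OF assms(2)] by (auto simp: TV_def)

text \<open>Two independent changes are combined. Maps with equivalent corners are equivalent on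
  every finite size, which replaces g by h; and h carries the partial isometry between ps and ka to
  one between their images.\<close>

lemma sim_smap:
 assumes g: "chom r r' g" and h: "chom r r' h"
  and gh: "!!t. t < r ==> sim (A [1]) (%x. g (mv 0 t x)) (%x. h (mv 0 t x))"
  and ps: "ps:TV r" and ka: "ka:TV r" and s: "sim (A [1]) ps ka" and r: "0 < r"
 shows "sim (A [1]) (%x. g (ps x)) (%x. h (ka x))"
proof -
 define ks where "ks = replicate r (1::nat)"
 have ks: "valid_sizes ks" "length ks = r" using r by (auto simp: ks_def valid_sizes_def)
 obtain N where N: "0 < N" "ps ` A [1] <= A (ts N ks)"
  using hom_into_mats[OF TV_hom[OF ps] _ ks(1)] TV_upto[OF ps] ks(2) by blast
 have "sim (A (ts N ks)) g h"
  by (rule sim_of_corners'[OF chom_hom[OF g] chom_hom[OF h]]) (use ks gh in auto)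
 hence 1: "sim (A [1]) (%x. g (ps x)) (%x. h (ps x))"
  using sim_comp[OF _ N(2)] by (simp add: comp_def)
 obtain w where w: "w:full E" "star w:full E" "star w * w = ps u1"
  "!!x. x:A [1] ==> ka x = w * ps x * star w" "w * ps u1 = w"
  using sim_hom_partial_isometry[OF TV_hom[OF ps] s] by metis
 have up: "ps u1:upto E r" using TV_upto[OF ps] E.unitm_in by blast
 note EC = upto_mono[OF E_sub_CE, THEN subsetD]
 \<comment> \<open>h is multiplicative only on the first r summands, so w has to be placed there; it
   is, being equal to \<open>w * ps u1\<close>.\<close>
 have wu: "w:upto E r" using E.upto_closed(5)[OF w(1) up] w(5) by simp
 have sw: "ps u1 * star w = star w"
  using arg_cong[OF w(5), of star] hom_unit(2)[OF TV_hom[OF ps]] by simp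
 have swu: "star w:upto E r" using E.upto_closed(4)[OF up w(2)] sw by simp
 have hw: "h (star w) = star (h w)" by (rule shomD(1)[OF chomD(1)[OF h] EC[OF wu]])
 note m = shomD(5)[OF chomD(1)[OF h]]
 have "sim (A [1]) (%x. h (ps x)) (%x. h (ka x))"
  unfolding sim_def
 proof (rule bexI[of _ "h w"], intro conjI ballI)
  show "h w:full E" "star (h w):full E"
   using upto_full[OF chomD(3)[OF h wu]] upto_full[OF chomD(3)[OF h swu]] hw by simp_all
  fix x assume x: "x:A [1]"
  have px: "ps x:upto E r" using TV_upto[OF ps] x by blast
  have ww: "star (h w) * h w = h (ps u1)"
   using m[OF EC[OF swu] EC[OF wu]] by (simp add: hw w(3))
  show "star (h w) * h w * h (ps x) = h (ps x)" "h (ps x) * (star (h w) * h w) = h (ps x)"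
   unfolding ww using m[OF EC[OF up] EC[OF px]] m[OF EC[OF px] EC[OF up]] hom_unit(6,7)[OF TV_hom[OF ps] x] by simp_all
  have wp: "w * ps x:upto E r" by (rule E.upto_closed(5)[OF w(1) px])
  show "h (ka x) = h w * h (ps x) * star (h w)"
   using m[OF EC[OF wp] EC[OF swu]] m[OF EC[OF wu] EC[OF px]] by (simp add: w(4)[OF x] hw)
 qed
 with 1 show ?thesis by (rule sim_trans)
qed

lemma smap_amp:
 assumes ns: "valid_sizes ns" and ms: "valid_sizes ms" and f: "hom ns f" "f ` A ns <= A ms"
  "!!t. t < length ns ==> (%x. f (mv 0 t x)):T1"
 shows "smap (length ns) (length ms) (amp ns ms f)"
proof -
 note c = amp_chom[OF f(1,2) ms ns]
 have "(%x. amp ns ms f (mv 0 t x)):T1" if t: "t < length ns" for t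
 proof (rule T1_sim[OF f(3)[OF t]])
  have n: "1 <= ns ! t" using valid_sizesD[OF ns t] by simp
  show "hom [1] (%x. amp ns ms f (mv 0 t x))" by (rule hom_comp_mv[OF chom_hom[OF c refl] t n])
  show "sim (A [1]) (%x. f (mv 0 t x)) (%x. amp ns ms f (mv 0 t x))"
   by (rule sim_cong[OF hom_sim_refl[OF T1_hom[OF f(3)[OF t]]]])
    (use amp_corner[OF f(1,2) ms ns t A_sub_C[THEN subsetD]] in auto)
 qed
 thus ?thesis using c by (simp add: smap_def)
qed

lemma length_pos: "valid_sizes ns ==> 0 < length ns" by (simp add: valid_sizes_def)

text \<open>By \<open>sim_smap\<close> the class of g composed with ps depends only on the corners
  of g. Hence every stable map whose corners are equivalent to those of f computes the induced
  map.\<close>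

lemma V_hat_vc:
 assumes ns: "valid_sizes ns" and ms: "valid_sizes ms" and f: "rep_by ns f ph" "f ` A ns <= A ms"
  "!!t. t < length ns ==> (%x. f (mv 0 t x)):T1"
  and g: "smap (length ns) (length ms) g"
  "!!t. t < length ns ==> sim (A [1]) (%x. f (mv 0 t x)) (%x. g (mv 0 t x))"
  and ps: "ps:TV (length ns)"
 shows "V_hat E F ns ms ph (vc (length ns) ps) = vc (length ms) (%x. g (ps x))"
 unfolding V_hat_def
proof (rule Union_constant)
 show "(%ps. V_class E F ms (amplify ns ms ph o ps)) ` vc (length ns) ps ~= {}"
  using vc_self[OF ps] by blast
 fix Z assume "Z:(%ps. V_class E F ms (amplify ns ms ph o ps)) ` vc (length ns) ps"
 then obtain ps0 where Z: "Z = V_class E F ms (amplify ns ms ph o ps0)" "ps0:vc (length ns) ps" by blast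
 obtain ps1 where ps1: "ps1:TV (length ns)" "rep_by [1] ps1 ps0" "sim (A [1]) ps ps1" using vc_memberE[OF Z(2)] .
 have hf: "hom ns f" using f(1) by (simp add: rep_by_def)
 note a = smap_amp[OF ns ms hf f(2,3)]
 note t = TV_comp[OF a ps1(1)]
 have "sim (A [1]) (%x. amp ns ms f (ps1 x)) (%x. g (ps x))"
 proof (rule sim_smap[OF smap_chom[OF a] smap_chom[OF g(1)] _ ps1(1) ps sim_sym[OF ps1(3)] length_pos[OF ns]])
  fix t assume t: "t < length ns"
  show "sim (A [1]) (%x. amp ns ms f (mv 0 t x)) (%x. g (mv 0 t x))"
   by (rule sim_cong[OF g(2)[OF t]]) (use amp_corner[OF hf f(2) ms ns t A_sub_C[THEN subsetD]] in auto)
 qed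
 hence "vc (length ms) (%x. amp ns ms f (ps1 x)) = vc (length ms) (%x. g (ps x))" by (rule vc_cong)
 thus "Z = vc (length ms) (%x. g (ps x))"
  using Z(1) V_class_eq[OF ms t rep_by_amplify[OF f(1,2) ms ns ps1(2) TV_upto[OF ps1(1)]]] by simp
qed

text \<open>The action amplifies a representative of the class of ps. A stable map equivalent to ps
  on E may take the place of this amplification, and then the action is plain composition.\<close>

lemma V_act_vc:
 assumes ns: "valid_sizes ns" "r = length ns" and ps: "ps:TV r" and th: "th:TV 1"
  and g: "smap 1 r g" "sim (A [1]) ps g"
 shows "V_act E F ns (vc r ps) (vc 1 th) = vc r (%x. g (th x))"
 unfolding V_act_def
proof (rule Union_constant)
 obtain N where N: "0 < N" "ps ` A [1] <= A (ts N ns)"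
  using hom_into_mats[OF TV_hom[OF ps] _ ns(1)] TV_upto[OF ps] ns(2) by blast
 hence "maps_into E (ts N ns) (elift ps)"
  using maps_into_iff[OF rep_by_elift[OF TV_hom[OF ps]]] by blast
 thus "{V_class E F ns (amplify [1] (ts N ns) ps' o th') |N ps' th'.
   ps':vc r ps & th':vc 1 th & 0 < N & maps_into E (ts N ns) ps'} ~= {}"
  using vc_self[OF ps] vc_self[OF th] N(1) by blast
next
 fix Z
 assume "Z:{V_class E F ns (amplify [1] (ts N ns) ps' o th') |N ps' th'.
   ps':vc r ps & th':vc 1 th & 0 < N & maps_into E (ts N ns) ps'}"
 then obtain N ps0 th0 where Z: "Z = V_class E F ns (amplify [1] (ts N ns) ps0 o th0)"
  and m: "ps0:vc r ps" "th0:vc 1 th" "0 < N" "maps_into E (ts N ns) ps0" by blast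
 obtain ps1 where ps1: "ps1:TV r" "rep_by [1] ps1 ps0" "sim (A [1]) ps ps1" using vc_memberE[OF m(1)] .
 obtain th1 where th1: "th1:TV 1" "rep_by [1] th1 th0" "sim (A [1]) th th1" using vc_memberE[OF m(2)] .
 let ?ms = "ts N ns"
 have p: "ps1 ` A [1] <= A ?ms" using maps_into_iff[OF ps1(2)] m(4) by blast
 note h1 = TV_hom[OF ps1(1)] and vm = valid_tensor[OF ns(1) m(3)]
 have len: "length [1::nat] = 1" "length ?ms = r" using ns(2) by (simp_all add: One_nat_def)
 have c0: "sim (A [1]) (%x. f (mv 0 t x)) f" if "hom [1] f" "t < 1" for f t
  by (rule sim_cong[OF hom_sim_refl[OF that(1)]]) (use that(2) in \<open>simp_all add: mv_0_0[OF mats_single]\<close>)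
 have "smap (length [1::nat]) (length ?ms) (amp [1] ?ms ps1)"
 proof (rule smap_amp[OF valid_sizes_one(1) vm h1 p])
  fix t assume "t < length [1::nat]"
  hence t: "t < 1" by (simp add: One_nat_def)
  show "(%x. ps1 (mv 0 t x)):T1"
   by (rule T1_sim[OF TV_T1[OF ps1(1)] hom_comp_mv[OF h1] sim_sym[OF c0[OF h1 t]]]) (use t in simp_all)
 qed
 hence a: "smap 1 r (amp [1] ?ms ps1)" unfolding len .
 note t = TV_comp[OF a th1(1)]
 have rep: "rep_by [1] (%x. amp [1] ?ms ps1 (th1 x)) (amplify [1] ?ms ps0 o th0)"
  by (rule rep_by_amplify[OF ps1(2) p vm valid_sizes_one(1) th1(2)]) (simp only: len(1) TV_upto[OF th1(1)])
 have hg: "hom [1] g" by (rule chom_hom[OF smap_chom[OF g(1)] len(1)])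
 have "sim (A [1]) (%x. amp [1] ?ms ps1 (th1 x)) (%x. g (th x))"
 proof (rule sim_smap[OF smap_chom[OF a] smap_chom[OF g(1)] _ th1(1) th sim_sym[OF th1(3)]])
  fix t :: nat assume t: "t < 1"
  have "sim (A [1]) (%x. ps1 (mv 0 t x)) (%x. g (mv 0 t x))"
   using sim_trans[OF c0[OF h1 t] sim_trans[OF sim_sym[OF ps1(3)] sim_trans[OF g(2) sim_sym[OF c0[OF hg t]]]]] .
  thus "sim (A [1]) (%x. amp [1] ?ms ps1 (mv 0 t x)) (%x. g (mv 0 t x))"
   by (rule sim_cong) (use amp_corner[OF h1 p vm valid_sizes_one(1) _ A_sub_C[THEN subsetD], of t] t len in auto)
 qed simp
 hence "vc r (%x. amp [1] ?ms ps1 (th1 x)) = vc r (%x. g (th x))" by (rule vc_cong)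
 thus "Z = vc r (%x. g (th x))"
  unfolding Z using V_class_eq[OF ns(1) t[unfolded ns(2)] rep] ns(2) by simp
qed

text \<open>The amplification of ps is stable and agrees with ps on E.\<close>

lemma exists_smap:
 assumes ns: "valid_sizes ns" "r = length ns" and ps: "ps:TV r"
 shows "EX g. smap 1 r g & sim (A [1]) ps g"
proof -
 obtain N where N: "0 < N" "ps ` A [1] <= A (ts N ns)"
  using hom_into_mats[OF TV_hom[OF ps] _ ns(1)] TV_upto[OF ps] ns(2) by blast
 note h1 = TV_hom[OF ps] and vm = valid_tensor[OF ns(1) N(1)]
 have len: "length [1::nat] = 1" "length (ts N ns) = r" using ns(2) by (simp_all add: One_nat_def)
 have "smap (length [1::nat]) (length (ts N ns)) (amp [1] (ts N ns) ps)"
 proof (rule smap_amp[OF valid_sizes_one(1) vm h1 N(2)])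
  fix t assume "t < length [1::nat]"
  hence t: "t = 0" by (simp add: One_nat_def)
  have s0: "sim (A [1]) ps (%x. ps (mv 0 t x))"
   by (rule sim_cong[OF hom_sim_refl[OF h1]]) (simp_all add: t mv_0_0[OF mats_single])
  show "(%x. ps (mv 0 t x)):T1"
   by (rule T1_sim[OF TV_T1[OF ps] hom_comp_mv[OF h1] s0]) (use t in simp_all)
 qed
 hence 1: "smap 1 r (amp [1] (ts N ns) ps)" unfolding len .
 have "amp [1] (ts N ns) ps x = ps x" if "x:A [1]" for x
  by (rule amp_extends[OF homD(1)[OF h1] _ vm]) (use hom_range[OF h1 N(2)] A_sub_C that in auto)
 hence "sim (A [1]) ps (amp [1] (ts N ns) ps)"
  by (intro sim_cong[OF hom_sim_refl[OF h1]]) simp_all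
 thus ?thesis using 1 by blast
qed

lemma scale_elem_eq:
 assumes ns: "valid_sizes ns"
 shows "scale_elem E F ns = vc (length ns) ` {ps:TV (length ns). ps ` A [1] <= A ns}"
proof (intro set_eqI iffI)
 fix X assume "X:scale_elem E F ns"
 then obtain ph where ph: "ph:V_maps E F ns" "X = V_class E F ns ph" "maps_into E ns ph" by (auto simp: scale_elem_def)
 then obtain ps where "ps:TV (length ns)" "rep_by [1] ps ph" using V_maps_iff[OF ns] by blast
 thus "X:vc (length ns) ` {ps:TV (length ns). ps ` A [1] <= A ns}"
  using V_class_eq[OF ns] ph(2,3) maps_into_iff by blast
next
 fix X assume "X:vc (length ns) ` {ps:TV (length ns). ps ` A [1] <= A ns}"
 then obtain ps where ps: "ps:TV (length ns)" "X = vc (length ns) ps" "ps ` A [1] <= A ns" by blast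
 have r: "rep_by [1] ps (elift ps)" by (rule rep_by_elift[OF TV_hom[OF ps(1)]])
 hence "elift ps:V_maps E F ns" using V_maps_iff[OF ns] ps(1) by blast
 thus "X:scale_elem E F ns" unfolding scale_elem_def
  using V_class_eq[OF ns ps(1) r] ps(2,3) maps_into_iff[OF r] by blast
qed

text \<open>Prescribed classes on the corners lift to a homomorphism: each class is realised by a
  stable map applied to its own summand, and the resulting maps are conjugated into orthogonal
  diagonal blocks before they are added.\<close>

lemma exists_hom_corners:
 assumes ns: "valid_sizes ns" and ms: "valid_sizes ms"
  and ps: "!!t. t < length ns ==> ps t:TV (length ms)"
 shows "EX f. hom ns f & f ` A ns <= upto E (length ms) \<and>
  (ALL t<length ns. sim (A [1]) (ps t) (%x. f (mv 0 t x)))"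
proof -
 let ?r = "length ms"
 have "EX g. t < length ns --> smap 1 ?r g & sim (A [1]) (ps t) g" for t
  using exists_smap[OF ms refl ps] by blast
 then obtain g where g: "!!t. t < length ns ==> smap 1 ?r (g t)" "!!t. t < length ns ==> sim (A [1]) (ps t) (g t)"
  by metis
 define k where "k t x = g t (mv t 0 x)" for t x
 have k: "hom ns (k t)" "k t ` A ns <= upto E ?r" if t: "t < length ns" for t
 proof -
  note c = smap_chom[OF g(1)[OF t]]
  have h: "hom ns (mv t 0)" by (rule hom_mv[OF hom_id])
  have up: "mv t 0 ` A ns <= upto E 1" using mv_0_upto[OF mats_full E.opr_axioms] by blast
  show "hom ns (k t)" using chom_comp_hom[OF c h up] by (simp add: k_def[abs_def])
  show "k t ` A ns <= upto E ?r" unfolding k_def using chomD(3)[OF c] up by blast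
 qed
 have "EX N. t < length ns --> 0 < N & k t ` A ns <= A (ts N ms)" for t
  using hom_into_mats[OF k(1) k(2) ms] by blast
 then obtain N where N: "!!t. t < length ns ==> k t ` A ns <= A (ts (N t) ms)" by metis
 \<comment> \<open>A common size for all ranges; \<open>Suc\<close> makes it positive, so that
   \<open>ts M ms\<close> is a valid list of sizes.\<close>
 define M where "M = Suc (\<Sum>t<length ns. N t)"
 have kM: "k t ` A ns <= A (ts M ms)" if t: "t < length ns" for t
 proof -
  have "N t <= (\<Sum>t<length ns. N t)" using t by (intro member_le_sum) auto
  hence "N t <= M" by (simp add: M_def)
  thus ?thesis using mats_tensor_mono N[OF t] by blast
 qed
 let ?ms = "ts M ms"
 have vm: "valid_sizes ?ms" by (rule valid_tensor[OF ms]) (simp add: M_def)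
 have kC: "k t x:C ?ms" if "t < length ns" "x:C ns" for t x
  by (rule hom_range[OF k(1)[OF that(1)] kM[OF that(1)] that(2)])
 define w where "w t = (shift ?ms t :: 'h mat)" for t
 have w: "w t:full E" "star (w t):full E" for t unfolding w_def by (rule E.shift_full)+
 have ww: "star (w t) * w t' = (if t = t' then unitm ?ms else 0)" for t t'
  unfolding w_def by (rule star_shift_shift[OF vm])
 define l where "l t x = w t * k t x * star (w t)" for t x
 have l: "hom ns (l t)" if t: "t < length ns" for t
  unfolding l_def[abs_def] by (rule hom_conj[OF k(1)[OF t] w]) (simp add: ww unitm_mats(2)[OF kC[OF t]])
 have lorth: "l t x * l t' y = 0" if "t ~= t'" for t t' x y
 proof -
  have "l t x * l t' y = w t * k t x * (star (w t) * w t') * k t' y * star (w t')"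
   by (simp add: l_def mult.assoc)
  thus ?thesis using that by (simp add: ww)
 qed
 define f where "f n x = (\<Sum>t<n. l t x)" for n x
 have hf: "hom ns (f n)" if "n <= length ns" for n
  using that
 proof (induction n)
  case 0
  thus ?case by (simp add: f_def[abs_def] hom_def shom_def E.full_closed CE.full_closed image_subset_iff)
 next
  case (Suc n)
  have "f n (unitm ns) * l n (unitm ns) = 0"
   unfolding f_def sum_distrib_right by (rule sum.neutral) (simp add: lorth)
  hence "hom ns (%x. f n x + l n x)" using Suc l by (intro hom_add) simp_all
  thus ?case by (simp add: f_def[abs_def])
 qed
 have lup: "l t x:upto E ?r" if "t < length ns" "x:A ns" for t x
  unfolding l_def using k(2)[OF that(1)] that(2)
  by (intro E.upto_closed(4,5) w) auto
 have "f n x:upto E ?r" if "n <= length ns" "x:A ns" for n x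
  using that by (induction n) (auto simp: f_def E.upto_closed(1,2) lup)
 hence fup: "f (length ns) ` A ns <= upto E ?r" by blast
 have "sim (A [1]) (ps t) (%x. f (length ns) (mv 0 t x))" if t: "t < length ns" for t
 proof -
  have n: "1 <= ns ! t" using valid_sizesD[OF ns t] by simp
  have mC: "mv 0 t x:C ns" if "x:A [1]" for x
   using mv_mats[OF CE.opr_axioms _ t] mats_single_mono[OF n] A_sub_C that by blast
  have "l t' (mv 0 t x) = 0" if "t' ~= t" "t' < length ns" "x:A [1]" for t' x
  proof -
   have "k t' (mv 0 t x) = g t' 0" using that(1) by (simp add: k_def mv_mv)
   also have "... = 0"
    by (rule shomD(7)[OF chomD(1)[OF smap_chom[OF g(1)[OF that(2)]]] CE.upto_closed(1)])
   finally show ?thesis by (simp add: l_def)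
  qed
  hence "f (length ns) (mv 0 t x) = (\<Sum>t'<length ns. if t' = t then l t (mv 0 t x) else 0)" if "x:A [1]" for x
   unfolding f_def using that by (intro sum.cong) auto
  hence fl: "f (length ns) (mv 0 t x) = l t (mv 0 t x)" if "x:A [1]" for x
   using that t by simp
  have kg: "k t (mv 0 t x) = g t x" if "x:A [1]" for x
   using mv_0_0[OF mats_single[OF that]] by (simp add: k_def mv_mv)
  have "sim (A [1]) (g t) (%x. f (length ns) (mv 0 t x))" unfolding sim_def
  proof (rule bexI[OF _ w(1)[of t]], intro conjI ballI)
   fix x assume x: "x:A [1]"
   have gC: "g t x:C ?ms" using kC[OF t mC[OF x]] kg[OF x] by simp
   show "star (w t) * w t * g t x = g t x" "g t x * (star (w t) * w t) = g t x"
    using unitm_mats[OF gC] by (simp_all add: ww)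
   show "f (length ns) (mv 0 t x) = w t * g t x * star (w t)"
    using fl[OF x] kg[OF x] by (simp add: l_def)
  qed (rule w)
  thus ?thesis using sim_trans[OF g(2)[OF t]] by blast
 qed
 thus ?thesis using hf[OF order_refl] fup by blast
qed

end

section \<open>Dimension modules\<close>

lemma connecting_refl [simp]: "connecting ph k k = id"
 by (simp add: connecting_def)

lemma conn_Suc: "k <= l ==> connecting ph k (Suc l) = ph l o connecting ph k l"
 by (simp add: connecting_def)

lemma conn_trans:
 assumes "k <= l" "l <= m" shows "connecting ph l m (connecting ph k l x) = connecting ph k m x"
 using assms(2)
proof (induction m rule: dec_induct)
 case (step m)
 thus ?case using assms(1) by (simp add: conn_Suc)
qed simp

context closed_fam
begin

lemma smap_id: "smap r r (%x. x)"
 by (simp add: smap_def chom_def shom_def T1_mv)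

lemma TV_mv: "t < r ==> mv 0 t:TV r"
 using mv_upto[OF E.opr_axioms mats_full] by (auto simp: TV_def T1_mv)

lemma smap_comp:
 assumes g: "smap r r' g" and h: "smap r' r'' h" shows "smap r r'' (%x. h (g x))"
proof -
 note cg = smap_chom[OF g] and ch = smap_chom[OF h]
 have "shom (upto CE r) (%x. h (g x))"
  unfolding shom_def using shomD[OF chomD(1)[OF cg]] shomD[OF chomD(1)[OF ch]] chomD(2)[OF cg] by simp
 hence "chom r r'' (%x. h (g x))" unfolding chom_def using chomD(2,3)[OF cg] chomD(2,3)[OF ch] by auto
 moreover have "(%x. h (g (mv 0 t x))):T1" if "t < r" for t
  by (rule TV_T1[OF TV_comp[OF h TV_comp[OF g TV_mv[OF that]]]])
 ultimately show ?thesis by (simp add: smap_def)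
qed

lemma sim_post:
 assumes "smap r r' g" "ps:TV r" "ka:TV r" "sim (A [1]) ps ka" "0 < r"
 shows "sim (A [1]) (%x. g (ps x)) (%x. g (ka x))"
 using smap_chom[OF assms(1)]
 by (rule sim_smap[OF _ smap_chom[OF assms(1)] TV_refl[OF TV_comp[OF assms(1) TV_mv]] assms(2-5)])

lemma TV_zero: "(%x. 0):TV r"
 by (auto simp: TV_def T1_zero E.upto_closed(1))

text \<open>Germs do not involve the sizes \<open>ns k\<close>, only the numbers \<open>r k\<close> of summands.\<close>

definition germ_eq :: "(nat => 'h mat => 'h mat) => nat => ('h mat => 'h mat) => nat => ('h mat => 'h mat) => bool" where
 "germ_eq g k ps l ka \<longleftrightarrow>
  (EX m>=max k l. sim (A [1]) (%x. connecting g k m (ps x)) (%x. connecting g l m (ka x)))"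

definition gm :: "(nat => nat) => (nat => 'h mat => 'h mat) => nat => ('h mat => 'h mat) => 'h dim_elt" where
 "gm r g k ps = {(l, Y). EX ka:TV (r l). Y = vc (r l) ka & germ_eq g k ps l ka}"

lemma V_elem_one: "V_elem E F [1] = vc 1 ` TV 1"
 using V_elem_eq[OF valid_sizes_one(1)] by (simp add: One_nat_def)

end

text \<open>A direct system whose connecting maps are given as stable maps. Such a g acts on every
  matrix size at once and is shared by the system and its tensor products with matrix
  algebras.\<close>

locale dsys = closed_fam E F for E :: "('h::complex_hilbert \<Rightarrow>\<^sub>L 'h) set" and F :: "'h family" +
 fixes ns :: "nat => nat list" and ph :: "nat => 'h elt => 'h elt" and g :: "nat => 'h mat => 'h mat"
 assumes valid: "valid_sizes (ns k)"
  and rep: "rep_by (ns k) (g k) (ph k)"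
  and into: "g k ` A (ns k) <= A (ns (Suc k))"
  and stable: "smap (length (ns k)) (length (ns (Suc k))) (g k)"
begin

abbreviation "r == %k. length (ns k)"
abbreviation "cn == connecting g"
abbreviation "germ == gm r g"

lemma r_pos: "0 < r k" by (rule length_pos[OF valid])

lemma cn_stable: "k <= l ==> smap (r k) (r l) (cn k l)"
proof (induction l rule: dec_induct)
 case base show ?case using smap_id by (simp add: id_def)
next
 case (step l)
 show ?case using smap_comp[OF step.IH stable] step.hyps by (simp add: conn_Suc comp_def)
qed

lemma cn_A: "k <= l ==> cn k l ` A (ns k) <= A (ns l)"
proof (induction l rule: dec_induct)
 case (step l)
 thus ?case using into[of l] by (auto simp: conn_Suc)
qed simp

lemma hom_g: "hom (ns k) (g k)" using rep by (simp add: rep_by_def)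

lemma cn_hom: "k <= l ==> hom (ns k) (cn k l)"
 by (rule chom_hom[OF smap_chom[OF cn_stable] refl])

lemma cn_TV: "k <= l ==> ps:TV (r k) ==> (%x. cn k l (ps x)):TV (r l)"
 by (rule TV_comp[OF cn_stable])

lemma cn_sim:
 assumes "k <= l" "ps:TV (r k)" "ka:TV (r k)" "sim (A [1]) ps ka"
 shows "sim (A [1]) (%x. cn k l (ps x)) (%x. cn k l (ka x))"
 by (rule sim_post[OF cn_stable[OF assms(1)] assms(2-4) r_pos])

lemma V_connecting_vc:
 "k <= m ==> ps:TV (r k) ==> V_connecting E F ns ph k m (vc (r k) ps) = vc (r m) (%x. cn k m (ps x))"
proof (induction m rule: dec_induct)
 case base thus ?case by (simp add: V_connecting_def)
next
 case (step m)
 have T: "(%x. g m (mv 0 t x)):T1" if "t < r m" for t using stable that by (simp add: smap_def)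
 have "V_connecting E F ns ph k (Suc m) (vc (r k) ps) = V_hat E F (ns m) (ns (Suc m)) (ph m) (vc (r m) (%x. cn k m (ps x)))"
  using step by (simp add: V_connecting_def conn_Suc)
 also have "... = vc (r (Suc m)) (%x. g m (cn k m (ps x)))"
  by (rule V_hat_vc[OF valid valid rep into T stable hom_sim_refl[OF T1_hom[OF T]] cn_TV[OF step.hyps(1) step.prems]])
 finally show ?case using step.hyps(1) by (simp add: conn_Suc)
qed

lemma sim_later:
 assumes "k <= m" "l <= m" "m <= m'" "ps:TV (r k)" "ka:TV (r l)"
  "sim (A [1]) (%x. cn k m (ps x)) (%x. cn l m (ka x))"
 shows "sim (A [1]) (%x. cn k m' (ps x)) (%x. cn l m' (ka x))"
 using cn_sim[OF assms(3) cn_TV[OF assms(1,4)] cn_TV[OF assms(2,5)] assms(6)]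
 by (simp add: conn_trans[OF assms(1,3)] conn_trans[OF assms(2,3)])

lemma germ_eq_later:
 assumes "germ_eq g k ps l ka" "ps:TV (r k)" "ka:TV (r l)"
 shows "EX m0>=max k l. ALL m>=m0. sim (A [1]) (%x. cn k m (ps x)) (%x. cn l m (ka x))"
proof -
 obtain m where "m >= max k l" "sim (A [1]) (%x. cn k m (ps x)) (%x. cn l m (ka x))"
  using assms(1) by (auto simp: germ_eq_def)
 thus ?thesis using sim_later[of k m l _ ps ka] assms(2,3) by auto
qed

lemma germ_eq_refl: "ps:TV (r k) ==> germ_eq g k ps k ps"
 unfolding germ_eq_def by (rule exI[of _ k]) (simp add: TV_refl)

lemma germ_eq_sym: "germ_eq g k ps l ka ==> germ_eq g l ka k ps"
 unfolding germ_eq_def by (metis sim_sym max.commute)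

lemma germ_eq_trans:
 assumes "germ_eq g k ps l ka" "germ_eq g l ka m om" "ps:TV (r k)" "ka:TV (r l)" "om:TV (r m)"
 shows "germ_eq g k ps m om"
proof -
 obtain p where p: "p >= max k l" "!!q. q >= p ==> sim (A [1]) (%x. cn k q (ps x)) (%x. cn l q (ka x))"
  using germ_eq_later[OF assms(1,3,4)] by blast
 obtain p' where p': "p' >= max l m" "!!q. q >= p' ==> sim (A [1]) (%x. cn l q (ka x)) (%x. cn m q (om x))"
  using germ_eq_later[OF assms(2,4,5)] by blast
 have "sim (A [1]) (%x. cn k (max p p') (ps x)) (%x. cn m (max p p') (om x))"
  by (rule sim_trans[OF p(2) p'(2)]) simp_all
 thus ?thesis unfolding germ_eq_def using p(1) p'(1) by (intro exI[of _ "max p p'"]) auto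
qed

lemma V_germ_eq:
 assumes "ps:TV (r k)" shows "V_germ E F ns ph k (vc (r k) ps) = germ k ps"
proof -
 have "(EX m>=max k l. V_connecting E F ns ph k m (vc (r k) ps) = V_connecting E F ns ph l m (vc (r l) ka)) \<longleftrightarrow>
  germ_eq g k ps l ka" if "ka:TV (r l)" for l ka
 proof -
  have "V_connecting E F ns ph k m (vc (r k) ps) = V_connecting E F ns ph l m (vc (r l) ka) \<longleftrightarrow>
   sim (A [1]) (%x. cn k m (ps x)) (%x. cn l m (ka x))" if m: "m >= max k l" for m
   using V_connecting_vc[of k m ps] V_connecting_vc[of l m ka] vc_eq_iff[OF cn_TV[of k m ps] cn_TV[of l m ka]]
    assms \<open>ka:TV (r l)\<close> m by simp
  thus ?thesis unfolding germ_eq_def by blast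
 qed
 thus ?thesis unfolding V_germ_def gm_def V_elem_eq[OF valid] by auto
qed

lemma germ_iff:
 assumes "ps:TV (r k)" "ka:TV (r l)" shows "germ k ps = germ l ka \<longleftrightarrow> germ_eq g k ps l ka"
proof
 assume "germ k ps = germ l ka"
 moreover have "(l, vc (r l) ka):germ l ka" using germ_eq_refl[OF assms(2)] assms(2) by (auto simp: gm_def)
 ultimately have "(l, vc (r l) ka):germ k ps" by simp
 then obtain om where om: "om:TV (r l)" "vc (r l) ka = vc (r l) om" "germ_eq g k ps l om" by (auto simp: gm_def)
 have "sim (A [1]) om ka" using vc_eq_iff[OF assms(2) om(1)] om(2) sim_sym by blast
 hence "germ_eq g l om l ka" unfolding germ_eq_def by (intro exI[of _ l]) simp
 thus "germ_eq g k ps l ka" using germ_eq_trans[OF om(3) _ assms(1) om(1) assms(2)] by blast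
next
 assume e: "germ_eq g k ps l ka"
 have "germ_eq g k ps m om \<longleftrightarrow> germ_eq g l ka m om" if "om:TV (r m)" for m om
  using germ_eq_trans[OF e _ assms that] germ_eq_trans[OF germ_eq_sym[OF e] _ assms(2,1) that] by blast
 thus "germ k ps = germ l ka" unfolding gm_def by auto
qed

lemma germ_later:
 assumes "germ k ps = germ l ka" "ps:TV (r k)" "ka:TV (r l)"
 shows "EX m0>=max k l. ALL m>=m0. sim (A [1]) (%x. cn k m (ps x)) (%x. cn l m (ka x))"
 by (rule germ_eq_later[OF germ_iff[OF assms(2,3), THEN iffD1, OF assms(1)] assms(2,3)])

lemma germ_member:
 assumes "ps:TV (r k)" "(l, Y):germ k ps"
 obtains ka where "ka:TV (r l)" "Y = vc (r l) ka" "germ l ka = germ k ps"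
proof -
 obtain ka where ka: "ka:TV (r l)" "Y = vc (r l) ka" "germ_eq g k ps l ka" using assms(2) by (auto simp: gm_def)
 show ?thesis by (rule that[OF ka(1,2)]) (use germ_iff[OF assms(1) ka(1)] ka(3) in simp)
qed

lemma germ_self: "ps:TV (r k) ==> (k, vc (r k) ps):germ k ps"
 using germ_eq_refl by (auto simp: gm_def)

lemma germ_sim: "ps:TV (r k) ==> ka:TV (r k) ==> sim (A [1]) ps ka ==> germ k ps = germ k ka"
 by (subst germ_iff) (auto simp: germ_eq_def intro: exI[of _ k])

lemma germ_push:
 assumes "k <= l" "ps:TV (r k)" shows "germ l (%x. cn k l (ps x)) = germ k ps"
proof -
 have "germ_eq g l (%x. cn k l (ps x)) k ps" unfolding germ_eq_def
  using assms(1) TV_refl[OF cn_TV[OF assms]] by (intro exI[of _ l]) simp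
 thus ?thesis using germ_iff[OF cn_TV[OF assms] assms(2)] by blast
qed

lemma germ_eqI:
 assumes "ps:TV (r k)" "ka:TV (r l)" "k <= m" "l <= m" "sim (A [1]) (%x. cn k m (ps x)) (%x. cn l m (ka x))"
 shows "germ k ps = germ l ka"
 by (rule germ_iff[OF assms(1,2), THEN iffD2]) (use assms(3-5) in \<open>auto simp: germ_eq_def intro: exI[of _ m]\<close>)

lemma dim_module_eq: "dim_module E F ns ph = {germ k ps | k ps. ps:TV (r k)}"
 unfolding dim_module_def V_elem_eq[OF valid] using V_germ_eq by (auto, blast+)

lemma germ_in: "ps:TV (r k) ==> germ k ps:dim_module E F ns ph"
 unfolding dim_module_eq by blast

lemma dim_scale_eq: "dim_scale E F ns ph = {germ k ps | k ps. ps:TV (r k) & ps ` A [1] <= A (ns k)}"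
proof (intro set_eqI iffI)
 fix P assume "P:dim_scale E F ns ph"
 then obtain k ps where "ps:TV (r k)" "ps ` A [1] <= A (ns k)" "P = V_germ E F ns ph k (vc (r k) ps)"
  unfolding dim_scale_def scale_elem_eq[OF valid] by blast
 thus "P:{germ k ps | k ps. ps:TV (r k) & ps ` A [1] <= A (ns k)}" using V_germ_eq by blast
next
 fix P assume "P:{germ k ps | k ps. ps:TV (r k) & ps ` A [1] <= A (ns k)}"
 then obtain k ps where *: "ps:TV (r k)" "ps ` A [1] <= A (ns k)" "P = germ k ps" by blast
 hence "P = V_germ E F ns ph k (vc (r k) ps)" using V_germ_eq by simp
 thus "P:dim_scale E F ns ph" unfolding dim_scale_def scale_elem_eq[OF valid] using *(1,2) by blast
qed

text \<open>The union in \<open>dim_add\<close> runs over all common stages and representatives. At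
  a later stage any two choices are equivalent term by term, and \<open>sim_add\<close> makes their
  orthogonal sums equivalent.\<close>

lemma dim_add_germ:
 assumes ps: "ps:TV (r k)" and om: "om:TV (r k)" and orth: "ps u1 * om u1 = 0"
 shows "dim_add E F ns ph (germ k ps) (germ k om) = germ k (%x. ps x + om x)"
 unfolding dim_add_def
proof (rule Union_constant)
 show "{V_germ E F ns ph l (V_add E F (ns l) X Y) |l X Y. (l, X):germ k ps & (l, Y):germ k om} ~= {}"
  using germ_self[OF ps] germ_self[OF om] by blast
 fix Z assume "Z:{V_germ E F ns ph l (V_add E F (ns l) X Y) |l X Y. (l, X):germ k ps & (l, Y):germ k om}"
 then obtain l X Y where Z: "Z = V_germ E F ns ph l (V_add E F (ns l) X Y)"
  and X: "(l, X):germ k ps" and Y: "(l, Y):germ k om" by blast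
 obtain ps1 where ps1: "ps1:TV (r l)" "X = vc (r l) ps1" "germ l ps1 = germ k ps" using germ_member[OF ps X] .
 obtain om1 where om1: "om1:TV (r l)" "Y = vc (r l) om1" "germ l om1 = germ k om" using germ_member[OF om Y] .
 obtain om2 where om2: "om2:TV (r l)" "sim (A [1]) om1 om2" "ps1 u1 * om2 u1 = 0"
  using TV_orthogonal[OF valid refl ps1(1) om1(1)] by blast
 note s1 = TV_add[OF ps1(1) om2(1,3)] and s = TV_add[OF ps om orth]
 have om2g: "germ l om2 = germ k om" using germ_sim[OF om1(1) om2(1,2)] om1(3) by simp
 obtain m1 where m1: "m1 >= max l k" "ALL m>=m1. sim (A [1]) (%x. cn l m (ps1 x)) (%x. cn k m (ps x))"
  using germ_later[OF ps1(3,1) ps] by blast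
 obtain m2 where m2: "m2 >= max l k" "ALL m>=m2. sim (A [1]) (%x. cn l m (om2 x)) (%x. cn k m (om x))"
  using germ_later[OF om2g om2(1) om] by blast
 define m where "m = max m1 m2"
 have m: "k <= m" "l <= m" "sim (A [1]) (%x. cn l m (ps1 x)) (%x. cn k m (ps x))"
  "sim (A [1]) (%x. cn l m (om2 x)) (%x. cn k m (om x))"
  using m1 m2 by (auto simp: m_def)
 have up: "ka x:upto CE (r p)" if "ka:TV (r p)" "x:A [1]" for ka p x
  using TV_upto[OF that(1)] that(2) upto_mono[OF E_sub_CE] by blast
 have lin: "cn p m (ka x + ka' x) = cn p m (ka x) + cn p m (ka' x)" "cn p m (ka x * ka' x) = cn p m (ka x) * cn p m (ka' x)"
   "cn p m 0 = 0"
  if "ka:TV (r p)" "ka':TV (r p)" "x:A [1]" "p <= m" for ka ka' x p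
  using shomD(4,5,7)[OF chomD(1)[OF smap_chom[OF cn_stable[OF that(4)]]] up[OF that(1,3)]] up[OF that(2,3)] by simp_all
 have orth': "cn p m (ka u1) * cn p m (ka' u1) = 0"
  if "ka:TV (r p)" "ka':TV (r p)" "p <= m" "ka u1 * ka' u1 = 0" for ka ka' p
  using lin(2,3)[OF that(1,2) E.unitm_in that(3)] that(4) by simp
 have "sim (A [1]) (%x. cn l m (ps1 x) + cn l m (om2 x)) (%x. cn k m (ps x) + cn k m (om x))"
  by (rule sim_add[OF TV_hom[OF cn_TV[OF m(2) ps1(1)]] TV_hom[OF cn_TV[OF m(2) om2(1)]] m(3,4)
   TV_hom[OF cn_TV[OF m(1) ps]] TV_hom[OF cn_TV[OF m(1) om]]
   orth'[OF ps1(1) om2(1) m(2) om2(3)] orth'[OF ps om m(1) orth]])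
 hence "sim (A [1]) (%x. cn l m (ps1 x + om2 x)) (%x. cn k m (ps x + om x))"
  by (rule sim_cong) (simp_all add: lin(1)[OF ps1(1) om2(1) _ m(2)] lin(1)[OF ps om _ m(1)])
 from germ_eqI[OF s1 s m(2,1) this] have "germ l (%x. ps1 x + om2 x) = germ k (%x. ps x + om x)" .
 moreover have "V_add E F (ns l) X Y = vc (r l) (%x. ps1 x + om2 x)"
  unfolding ps1(2) om1(2)
  by (rule V_add_vc[OF valid refl ps1(1) om1(1) ps1(1) TV_refl[OF ps1(1)] om2])
 ultimately show "Z = germ k (%x. ps x + om x)" unfolding Z using V_germ_eq[OF s1] by simp
qed

lemma smap_corner:
 assumes "hom [1] f" "t < 1" shows "sim (A [1]) (%x. f (mv 0 t x)) f"
 by (rule sim_cong[OF hom_sim_refl[OF assms(1)]]) (use assms(2) in \<open>simp_all add: mv_0_0[OF mats_single]\<close>)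

lemma smap_TV:
 assumes "smap 1 p h" shows "h:TV p"
proof -
 have hh: "hom [1] h" by (rule chom_hom[OF smap_chom[OF assms]]) (simp add: One_nat_def)
 have "(%x. h (mv 0 0 x)):TV p" by (rule TV_comp[OF assms TV_mv]) simp
 thus ?thesis by (rule TV_cong[OF _ hh]) (simp add: mv_0_0[OF mats_single])
qed

text \<open>For a stable representative the action is composition. Another representative of the
  germ is first replaced by a stable one, which is equivalent to h at a later stage;
  \<open>sim_smap\<close> transfers this to the composites with th.\<close>

lemma dim_act_germ:
 assumes h: "smap 1 (r k) h" and th: "th:TV 1"
 shows "dim_act E F ns ph (germ k h) (vc 1 th) = germ k (%x. h (th x))"
 unfolding dim_act_def
proof (rule Union_constant)
 note hT = smap_TV[OF h]
 show "{V_germ E F ns ph l (V_act E F (ns l) X (vc 1 th)) |l X. (l, X):germ k h} ~= {}"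
  using germ_self[OF hT] by blast
 fix Z assume "Z:{V_germ E F ns ph l (V_act E F (ns l) X (vc 1 th)) |l X. (l, X):germ k h}"
 then obtain l X where Z: "Z = V_germ E F ns ph l (V_act E F (ns l) X (vc 1 th))" and X: "(l, X):germ k h" by blast
 obtain ps where ps: "ps:TV (r l)" "X = vc (r l) ps" "germ l ps = germ k h" using germ_member[OF hT X] .
 obtain q where q: "smap 1 (r l) q" "sim (A [1]) ps q" using exists_smap[OF valid refl ps(1)] by blast
 note qT = smap_TV[OF q(1)]
 have "germ l q = germ k h" using germ_sim[OF ps(1) qT q(2)] ps(3) by simp
 from germ_later[OF this qT hT] obtain m where
  m: "m >= max l k" "sim (A [1]) (%x. cn l m (q x)) (%x. cn k m (h x))" by blast
 hence lm: "l <= m" "k <= m" by auto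
 note sq = smap_comp[OF q(1) cn_stable[OF lm(1)]] and sh = smap_comp[OF h cn_stable[OF lm(2)]]
 have "sim (A [1]) (%x. cn l m (q (th x))) (%x. cn k m (h (th x)))"
 proof (rule sim_smap[OF smap_chom[OF sq] smap_chom[OF sh] _ th th TV_refl[OF th]])
  fix t :: nat assume t: "t < 1"
  show "sim (A [1]) (%x. cn l m (q (mv 0 t x))) (%x. cn k m (h (mv 0 t x)))"
   by (rule sim_trans[OF smap_corner[OF TV_hom[OF smap_TV[OF sq]] t]
    sim_trans[OF m(2) sim_sym[OF smap_corner[OF TV_hom[OF smap_TV[OF sh]] t]]]])
 qed simp
 from germ_eqI[OF TV_comp[OF q(1) th] TV_comp[OF h th] lm this]
 have "germ l (%x. q (th x)) = germ k (%x. h (th x))" .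
 moreover have "V_act E F (ns l) X (vc 1 th) = vc (r l) (%x. q (th x))"
  unfolding ps(2) by (rule V_act_vc[OF valid refl ps(1) th q])
 ultimately show "Z = germ k (%x. h (th x))" unfolding Z using V_germ_eq[OF TV_comp[OF q(1) th]] by simp
qed

end

lemma mv_orthogonal: "t ~= t' ==> mv s t x * mv s' t' y = (0 :: 'h::complex_hilbert mat)"
proof (rule mat_eqI)
 assume t: "t ~= t'"
 fix u i j
 obtain n where n: "bsup n (ent (mv s t x))" using ex_bounded by blast
 show "ent (mv s t x * mv s' t' y) u i j = ent 0 u i j"
  unfolding ent_times[OF n] zero_mat.rep_eq by (rule sum.neutral) (use t in \<open>auto simp: ent_mv\<close>)
qed

section \<open>The stabilised system, which has the same module and the whole module as its
  scale\<close>

context closed_fam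
begin

text \<open>The amplifications of the connecting maps serve two systems: the given one, and the one
  of the algebras A_k tensored with M_(k+1). The growing size k+1 makes the second system absorb
  every finite matrix size.\<close>

lemma exists_dsys:
 assumes D: "direct_system E F ns ph"
 shows "EX g. dsys E F ns ph g \<and>
  dsys E F (%k. ts (Suc k) (ns k)) (%k. amplify (ns k) (ns (Suc k)) (ph k)) g \<and>
  (ALL k N. g k ` A (ts N (ns k)) <= A (ts N (ns (Suc k)))) \<and>
  (ALL k. ALL x:upto E (length (ns k)). amplify (ns k) (ns (Suc k)) (ph k) (ent x) = ent (g k x))"
proof -
 have v: "valid_sizes (ns k)" and ph: "ph k:tilde_family E F (ns k) (ns (Suc k))" for k
  using D by (auto simp: direct_system_def)
 have "ALL k. EX f. rep_by (ns k) f (ph k) & f ` A (ns k) <= A (ns (Suc k)) & (ALL t<length (ns k). (%x. f (mv 0 t x)):T1)"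
  using ph unfolding tilde_iff[OF v v] by blast
 then obtain f where f: "!!k. rep_by (ns k) (f k) (ph k)" "!!k. f k ` A (ns k) <= A (ns (Suc k))"
  "!!k t. t < length (ns k) ==> (%x. f k (mv 0 t x)):T1" by metis
 have h: "hom (ns k) (f k)" "!!x. x:A (ns k) ==> ph k (ent x) = ent (f k x)" for k
  using f(1) by (simp_all add: rep_by_def)
 have fC: "f k ` C (ns k) <= C (ns (Suc k))" for k using hom_range[OF h(1) f(2)] by blast
 define g where "g k = amp (ns k) (ns (Suc k)) (f k)" for k
 have ge: "g k x = f k x" if "x:C (ns k)" for k x
  unfolding g_def by (rule amp_extends[OF homD(1)[OF h(1)] fC v that])
 have gs: "smap (length (ns k)) (length (ns (Suc k))) (g k)" for k
  unfolding g_def by (rule smap_amp[OF v v h(1) f(2,3)])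
 have gA: "g k ` A (ts N (ns k)) <= A (ts N (ns (Suc k)))" for k N
  unfolding g_def using amp_mats(2)[OF homD(1)[OF h(1)] fC f(2) v] by blast
 have ga: "amplify (ns k) (ns (Suc k)) (ph k) (ent x) = ent (g k x)" if x: "x:upto E (length (ns k))" for k x
 proof -
  have "x:upto CE (length (ns k))" using x upto_mono[OF E_sub_CE] by blast
  thus ?thesis
   using amplify_cong[of "ns k" "ph k" "f k" x "ns (Suc k)", OF h(2) x] ent_amp[OF homD(1)[OF h(1)] fC v v]
   by (simp add: g_def)
 qed
 have "dsys E F ns ph g"
 proof (intro dsys.intro[OF closed_fam_axioms] dsys_axioms.intro v gs)
  fix k
  show "rep_by (ns k) (g k) (ph k)"
   unfolding rep_by_def using chom_hom[OF smap_chom[OF gs] refl] h(2) ge[OF A_sub_C[THEN subsetD]] by simp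
  show "g k ` A (ns k) <= A (ns (Suc k))" using f(2) ge[OF A_sub_C[THEN subsetD]] by (simp add: image_subset_iff)
 qed
 moreover have "dsys E F (%k. ts (Suc k) (ns k)) (%k. amplify (ns k) (ns (Suc k)) (ph k)) g"
 proof (intro dsys.intro[OF closed_fam_axioms] dsys_axioms.intro valid_tensor[OF v])
  fix k
  show "0 < Suc k" by simp
  show "rep_by (ts (Suc k) (ns k)) (g k) (amplify (ns k) (ns (Suc k)) (ph k))"
   unfolding rep_by_def
  proof (intro conjI ballI)
   show "hom (ts (Suc k) (ns k)) (g k)" by (rule chom_hom[OF smap_chom[OF gs] length_tensor])
   fix x assume "x:A (ts (Suc k) (ns k))"
   thus "amplify (ns k) (ns (Suc k)) (ph k) (ent x) = ent (g k x)" by (intro ga) (drule mats_upto, simp)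
  qed
  show "g k ` A (ts (Suc k) (ns k)) <= A (ts (Suc (Suc k)) (ns (Suc k)))"
   by (rule subset_trans[OF gA mats_tensor_mono]) simp
  show "smap (length (ts (Suc k) (ns k))) (length (ts (Suc (Suc k)) (ns (Suc k)))) (g k)"
   using gs by simp
 qed
 ultimately show ?thesis using gA ga by blast
qed

lemma FM_T1: assumes "f:FM" "!!x. x:A [1] ==> f x:upto E 1" shows "f:TV 1"
proof -
 have "(%x. mv s 0 (f x)):FM" for s
 proof (cases "s = 0")
  case True
  have e: "mv 0 0 (f x) = f x" if "x:A [1]" for x by (rule mv_0_0[OF assms(2)[OF that]])
  show ?thesis unfolding True
   by (rule FM_sim[OF assms(1) hom_mv[OF FM_hom[OF assms(1)]]])
    (auto simp: e assms(2) intro!: sim_cong[OF hom_sim_refl[OF FM_hom[OF assms(1)]]])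
 next
  case False
  have z: "mv s 0 (f x) = 0" if "x:A [1]" for x
   using assms(2)[OF that] False by (intro mat_eqI) (auto simp: ent_mv upto_def)
  show ?thesis
   by (rule FM_sim[OF FM_zero hom_mv[OF FM_hom[OF assms(1)]]])
    (auto simp: z E.upto_closed(1) intro!: sim_cong[OF hom_sim_refl[OF FM_hom[OF FM_zero]]])
 qed
 hence "f:T1" using FM_hom[OF assms(1)] by (simp add: T1_def)
 thus ?thesis using assms(2) by (auto simp: TV_def)
qed

lemma TV_component: assumes "ps:TV p" shows "(%x. mv t 0 (ps x)):TV 1"
 by (rule FM_T1[OF T1_FM[OF TV_T1[OF assms]]])
  (rule mv_0_upto[OF homD(3)[OF TV_hom[OF assms]] E.opr_axioms])

lemma smap_mv: assumes "t < p" shows "smap 1 p (mv 0 t)"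
proof -
 have "mv 0 t ` upto K 1 <= upto K p" if "opr K" for K
  using mv_upto[OF that upto_full assms] by blast
 hence "chom 1 p (mv 0 t)" unfolding chom_def using shom_mv E.opr_axioms CE.opr_axioms by blast
 moreover have "(%x. mv 0 t (mv 0 t' x)):T1" if "t' < 1" for t' using that T1_mv[of t] by (simp add: mv_mv)
 ultimately show ?thesis by (simp add: smap_def)
qed

text \<open>The map \<open>a \<mapsto> a \<otimes> 1\<close>, whose class is the largest one in the scale.\<close>

lemma unit_embedding: "EX th:TV (length ns). th ` A [1] <= A ns & th u1 = unitm ns"
proof -
 \<comment> \<open>The copy of E at one diagonal position. It is conjugate to the corner embedding
   of its summand, hence in the family, and the copies at distinct positions are orthogonal.\<close>
 define d :: "nat \<times> nat => 'h mat => 'h mat" where "d = (%(s, i) x. sgl s i i (ent x 0 0 0))"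
 have lin: "clin (ent x s i j)" for x :: "'h mat" and s i j by (rule clin_ent)
 have d0: "d p x * d q y = 0" if "p ~= q" for p q x y
  using that by (cases p; cases q) (auto simp: d_def sgl_mult[OF lin lin])
 have dT: "d (s, i):TV (length ns)" and dA: "d (s, i) ` A [1] <= A ns" if p: "pos_in ns s i" for s i
 proof -
  define w :: "'h mat" where "w = sgl s i 0 id_blinfun"
  have w: "w:full E" "star w:full E" "star w * w = sgl s 0 0 id_blinfun"
   by (simp_all add: w_def E.sgl_full E.one star_sgl sgl_mult clin_intros op_adj_id)
  have x1: "x = sgl 0 0 0 (ent x 0 0 0)" if "x:C [1]" for x
   using that unfolding mats_single_iff by (intro mat_eqI) (auto simp: ent_sgl[OF lin] One_nat_def)
  have m: "mv 0 s x = sgl s 0 0 (ent x 0 0 0)" if "x:C [1]" for x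
   by (subst x1[OF that]) (simp add: mv_sgl[OF lin])
  have eq: "w * mv 0 s x * star w = d (s, i) x" if "x:C [1]" for x
   by (simp add: m[OF that] w_def d_def star_sgl sgl_mult clin_intros lin op_adj_id)
  have id: "mv 0 s x * (star w * w) = mv 0 s x" "star w * w * mv 0 s x = mv 0 s x" if "x:C [1]" for x
   by (simp_all add: m[OF that] w(3) sgl_mult clin_intros lin)
  have h: "hom [1] (d (s, i))"
   by (rule hom_cong[OF hom_conj[OF T1_hom[OF T1_mv] w(1,2) id(1)] eq])
  have s: "sim (A [1]) (mv 0 s) (d (s, i))" unfolding sim_def
   by (rule bexI[OF _ w(1)]) (simp add: w(2) id[OF A_sub_C[THEN subsetD]] eq[OF A_sub_C[THEN subsetD]])
  show "d (s, i) ` A [1] <= A ns"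
  proof (rule image_subsetI)
   fix x assume "x:A [1]"
   hence "ent x 0 0 0:E" using mats_full unfolding full_def by blast
   thus "d (s, i) x:A ns" unfolding d_def prod.case using p by (intro E.sgl_mats)
  qed
  hence "d (s, i) ` A [1] <= upto E (length ns)" using mats_upto by blast
  thus "d (s, i):TV (length ns)" using T1_sim[OF T1_mv h s] by (simp add: TV_def)
 qed
 have J: "(%x. \<Sum>p\<in>J. d p x):TV (length ns) & (%x. \<Sum>p\<in>J. d p x) ` A [1] <= A ns"
  if "finite J" "J <= positions ns" for J
  using that
 proof (induction J)
  case empty
  show ?case by (auto simp: TV_zero E.mats_closed(1))
 next
  case (insert p J)
  obtain s i where p: "p = (s, i)" "pos_in ns s i" using insert.prems by (metis insert_subset positions_iff surj_pair)
  have z: "d p u1 * (\<Sum>p\<in>J. d p u1) = 0"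
   unfolding sum_distrib_left by (rule sum.neutral) (use insert.hyps(2) in \<open>auto intro!: d0\<close>)
  have J: "(%x. \<Sum>p\<in>J. d p x):TV (length ns)" "(%x. \<Sum>p\<in>J. d p x) ` A [1] <= A ns"
   using insert.IH insert.prems by simp_all
  have "(%x. d p x + (\<Sum>p\<in>J. d p x)):TV (length ns)" using TV_add[OF dT[OF p(2)] J(1)] z by (simp add: p(1))
  moreover have "(%x. d p x + (\<Sum>p\<in>J. d p x)) ` A [1] <= A ns"
   using dA[OF p(2)] J(2) by (auto simp: p(1) intro!: E.mats_closed(2))
  ultimately show ?case using insert.hyps by simp
 qed
 note * = J[OF finite_positions subset_refl]
 have "(\<Sum>p\<in>positions ns. d p u1) = unitm ns"
  unfolding unitm_def[of ns] pmat_def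
  by (rule sum.cong) (auto simp: d_def ent_unitm One_nat_def)
 with * show ?thesis by blast
qed

end

context dsys
begin

lemma germ_cong:
 assumes "ps:TV (r k)" "ka:TV (r k)" "!!x. x:A [1] ==> ps x = ka x"
 shows "germ k ps = germ k ka"
 by (rule germ_sim[OF assms(1,2)]) (rule sim_cong[OF TV_refl[OF assms(1)]], simp_all add: assms(3))

lemma cn_orthogonal:
 assumes "k <= m" "ps:TV (r k)" "om:TV (r k)" "ps u1 * om u1 = 0"
 shows "cn k m (ps u1) * cn k m (om u1) = 0"
proof -
 have up: "ka u1:upto CE (r k)" if "ka:TV (r k)" for ka
  using TV_upto[OF that] E.unitm_in upto_mono[OF E_sub_CE] by blast
 note s = chomD(1)[OF smap_chom[OF cn_stable[OF assms(1)]]]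
 show ?thesis using shomD(5,7)[OF s up[OF assms(2)]] up[OF assms(3)] assms(4) by metis
qed

text \<open>Pushed to a common stage, which may be as late as desired, two germs have
  representatives with orthogonal ranges; for these the sum of the germs is the germ of the
  pointwise sum.\<close>

lemma dim_module_pair:
 assumes "P:dim_module E F ns ph" "Q:dim_module E F ns ph"
 shows "EX k>=q. EX ps:TV (r k). EX om:TV (r k). ps u1 * om u1 = 0 & P = germ k ps & Q = germ k om"
proof -
 obtain k ps l om where *: "ps:TV (r k)" "P = germ k ps" "om:TV (r l)" "Q = germ l om"
  using assms unfolding dim_module_eq by blast
 define m where "m = max q (max k l)"
 have m: "k <= m" "l <= m" "q <= m" by (auto simp: m_def)
 note p = cn_TV[OF m(1) *(1)] and o = cn_TV[OF m(2) *(3)]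
 obtain om' where om': "om':TV (r m)" "sim (A [1]) (%x. cn l m (om x)) om'"
  "cn k m (ps u1) * om' u1 = 0"
  using TV_orthogonal[OF valid refl p o] by blast
 have "germ m om' = Q" using germ_sim[OF o om'(1,2)] germ_push[OF m(2) *(3)] *(4) by simp
 thus ?thesis using p om'(1,3) germ_push[OF m(1) *(1)] *(2) m(3) by metis
qed

lemma dim_module_smap:
 assumes "P:dim_module E F ns ph" shows "EX k>=q. EX h. smap 1 (r k) h & P = germ k h"
proof -
 obtain k ps where k: "k >= q" "ps:TV (r k)" "P = germ k ps" using dim_module_pair[OF assms assms] by blast
 obtain h where h: "smap 1 (r k) h" "sim (A [1]) ps h" using exists_smap[OF valid refl k(2)] by blast
 show ?thesis using germ_sim[OF k(2) smap_TV[OF h(1)] h(2)] k h(1) by blast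
qed

lemma dim_add_in: "P:dim_module E F ns ph ==> Q:dim_module E F ns ph ==> dim_add E F ns ph P Q:dim_module E F ns ph"
proof -
 assume "P:dim_module E F ns ph" "Q:dim_module E F ns ph"
 from dim_module_pair[OF this] obtain k ps om where *: "ps:TV (r k)" "om:TV (r k)"
  "ps u1 * om u1 = 0" "P = germ k ps" "Q = germ k om" by blast
 show ?thesis unfolding *(4,5) dim_add_germ[OF *(1-3)] by (rule germ_in[OF TV_add[OF *(1-3)]])
qed

lemma dim_act_in:
 assumes "P:dim_module E F ns ph" "T:V_elem E F [1]" shows "dim_act E F ns ph P T:dim_module E F ns ph"
proof -
 obtain th where th: "th:TV 1" "T = vc 1 th" using assms(2) V_elem_one by blast
 obtain k h where h: "smap 1 (r k) h" "P = germ k h" using dim_module_smap[OF assms(1)] by blast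
 show ?thesis unfolding th(2) h(2) dim_act_germ[OF h(1) th(1)] by (rule germ_in[OF TV_comp[OF h(1) th(1)]])
qed

end

text \<open>Germs are formed from g and the numbers of summands alone, and both systems have these
  in common.\<close>

lemma (in closed_fam) dim_module_sizes:
 assumes "dsys E F ns ph g" "dsys E F ms ph' g" "!!k. length (ms k) = length (ns k)"
 shows "dim_module E F ms ph' = dim_module E F ns ph"
  "P:dim_module E F ns ph ==> Q:dim_module E F ns ph ==> dim_add E F ms ph' P Q = dim_add E F ns ph P Q"
  "P:dim_module E F ns ph ==> T:V_elem E F [1] ==> dim_act E F ms ph' P T = dim_act E F ns ph P T"
proof -
 interpret S: dsys E F ns ph g by fact
 interpret S': dsys E F ms ph' g by fact
 note r = assms(3)
 show "dim_module E F ms ph' = dim_module E F ns ph" unfolding S.dim_module_eq S'.dim_module_eq r ..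
 { assume "P:dim_module E F ns ph" "Q:dim_module E F ns ph"
  from S.dim_module_pair[OF this, of 0] obtain k ps om where "ps:TV (length (ns k))" "om:TV (length (ns k))" "ps u1 * om u1 = 0"
   "P = S.germ k ps" "Q = S.germ k om" by blast
  thus "dim_add E F ms ph' P Q = dim_add E F ns ph P Q"
   using S.dim_add_germ[of ps k om] S'.dim_add_germ[of ps k om] by (simp add: r) }
 { assume P: "P:dim_module E F ns ph" and T: "T:V_elem E F [1]"
  obtain th where "th:TV 1" "T = vc 1 th" using T V_elem_one by blast
  moreover obtain k h where "smap 1 (length (ns k)) h" "P = S.germ k h"
   using S.dim_module_smap[OF P, of 0] by blast
  ultimately show "dim_act E F ms ph' P T = dim_act E F ns ph P T"
   using S.dim_act_germ[of k h th] S'.dim_act_germ[of k h th] by (simp add: r) }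
qed

text \<open>A representative at stage k has its range in some A_k tensored with M_N. At stage
  \<open>l = max k N\<close> this range lies in the algebra of the system itself, whose matrix size
  is \<open>Suc l\<close>, so its germ belongs to the scale.\<close>

lemma (in closed_fam) dim_scale_stable:
 assumes "dsys E F ns ph g" "dsys E F (%k. ts (Suc k) (ns k)) ph' g"
  and gA: "!!k N. g k ` A (ts N (ns k)) <= A (ts N (ns (Suc k)))"
 shows "dim_scale E F (%k. ts (Suc k) (ns k)) ph' = dim_module E F (%k. ts (Suc k) (ns k)) ph'"
proof -
 interpret S: dsys E F ns ph g by fact
 interpret S': dsys E F "%k. ts (Suc k) (ns k)" ph' g by fact
 have c: "connecting g k l ` A (ts N (ns k)) <= A (ts N (ns l))" if "k <= l" for k l N
  using that
 proof (induction l rule: dec_induct)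
  case (step l)
  thus ?case using gA[of l N] by (auto simp: conn_Suc)
 qed simp
 have "S'.germ k ps:dim_scale E F (%k. ts (Suc k) (ns k)) ph'" if ps: "ps:TV (length (ns k))" for k ps
 proof -
  obtain N where N: "ps ` A [1] <= A (ts N (ns k))"
   using hom_into_mats[OF TV_hom[OF ps] TV_upto[OF ps] S.valid] by blast
  define l where "l = max k N"
  have l: "k <= l" "N <= Suc l" by (auto simp: l_def)
  have ps': "ps:TV (length (ts (Suc k) (ns k)))" using ps by simp
  have "(%x. connecting g k l (ps x)) ` A [1] <= A (ts (Suc l) (ns l))"
   using N c[OF l(1), of N] mats_tensor_mono[OF l(2), of E "ns l"] by blast
  thus ?thesis unfolding S'.dim_scale_eq using S'.cn_TV[OF l(1) ps'] S'.germ_push[OF l(1) ps', symmetric] by blast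
 qed
 hence "dim_module E F (%k. ts (Suc k) (ns k)) ph' <= dim_scale E F (%k. ts (Suc k) (ns k)) ph'"
  unfolding S'.dim_module_eq by auto
 moreover have "dim_scale E F (%k. ts (Suc k) (ns k)) ph' <= dim_module E F (%k. ts (Suc k) (ns k)) ph'"
  unfolding S'.dim_module_eq S'.dim_scale_eq by blast
 ultimately show ?thesis by blast
qed

lemma module_iso_inverse:
 assumes iso: "module_iso E F ns ph ns' ph' Ga"
  and cl: "!!P Q. P:dim_module E F ns ph ==> Q:dim_module E F ns ph ==> dim_add E F ns ph P Q:dim_module E F ns ph"
  "!!P T. P:dim_module E F ns ph ==> T:V_elem E F [1] ==> dim_act E F ns ph P T:dim_module E F ns ph"
 shows "module_iso E F ns' ph' ns ph (inv_into (dim_module E F ns ph) Ga)"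
proof -
 let ?M = "dim_module E F ns ph" and ?M' = "dim_module E F ns' ph'"
 let ?I = "inv_into ?M Ga"
 have b: "bij_betw Ga ?M ?M'" using iso by (simp add: module_iso_def)
 have i: "?I P:?M" "Ga (?I P) = P" if "P:?M'" for P
  using bij_betw_inv_into_right[OF b that] bij_betw_apply[OF bij_betw_inv_into[OF b] that] by simp_all
 have l: "?I (Ga P) = P" if "P:?M" for P by (rule bij_betw_inv_into_left[OF b that])
 have add: "Ga (dim_add E F ns ph P Q) = dim_add E F ns' ph' (Ga P) (Ga Q)" if "P:?M" "Q:?M" for P Q
  using iso that by (simp add: module_iso_def)
 have act: "Ga (dim_act E F ns ph P T) = dim_act E F ns' ph' (Ga P) T" if "P:?M" "T:V_elem E F [1]" for P T
  using iso that by (simp add: module_iso_def)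
 have "?I (dim_add E F ns' ph' P Q) = dim_add E F ns ph (?I P) (?I Q)" if "P:?M'" "Q:?M'" for P Q
  using add[OF i(1)[OF that(1)] i(1)[OF that(2)]] l[OF cl(1)[OF i(1)[OF that(1)] i(1)[OF that(2)]]] i(2)[OF that(1)] i(2)[OF that(2)]
  by simp
 moreover have "?I (dim_act E F ns' ph' P T) = dim_act E F ns ph (?I P) T" if "P:?M'" "T:V_elem E F [1]" for P T
  using act[OF i(1)[OF that(1)] that(2)] l[OF cl(2)[OF i(1)[OF that(1)] that(2)]] i(2)[OF that(1)] by simp
 ultimately show ?thesis unfolding module_iso_def using bij_betw_inv_into[OF b] by blast
qed

section \<open>Intertwinings from module isomorphisms\<close>

text \<open>Dependent choice for an intertwining. R and R' describe admissible crossover maps in the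
  two directions, P and Q the commuting triangles; a state records a pair of consecutive crossover
  maps so that the next map can be chosen to fit the last one.\<close>

lemma zigzag:
 fixes R :: "nat => nat => 'a => bool" and R' :: "nat => nat => 'b => bool"
 assumes start: "EX m al. 0 < m & R 0 m al"
  and step: "!!k m al. R k m al ==> EX k'>m. \<exists>bt. R' m k' bt & P k m k' al bt"
  and step': "!!m k bt. R' m k bt ==> EX m'>k. \<exists>al. R k m' al & Q m k m' bt al"
 shows "EX n m al bt. ALL i. n i < m i & m i < n (Suc i) & R (n i) (m i) (al i) & R' (m i) (n (Suc i)) (bt i) \<and>
  P (n i) (m i) (n (Suc i)) (al i) (bt i) & Q (m i) (n (Suc i)) (m (Suc i)) (bt i) (al (Suc i))"
proof -
 define I :: "nat => nat \<times> nat \<times> 'a \<times> nat \<times> 'b => bool"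
  where "I = (%(i::nat) (k, m, al, k', bt). k < m & m < k' & R k m al & R' m k' bt & P k m k' al bt)"
 define J :: "nat => nat \<times> nat \<times> 'a \<times> nat \<times> 'b => nat \<times> nat \<times> 'a \<times> nat \<times> 'b => bool"
  where "J = (%i (k, m, al, k', bt) (l, p, al', l', bt'). l = k' & Q m k' p bt al')"
 have "EX f. ALL i. I i (f i) & J i (f i) (f (Suc i))"
 proof (rule dependent_nat_choice)
  obtain m al where "0 < m" "R 0 m al" using start by blast
  moreover from step[OF this(2)] obtain k' bt where "k' > m" "R' m k' bt" "P 0 m k' al bt" by blast
  ultimately have "I 0 (0, m, al, k', bt)" by (simp add: I_def)
  thus "EX x. I 0 x" ..
 next
  fix x i assume "I i x"
  moreover obtain k m al k' bt where x: "x = (k, m, al, k', bt)" by (cases x)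
  ultimately have "R' m k' bt" by (simp add: I_def)
  from step'[OF this] obtain p al' where p: "p > k'" "R k' p al'" "Q m k' p bt al'" by blast
  from step[OF p(2)] obtain l' bt' where "l' > p" "R' p l' bt'" "P k' p l' al' bt'" by blast
  hence "I (Suc i) (k', p, al', l', bt') & J i x (k', p, al', l', bt')" using p by (simp add: I_def J_def x)
  thus "EX y. I (Suc i) y & J i x y" ..
 qed
 then obtain f where f: "!!i. I i (f i)" "!!i. J i (f i) (f (Suc i))" by blast
 define n m al k' bt where "n i = fst (f i)" and "m i = fst (snd (f i))" and "al i = fst (snd (snd (f i)))"
  and "k' i = fst (snd (snd (snd (f i))))" and "bt i = snd (snd (snd (snd (f i))))" for i
 note d = n_def m_def al_def k'_def bt_def
 have "n i < m i & m i < k' i & R (n i) (m i) (al i) & R' (m i) (k' i) (bt i) & P (n i) (m i) (k' i) (al i) (bt i)" for i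
  using f(1)[of i] unfolding I_def d by (simp add: case_prod_beta)
 moreover have "n (Suc i) = k' i & Q (m i) (k' i) (m (Suc i)) (bt i) (al (Suc i))" for i
  using f(2)[of i] unfolding J_def d by (simp add: case_prod_beta)
 ultimately show ?thesis by (intro exI[of _ n] exI[of _ m] exI[of _ al] exI[of _ bt]) metis
qed

context fin_acting
begin

text \<open>Membership in the family is kept out of this notion, which is shared by the crossover
  maps obtained from module isomorphisms and those obtained from isomorphisms of limits.\<close>

definition intertwining ::
  "(nat => nat list) => (nat => 'h mat => 'h mat) => (nat => nat list) => (nat => 'h mat => 'h mat) =>
   (nat => nat) => (nat => nat) => (nat => 'h mat => 'h mat) => (nat => 'h mat => 'h mat) => bool" where
 "intertwining ns g ns' g' n m al bt \<longleftrightarrow> (ALL i. n i < m i & m i < n (Suc i) \<and>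
   hom (ns (n i)) (al i) & al i ` A (ns (n i)) <= A (ns' (m i)) \<and>
   hom (ns' (m i)) (bt i) & bt i ` A (ns' (m i)) <= A (ns (n (Suc i))) \<and>
   (ALL x:A (ns (n i)). bt i (al i x) = connecting g (n i) (n (Suc i)) x) \<and>
   (ALL x:A (ns' (m i)). al (Suc i) (bt i x) = connecting g' (m i) (m (Suc i)) x))"

end

section \<open>Lifting a module isomorphism to crossover maps\<close>

locale dsys_pair = closed_fam E F + S: dsys E F ns ph g + S': dsys E F ns' ph' g'
 for E :: "('h::complex_hilbert \<Rightarrow>\<^sub>L 'h) set" and F :: "'h family"
  and ns ph g and ns' ph' g'

text \<open>The inclusion of scales is what makes lifts of Ga land in the algebras of the second
  system rather than in their stabilisations. The inverse of Ga gives another instance with the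
  systems exchanged.\<close>

locale dsys_iso = dsys_pair E F ns ph g ns' ph' g'
 for E :: "('h::complex_hilbert \<Rightarrow>\<^sub>L 'h) set" and F ns ph g ns' ph' g' +
 fixes Ga :: "'h dim_elt => 'h dim_elt"
 assumes iso: "module_iso E F ns ph ns' ph' Ga"
  and scale: "Ga ` dim_scale E F ns ph <= dim_scale E F ns' ph'"
begin

lemma iso_add:
 assumes "ps:TV (S.r k)" "om:TV (S.r k)" "ps u1 * om u1 = 0"
 shows "Ga (S.germ k (%x. ps x + om x)) = dim_add E F ns' ph' (Ga (S.germ k ps)) (Ga (S.germ k om))"
 unfolding S.dim_add_germ[OF assms, symmetric]
 by (rule iso[unfolded module_iso_def, THEN conjunct2, THEN conjunct1, THEN bspec, THEN bspec,
  OF S.germ_in[OF assms(1)] S.germ_in[OF assms(2)]])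

lemma iso_act:
 assumes "smap 1 (S.r k) h" "th:TV 1"
 shows "Ga (S.germ k (%x. h (th x))) = dim_act E F ns' ph' (Ga (S.germ k h)) (vc 1 th)"
proof -
 have "vc 1 th:V_elem E F [1]" using assms(2) V_elem_one by blast
 thus ?thesis unfolding S.dim_act_germ[OF assms, symmetric]
  by (rule iso[unfolded module_iso_def, THEN conjunct2, THEN conjunct2, THEN bspec, THEN bspec,
   OF S.germ_in[OF S.smap_TV[OF assms(1)]]])
qed

text \<open>Every ps is the orthogonal sum of its components, and each component is a corner
  embedding \<open>mv 0 t\<close> acted on by an element of the semiring. So additivity and the
  module action determine Ga by its values on the corner embeddings.\<close>

lemma iso_extend:
 assumes a: "smap (S.r k) (S'.r m) a"
  and corner: "!!t. t < S.r k ==> Ga (S.germ k (mv 0 t)) = S'.germ m (%x. a (mv 0 t x))"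
  and ps: "ps:TV (S.r k)"
 shows "Ga (S.germ k ps) = S'.germ m (%x. a (ps x))"
proof -
 have part: "Ga (S.germ k (%x. mv 0 t (th x))) = S'.germ m (%x. a (mv 0 t (th x)))"
  if t: "t < S.r k" and th: "th:TV 1" for t th
  unfolding iso_act[OF smap_mv[OF t] th] corner[OF t]
  by (rule S'.dim_act_germ[OF smap_comp[OF smap_mv[OF t] a] th])
 define f where "f n x = (\<Sum>t<n. mv 0 t (mv t 0 (ps x)))" for n x
 have c: "(%x. mv 0 t (mv t 0 (ps x))):TV (S.r k)" if "t < S.r k" for t
  by (rule TV_comp[OF smap_mv[OF that] TV_component[OF ps]])
 have orth: "f n u1 * mv 0 n (mv n 0 (ps u1)) = 0" for n
  unfolding f_def sum_distrib_right by (rule sum.neutral) (auto intro: mv_orthogonal)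
 note aC = chomD(1)[OF smap_chom[OF a]]
 have up: "ka x:upto CE (S.r k)" if "ka:TV (S.r k)" "x:A [1]" for ka x
  using TV_upto[OF that(1)] that(2) upto_mono[OF E_sub_CE] by blast
 have "f n:TV (S.r k) & Ga (S.germ k (f n)) = S'.germ m (%x. a (f n x))" if "n <= S.r k" for n
  using that
 proof (induction n)
  case 0
  \<comment> \<open>Preservation of zero is not part of \<open>module_iso\<close>; it follows by
    letting the zero map act on the first corner embedding.\<close>
  show ?case using part[OF S.r_pos TV_zero[of 1]] TV_zero by (simp add: f_def[abs_def])
 next
  case (Suc n)
  have n: "n < S.r k" and f: "f n:TV (S.r k)" "Ga (S.germ k (f n)) = S'.germ m (%x. a (f n x))" using Suc by auto
  let ?c = "%x. mv 0 n (mv n 0 (ps x))"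
  have fS: "f (Suc n) = (%x. f n x + ?c x)" by (simp add: f_def fun_eq_iff)
  note T = TV_add[OF f(1) c[OF n] orth]
  have ao: "a (f n u1) * a (?c u1) = 0"
   using shomD(5,7)[OF aC up[OF f(1) E.unitm_in]] up[OF c[OF n] E.unitm_in] orth[of n] by metis
  have "Ga (S.germ k (f (Suc n))) = S'.germ m (%x. a (f n x) + a (?c x))"
   unfolding fS iso_add[OF f(1) c[OF n] orth] f(2) part[OF n TV_component[OF ps]]
   by (rule S'.dim_add_germ[OF TV_comp[OF a f(1)] TV_comp[OF a c[OF n]] ao])
  also have "... = S'.germ m (%x. a (f n x + ?c x))"
   by (rule S'.germ_cong[OF TV_add[OF TV_comp[OF a f(1)] TV_comp[OF a c[OF n]] ao] TV_comp[OF a T]])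
    (rule shomD(4)[OF aC up[OF f(1)] up[OF c[OF n]], symmetric])
  finally show ?case using T unfolding fS by simp
 qed
 from this[OF order_refl] have f: "f (S.r k):TV (S.r k)" "Ga (S.germ k (f (S.r k))) = S'.germ m (%x. a (f (S.r k) x))"
  by simp_all
 have eq: "f (S.r k) x = ps x" if "x:A [1]" for x
  unfolding f_def using TV_upto[OF ps] that by (intro upto_sum_mv[of _ E, symmetric]) blast
 have "S'.germ m (%x. a (f (S.r k) x)) = S'.germ m (%x. a (ps x))"
  by (rule S'.germ_cong[OF TV_comp[OF a f(1)] TV_comp[OF a ps]]) (simp add: eq)
 thus ?thesis using S.germ_cong[OF f(1) ps eq] f(2) by simp
qed

text \<open>The maps of elementary algebras that induce \<open>Ga\<close>; by the previous lemma it is enough to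
 look at the corners.\<close>

definition crossing :: "nat => nat => ('h mat => 'h mat) => bool" where
 "crossing k m al \<longleftrightarrow> hom (ns k) al & al ` A (ns k) <= A (ns' m) \<and>
  (ALL t<S.r k. (%x. al (mv 0 t x)):TV (S'.r m) & Ga (S.germ k (mv 0 t)) = S'.germ m (%x. al (mv 0 t x)))"

lemma crossingD:
 assumes "crossing k m al"
 shows "hom (ns k) al" "al ` A (ns k) <= A (ns' m)" "t < S.r k ==> (%x. al (mv 0 t x)):TV (S'.r m)"
  "t < S.r k ==> Ga (S.germ k (mv 0 t)) = S'.germ m (%x. al (mv 0 t x))"
 using assms by (simp_all add: crossing_def)

text \<open>The amplification of al is a stable map that agrees with al on the range of ps, so
  \<open>iso_extend\<close> applies to it.\<close>

lemma crossing_induces: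
 assumes "crossing k m al" "ps:TV (S.r k)" "ps ` A [1] <= A (ns k)"
 shows "(%x. al (ps x)):TV (S'.r m)" "Ga (S.germ k ps) = S'.germ m (%x. al (ps x))"
proof -
 note al = crossingD[OF assms(1)]
 let ?a = "amp (ns k) (ns' m) al"
 have aC: "al ` C (ns k) <= C (ns' m)" using hom_range[OF al(1,2)] by blast
 have a: "smap (S.r k) (S'.r m) ?a"
  by (rule smap_amp[OF S.valid S'.valid al(1,2) TV_T1[OF al(3)]])
 have e: "?a x = al x" if "x:A (ns k)" for x
  by (rule amp_extends[OF homD(1)[OF al(1)] aC S'.valid A_sub_C[THEN subsetD, OF that]])
 have "Ga (S.germ k ps) = S'.germ m (%x. ?a (ps x))"
 proof (rule iso_extend[OF a _ assms(2)])
  fix t assume t: "t < S.r k"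
  have "S'.germ m (%x. al (mv 0 t x)) = S'.germ m (%x. ?a (mv 0 t x))"
   by (rule S'.germ_cong[OF al(3)[OF t] TV_comp[OF a TV_mv[OF t]]])
    (rule amp_corner[OF al(1,2) S'.valid S.valid t A_sub_C[THEN subsetD], symmetric])
  thus "Ga (S.germ k (mv 0 t)) = S'.germ m (%x. ?a (mv 0 t x))" using al(4)[OF t] by simp
 qed
 moreover have p: "?a (ps x) = al (ps x)" if "x:A [1]" for x using e assms(3) that by blast
 have P: "hom [1] (%x. al (ps x))"
 proof (rule hom_cong[OF TV_hom[OF TV_comp[OF a assms(2)]]])
  fix x assume "x:C [1]"
  hence "ps x:C (ns k)" by (rule hom_range[OF TV_hom[OF assms(2)] assms(3)])
  thus "?a (ps x) = al (ps x)" by (rule amp_extends[OF homD(1)[OF al(1)] aC S'.valid])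
 qed
 show T: "(%x. al (ps x)):TV (S'.r m)" by (rule TV_cong[OF TV_comp[OF a assms(2)] P p])
 ultimately show "Ga (S.germ k ps) = S'.germ m (%x. al (ps x))"
  using S'.germ_cong[OF TV_comp[OF a assms(2)] T p] by simp
qed

lemma germ_iso_at:
 assumes "P:dim_module E F ns ph"
 shows "EX m0. ALL m>=m0. EX ka:TV (S'.r m). Ga P = S'.germ m ka"
proof -
 have "Ga P:dim_module E F ns' ph'"
  by (rule bij_betw_apply[OF iso[unfolded module_iso_def, THEN conjunct1] assms])
 then obtain m0 ka where "ka:TV (S'.r m0)" "Ga P = S'.germ m0 ka" unfolding S'.dim_module_eq by blast
 thus ?thesis using S'.germ_push S'.cn_TV by metis
qed

text \<open>The images of the corner classes are represented at one stage and assembled to a map f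
  into a stabilisation. The class of the unital embedding th lies in the scale, hence so does its
  image under Ga; the partial isometry expressing this carries the range of f into an algebra of the
  second system.\<close>

lemma exists_crossing: "EX m>=q. \<exists>al. crossing k m al"
proof -
 have "EX m0. t < S.r k --> (ALL m>=m0. EX ka:TV (S'.r m). Ga (S.germ k (mv 0 t)) = S'.germ m ka)" for t
  using germ_iso_at[OF S.germ_in[OF TV_mv]] by blast
 then obtain M where M: "!!t m. t < S.r k ==> M t <= m ==> EX ka:TV (S'.r m). Ga (S.germ k (mv 0 t)) = S'.germ m ka"
  by metis
 define m where "m = (\<Sum>t<S.r k. M t)"
 have "\<exists>ka. t < S.r k --> ka:TV (S'.r m) & Ga (S.germ k (mv 0 t)) = S'.germ m ka" for t
 proof (cases "t < S.r k")
  case True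
  hence "M t <= m" unfolding m_def by (intro member_le_sum) auto
  thus ?thesis using M[OF True] by blast
 qed simp
 then obtain ka where ka: "!!t. t < S.r k ==> ka t:TV (S'.r m)" "!!t. t < S.r k ==> Ga (S.germ k (mv 0 t)) = S'.germ m (ka t)"
  by metis
 obtain f where f: "hom (ns k) f" "f ` A (ns k) <= upto E (S'.r m)"
  "!!t. t < S.r k ==> sim (A [1]) (ka t) (%x. f (mv 0 t x))"
  using exists_hom_corners[where ps = ka, OF S.valid S'.valid ka(1)] by blast
 obtain N where N: "0 < N" "f ` A (ns k) <= A (ts N (ns' m))" using hom_into_mats[OF f(1,2) S'.valid] by blast
 have mvA: "mv 0 t x:A (ns k)" if "t < S.r k" "x:A [1]" for t x
  using mv_mats[OF E.opr_axioms _ that(1)] mats_single_mono[of 1 "ns k ! t" E] valid_sizesD[OF S.valid that(1)] that(2)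
  by (metis One_nat_def Suc_leI subsetD)
 have fT: "(%x. f (mv 0 t x)):TV (S'.r m)" if t: "t < S.r k" for t
 proof -
  have "hom [1] (%x. f (mv 0 t x))"
   by (rule hom_comp_mv[OF f(1) t]) (use valid_sizesD[OF S.valid t] in \<open>simp add: One_nat_def\<close>)
  hence "(%x. f (mv 0 t x)):T1" by (rule T1_sim[OF TV_T1[OF ka(1)[OF t]] _ f(3)[OF t]])
  thus ?thesis using f(2) mvA[OF t] by (auto simp: TV_def)
 qed
 have fg: "Ga (S.germ k (mv 0 t)) = S'.germ m (%x. f (mv 0 t x))" if t: "t < S.r k" for t
  using ka(2)[OF t] S'.germ_sim[OF ka(1)[OF t] fT[OF t] f(3)[OF t]] by simp
 note vN = valid_tensor[OF S'.valid[of m] N(1)]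
 let ?a = "amp (ns k) (ts N (ns' m)) f"
 have fC: "f ` C (ns k) <= C (ts N (ns' m))" using hom_range[OF f(1) N(2)] by blast
 have "smap (S.r k) (length (ts N (ns' m))) ?a"
  by (rule smap_amp[OF S.valid vN f(1) N(2) TV_T1[OF fT]])
 hence a: "smap (S.r k) (S'.r m) ?a" by simp
 have ae: "?a x = f x" if "x:C (ns k)" for x by (rule amp_extends[OF homD(1)[OF f(1)] fC vN that])
 obtain th where th: "th:TV (S.r k)" "th ` A [1] <= A (ns k)" "th u1 = unitm (ns k)" using unit_embedding by blast
 have ag: "Ga (S.germ k th) = S'.germ m (%x. ?a (th x))"
 proof (rule iso_extend[OF a _ th(1)])
  fix t assume t: "t < S.r k"
  have "S'.germ m (%x. f (mv 0 t x)) = S'.germ m (%x. ?a (mv 0 t x))"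
   by (rule S'.germ_cong[OF fT[OF t] TV_comp[OF a TV_mv[OF t]]])
    (rule ae[OF A_sub_C[THEN subsetD, OF mvA[OF t]], symmetric])
  thus "Ga (S.germ k (mv 0 t)) = S'.germ m (%x. ?a (mv 0 t x))" using fg[OF t] by simp
 qed
 have "S.germ k th:dim_scale E F ns ph" unfolding S.dim_scale_eq using th(1,2) by blast
 hence "S'.germ m (%x. ?a (th x)):dim_scale E F ns' ph'" using scale ag by (metis imageI subsetD)
 then obtain l om where om: "om:TV (S'.r l)" "om ` A [1] <= A (ns' l)" "S'.germ m (%x. ?a (th x)) = S'.germ l om"
  unfolding S'.dim_scale_eq by blast
 note aT = TV_comp[OF a th(1)]
 obtain p0 where p0: "p0 >= max m l" "ALL p>=p0. sim (A [1]) (%x. S'.cn m p (?a (th x))) (%x. S'.cn l p (om x))"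
  using S'.germ_later[OF om(3) aT om(1)] by blast
 define p where "p = max p0 q"
 have p: "m <= p" "l <= p" "q <= p" "sim (A [1]) (%x. S'.cn m p (?a (th x))) (%x. S'.cn l p (om x))"
  using p0 by (auto simp: p_def)
 have u: "?a (th u1) = f (unitm (ns k))" using th(3) ae[OF CE.unitm_in] by simp
 obtain w where w: "w:full E" "star w:full E" "star w * w = S'.cn m p (f (unitm (ns k)))"
  "!!x. x:A [1] ==> S'.cn l p (om x) = w * S'.cn m p (?a (th x)) * star w"
  using sim_hom_partial_isometry[OF TV_hom[OF S'.cn_TV[OF p(1) aT]] p(4)] u by metis
 define h where "h x = S'.cn m p (f x)" for x
 have h: "hom (ns k) h" unfolding h_def[abs_def]
  by (rule chom_comp_hom[OF smap_chom[OF S'.cn_stable[OF p(1)]] f(1,2)])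
 have hu: "star w * w = h (unitm (ns k))" using w(3) by (simp add: h_def)
 \<comment> \<open>Conjugation by w sends the unit of \<open>A (ns k)\<close> to the image of
   \<open>om u1\<close>, which lies in \<open>A (ns' p)\<close>; the image of the unit then cuts the
   whole range down to that algebra.\<close>
 define al where "al x = w * h x * star w" for x
 have al: "hom (ns k) al" unfolding al_def[abs_def]
  by (rule hom_conj[OF h w(1,2)]) (simp add: hu hom_unit(5)[OF h])
 have "al (unitm (ns k)) = S'.cn l p (om u1)" using w(4)[OF E.unitm_in] u by (simp add: al_def h_def)
 hence alu: "al (unitm (ns k)):A (ns' p)" using om(2) E.unitm_in[of "[1]"] S'.cn_A[OF p(2)] by auto
 have alA: "al ` A (ns k) <= A (ns' p)"
 proof (rule image_subsetI)
  fix x assume x: "x:A (ns k)"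
  have "al x = al (unitm (ns k)) * al x * al (unitm (ns k))" using hom_unit(6,7)[OF al x] by simp
  thus "al x:A (ns' p)" using E.mats_closed(5)[OF alu homD(3)[OF al x] alu] by simp
 qed
 have hs: "sim (A (ns k)) h al" unfolding sim_def
  by (rule bexI[OF _ w(1)]) (simp add: w(2) hu hom_unit(6,7)[OF h] al_def)
 have "crossing k p al" unfolding crossing_def
 proof (intro conjI al alA allI impI)
  fix t assume t: "t < S.r k"
  have s: "sim (A [1]) (%x. h (mv 0 t x)) (%x. al (mv 0 t x))"
   using sim_comp[OF hs, of "mv 0 t" "A [1]"] mvA[OF t] by (auto simp: comp_def)
  have hT: "(%x. h (mv 0 t x)):TV (S'.r p)" unfolding h_def by (rule S'.cn_TV[OF p(1) fT[OF t]])
  have h1: "hom [1] (%x. al (mv 0 t x))"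
   by (rule hom_comp_mv[OF al t]) (use valid_sizesD[OF S.valid t] in \<open>simp add: One_nat_def\<close>)
  have "(%x. al (mv 0 t x)) ` A [1] <= upto E (S'.r p)"
   using alA mvA[OF t] mats_upto by blast
  thus T: "(%x. al (mv 0 t x)):TV (S'.r p)" using T1_sim[OF TV_T1[OF hT] h1 s] by (simp add: TV_def)
  have "Ga (S.germ k (mv 0 t)) = S'.germ p (%x. h (mv 0 t x))"
   unfolding fg[OF t] h_def by (rule S'.germ_push[OF p(1) fT[OF t], symmetric])
  thus "Ga (S.germ k (mv 0 t)) = S'.germ p (%x. al (mv 0 t x))" using S'.germ_sim[OF hT T s] by simp
 qed
 thus ?thesis using p(3) by blast
qed

text \<open>The composite of bt with a crossing and the connecting map induce the same classes on
  corners, so at a later stage they are equivalent by a unitary. Absorbing the unitary into the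
  crossing makes the triangle commute exactly and leaves the classes unchanged.\<close>

lemma crossing_after:
 assumes bt: "hom (ns' p) bt" "bt ` A (ns' p) <= A (ns k)"
  "!!t. t < S'.r p ==> (%x. bt (mv 0 t x)):TV (S.r k)"
  "!!t. t < S'.r p ==> Ga (S.germ k (%x. bt (mv 0 t x))) = S'.germ p (mv 0 t)"
 shows "EX m>q. \<exists>al. crossing k m al & (ALL x:A (ns' p). al (bt x) = S'.cn p m x)"
proof -
 obtain m al where m: "m >= max p (Suc q)" and c: "crossing k m al" using exists_crossing by blast
 note al = crossingD[OF c]
 have mvA: "mv 0 t x:A (ns' p)" if "t < S'.r p" "x:A [1]" for t x
  using mv_mats[OF E.opr_axioms _ that(1)] mats_single_mono[of 1 "ns' p ! t" E] valid_sizesD[OF S'.valid that(1)] that(2)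
  by (metis One_nat_def Suc_leI subsetD)
 have btA: "(%x. bt (mv 0 t x)) ` A [1] <= A (ns k)" if "t < S'.r p" for t using bt(2) mvA[OF that] by blast
 have "EX M>=max m p. ALL j>=M. sim (A [1]) (%x. S'.cn m j (al (bt (mv 0 t x)))) (%x. S'.cn p j (mv 0 t x))"
  if t: "t < S'.r p" for t
 proof -
  note i = crossing_induces[OF c bt(3)[OF t] btA[OF t]]
  show ?thesis by (rule S'.germ_later[OF _ i(1) TV_mv[OF t]]) (use i(2) bt(4)[OF t] in simp)
 qed
 then obtain M where M: "!!t j. t < S'.r p ==> j >= M t ==>
   sim (A [1]) (%x. S'.cn m j (al (bt (mv 0 t x)))) (%x. S'.cn p j (mv 0 t x))"
  by metis
 define j where "j = m + (\<Sum>t<S'.r p. M t)"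
 have "M t <= j" if "t < S'.r p" for t
  using member_le_sum[of t "{..<S'.r p}" M] that by (simp add: j_def)
 hence s0: "sim (A [1]) (%x. S'.cn m j (al (bt (mv 0 t x)))) (%x. S'.cn p j (mv 0 t x))" if "t < S'.r p" for t
  using M that by blast
 have j: "m <= j" "p <= j" "q < j" using m by (auto simp: j_def)
 note cm = smap_chom[OF S'.cn_stable[OF j(1)]]
 define a where "a x = S'.cn m j (al x)" for x
 have alu: "al ` A (ns k) <= upto E (S'.r m)" using al(2) mats_upto by blast
 have a: "hom (ns k) a" unfolding a_def[abs_def] by (rule chom_comp_hom[OF cm al(1) alu])
 have aA: "a ` A (ns k) <= A (ns' j)" unfolding a_def using al(2) S'.cn_A[OF j(1)] by blast
 have ab: "hom (ns' p) (%x. a (bt x))"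
 proof -
  have "shom (C (ns' p)) (%x. a (bt x))" unfolding shom_def
   using shomD[OF homD(1)[OF bt(1)]] shomD[OF homD(1)[OF a]] hom_range[OF bt(1,2)] by simp
  thus ?thesis unfolding hom_def using homD(2,3)[OF a] hom_range[OF bt(1,2)] bt(2) by auto
 qed
 have abA: "(%x. a (bt x)) ` A (ns' p) <= A (ns' j)" using bt(2) aA by blast
 have "sim (A (ns' p)) (%x. a (bt x)) (S'.cn p j)"
  by (rule sim_of_corners'[OF ab S'.cn_hom[OF j(2)]]) (use s0 in \<open>simp add: a_def\<close>)
 from sim_unitary[OF ab abA S'.cn_A[OF j(2)] this] obtain U where
  U: "U:A (ns' j)" "star U:A (ns' j)" "star U * U = unitm (ns' j)" "U * star U = unitm (ns' j)"
   "!!x. x:A (ns' p) ==> S'.cn p j x = U * a (bt x) * star U" by blast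
 define al' where "al' x = U * a x * star U" for x
 note UE = mats_full[OF U(1)] mats_full[OF U(2)]
 have aC: "a x:C (ns' j)" if "x:C (ns k)" for x by (rule hom_range[OF a aA that])
 have h: "hom (ns k) al'" unfolding al'_def[abs_def]
  by (rule hom_conj[OF a UE]) (simp add: U(3) unitm_mats(2)[OF aC])
 have hA: "al' ` A (ns k) <= A (ns' j)" unfolding al'_def using aA E.mats_closed(4) U(1,2) by blast
 have hs: "sim (A (ns k)) a al'" unfolding sim_def
  by (rule bexI[OF _ UE(1)]) (simp add: UE(2) U(3) unitm_mats[OF aC[OF A_sub_C[THEN subsetD]]] al'_def)
 have "crossing k j al'" unfolding crossing_def
 proof (intro conjI h hA allI impI)
  fix t assume t: "t < S.r k"
  have "1 <= ns k ! t" using valid_sizesD[OF S.valid t] by simp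
  from mats_single_mono[OF this] have mvA': "mv 0 t ` A [1] <= A (ns k)"
   using mv_mats[OF E.opr_axioms _ t] by (meson image_subsetI subsetD)
  have s: "sim (A [1]) (%x. a (mv 0 t x)) (%x. al' (mv 0 t x))"
   using sim_comp[OF hs mvA'] by (simp add: comp_def)
  have hT: "(%x. a (mv 0 t x)):TV (S'.r j)" unfolding a_def by (rule S'.cn_TV[OF j(1) al(3)[OF t]])
  have h1: "hom [1] (%x. al' (mv 0 t x))"
   by (rule hom_comp_mv[OF h t]) (use valid_sizesD[OF S.valid t] in \<open>simp add: One_nat_def\<close>)
  have "(%x. al' (mv 0 t x)) ` A [1] <= upto E (S'.r j)" using hA mvA' mats_upto by blast
  thus T: "(%x. al' (mv 0 t x)):TV (S'.r j)" using T1_sim[OF TV_T1[OF hT] h1 s] by (simp add: TV_def)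
  have "Ga (S.germ k (mv 0 t)) = S'.germ j (%x. a (mv 0 t x))"
   unfolding al(4)[OF t] a_def by (rule S'.germ_push[OF j(1) al(3)[OF t], symmetric])
  thus "Ga (S.germ k (mv 0 t)) = S'.germ j (%x. al' (mv 0 t x))" using S'.germ_sim[OF hT T s] by simp
 qed
 moreover have "ALL x:A (ns' p). al' (bt x) = S'.cn p j x" using U(5) by (simp add: al'_def)
 ultimately show ?thesis using j(3) by blast
qed

end

context dsys_pair
begin

text \<open>The inverse of Ga is again a module isomorphism that preserves scales, so crossings
  exist in both directions and each one can be corrected against its predecessor.\<close>

lemma intertwining_of_module_iso:
 assumes iso: "module_iso E F ns ph ns' ph' Ga" and sc: "bij_betw Ga (dim_scale E F ns ph) (dim_scale E F ns' ph')"
 shows "EX n m al bt. intertwining ns g ns' g' n m al bt"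
proof -
 let ?M = "dim_module E F ns ph"
 let ?I = "inv_into ?M Ga"
 have b: "bij_betw Ga ?M (dim_module E F ns' ph')" using iso by (simp add: module_iso_def)
 have sM: "dim_scale E F ns ph <= ?M" unfolding S.dim_scale_eq S.dim_module_eq by blast
 have "?I ` dim_scale E F ns' ph' <= dim_scale E F ns ph"
 proof (rule image_subsetI)
  fix P assume "P:dim_scale E F ns' ph'"
  then obtain Q where Q: "Q:dim_scale E F ns ph" "P = Ga Q" using sc by (auto simp: bij_betw_def)
  thus "?I P:dim_scale E F ns ph" using bij_betw_inv_into_left[OF b] sM by auto
 qed
 then interpret R: dsys_iso E F ns' ph' g' ns ph g ?I
  by unfold_locales (use module_iso_inverse[OF iso S.dim_add_in S.dim_act_in] in simp_all)
 interpret T: dsys_iso E F ns ph g ns' ph' g' Ga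
  by unfold_locales (use iso sc in \<open>auto simp: bij_betw_def\<close>)
 let ?P = "%k m k' al bt. ALL x:A (ns k). bt (al x) = S.cn k k' x"
 let ?Q = "%m k m' bt al. ALL x:A (ns' m). al (bt x) = S'.cn m m' x"
 have "EX n m al bt. ALL i. n i < m i & m i < n (Suc i) & T.crossing (n i) (m i) (al i) & R.crossing (m i) (n (Suc i)) (bt i) \<and>
  ?P (n i) (m i) (n (Suc i)) (al i) (bt i) & ?Q (m i) (n (Suc i)) (m (Suc i)) (bt i) (al (Suc i))"
 proof (rule zigzag)
  obtain m al where "m >= 1" "T.crossing 0 m al" using T.exists_crossing by blast
  thus "EX m al. 0 < m & T.crossing 0 m al" by (intro exI[of _ m] exI[of _ al]) simp
 next
  fix k m al assume c: "T.crossing k m al"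
  note d = T.crossingD[OF c]
  have "?I (S'.germ m (%x. al (mv 0 t x))) = S.germ k (mv 0 t)" if "t < S.r k" for t
   using bij_betw_inv_into_left[OF b S.germ_in[OF TV_mv[OF that]]] d(4)[OF that] by simp
  from R.crossing_after[OF d(1,2,3) this]
  show "EX k'>m. \<exists>bt. R.crossing m k' bt & ?P k m k' al bt" by blast
 next
  fix m k bt assume c: "R.crossing m k bt"
  note d = R.crossingD[OF c]
  have "Ga (S.germ k (%x. bt (mv 0 t x))) = S'.germ m (mv 0 t)" if "t < S'.r m" for t
   using bij_betw_inv_into_right[OF b S'.germ_in[OF TV_mv[OF that]]] d(4)[OF that] by simp
  from T.crossing_after[OF d(1,2,3) this]
  show "EX m'>k. \<exists>al. T.crossing k m' al & ?Q m k m' bt al" by blast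
 qed
 then obtain n m al bt where *: "!!i. n i < m i & m i < n (Suc i) & T.crossing (n i) (m i) (al i) & R.crossing (m i) (n (Suc i)) (bt i) \<and>
  ?P (n i) (m i) (n (Suc i)) (al i) (bt i) & ?Q (m i) (n (Suc i)) (m (Suc i)) (bt i) (al (Suc i))" by blast
 have c: "T.crossing (n i) (m i) (al i)" "R.crossing (m i) (n (Suc i)) (bt i)" for i using * by blast+
 have "intertwining ns g ns' g' n m al bt"
  unfolding intertwining_def using * T.crossingD(1,2)[OF c(1)] R.crossingD(1,2)[OF c(2)] by simp
 thus ?thesis by blast
qed

end

section \<open>Module isomorphisms from intertwinings\<close>

context dsys_pair
begin

text \<open>The stages \<open>a i\<close> are cofinal and the maps are compatible with the
  connecting maps up to equivalence. Hence the value does not depend on the stage or the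
  representative at which a germ is met.\<close>

lemma induced_map:
 assumes a: "!!i. i <= a i" "mono a" and b: "mono b"
  and al: "!!i. smap (S.r (a i)) (S'.r (b i)) (al i)"
  and comm: "!!i ps. ps:TV (S.r (a i)) ==>
   sim (A [1]) (%x. al (Suc i) (S.cn (a i) (a (Suc i)) (ps x))) (%x. S'.cn (b i) (b (Suc i)) (al i (ps x)))"
 shows "\<exists>Ga. ALL i. ALL ps:TV (S.r (a i)). Ga (S.germ (a i) ps) = S'.germ (b i) (%x. al i (ps x))"
proof -
 have aa: "a i <= a j" "b i <= b j" if "i <= j" for i j using that a(2) b by (auto simp: mono_def)
 have step: "S'.germ (b j) (%x. al j (S.cn (a i) (a j) (ps x))) = S'.germ (b i) (%x. al i (ps x))"
  if ij: "i <= j" and ps: "ps:TV (S.r (a i))" for i j ps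
  using ij
 proof (induction j rule: dec_induct)
  case (step j)
  have l: "a j <= a (Suc j)" "b j <= b (Suc j)" "a i <= a j" using aa[of j "Suc j"] aa[OF step.hyps(1)] by auto
  note ka = S.cn_TV[OF l(3) ps]
  have "S'.germ (b (Suc j)) (%x. al (Suc j) (S.cn (a i) (a (Suc j)) (ps x))) =
    S'.germ (b (Suc j)) (%x. al (Suc j) (S.cn (a j) (a (Suc j)) (S.cn (a i) (a j) (ps x))))"
   by (simp only: conn_trans[OF l(3,1)])
  also have "... = S'.germ (b (Suc j)) (%x. S'.cn (b j) (b (Suc j)) (al j (S.cn (a i) (a j) (ps x))))"
   by (rule S'.germ_sim[OF TV_comp[OF al S.cn_TV[OF l(1) ka]] S'.cn_TV[OF l(2) TV_comp[OF al ka]] comm[OF ka]])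
  also have "... = S'.germ (b j) (%x. al j (S.cn (a i) (a j) (ps x)))" by (rule S'.germ_push[OF l(2) TV_comp[OF al ka]])
  finally show ?case using step.IH by simp
 qed simp
 have wd: "S'.germ (b i) (%x. al i (ps x)) = S'.germ (b j) (%x. al j (ka x))"
  if ps: "ps:TV (S.r (a i))" and ka: "ka:TV (S.r (a j))" and eq: "S.germ (a i) ps = S.germ (a j) ka" for i j ps ka
 proof -
  obtain m0 where m0: "ALL m>=m0. sim (A [1]) (%x. S.cn (a i) m (ps x)) (%x. S.cn (a j) m (ka x))"
   using S.germ_later[OF eq ps ka] by blast
  define l where "l = max m0 (max i j)"
  have l: "i <= l" "j <= l" "m0 <= a l" using order_trans[OF _ a(1)[of l], of m0] by (auto simp: l_def)
  note p = S.cn_TV[OF aa(1)[OF l(1)] ps] and q = S.cn_TV[OF aa(1)[OF l(2)] ka]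
  have "sim (A [1]) (%x. al l (S.cn (a i) (a l) (ps x))) (%x. al l (S.cn (a j) (a l) (ka x)))"
   using m0 l(3) by (intro sim_post[OF al p q _ S.r_pos]) blast
  from S'.germ_sim[OF TV_comp[OF al p] TV_comp[OF al q] this] show ?thesis
   using step[OF l(1) ps] step[OF l(2) ka] by simp
 qed
 define Ga where "Ga P = (SOME Q. EX i. EX ps:TV (S.r (a i)). P = S.germ (a i) ps & Q = S'.germ (b i) (%x. al i (ps x)))" for P
 have "Ga (S.germ (a i) ps) = S'.germ (b i) (%x. al i (ps x))" if "ps:TV (S.r (a i))" for i ps
  unfolding Ga_def
 proof (rule some_equality)
  show "EX j. EX ka:TV (S.r (a j)). S.germ (a i) ps = S.germ (a j) ka \<and>
   S'.germ (b i) (%x. al i (ps x)) = S'.germ (b j) (%x. al j (ka x))" using that by blast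
 qed (use wd[OF that] in metis)
 thus ?thesis by blast
qed

lemma induced_map_module_hom:
 assumes a: "!!i. i <= a i"
  and al: "!!i. smap (S.r (a i)) (S'.r (b i)) (al i)"
  and Ga: "!!i ps. ps:TV (S.r (a i)) ==> Ga (S.germ (a i) ps) = S'.germ (b i) (%x. al i (ps x))"
 shows "P:dim_module E F ns ph ==> Q:dim_module E F ns ph ==>
   Ga (dim_add E F ns ph P Q) = dim_add E F ns' ph' (Ga P) (Ga Q)"
  "P:dim_module E F ns ph ==> T:V_elem E F [1] ==>
   Ga (dim_act E F ns ph P T) = dim_act E F ns' ph' (Ga P) T"
proof -
 have up: "ka x:upto CE (S.r p)" if "ka:TV (S.r p)" "x:A [1]" for ka x p
  using TV_upto[OF that(1)] that(2) upto_mono[OF E_sub_CE] by blast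
 { assume "P:dim_module E F ns ph" "Q:dim_module E F ns ph"
  from S.dim_module_pair[OF this, of 0] obtain k ps0 om0 where 0: "ps0:TV (S.r k)" "om0:TV (S.r k)"
   "ps0 u1 * om0 u1 = 0" "P = S.germ k ps0" "Q = S.germ k om0" by blast
  define ps om where "ps x = S.cn k (a k) (ps0 x)" and "om x = S.cn k (a k) (om0 x)" for x
  have T: "ps:TV (S.r (a k))" "om:TV (S.r (a k))" "ps u1 * om u1 = 0"
   unfolding ps_def[abs_def] om_def[abs_def] using S.cn_TV[OF a] S.cn_orthogonal[OF a] 0(1-3) by simp_all
  have PQ: "P = S.germ (a k) ps" "Q = S.germ (a k) om"
   unfolding 0(4,5) ps_def[abs_def] om_def[abs_def] using S.germ_push[OF a] 0(1,2) by simp_all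
  note s = chomD(1)[OF smap_chom[OF al]]
  have o: "al k (ps u1) * al k (om u1) = 0"
   using shomD(5,7)[OF s up[OF T(1) E.unitm_in]] up[OF T(2) E.unitm_in] T(3) by metis
  note A1 = TV_comp[OF al T(1)] and A2 = TV_comp[OF al T(2)]
  have "Ga (dim_add E F ns ph P Q) = S'.germ (b k) (%x. al k (ps x + om x))"
   unfolding PQ S.dim_add_germ[OF T] by (rule Ga[OF TV_add[OF T]])
  also have "... = S'.germ (b k) (%x. al k (ps x) + al k (om x))"
   by (rule S'.germ_cong[OF TV_comp[OF al TV_add[OF T]] TV_add[OF A1 A2 o]])
    (rule shomD(4)[OF s up[OF T(1)] up[OF T(2)]])
  also have "... = dim_add E F ns' ph' (Ga P) (Ga Q)"
   unfolding PQ Ga[OF T(1)] Ga[OF T(2)] by (rule S'.dim_add_germ[OF A1 A2 o, symmetric])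
  finally show "Ga (dim_add E F ns ph P Q) = dim_add E F ns' ph' (Ga P) (Ga Q)" . }
 { assume P: "P:dim_module E F ns ph" and T: "T:V_elem E F [1]"
  obtain th where th: "th:TV 1" "T = vc 1 th" using T V_elem_one by blast
  obtain k h0 where h0: "smap 1 (S.r k) h0" "P = S.germ k h0" using S.dim_module_smap[OF P, of 0] by blast
  define h where "h x = S.cn k (a k) (h0 x)" for x
  have h: "smap 1 (S.r (a k)) h" unfolding h_def[abs_def] by (rule smap_comp[OF h0(1) S.cn_stable[OF a]])
  have Ph: "P = S.germ (a k) h" unfolding h0(2) h_def[abs_def] by (rule S.germ_push[OF a S.smap_TV[OF h0(1)], symmetric])
  have "Ga (dim_act E F ns ph P T) = S'.germ (b k) (%x. al k (h (th x)))"
   unfolding Ph th(2) S.dim_act_germ[OF h th(1)] by (rule Ga[OF TV_comp[OF h th(1)]])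
  also have "... = dim_act E F ns' ph' (Ga P) T"
   unfolding Ph th(2) Ga[OF S.smap_TV[OF h]] by (rule S'.dim_act_germ[OF smap_comp[OF h al] th(1), symmetric])
  finally show "Ga (dim_act E F ns ph P T) = dim_act E F ns' ph' (Ga P) T" . }
qed

text \<open>De after Ga sends a germ to its own push-forward along a connecting map, which is the
  same element of the direct limit.\<close>

lemma round_trip:
 assumes ge: "!!i. i <= n i" and le: "!!i. n i <= n (Suc i)"
  and a: "!!i. smap (S.r (n i)) (S'.r (m i)) (a i)" and b: "!!i. smap (S'.r (m i)) (S.r (n (Suc i))) (b i)"
  and ba: "!!i ps. ps:TV (S.r (n i)) ==> sim (A [1]) (%x. b i (a i (ps x))) (%x. S.cn (n i) (n (Suc i)) (ps x))"
  and Ga: "!!i ps. ps:TV (S.r (n i)) ==> Ga (S.germ (n i) ps) = S'.germ (m i) (%x. a i (ps x))"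
  and De: "!!i ps. ps:TV (S'.r (m i)) ==> De (S'.germ (m i) ps) = S.germ (n (Suc i)) (%x. b i (ps x))"
  and P: "P:dim_module E F ns ph"
 shows "Ga P:dim_module E F ns' ph'" "De (Ga P) = P"
proof -
 obtain i ps0 where 0: "ps0:TV (S.r i)" "P = S.germ i ps0" using P unfolding S.dim_module_eq by blast
 define ps where "ps x = S.cn i (n i) (ps0 x)" for x
 have ps: "ps:TV (S.r (n i))" "P = S.germ (n i) ps"
  unfolding ps_def[abs_def] 0(2) using S.cn_TV[OF ge 0(1)] S.germ_push[OF ge 0(1)] by simp_all
 note T = TV_comp[OF a ps(1)]
 show "Ga P:dim_module E F ns' ph'" unfolding ps(2) Ga[OF ps(1)] by (rule S'.germ_in[OF T])
 have "De (Ga P) = S.germ (n (Suc i)) (%x. b i (a i (ps x)))" unfolding ps(2) Ga[OF ps(1)] by (rule De[OF T])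
 also have "... = S.germ (n (Suc i)) (%x. S.cn (n i) (n (Suc i)) (ps x))"
  by (rule S.germ_sim[OF TV_comp[OF b T] S.cn_TV[OF le ps(1)] ba[OF ps(1)]])
 also have "... = P" unfolding ps(2) by (rule S.germ_push[OF le ps(1)])
 finally show "De (Ga P) = P" .
qed

lemma scale_image:
 assumes ge: "!!i. i <= n i" and a: "!!i. smap (S.r (n i)) (S'.r (m i)) (a i)"
  and aA: "!!i x. x:A (ns (n i)) ==> a i x:A (ns' (m i))"
  and Ga: "!!i ps. ps:TV (S.r (n i)) ==> Ga (S.germ (n i) ps) = S'.germ (m i) (%x. a i (ps x))"
 shows "Ga ` dim_scale E F ns ph <= dim_scale E F ns' ph'"
proof (rule image_subsetI)
 fix P assume "P:dim_scale E F ns ph"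
 then obtain k ps where ps: "ps:TV (S.r k)" "ps ` A [1] <= A (ns k)" "P = S.germ k ps" unfolding S.dim_scale_eq by blast
 note T = S.cn_TV[OF ge[of k] ps(1)]
 have "a k (S.cn k (n k) (ps x)):A (ns' (m k))" if "x:A [1]" for x
  using that ps(2) S.cn_A[OF ge[of k]] by (intro aA) blast
 moreover have "Ga P = S'.germ (m k) (%x. a k (S.cn k (n k) (ps x)))"
  unfolding ps(3) S.germ_push[OF ge[of k] ps(1), symmetric] by (rule Ga[OF T])
 ultimately show "Ga P:dim_scale E F ns' ph'" unfolding S'.dim_scale_eq using TV_comp[OF a T] by blast
qed

text \<open>The crossover maps act on classes because \<open>alT\<close> and \<open>btT\<close> put
  their partial maps into the family. Their amplifications commute with the connecting maps up to
  equivalence, by comparison on corners, so the induced maps of modules are inverse to each other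
  and preserve the scales.\<close>

lemma module_iso_of_intertwining:
 assumes I: "intertwining ns g ns' g' n m al bt"
  and alT: "!!i t. t < S.r (n i) ==> (%x. al i (mv 0 t x)):T1"
  and btT: "!!i t. t < S'.r (m i) ==> (%x. bt i (mv 0 t x)):T1"
 shows "\<exists>Ga. module_iso E F ns ph ns' ph' Ga & bij_betw Ga (dim_scale E F ns ph) (dim_scale E F ns' ph')"
proof -
 interpret R: dsys_pair E F ns' ph' g' ns ph g by unfold_locales
 have nm: "n i < m i" "m i < n (Suc i)" and al: "hom (ns (n i)) (al i)" "al i ` A (ns (n i)) <= A (ns' (m i))"
  and bt: "hom (ns' (m i)) (bt i)" "bt i ` A (ns' (m i)) <= A (ns (n (Suc i)))"
  and btal: "!!x. x:A (ns (n i)) ==> bt i (al i x) = S.cn (n i) (n (Suc i)) x"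
  and albt: "!!x. x:A (ns' (m i)) ==> al (Suc i) (bt i x) = S'.cn (m i) (m (Suc i)) x" for i
  using I by (simp_all add: intertwining_def)
 have mono: "strict_mono n" "strict_mono m"
  unfolding strict_mono_Suc_iff using nm order_less_trans by (blast, metis nm(1,2) order_less_trans)
 have mono': "mono n" "mono m" "mono (%i. n (Suc i))"
  using strict_mono_mono[OF mono(1)] strict_mono_mono[OF mono(2)] by (auto simp: mono_def)
 have ge: "i <= n i" "i <= m i" for i using strict_mono_imp_increasing mono by blast+
 define a where "a i = amp (ns (n i)) (ns' (m i)) (al i)" for i
 define b where "b i = amp (ns' (m i)) (ns (n (Suc i))) (bt i)" for i
 have a: "smap (S.r (n i)) (S'.r (m i)) (a i)" and b: "smap (S'.r (m i)) (S.r (n (Suc i))) (b i)" for i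
  unfolding a_def b_def by (rule smap_amp S.valid S'.valid al bt alT btT | assumption)+
 have ae: "a i x = al i x" if "x:A (ns (n i))" for i x unfolding a_def
  by (rule amp_extends[OF homD(1)[OF al(1)] _ S'.valid A_sub_C[THEN subsetD, OF that]]) (use hom_range[OF al] in blast)
 have be: "b i x = bt i x" if "x:A (ns' (m i))" for i x unfolding b_def
  by (rule amp_extends[OF homD(1)[OF bt(1)] _ S.valid A_sub_C[THEN subsetD, OF that]]) (use hom_range[OF bt] in blast)
 have corner: "mv 0 t x:A ks" if "valid_sizes ks" "t < length ks" "x:A [1]" for t x ks
 proof (rule mv_mats[OF E.opr_axioms _ that(2)])
  have "1 <= ks ! t" using valid_sizesD[OF that(1,2)] by simp
  thus "x:A [ks ! t]" using mats_single_mono[of 1 "ks ! t" E] that(3) by blast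
 qed
 have ba: "sim (A [1]) (%x. b i (a i (ps x))) (%x. S.cn (n i) (n (Suc i)) (ps x))" if ps: "ps:TV (S.r (n i))" for i ps
 proof -
  have le: "n i <= n (Suc i)" using nm[of i] by simp
  show ?thesis
  proof (rule sim_smap[OF smap_chom[OF smap_comp[OF a b]] smap_chom[OF S.cn_stable[OF le]] _ ps ps TV_refl[OF ps] S.r_pos])
   fix t assume t: "t < S.r (n i)"
   show "sim (A [1]) (%x. b i (a i (mv 0 t x))) (%x. S.cn (n i) (n (Suc i)) (mv 0 t x))"
    by (rule sim_cong[OF TV_refl[OF S.cn_TV[OF le TV_mv[OF t]]]])
     (use corner[OF S.valid t] ae be btal al(2) in \<open>simp_all add: image_subset_iff\<close>)
  qed
 qed
 have ab: "sim (A [1]) (%x. a (Suc i) (b i (ps x))) (%x. S'.cn (m i) (m (Suc i)) (ps x))" if ps: "ps:TV (S'.r (m i))" for i ps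
 proof -
  have le: "m i <= m (Suc i)" using nm[of i] nm[of "Suc i"] by simp
  show ?thesis
  proof (rule sim_smap[OF smap_chom[OF smap_comp[OF b a]] smap_chom[OF S'.cn_stable[OF le]] _ ps ps TV_refl[OF ps] S'.r_pos])
   fix t assume t: "t < S'.r (m i)"
   show "sim (A [1]) (%x. a (Suc i) (b i (mv 0 t x))) (%x. S'.cn (m i) (m (Suc i)) (mv 0 t x))"
    by (rule sim_cong[OF TV_refl[OF S'.cn_TV[OF le TV_mv[OF t]]]])
     (use corner[OF S'.valid t] ae be albt bt(2) in \<open>simp_all add: image_subset_iff\<close>)
  qed
 qed
 have "\<exists>Ga. ALL i. ALL ps:TV (S.r (n i)). Ga (S.germ (n i) ps) = S'.germ (m i) (%x. a i (ps x))"
 proof (rule induced_map[OF ge(1) mono'(1,2) a])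
  fix i ps assume ps: "ps:TV (S.r (n i))"
  have le: "n i <= n (Suc i)" using nm[of i] by simp
  note T = TV_comp[OF a ps]
  show "sim (A [1]) (%x. a (Suc i) (S.cn (n i) (n (Suc i)) (ps x))) (%x. S'.cn (m i) (m (Suc i)) (a i (ps x)))"
   by (rule sim_trans[OF sim_post[OF a S.cn_TV[OF le ps] TV_comp[OF b T] sim_sym[OF ba[OF ps]] S.r_pos] ab[OF T]])
 qed
 then obtain Ga where Ga: "!!i ps. ps:TV (S.r (n i)) ==> Ga (S.germ (n i) ps) = S'.germ (m i) (%x. a i (ps x))" by blast
 have "\<exists>De. ALL i. ALL ps:TV (S'.r (m i)). De (S'.germ (m i) ps) = S.germ (n (Suc i)) (%x. b i (ps x))"
 proof (rule R.induced_map[OF ge(2) mono'(2,3) b])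
  fix i ps assume ps: "ps:TV (S'.r (m i))"
  have le: "m i <= m (Suc i)" using nm[of i] nm[of "Suc i"] by simp
  note T = TV_comp[OF b ps]
  show "sim (A [1]) (%x. b (Suc i) (S'.cn (m i) (m (Suc i)) (ps x))) (%x. S.cn (n (Suc i)) (n (Suc (Suc i))) (b i (ps x)))"
   by (rule sim_trans[OF sim_post[OF b S'.cn_TV[OF le ps] TV_comp[OF a T] sim_sym[OF ab[OF ps]] S'.r_pos] ba[OF T]])
 qed
 then obtain De where De: "!!i ps. ps:TV (S'.r (m i)) ==> De (S'.germ (m i) ps) = S.germ (n (Suc i)) (%x. b i (ps x))" by blast
 note G = round_trip[of n m a b Ga De, OF ge(1) less_imp_le[OF order_less_trans[OF nm]] a b ba Ga De]
 have lm: "m i <= m (Suc i)" for i using nm[of i] nm[of "Suc i"] by simp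
 \<comment> \<open>In this direction the index is shifted by one: \<open>b i\<close> is followed by
   \<open>a (Suc i)\<close>.\<close>
 note D = R.round_trip[of m "%i. n (Suc i)" b "%i. a (Suc i)" De Ga, OF ge(2) lm b a ab De Ga]
 have "bij_betw Ga (dim_module E F ns ph) (dim_module E F ns' ph')"
  by (rule bij_betw_byWitness[where f' = De]) (use G D in auto)
 hence iso: "module_iso E F ns ph ns' ph' Ga"
  unfolding module_iso_def using induced_map_module_hom[of n m a Ga, OF ge(1) a Ga] by blast
 have sub: "dim_scale E F ns ph <= dim_module E F ns ph" "dim_scale E F ns' ph' <= dim_module E F ns' ph'"
  unfolding S.dim_scale_eq S.dim_module_eq S'.dim_scale_eq S'.dim_module_eq by blast+
 have "a i x:A (ns' (m i))" if "x:A (ns (n i))" for i x using ae[OF that] al(2) that by auto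
 from scale_image[of n m a Ga, OF ge(1) a this Ga]
 have GS: "Ga ` dim_scale E F ns ph <= dim_scale E F ns' ph'" by simp
 have "b i x:A (ns (n (Suc i)))" if "x:A (ns' (m i))" for i x using be[OF that] bt(2) that by auto
 from R.scale_image[of m "%i. n (Suc i)" b De, OF ge(2) b this De]
 have DS: "De ` dim_scale E F ns' ph' <= dim_scale E F ns ph" by simp
 have "bij_betw Ga (dim_scale E F ns ph) (dim_scale E F ns' ph')"
  by (rule bij_betw_byWitness[where f' = De]) (use G(2) D(2) sub GS DS in auto)
 thus ?thesis using iso by blast
qed

end

section \<open>Limit algebras\<close>

lemma null_mult:
 fixes x y :: "nat => 'a::real_normed_algebra"
 assumes "Bfun x sequentially" "Bfun y sequentially"
  "(%k. x' k - x k) ----> 0" "(%k. y' k - y k) ----> 0"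
 shows "(%k. x' k * y' k - x k * y k) ----> 0"
proof -
 have Z: "Zfun (%k. x' k - x k) sequentially" "Zfun (%k. y' k - y k) sequentially"
  using assms(3,4) by (simp_all add: tendsto_Zfun_iff)
 have "Zfun (%k. (x' k - x k) * (y' k - y k) + (x' k - x k) * y k + x k * (y' k - y k)) sequentially"
  by (intro Zfun_add bounded_bilinear.Zfun[OF bounded_bilinear_mult] Z
   bounded_bilinear.Zfun_prod_Bfun[OF bounded_bilinear_mult Z(1) assms(2)]
   bounded_bilinear.Bfun_prod_Zfun[OF bounded_bilinear_mult assms(1) Z(2)])
 moreover have "(x' k - x k) * (y' k - y k) + (x' k - x k) * y k + x k * (y' k - y k) = x' k * y' k - x k * y k" for k
  by (simp add: algebra_simps)
 ultimately show ?thesis by (simp add: tendsto_Zfun_iff)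
qed

section \<open>Composition and inversion of star-extendible isomorphisms\<close>

lemma star_extendibly_isomorphic_trans:
 assumes "star_extendibly_isomorphic A B" "star_extendibly_isomorphic B D"
 shows "star_extendibly_isomorphic A D"
proof -
 obtain f p where f: "bij_betw f (alg A) (alg B)" "extends_to A B f p" "bij_betw p (cstar A) (cstar B)"
  using assms(1) by (auto simp: star_extendibly_isomorphic_def)
 obtain h q where h: "bij_betw h (alg B) (alg D)" "extends_to B D h q" "bij_betw q (cstar B) (cstar D)"
  using assms(2) by (auto simp: star_extendibly_isomorphic_def)
 have "star_hom A D (q o p)" using f(2) h(2) by (simp add: extends_to_def star_hom_def)
 moreover have "h (f x) = q (p x)" if "x:alg A" for x
  using f(2) h(2) bij_betw_apply[OF f(1) that] that by (simp add: extends_to_def)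
 ultimately have "extends_to A D (h o f) (q o p)" by (simp add: extends_to_def)
 thus ?thesis unfolding star_extendibly_isomorphic_def
  using bij_betw_trans[OF f(1) h(1)] bij_betw_trans[OF f(3) h(3)] by blast
qed

definition star_closed :: "'a op_alg => bool" where
 "star_closed L \<longleftrightarrow> alg L <= cstar L & (ALL x:cstar L. starA L x:cstar L & (ALL c. scaleA L c x:cstar L) \<and>
   (ALL y:cstar L. addA L x y:cstar L & mulA L x y:cstar L))"

lemma star_hom_inverse:
 assumes "star_closed L" "star_hom L M p" "bij_betw p (cstar L) (cstar M)"
 shows "star_hom M L (inv_into (cstar L) p)"
proof -
 let ?q = "inv_into (cstar L) p"
 have q: "?q y:cstar L" "p (?q y) = y" if "y:cstar M" for y
  using bij_betw_apply[OF bij_betw_inv_into[OF assms(3)] that] bij_betw_inv_into_right[OF assms(3) that] by simp_all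
 have eq: "?q (p x) = x" if "x:cstar L" for x by (rule bij_betw_inv_into_left[OF assms(3) that])
 show ?thesis unfolding star_hom_def
 proof (intro ballI conjI allI q(1))
  fix y c assume y: "y:cstar M"
  show "?q (starA M y) = starA L (?q y)" "?q (scaleA M c y) = scaleA L c (?q y)"
   using eq[of "starA L (?q y)"] eq[of "scaleA L c (?q y)"] q[OF y] assms(1,2)
   by (auto simp: star_closed_def star_hom_def)
  fix z assume z: "z:cstar M"
  show "?q (addA M y z) = addA L (?q y) (?q z)" "?q (mulA M y z) = mulA L (?q y) (?q z)"
   using eq[of "addA L (?q y) (?q z)"] eq[of "mulA L (?q y) (?q z)"] q[OF y] q[OF z] assms(1,2)
   by (auto simp: star_closed_def star_hom_def)
 qed
qed

lemma star_extendibly_isomorphicE: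
 assumes "star_extendibly_isomorphic L M"
 obtains p where "star_hom L M p" "bij_betw p (cstar L) (cstar M)" "bij_betw p (alg L) (alg M)"
proof -
 obtain f p where f: "bij_betw f (alg L) (alg M)" "extends_to L M f p" "bij_betw p (cstar L) (cstar M)"
  using assms by (auto simp: star_extendibly_isomorphic_def)
 have "bij_betw p (alg L) (alg M)"
  using f(1,2) by (simp add: extends_to_def cong: bij_betw_cong)
 thus ?thesis by (intro that[of p]) (use f(2,3) in \<open>simp_all add: extends_to_def\<close>)
qed

lemma bij_betw_inv_into_alg:
 assumes "star_closed L" "bij_betw p (cstar L) (cstar M)" "bij_betw p (alg L) (alg M)"
 shows "bij_betw (inv_into (cstar L) p) (alg M) (alg L)"
proof (rule bij_betw_byWitness[where f' = p])
 have s: "alg L <= cstar L" using assms(1) by (simp add: star_closed_def)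
 have *: "EX x:alg L. y = p x" if "y:alg M" for y using assms(3) that by (auto simp: bij_betw_def)
 have i: "inv_into (cstar L) p (p x) = x" if "x:alg L" for x
  using bij_betw_inv_into_left[OF assms(2)] s that by blast
 show "ALL y:alg M. p (inv_into (cstar L) p y) = y" using * i by fastforce
 show "ALL x:alg L. inv_into (cstar L) p (p x) = x" using i by blast
 show "inv_into (cstar L) p ` alg M <= alg L" using * i by fastforce
 show "p ` alg L <= alg M" using assms(3) by (simp add: bij_betw_def)
qed

lemma star_extendibly_isomorphic_sym:
 assumes "star_closed L" "star_extendibly_isomorphic L M" shows "star_extendibly_isomorphic M L"
proof -
 obtain p where p: "star_hom L M p" "bij_betw p (cstar L) (cstar M)" "bij_betw p (alg L) (alg M)"
  using star_extendibly_isomorphicE[OF assms(2)] .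
 show ?thesis unfolding star_extendibly_isomorphic_def extends_to_def
  by (intro exI[of _ "inv_into (cstar L) p"] conjI ballI refl star_hom_inverse[OF assms(1) p(1,2)]
   bij_betw_inv_into_alg[OF assms(1) p(2,3)] bij_betw_inv_into[OF p(2)])
qed

lemma cscale_diff: "cscale c (x - y) = cscale c x - cscale c y"
proof -
 have "cscale c (- y) = - cscale c y" by (simp only: cscale_minus_one[symmetric] cscale_simps(3) mult.commute)
 thus ?thesis using cscale_simps(1)[of c x "- y"] by simp
qed

lemma norm_cscale: "norm (cscale c x) = cmod c * norm x"
proof -
 have "(norm (cscale c x))\<^sup>2 = norm (cscale (cnj c * c) (star x * x))"
  by (simp add: mult.commute flip: norm_star_mult_self)
 also have "cnj c * c = complex_of_real ((cmod c)\<^sup>2)" by (simp only: complex_norm_square mult.commute)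
 also have "norm (cscale ... (star x * x)) = (cmod c * norm x)\<^sup>2"
  unfolding cscale_real by (simp add: norm_star_mult_self power_mult_distrib)
 finally show ?thesis by (simp add: power2_eq_iff_nonneg)
qed

text \<open>A common frame for the systems of elementary algebras and of their stabilisations: P
  holds the operator algebras and S the ambient star algebras. The assumption \<open>ext\<close>
  identifies the chosen star extension of each connecting map with g.\<close>

locale lsys =
 fixes P S :: "nat => 'h::complex_hilbert mat set" and g :: "nat => 'h mat => 'h mat"
  and AA :: "nat => 'h elt op_alg" and ph :: "nat => 'h elt => 'h elt"
 assumes AA: "AA k = mk_alg (ent ` P k) (ent ` S k)"
  and PS: "P k <= S k"
  and closed: "0:S k" "x:S k ==> y:S k ==> x + y:S k" "x:S k ==> y:S k ==> x * y:S k"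
   "x:S k ==> star x:S k" "x:S k ==> cscale c x:S k"
  and ext: "x:S k ==> star_extension (AA k) (AA (Suc k)) (ph k) (ent x) = ent (g k x)"
  and hom_g: "shom (S k) (g k)" and g_S: "x:S k ==> g k x:S (Suc k)" and g_P: "x:P k ==> g k x:P (Suc k)"
  and contr: "x:S k ==> norm (g k x) <= norm x"
begin

abbreviation "L == alg_lim AA ph"
abbreviation "cn == connecting g"

text \<open>This and the next four definitions express \<open>seqs\<close>,
  \<open>seq_class\<close>, \<open>coherent\<close> and the two carriers of \<open>alg_lim\<close>
  by sequences of matrices.\<close>

definition "Sq = {x. ALL k. x k:S k}"
definition "cls x = {(%k. ent (y k)) | y. y:Sq & (%k. x k - y k) ----> 0}"
definition "coh x \<longleftrightarrow> x:Sq & (EV k. x (Suc k) = g k (x k))"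
definition "acoh x \<longleftrightarrow> coh x & (EV k. x k:P k)"
definition "clo x \<longleftrightarrow> x:Sq & (ALL ep>0. EX y. coh y & (EV k. norm (x k - y k) <= ep))"

lemma SqD: "x:Sq ==> x k:S k" by (simp add: Sq_def)
lemma coh_Sq: "coh x ==> x:Sq" by (simp add: coh_def)
lemma clo_Sq: "clo x ==> x:Sq" by (simp add: clo_def)
lemma minus_closed: "x:S k ==> y:S k ==> x - y:S k"
 using closed(2)[OF _ closed(5)[of y k "-1"]] by (simp add: cscale_minus_one)

lemma coh_clo: "coh x ==> clo x"
 unfolding clo_def using coh_Sq by (intro conjI allI impI exI[of _ x]) auto

lemma seqs_eq: "seqs AA = (%x k. ent (x k)) ` Sq"
proof (intro set_eqI iffI)
 fix z assume "z:seqs AA"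
 hence z: "z k:ent ` S k" for k by (simp add: seqs_def AA)
 have "z k = ent (Abs_mat (z k))" "Abs_mat (z k):S k" for k using z[of k] by (auto simp: ent_inverse)
 hence "z = (%k. ent (Abs_mat (z k)))" "(%k. Abs_mat (z k)):Sq" by (auto simp: Sq_def)
 thus "z:(%x k. ent (x k)) ` Sq" by (rule image_eqI)
qed (auto simp: seqs_def AA Sq_def)

lemma seq_ent_inject: "(%k. ent (x k)) = (%k. ent (y k)) \<longleftrightarrow> x = y"
proof
 assume h: "(%k. ent (x k)) = (%k. ent (y k))"
 have "x k = y k" for k using fun_cong[OF h, of k] by (simp only: ent_inject)
 thus "x = y" by (simp add: fun_eq_iff)
qed simp

lemma image_Coll: "{y:f ` X. Q y} = {f y | y. y:X & Q (f y)}"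
 by auto

lemma seq_class_eq: "seq_class AA (%k. ent (x k)) = cls x"
proof -
 have "seq_class AA (%k. ent (x k)) = {(%k. ent (y k)) | y. y:Sq \<and>
   (%k. normA (AA k) (subA (AA k) (ent (x k)) (ent (y k)))) ----> 0}"
  by (simp only: seq_class_def seqs_eq image_Coll)
 also have "... = cls x" by (simp add: AA cls_def tendsto_norm_zero_iff)
 finally show ?thesis .
qed

lemma coherent_iff: "(%k. ent (x k)):coherent AA ph \<longleftrightarrow> coh x"
proof -
 have "(%k. ent (x k)):seqs AA \<longleftrightarrow> x:Sq" unfolding seqs_eq by (auto simp: seq_ent_inject image_iff)
 moreover have "ent (x (Suc k)) = star_extension (AA k) (AA (Suc k)) (ph k) (ent (x k)) \<longleftrightarrow> x (Suc k) = g k (x k)"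
  if "x:Sq" for k using ext[OF SqD[OF that]] by (simp add: ent_inject)
 ultimately show ?thesis unfolding coherent_def coh_def by auto
qed

lemma coherentE: "z:coherent AA ph ==> EX x. coh x & z = (%k. ent (x k))"
proof -
 assume z: "z:coherent AA ph"
 hence "z:seqs AA" by (simp add: coherent_def)
 then obtain x where "z = (%k. ent (x k))" unfolding seqs_eq by blast
 thus ?thesis using z coherent_iff[of x] by auto
qed

lemma alg_L: "alg L = {cls x | x. acoh x}"
proof -
 have "alg L = {seq_class AA x | x. x:coherent AA ph & (EV k. x k:alg (AA k))}"
  by (simp add: alg_lim_def)
 also have "... = {cls x | x. acoh x}"
 proof (intro set_eqI iffI)
  fix X assume "X:{seq_class AA x | x. x:coherent AA ph & (EV k. x k:alg (AA k))}"
  then obtain z where z: "X = seq_class AA z" "z:coherent AA ph" "EV k. z k:alg (AA k)" by blast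
  then obtain x where x: "coh x" "z = (%k. ent (x k))" using coherentE by blast
  have "EV k. x k:P k" using z(3) x(2) by (simp add: AA image_iff ent_inject)
  thus "X:{cls x | x. acoh x}" using x z(1) seq_class_eq by (auto simp: acoh_def)
 next
  fix X assume "X:{cls x | x. acoh x}"
  then obtain x where x: "X = cls x" "acoh x" by blast
  have "EV k. ent (x k):alg (AA k)" using x(2) by (auto simp: AA acoh_def elim: eventually_mono)
  thus "X:{seq_class AA x | x. x:coherent AA ph & (EV k. x k:alg (AA k))}"
   using x seq_class_eq coherent_iff[of x] by (intro CollectI exI[of _ "%k. ent (x k)"]) (auto simp: acoh_def)
 qed
 finally show ?thesis .
qed

lemma cstar_L: "cstar L = {cls x | x. clo x}"
proof -
 have i: "(EX z:coherent AA ph. EV k. normA (AA k) (subA (AA k) (ent (x k)) (z k)) <= ep) \<longleftrightarrow>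
   (EX y. coh y & (EV k. norm (x k - y k) <= ep))" for x ep
 proof
  assume "EX z:coherent AA ph. EV k. normA (AA k) (subA (AA k) (ent (x k)) (z k)) <= ep"
  then obtain z where z: "z:coherent AA ph" "EV k. normA (AA k) (subA (AA k) (ent (x k)) (z k)) <= ep" by blast
  obtain y where y: "coh y" "z = (%k. ent (y k))" using coherentE[OF z(1)] by blast
  show "EX y. coh y & (EV k. norm (x k - y k) <= ep)"
   using y(1) z(2) unfolding y(2) by (intro exI[of _ y]) (simp add: AA)
 next
  assume "EX y. coh y & (EV k. norm (x k - y k) <= ep)"
  then obtain y where y: "coh y" "EV k. norm (x k - y k) <= ep" by blast
  show "EX z:coherent AA ph. EV k. normA (AA k) (subA (AA k) (ent (x k)) (z k)) <= ep"
   using coherent_iff y by (intro bexI[of _ "%k. ent (y k)"]) (simp_all add: AA)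
 qed
 have "cstar L = {seq_class AA x | x. x:seqs AA & (ALL ep>0. EX y:coherent AA ph.
   EV k. normA (AA k) (subA (AA k) (x k) (y k)) <= ep)}"
  by (simp add: alg_lim_def)
 also have "... = {seq_class AA (%k. ent (x k)) | x. clo x}"
  unfolding seqs_eq clo_def i[symmetric] by blast
 finally show ?thesis by (simp only: seq_class_eq)
qed

lemma cls_self: "x:Sq ==> (%k. ent (x k)):cls x" by (auto simp: cls_def)

lemma cls_memD: assumes "z:cls x" obtains y where "z = (%k. ent (y k))" "y:Sq" "(%k. x k - y k) ----> 0"
 using assms by (auto simp: cls_def)

lemma cls_eqI: assumes "(%k. x k - y k) ----> 0" shows "cls x = cls y"
proof -
 have "(%k. x k - z k) ----> 0 \<longleftrightarrow> (%k. y k - z k) ----> 0" for z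
  using tendsto_add[OF assms, of "%k. y k - z k" 0] tendsto_diff[of "%k. x k - z k" 0 _ _ 0, OF _ assms] by auto
 thus ?thesis by (simp add: cls_def)
qed

lemma cls_eqD: assumes "cls x = cls y" "y:Sq" shows "(%k. x k - y k) ----> 0"
proof -
 have "(%k. ent (y k)):cls x" using cls_self[OF assms(2)] assms(1) by simp
 thus ?thesis by (auto simp: cls_def seq_ent_inject)
qed

lemma coh_eventually:
 assumes "coh x" shows "EX k0. ALL k>=k0. ALL l>=k. x l = cn k l (x k)"
proof -
 obtain k0 where k0: "!!k. k >= k0 ==> x (Suc k) = g k (x k)" using assms by (auto simp: coh_def eventually_sequentially)
 have "x l = cn k l (x k)" if "k >= k0" "l >= k" for k l
  using that(2)
 proof (induction l rule: dec_induct)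
  case (step l) thus ?case using k0[of l] that(1) by (simp add: conn_Suc)
 qed simp
 thus ?thesis by blast
qed

lemma cn_S: "k <= l ==> x:S k ==> cn k l x:S l"
 by (induction l rule: dec_induct) (simp_all add: conn_Suc g_S)
lemma cn_P: "k <= l ==> x:P k ==> cn k l x:P l"
 by (induction l rule: dec_induct) (simp_all add: conn_Suc g_P)
lemma cn_contr: "k <= l ==> x:S k ==> norm (cn k l x) <= norm x"
 by (induction l rule: dec_induct) (auto simp: conn_Suc intro: order_trans[OF contr[OF cn_S]])
lemma cn_shom: "k <= l ==> shom (S k) (cn k l)"
proof (induction l rule: dec_induct)
 case base show ?case by (simp add: shom_def)
next
 case (step l)
 thus ?case using shomD[OF hom_g cn_S[OF step.hyps(1)]] shomD[OF step.IH] cn_S[OF step.hyps(1)]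
  unfolding shom_def by (simp add: conn_Suc)
qed

lemma coh_bounded: assumes "coh x" shows "Bfun x sequentially"
proof -
 obtain k0 where k0: "!!k l. k0 <= k ==> k <= l ==> x l = cn k l (x k)" using coh_eventually[OF assms] by blast
 have "norm (x l) <= norm (x k0)" if "k0 <= l" for l
  using k0[OF order_refl that] cn_contr[OF that SqD[OF coh_Sq[OF assms]]] by simp
 thus ?thesis by (intro BfunI[of _ "norm (x k0)"]) (auto simp: eventually_sequentially)
qed

lemma clo_bounded: assumes "clo x" shows "Bfun x sequentially"
proof -
 obtain y where y: "coh y" "EV k. norm (x k - y k) <= 1"
  using assms zero_less_one unfolding clo_def by blast
 obtain K where "EV k. norm (y k) <= K" using coh_bounded[OF y(1)] by (auto simp: Bfun_def)
 hence "EV k. norm (x k) <= 1 + K"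
  using y(2) by eventually_elim (metis add_mono diff_add_cancel norm_triangle_ineq order_trans)
 thus ?thesis by (rule BfunI)
qed

text \<open>The unions over representatives have a single value since the operations respect null
  differences. For products this uses boundedness, which limits of coherent sequences inherit from
  the contractive connecting maps.\<close>

lemma ops_L:
 assumes "clo x" "clo y"
 shows "addA L (cls x) (cls y) = cls (%k. x k + y k)" "mulA L (cls x) (cls y) = cls (%k. x k * y k)"
  "scaleA L c (cls x) = cls (%k. cscale c (x k))" "starA L (cls x) = cls (%k. star (x k))"
proof -
 note x = clo_Sq[OF assms(1)] and y = clo_Sq[OF assms(2)]
 have bin: "(\<Union>u\<in>cls x. \<Union>v\<in>cls y. seq_class AA (%k. f k (u k) (v k))) = cls (%k. h (x k) (y k))"
  if fh: "!!k a b. f k (ent a) (ent b) = ent (h a b)"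
   "!!x' y'. (%k. x k - x' k) ----> 0 ==> (%k. y k - y' k) ----> 0 ==> (%k. h (x k) (y k) - h (x' k) (y' k)) ----> 0"
  for f h
 proof -
  have "seq_class AA (%k. f k (u k) (v k)) = cls (%k. h (x k) (y k))" if uv: "u:cls x" "v:cls y" for u v
  proof -
   obtain x' where x': "u = (%k. ent (x' k))" "(%k. x k - x' k) ----> 0" using cls_memD[OF uv(1)] .
   obtain y' where y': "v = (%k. ent (y' k))" "(%k. y k - y' k) ----> 0" using cls_memD[OF uv(2)] .
   have "seq_class AA (%k. f k (u k) (v k)) = cls (%k. h (x' k) (y' k))"
    unfolding x'(1) y'(1) fh(1) by (rule seq_class_eq)
   thus ?thesis using cls_eqI[OF fh(2)[OF x'(2) y'(2)]] by simp
  qed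
  thus ?thesis using cls_self[OF x] cls_self[OF y] by blast
 qed
 have un: "(\<Union>u\<in>cls x. seq_class AA (%k. f k (u k))) = cls (%k. h (x k))"
  if fh: "!!k a. f k (ent a) = ent (h a)" "!!x'. (%k. x k - x' k) ----> 0 ==> (%k. h (x k) - h (x' k)) ----> 0" for f h
 proof -
  have "seq_class AA (%k. f k (u k)) = cls (%k. h (x k))" if u: "u:cls x" for u
  proof -
   obtain x' where x': "u = (%k. ent (x' k))" "(%k. x k - x' k) ----> 0" using cls_memD[OF u] .
   have "seq_class AA (%k. f k (u k)) = cls (%k. h (x' k))"
    unfolding x'(1) fh(1) by (rule seq_class_eq)
   thus ?thesis using cls_eqI[OF fh(2)[OF x'(2)]] by simp
  qed
  thus ?thesis using cls_self[OF x] by blast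
 qed
 have neg: "(%k. b k - a k) ----> 0" if "(%k. a k - b k) ----> 0" for a b :: "nat => 'h mat"
  using tendsto_minus[OF that] by simp
 have "addA L (cls x) (cls y) = (\<Union>u\<in>cls x. \<Union>v\<in>cls y. seq_class AA (%k. addA (AA k) (u k) (v k)))"
  by (simp add: alg_lim_def)
 also have "... = cls (%k. x k + y k)"
 proof (rule bin[where f = "%k. addA (AA k)" and h = "(+)"])
  fix x' y' assume "(%k. x k - x' k) ----> 0" "(%k. y k - y' k) ----> 0"
  from tendsto_add[OF this] show "(%k. x k + y k - (x' k + y' k)) ----> 0" by (simp add: algebra_simps)
 qed (simp only: AA mk_alg_simps)
 finally show "addA L (cls x) (cls y) = cls (%k. x k + y k)" .
 have "mulA L (cls x) (cls y) = (\<Union>u\<in>cls x. \<Union>v\<in>cls y. seq_class AA (%k. mulA (AA k) (u k) (v k)))"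
  by (simp add: alg_lim_def)
 also have "... = cls (%k. x k * y k)"
 proof (rule bin)
  fix x' y' assume "(%k. x k - x' k) ----> 0" "(%k. y k - y' k) ----> 0"
  from null_mult[OF clo_bounded[OF assms(1)] clo_bounded[OF assms(2)] neg[OF this(1)] neg[OF this(2)]]
  show "(%k. x k * y k - x' k * y' k) ----> 0" by (rule neg)
 qed (simp add: AA)
 finally show "mulA L (cls x) (cls y) = cls (%k. x k * y k)" .
 have "scaleA L c (cls x) = (\<Union>u\<in>cls x. seq_class AA (%k. scaleA (AA k) c (u k)))" by (simp add: alg_lim_def)
 also have "... = cls (%k. cscale c (x k))"
 proof (rule un[where f = "%k. scaleA (AA k) c" and h = "cscale c"])
  fix x' assume "(%k. x k - x' k) ----> 0"
  hence "(%k. norm (cscale c (x k - x' k))) ----> 0"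
   unfolding norm_cscale by (intro tendsto_mult_right_zero tendsto_norm_zero)
  thus "(%k. cscale c (x k) - cscale c (x' k)) ----> 0" by (simp add: tendsto_norm_zero_iff cscale_diff)
 qed (simp only: AA mk_alg_simps)
 finally show "scaleA L c (cls x) = cls (%k. cscale c (x k))" .
 have "starA L (cls x) = (\<Union>u\<in>cls x. seq_class AA (%k. starA (AA k) (u k)))" by (simp add: alg_lim_def)
 also have "... = cls (%k. star (x k))"
 proof (rule un[where f = "%k. starA (AA k)" and h = star])
  fix x' assume z: "(%k. x k - x' k) ----> 0"
  have n: "norm (star (x k) - star (x' k)) = norm (x k - x' k)" for k by (metis norm_star star_minus(2))
  show "(%k. star (x k) - star (x' k)) ----> 0"
   using tendsto_norm_zero[OF z] by (simp only: tendsto_norm_zero_iff[of "%k. star (x k) - star (x' k)", symmetric] n)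
 qed (simp only: AA mk_alg_simps)
 finally show "starA L (cls x) = cls (%k. star (x k))" .
qed

lemma Sq_ops:
 assumes "x:Sq" shows "y:Sq ==> (%k. x k + y k):Sq" "y:Sq ==> (%k. x k - y k):Sq" "y:Sq ==> (%k. x k * y k):Sq"
  "(%k. star (x k)):Sq" "(%k. cscale c (x k)):Sq"
 using assms closed minus_closed by (simp_all add: Sq_def)

lemma coh_ops:
 assumes "coh x" shows "coh y ==> coh (%k. x k + y k)" "coh y ==> coh (%k. x k * y k)" "coh (%k. star (x k))" "coh (%k. cscale c (x k))"
proof -
 note x = coh_Sq[OF assms]
 have e: "EV k. x (Suc k) = g k (x k)" using assms by (simp add: coh_def)
 note h = shomD[OF hom_g SqD[OF x]]
 show "coh (%k. star (x k))" "coh (%k. cscale c (x k))" unfolding coh_def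
  using Sq_ops(4,5)[OF x] eventually_mono[OF e] by (auto simp: h(1,2))
 assume y: "coh y"
 have "EV k. x (Suc k) = g k (x k) & y (Suc k) = g k (y k)"
  using e y by (auto simp: coh_def eventually_conj_iff)
 hence "EV k. x (Suc k) + y (Suc k) = g k (x k + y k)"
  "EV k. x (Suc k) * y (Suc k) = g k (x k * y k)"
  by (eventually_elim, simp add: h(4,5)[OF SqD[OF coh_Sq[OF y]]])+
 thus "coh (%k. x k + y k)" "coh (%k. x k * y k)" unfolding coh_def
  using Sq_ops(1,3)[OF x coh_Sq[OF y]] by simp_all
qed

lemma clo_ops:
 assumes "clo x" shows "clo y ==> clo (%k. x k + y k)" "clo y ==> clo (%k. x k * y k)" "clo (%k. star (x k))" "clo (%k. cscale c (x k))"
proof -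
 note x = clo_Sq[OF assms]
 have near: "EX x'. coh x' & (EV k. norm (x k - x' k) <= ep)" if "ep > 0" "clo x" for x ep
  using that by (auto simp: clo_def)
 show "clo (%k. star (x k))" unfolding clo_def
 proof (intro conjI Sq_ops(4)[OF x] allI impI)
  fix ep :: real assume "ep > 0"
  then obtain x' where x': "coh x'" "EV k. norm (x k - x' k) <= ep" using near assms by blast
  have "norm (star (x k) - star (x' k)) = norm (x k - x' k)" for k by (simp only: norm_star flip: star_minus(2))
  thus "EX y. coh y & (EV k. norm (star (x k) - y k) <= ep)"
   using x' coh_ops(3) by (intro exI[of _ "%k. star (x' k)"]) simp
 qed
 show "clo (%k. cscale c (x k))" unfolding clo_def
 proof (intro conjI Sq_ops(5)[OF x] allI impI)
  fix ep :: real assume "ep > 0"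
  \<comment> \<open>The summand 1 covers the case c = 0.\<close>
  hence "ep / (1 + cmod c) > 0" by (simp add: add_pos_nonneg)
  then obtain x' where x': "coh x'" "EV k. norm (x k - x' k) <= ep / (1 + cmod c)" using near assms by blast
  have "norm (cscale c (x k) - cscale c (x' k)) <= ep" if "norm (x k - x' k) <= ep / (1 + cmod c)" for k
  proof -
   have "norm (cscale c (x k) - cscale c (x' k)) = cmod c * norm (x k - x' k)" by (simp only: norm_cscale flip: cscale_diff)
   also have "... <= (1 + cmod c) * (ep / (1 + cmod c))" using that by (intro mult_mono) auto
   also have "... = ep" using norm_ge_zero[of c] by (simp add: add_nonneg_eq_0_iff)
   finally show ?thesis .
  qed
  thus "EX y. coh y & (EV k. norm (cscale c (x k) - y k) <= ep)"
   by (intro exI[of _ "%k. cscale c (x' k)"] conjI coh_ops(4)[OF x'(1)] eventually_mono[OF x'(2)])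
 qed
 assume y: "clo y"
 note Y = clo_Sq[OF y]
 show "clo (%k. x k + y k)" unfolding clo_def
 proof (intro conjI Sq_ops(1)[OF x Y] allI impI)
  fix ep :: real assume "ep > 0"
  then obtain x' y' where x': "coh x'" "EV k. norm (x k - x' k) <= ep / 2"
   and y': "coh y'" "EV k. norm (y k - y' k) <= ep / 2"
   using near[OF half_gt_zero assms] near[OF half_gt_zero y] by blast
  have "EV k. norm (x k + y k - (x' k + y' k)) <= ep"
   using x'(2) y'(2)
  proof eventually_elim
   case (elim k)
   thus ?case using norm_triangle_ineq[of "x k - x' k" "y k - y' k"] by (simp add: algebra_simps)
  qed
  thus "EX z. coh z & (EV k. norm (x k + y k - z k) <= ep)" using coh_ops(1)[OF x'(1) y'(1)] by blast
 qed
 show "clo (%k. x k * y k)" unfolding clo_def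
 proof (intro conjI Sq_ops(3)[OF x Y] allI impI)
  fix ep :: real assume e: "ep > 0"
  \<comment> \<open>First x is approximated relative to the bound K of y, and only then y relative
    to the bound K' of the approximant of x; each choice contributes at most half of ep.\<close>
  obtain K where K: "0 < K" "EV k. norm (y k) <= K" using clo_bounded[OF y] by (auto simp: Bfun_def)
  obtain x' where x': "coh x'" "EV k. norm (x k - x' k) <= ep / (2 * K)"
   using near[of "ep / (2 * K)"] assms e K(1) by auto
  obtain K' where K': "0 < K'" "EV k. norm (x' k) <= K'" using coh_bounded[OF x'(1)] by (auto simp: Bfun_def)
  obtain y' where y': "coh y'" "EV k. norm (y k - y' k) <= ep / (2 * K')"
   using near[of "ep / (2 * K')"] y e K'(1) by auto
  have "EV k. norm (x k * y k - x' k * y' k) <= ep"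
   using x'(2) y'(2) K(2) K'(2)
  proof eventually_elim
   case (elim k)
   have "x k * y k - x' k * y' k = (x k - x' k) * y k + x' k * (y k - y' k)" by (simp add: algebra_simps)
   also have "norm ... <= norm ((x k - x' k) * y k) + norm (x' k * (y k - y' k))" by (rule norm_triangle_ineq)
   also have "... <= norm (x k - x' k) * norm (y k) + norm (x' k) * norm (y k - y' k)"
    by (intro add_mono norm_mult_ineq)
   also have "... <= ep / (2 * K) * K + K' * (ep / (2 * K'))"
    using elim K(1) K'(1) e by (intro add_mono mult_mono) auto
   also have "... = ep" using K(1) K'(1) by simp
   finally show ?case .
  qed
  thus "EX z. coh z & (EV k. norm (x k * y k - z k) <= ep)" using coh_ops(2)[OF x'(1) y'(1)] by blast
 qed
qed

lemma star_closed_L: "star_closed L"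
 unfolding star_closed_def
proof (intro conjI ballI allI)
 show "alg L <= cstar L" unfolding alg_L cstar_L using coh_clo by (auto simp: acoh_def)
 fix X c assume "X:cstar L"
 then obtain x where x: "X = cls x" "clo x" by (auto simp: cstar_L)
 show "starA L X:cstar L" "scaleA L c X:cstar L"
  unfolding x(1) ops_L(3,4)[OF x(2) x(2)] cstar_L using clo_ops(3,4)[OF x(2)] by blast+
 fix Y assume "Y:cstar L"
 then obtain y where y: "Y = cls y" "clo y" by (auto simp: cstar_L)
 show "addA L X Y:cstar L" "mulA L X Y:cstar L"
  unfolding x(1) y(1) ops_L(1,2)[OF x(2) y(2)] cstar_L using clo_ops(1,2)[OF x(2) y(2)] by blast+
qed

end

text \<open>The map \<open>T\<close> of sequences gives an isomorphism of the limits as soon as some contractive map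
 \<open>U\<close>, not necessarily multiplicative, inverts it on coherent sequences.\<close>

locale lsys_iso = L: lsys P S g AA ph + L': lsys P' S' g' AA' ph'
 for P S :: "nat => 'h::complex_hilbert mat set" and g AA ph and P' S' :: "nat => 'h mat set" and g' AA' ph' +
 fixes T U :: "(nat => 'h mat) => nat => 'h mat"
 assumes T_Sq: "x:L.Sq ==> T x:L'.Sq"
  and T_hom: "x:L.Sq ==> y:L.Sq ==> T (%k. x k + y k) k = T x k + T y k"
   "x:L.Sq ==> y:L.Sq ==> T (%k. x k * y k) k = T x k * T y k"
   "x:L.Sq ==> T (%k. star (x k)) k = star (T x k)" "x:L.Sq ==> T (%k. cscale c (x k)) k = cscale c (T x k)"
  and T_contr: "x:L.Sq ==> EV k. norm (x k) <= ep ==> EV k. norm (T x k) <= ep"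
  and T_coh: "L.coh x ==> L'.coh (T x)" "L.acoh x ==> L'.acoh (T x)"
  and U_Sq: "y:L'.Sq ==> U y:L.Sq"
  and U_diff: "y:L'.Sq ==> z:L'.Sq ==> U (%k. y k - z k) k = U y k - U z k"
  and U_contr: "y:L'.Sq ==> EV k. norm (y k) <= ep ==> EV k. norm (U y k) <= ep"
  and U_coh: "L'.coh y ==> L.coh (U y)" "L'.acoh y ==> L.acoh (U y)"
  and UT: "L.coh x ==> EV k. U (T x) k = x k"
  and TU: "L'.coh y ==> EV k. T (U y) k = y k"
begin

lemma T_diff: "x:L.Sq ==> y:L.Sq ==> T (%k. x k - y k) k = T x k - T y k"
 using T_hom(1)[OF _ L.Sq_ops(5)[of y "-1"], of x k] T_hom(4)[of y "-1" k] by (simp add: cscale_minus_one)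

lemma null_iff: "(x :: nat => 'h mat) ----> 0 \<longleftrightarrow> (ALL ep>0. EV k. norm (x k) <= ep)"
proof
 assume x: "x ----> 0"
 show "ALL ep>0. EV k. norm (x k) <= ep"
 proof (intro allI impI)
  fix ep :: real assume "ep > 0"
  from tendstoD[OF x this] show "EV k. norm (x k) <= ep" by (rule eventually_mono) simp
 qed
next
 assume a: "ALL ep>0. EV k. norm (x k) <= ep"
 show "x ----> 0"
 proof (rule tendstoI)
  fix e :: real assume "e > 0"
  hence "EV k. norm (x k) <= e / 2" using a half_gt_zero by blast
  thus "EV k. dist (x k) 0 < e" by (rule eventually_mono) (use \<open>e > 0\<close> in auto)
 qed
qed

lemma T_null: "x:L.Sq ==> x ----> 0 ==> T x ----> 0" using T_contr unfolding null_iff by blast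
lemma U_null: "x:L'.Sq ==> x ----> 0 ==> U x ----> 0" using U_contr unfolding null_iff by blast

lemma T_clo: assumes "L.clo x" shows "L'.clo (T x)"
 unfolding L'.clo_def
proof (intro conjI allI impI T_Sq L.clo_Sq[OF assms])
 fix ep :: real assume "ep > 0"
 then obtain y where y: "L.coh y" "EV k. norm (x k - y k) <= ep" using assms by (auto simp: L.clo_def)
 note s = L.clo_Sq[OF assms] L.coh_Sq[OF y(1)]
 have "EV k. norm (T x k - T y k) <= ep"
  using T_contr[OF L.Sq_ops(2)[OF s] y(2)] by (simp add: T_diff[OF s])
 thus "EX z. L'.coh z & (EV k. norm (T x k - z k) <= ep)" using T_coh(1)[OF y(1)] by blast
qed

lemma U_clo: assumes "L'.clo x" shows "L.clo (U x)"
 unfolding L.clo_def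
proof (intro conjI allI impI U_Sq L'.clo_Sq[OF assms])
 fix ep :: real assume "ep > 0"
 then obtain y where y: "L'.coh y" "EV k. norm (x k - y k) <= ep" using assms by (auto simp: L'.clo_def)
 note s = L'.clo_Sq[OF assms] L'.coh_Sq[OF y(1)]
 have "EV k. norm (U x k - U y k) <= ep"
  using U_contr[OF L'.Sq_ops(2)[OF s] y(2)] by (simp add: U_diff[OF s])
 thus "EX z. L.coh z & (EV k. norm (U x k - z k) <= ep)" using U_coh(1)[OF y(1)] by blast
qed

text \<open>On a coherent approximant the composite is eventually the identity; contractivity of T
  and U carries the approximation error through.\<close>

lemma UT_clo: assumes "L.clo x" shows "(%k. U (T x) k - x k) ----> 0"
 unfolding null_iff
proof (intro allI impI)
 fix ep :: real assume "ep > 0"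
 hence "ep / 2 > 0" by simp
 then obtain y where y: "L.coh y" "EV k. norm (x k - y k) <= ep / 2" using assms unfolding L.clo_def by blast
 note s = L.clo_Sq[OF assms] L.coh_Sq[OF y(1)]
 have t: "U (%k. T x k - T y k) k = U (T x) k - U (T y) k" for k by (rule U_diff[OF T_Sq[OF s(1)] T_Sq[OF s(2)]])
 have "EV k. norm (T x k - T y k) <= ep / 2"
  using T_contr[OF L.Sq_ops(2)[OF s] y(2)] by (simp add: T_diff[OF s])
 hence "EV k. norm (U (T x) k - U (T y) k) <= ep / 2"
  using U_contr[OF L'.Sq_ops(2)[OF T_Sq[OF s(1)] T_Sq[OF s(2)]], of "ep / 2"] unfolding t by blast
 thus "EV k. norm (U (T x) k - x k) <= ep"
  using y(2) UT[OF y(1)]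
 proof eventually_elim
  case (elim k)
  have "U (T x) k - x k = (U (T x) k - U (T y) k) - (x k - y k)" using elim(3) by simp
  thus ?case using norm_triangle_ineq4[of "U (T x) k - U (T y) k" "x k - y k"] elim(1,2) by simp
 qed
qed

lemma TU_clo: assumes "L'.clo x" shows "(%k. T (U x) k - x k) ----> 0"
 unfolding null_iff
proof (intro allI impI)
 fix ep :: real assume "ep > 0"
 hence "ep / 2 > 0" by simp
 then obtain y where y: "L'.coh y" "EV k. norm (x k - y k) <= ep / 2" using assms unfolding L'.clo_def by blast
 note s = L'.clo_Sq[OF assms] L'.coh_Sq[OF y(1)]
 have t: "T (%k. U x k - U y k) k = T (U x) k - T (U y) k" for k by (rule T_diff[OF U_Sq[OF s(1)] U_Sq[OF s(2)]])
 have "EV k. norm (U x k - U y k) <= ep / 2"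
  using U_contr[OF L'.Sq_ops(2)[OF s] y(2)] by (simp add: U_diff[OF s])
 hence "EV k. norm (T (U x) k - T (U y) k) <= ep / 2"
  using T_contr[OF L.Sq_ops(2)[OF U_Sq[OF s(1)] U_Sq[OF s(2)]], of "ep / 2"] unfolding t by blast
 thus "EV k. norm (T (U x) k - x k) <= ep"
  using y(2) TU[OF y(1)]
 proof eventually_elim
  case (elim k)
  have "T (U x) k - x k = (T (U x) k - T (U y) k) - (x k - y k)" using elim(3) by simp
  thus ?case using norm_triangle_ineq4[of "T (U x) k - T (U y) k" "x k - y k"] elim(1,2) by simp
 qed
qed

lemma T_cls_eq_iff:
 assumes "L.clo x" "L.clo y" shows "L'.cls (T x) = L'.cls (T y) \<longleftrightarrow> L.cls x = L.cls y"
proof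
 note s = L.clo_Sq[OF assms(1)] L.clo_Sq[OF assms(2)]
 assume "L'.cls (T x) = L'.cls (T y)"
 hence "(%k. T x k - T y k) ----> 0" by (rule L'.cls_eqD[OF _ T_Sq[OF s(2)]])
 hence "U (%k. T x k - T y k) ----> 0" by (rule U_null[OF L'.Sq_ops(2)[OF T_Sq[OF s(1)] T_Sq[OF s(2)]]])
 moreover have "U (%k. T x k - T y k) = (%k. U (T x) k - U (T y) k)"
  by (rule ext) (rule U_diff[OF T_Sq[OF s(1)] T_Sq[OF s(2)]])
 ultimately have "(%k. U (T x) k - U (T y) k) ----> 0" by simp
 from tendsto_add[OF tendsto_diff[OF this UT_clo[OF assms(1)]] UT_clo[OF assms(2)]]
 show "L.cls x = L.cls y" by (intro L.cls_eqI) simp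
next
 note s = L.clo_Sq[OF assms(1)] L.clo_Sq[OF assms(2)]
 assume "L.cls x = L.cls y"
 hence "(%k. x k - y k) ----> 0" by (rule L.cls_eqD[OF _ s(2)])
 moreover have "T (%k. x k - y k) = (%k. T x k - T y k)" by (rule ext) (rule T_diff[OF s])
 ultimately have "(%k. T x k - T y k) ----> 0" using T_null[OF L.Sq_ops(2)[OF s]] by simp
 thus "L'.cls (T x) = L'.cls (T y)" by (rule L'.cls_eqI)
qed

lemma isomorphic: "star_extendibly_isomorphic L.L L'.L"
proof -
 define \<pi> where "\<pi> X = L'.cls (T (SOME x. L.clo x & X = L.cls x))" for X
 have \<pi>: "\<pi> (L.cls x) = L'.cls (T x)" if "L.clo x" for x
 proof -
  have "L.clo (SOME y. L.clo y & L.cls x = L.cls y) & L.cls x = L.cls (SOME y. L.clo y & L.cls x = L.cls y)"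
   by (rule someI[of _ x]) (simp add: that)
  thus ?thesis unfolding \<pi>_def using T_cls_eq_iff[OF that] by metis
 qed
 have cE: "EX x. L.clo x & X = L.cls x" if "X:cstar L.L" for X using that unfolding L.cstar_L by blast
 have "star_hom L.L L'.L \<pi>" unfolding star_hom_def
 proof (intro ballI conjI allI)
  fix X c assume "X:cstar L.L"
  then obtain x where x: "L.clo x" "X = L.cls x" using cE by blast
  note Tx = T_clo[OF x(1)] and sx = L.clo_Sq[OF x(1)]
  show "\<pi> X:cstar L'.L" unfolding x(2) \<pi>[OF x(1)] L'.cstar_L using Tx by blast
  have e: "T (%k. star (x k)) = (%k. star (T x k))" "T (%k. cscale c (x k)) = (%k. cscale c (T x k))"
   using T_hom(3,4)[OF sx] by (simp_all add: fun_eq_iff)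
  show "\<pi> (starA L.L X) = starA L'.L (\<pi> X)" "\<pi> (scaleA L.L c X) = scaleA L'.L c (\<pi> X)"
   unfolding x(2) L.ops_L(3,4)[OF x(1) x(1)] \<pi>[OF L.clo_ops(3)[OF x(1)]] \<pi>[OF L.clo_ops(4)[OF x(1)]] \<pi>[OF x(1)]
    L'.ops_L(3,4)[OF Tx Tx] e by (rule refl)+
  fix Y assume "Y:cstar L.L"
  then obtain y where y: "L.clo y" "Y = L.cls y" using cE by blast
  note Ty = T_clo[OF y(1)] and sy = L.clo_Sq[OF y(1)]
  have e: "T (%k. x k + y k) = (%k. T x k + T y k)" "T (%k. x k * y k) = (%k. T x k * T y k)"
   using T_hom(1,2)[OF sx sy] by (simp_all add: fun_eq_iff)
  show "\<pi> (addA L.L X Y) = addA L'.L (\<pi> X) (\<pi> Y)" "\<pi> (mulA L.L X Y) = mulA L'.L (\<pi> X) (\<pi> Y)"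
   unfolding x(2) y(2) L.ops_L(1,2)[OF x(1) y(1)] \<pi>[OF L.clo_ops(1)[OF x(1) y(1)]] \<pi>[OF L.clo_ops(2)[OF x(1) y(1)]]
    \<pi>[OF x(1)] \<pi>[OF y(1)] L'.ops_L(1,2)[OF Tx Ty] e by (rule refl)+
 qed
 hence ext: "extends_to L.L L'.L \<pi> \<pi>" by (simp add: extends_to_def)
 have inj: "inj_on \<pi> (cstar L.L)"
 proof (rule inj_onI)
  fix X Y assume "X:cstar L.L" "Y:cstar L.L" and eq: "\<pi> X = \<pi> Y"
  then obtain x y where x: "L.clo x" "X = L.cls x" and y: "L.clo y" "Y = L.cls y" using cE by meson
  show "X = Y" using eq T_cls_eq_iff[OF x(1) y(1)] by (simp add: x(2) y(2) \<pi>[OF x(1)] \<pi>[OF y(1)])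
 qed
 have "\<pi> ` cstar L.L = cstar L'.L"
 proof (intro set_eqI iffI)
  fix Y assume "Y:\<pi> ` cstar L.L"
  then obtain x where "L.clo x" "Y = \<pi> (L.cls x)" using cE by blast
  thus "Y:cstar L'.L" using \<pi> T_clo unfolding L'.cstar_L by auto
 next
  fix Y assume "Y:cstar L'.L"
  then obtain y where y: "L'.clo y" "Y = L'.cls y" unfolding L'.cstar_L by blast
  have "\<pi> (L.cls (U y)) = Y" unfolding \<pi>[OF U_clo[OF y(1)]] y(2) by (rule L'.cls_eqI[OF TU_clo[OF y(1)]])
  moreover have "L.cls (U y):cstar L.L" using U_clo[OF y(1)] unfolding L.cstar_L by blast
  ultimately show "Y:\<pi> ` cstar L.L" by blast
 qed
 hence b: "bij_betw \<pi> (cstar L.L) (cstar L'.L)" using inj by (simp add: bij_betw_def)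
 have sub: "alg L.L <= cstar L.L" using L.star_closed_L by (simp add: star_closed_def)
 have "\<pi> ` alg L.L = alg L'.L"
 proof (intro set_eqI iffI)
  fix Y assume "Y:\<pi> ` alg L.L"
  then obtain x where x: "L.acoh x" "Y = \<pi> (L.cls x)" unfolding L.alg_L by blast
  have "L.clo x" using x(1) L.coh_clo by (simp add: L.acoh_def)
  thus "Y:alg L'.L" using \<pi> T_coh(2)[OF x(1)] x(2) unfolding L'.alg_L by auto
 next
  fix Y assume "Y:alg L'.L"
  then obtain y where y: "L'.acoh y" "Y = L'.cls y" unfolding L'.alg_L by blast
  have c: "L'.clo y" using y(1) L'.coh_clo by (simp add: L'.acoh_def)
  have "\<pi> (L.cls (U y)) = Y" unfolding \<pi>[OF U_clo[OF c]] y(2) by (rule L'.cls_eqI[OF TU_clo[OF c]])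
  moreover have "L.cls (U y):alg L.L" using U_coh(2)[OF y(1)] unfolding L.alg_L by blast
  ultimately show "Y:\<pi> ` alg L.L" by blast
 qed
 hence "bij_betw \<pi> (alg L.L) (alg L'.L)" using inj_on_subset[OF inj sub] by (simp add: bij_betw_def)
 thus ?thesis unfolding star_extendibly_isomorphic_def using ext b by blast
qed

end

section \<open>Maps between limits from crossover maps\<close>

lemma strict_mono_interval:
 fixes b :: "nat => nat"
 assumes "strict_mono b" "b 0 <= p" shows "EX i. b i <= p & p < b (Suc i)"
 using assms(2)
proof (induction p rule: dec_induct)
 case base thus ?case using assms(1) by (auto simp: strict_mono_Suc_iff)
next
 case (step p)
 then obtain i where i: "b i <= p" "p < b (Suc i)" by blast
 show ?case
 proof (cases "Suc p < b (Suc i)")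
  case True thus ?thesis using i by (intro exI[of _ i]) simp
 next
  case False
  hence "Suc p = b (Suc i)" using i by simp
  thus ?thesis using assms(1) by (intro exI[of _ "Suc i"]) (simp add: strict_mono_Suc_iff)
 qed
qed

text \<open>A sequence over the first system is carried to the second along the maps \<open>al i\<close>; between the
 stages \<open>b i\<close> and \<open>b (i + 1)\<close> it is continued coherently.\<close>

locale lsys_map = L: lsys P S g AA ph + L': lsys P' S' g' AA' ph'
 for P S :: "nat => 'h::complex_hilbert mat set" and g AA ph and P' S' :: "nat => 'h mat set" and g' AA' ph' +
 fixes a b :: "nat => nat" and al :: "nat => 'h mat => 'h mat"
 assumes mono: "strict_mono a" "strict_mono b"
  and al_hom: "shom (S (a i)) (al i)" and al_S: "x:S (a i) ==> al i x:S' (b i)" and al_P: "x:P (a i) ==> al i x:P' (b i)"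
  and al_contr: "x:S (a i) ==> norm (al i x) <= norm x"
  and comm: "x:S (a i) ==> al (Suc i) (L.cn (a i) (a (Suc i)) x) = L'.cn (b i) (b (Suc i)) (al i x)"
begin

definition stage :: "nat => nat" where "stage p = (SOME i. b i <= p & p < b (Suc i))"

lemma stage: assumes "b 0 <= p" shows "b (stage p) <= p" "p < b (Suc (stage p))"
 unfolding stage_def using someI_ex[OF strict_mono_interval[OF mono(2) assms]] by blast+

lemma stage_eq: assumes "b i <= p" "p < b (Suc i)" shows "stage p = i"
proof -
 have "b 0 <= p" using assms(1) strict_mono_less_eq[OF mono(2), of 0 i] by simp
 from stage[OF this] assms have "b (stage p) < b (Suc i)" "b i < b (Suc (stage p))" by simp_all
 thus ?thesis using strict_mono_less[OF mono(2)] by (simp add: less_Suc_eq_le)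
qed

lemma stage_b: "stage (b i) = i"
 by (rule stage_eq) (use mono(2) in \<open>auto simp: strict_mono_Suc_iff\<close>)

text \<open>No crossover map reaches the stages below \<open>b 0\<close>; the value 0 there is
  harmless because classes depend only on late stages.\<close>

definition T :: "(nat => 'h mat) => nat => 'h mat" where
 "T x p = (if p < b 0 then 0 else L'.cn (b (stage p)) p (al (stage p) (x (a (stage p)))))"

lemma T_Sq: "x:L.Sq ==> T x:L'.Sq"
 using L'.cn_S[OF stage(1)] al_S L.SqD L'.closed(1) by (auto simp: L'.Sq_def T_def not_less)

lemma T_hom:
 assumes "x:L.Sq"
 shows "y:L.Sq ==> T (%k. x k + y k) p = T x p + T y p" "y:L.Sq ==> T (%k. x k * y k) p = T x p * T y p"
  "T (%k. star (x k)) p = star (T x p)" "T (%k. cscale c (x k)) p = cscale c (T x p)"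
  "y:L.Sq ==> T (%k. x k - y k) p = T x p - T y p"
proof -
 let ?i = "stage p"
 note h = shomD[OF al_hom L.SqD[OF assms]]
 have h': "b 0 <= p ==> shom (S' (b ?i)) (L'.cn (b ?i) p)" by (rule L'.cn_shom[OF stage(1)])
 note k = shomD[OF h' al_S[OF L.SqD[OF assms]]]
 show s: "T (%k. star (x k)) p = star (T x p)" "T (%k. cscale c (x k)) p = cscale c (T x p)" for c
  using h(1,2) k(1,2) by (simp_all add: T_def)
 show a: "y:L.Sq ==> T (%k. x k + y k) p = T x p + T y p" "y:L.Sq ==> T (%k. x k * y k) p = T x p * T y p" for y
  using h(4,5)[OF L.SqD] k(4,5)[OF _ al_S[OF L.SqD]] by (simp_all add: T_def)
 assume y: "y:L.Sq"
 have "T (%k. cscale (-1) (y k)) p = cscale (-1) (T y p)"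
  using shomD(2)[OF al_hom L.SqD[OF y]] shomD(2)[OF h' al_S[OF L.SqD[OF y]]] by (simp add: T_def)
 thus "T (%k. x k - y k) p = T x p - T y p"
  using a(1)[OF L.Sq_ops(5)[OF y, of "-1"]] by (simp add: cscale_minus_one)
qed

lemma T_norm: "x:L.Sq ==> b 0 <= p ==> norm (T x p) <= norm (x (a (stage p)))"
 using L'.cn_contr[OF stage(1) al_S[OF L.SqD]] al_contr[OF L.SqD] by (force simp: T_def not_less intro: order_trans)

lemma stage_large: "EX p0>=b 0. ALL p>=p0. k <= stage p & k <= a (stage p)"
proof (intro exI[of _ "b k"] conjI allI impI)
 show "b 0 <= b k" using strict_mono_less_eq[OF mono(2)] by simp
 fix p assume p: "b k <= p"
 hence "b 0 <= p" using strict_mono_less_eq[OF mono(2), of 0 k] by simp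
 from stage(2)[OF this] p have "b k < b (Suc (stage p))" by simp
 thus k: "k <= stage p" using strict_mono_less[OF mono(2)] by simp
 show "k <= a (stage p)" using k strict_mono_imp_increasing[OF mono(1), of "stage p"] by simp
qed

lemma T_contr:
 assumes "x:L.Sq" "EV k. norm (x k) <= ep" shows "EV k. norm (T x k) <= ep"
proof -
 obtain k where k: "!!l. k <= l ==> norm (x l) <= ep" using assms(2) by (auto simp: eventually_sequentially)
 obtain p0 where "p0 >= b 0" "ALL p>=p0. k <= stage p & k <= a (stage p)" using stage_large by blast
 hence "ALL p>=p0. norm (T x p) <= ep" using T_norm[OF assms(1)] k by (meson order_trans)
 thus ?thesis by (auto simp: eventually_sequentially)
qed

text \<open>Inside an interval the sequence is continued by connecting maps; at the end of the
  interval \<open>comm\<close> replaces one crossover map by the next.\<close>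

lemma T_coh: assumes "L.coh x" shows "L'.coh (T x)"
proof -
 note s = L.coh_Sq[OF assms]
 obtain k0 where k0: "!!k l. k0 <= k ==> k <= l ==> x l = L.cn k l (x k)" using L.coh_eventually[OF assms] by blast
 obtain p0 where p0: "p0 >= b 0" "ALL p>=p0. k0 <= stage p & k0 <= a (stage p)" using stage_large by blast
 have "T x (Suc p) = g' p (T x p)" if p: "p >= p0" for p
 proof -
  let ?i = "stage p"
  have b0: "b 0 <= p" using p p0(1) by simp
  note st = stage[OF b0]
  have Tp: "T x p = L'.cn (b ?i) p (al ?i (x (a ?i)))" using b0 by (simp add: T_def)
  show ?thesis
  proof (cases "Suc p < b (Suc ?i)")
   case True
   hence "stage (Suc p) = ?i" using st by (intro stage_eq) auto
   thus ?thesis using b0 Tp st(1) by (simp add: T_def conn_Suc)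
  next
   case False
   hence e: "Suc p = b (Suc ?i)" using st by simp
   have "a ?i <= a (Suc ?i)" using strict_mono_less_eq[OF mono(1)] by simp
   hence "x (a (Suc ?i)) = L.cn (a ?i) (a (Suc ?i)) (x (a ?i))" using k0 p0(2) p by blast
   hence "T x (Suc p) = L'.cn (b ?i) (Suc p) (al ?i (x (a ?i)))"
    using comm[OF L.SqD[OF s]] b0 unfolding T_def e stage_b by (simp flip: e)
   thus ?thesis using Tp st(1) by (simp add: conn_Suc)
  qed
 qed
 thus ?thesis unfolding L'.coh_def eventually_sequentially using T_Sq[OF s] by blast
qed

lemma T_acoh: assumes "L.acoh x" shows "L'.acoh (T x)"
proof -
 obtain k where k: "!!l. k <= l ==> x l:P l" using assms by (auto simp: L.acoh_def eventually_sequentially)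
 obtain p0 where p0: "p0 >= b 0" "ALL p>=p0. k <= stage p & k <= a (stage p)" using stage_large by blast
 have "T x p:P' p" if p: "p >= p0" for p
 proof -
  have b0: "b 0 <= p" using p p0(1) by simp
  have "x (a (stage p)):P (a (stage p))" using k p0(2) p by blast
  thus ?thesis using L'.cn_P[OF stage(1)[OF b0] al_P] b0 by (simp add: T_def)
 qed
 thus ?thesis unfolding L'.acoh_def eventually_sequentially using T_coh assms by (auto simp: L.acoh_def)
qed

lemma T_b: "T x (b i) = al i (x (a i))"
 using strict_mono_less_eq[OF mono(2), of 0 i] by (simp add: T_def stage_b not_less)

lemma T_after:
 assumes "b 0 <= p" shows "T x p = L'.cn (b (stage p)) p (al (stage p) (x (a (stage p))))"
 using assms by (simp add: T_def)

end

lemma shom_comp: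
 assumes "shom S f" "!!x. x:S ==> f x:T" "shom T h" shows "shom S (%x. h (f x))"
 unfolding shom_def using shomD[OF assms(1)] shomD[OF assms(3,2)] assms(2) by simp

text \<open>\<open>star_extension\<close> is some chosen extension. It agrees with g on P, and the
  uniqueness hypothesis then forces it to agree with g on S.\<close>

lemma star_extension_rep:
 assumes g: "shom S g" "!!x. x:S ==> g x:S'" and PS: "P <= S" and ph: "!!x. x:P ==> ph (ent x) = ent (g x)"
  and unique: "!!f x. shom S f ==> (!!x. x:P ==> f x = g x) ==> x:S ==> f x = g x" and x: "x:S"
 shows "star_extension (mk_alg (ent ` P) (ent ` S)) (mk_alg (ent ` P') (ent ` S')) ph (ent x) = ent (g x)"
proof -
 let ?A = "mk_alg (ent ` P) (ent ` S)" and ?B = "mk_alg (ent ` P') (ent ` S')"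
 have "extends_to ?A ?B ph (elift g)" unfolding extends_to_def using star_hom_elift[OF g(2,1)] ph by simp
 hence e: "extends_to ?A ?B ph (star_extension ?A ?B ph)" unfolding star_extension_def by (rule someI[of "extends_to ?A ?B ph"])
 note c = star_hom_cong[OF e[unfolded extends_to_def, THEN conjunct1]]
 have "mlift (star_extension ?A ?B ph) z = g z" if "z:P" for z
 proof -
  have "ph (ent z) = star_extension ?A ?B ph (ent z)" using e that by (simp add: extends_to_def)
  thus ?thesis using c(2)[of z] ph[OF that] that PS by (auto simp: ent_inject)
 qed
 from unique[OF c(1) this x] show ?thesis using c(2)[OF x] by simp
qed

section \<open>The limits attached to a direct system and to its stabilisation\<close>

context dsys
begin

lemma elem_lsys: "lsys (%k. A (ns k)) (%k. C (ns k)) g (%k. elem E (ns k)) ph"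
proof
 fix k x y c
 show "elem E (ns k) = mk_alg (ent ` A (ns k)) (ent ` C (ns k))" by (rule elem_eq)
 show "A (ns k) <= C (ns k)" by (rule A_sub_C)
 show "0:C (ns k)" "x:C (ns k) ==> y:C (ns k) ==> x + y:C (ns k)" "x:C (ns k) ==> y:C (ns k) ==> x * y:C (ns k)"
  "x:C (ns k) ==> cscale c x:C (ns k)" by (rule CE.mats_closed, assumption?, assumption?)+
 show "x:C (ns k) ==> star x:C (ns k)" by (rule star_algD(4)[OF star_alg_C])
 show h: "shom (C (ns k)) (g k)" by (rule homD(1)[OF hom_g])
 show r: "x:C (ns k) ==> g k x:C (ns (Suc k))" for x by (rule hom_range[OF hom_g into])
 show "x:A (ns k) ==> g k x:A (ns (Suc k))" using into by blast
 show "x:C (ns k) ==> norm (g k x) <= norm x" by (rule shom_contractive[OF star_alg_C h])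
 show "star_extension (elem E (ns k)) (elem E (ns (Suc k))) (ph k) (ent x) = ent (g k x)" if "x:C (ns k)"
  unfolding elem_eq
 proof (rule star_extension_rep[OF h r A_sub_C _ _ that])
  show "ph k (ent x) = ent (g k x)" if "x:A (ns k)" for x using rep that by (simp add: rep_by_def)
  show "f x = g k x" if "shom (C (ns k)) f" "!!x. x:A (ns k) ==> f x = g k x" "x:C (ns k)" for f x
   by (rule shom_unique[OF that(1) h that(2,3)])
 qed
qed

lemma upto_C: "x:upto CE (r k) ==> EX N. x:C (ts N (ns k))"
 using upto_tensor[OF _ valid] by blast

text \<open>Contractivity and uniqueness of extensions hold on the finite-dimensional algebras of
  each size N, and every element of the union lies in one of them.\<close>

lemma stab_lsys:
 assumes ps: "!!k x. x:upto E (r k) ==> ps k (ent x) = ent (g k x)"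
 shows "lsys (%k. upto E (r k)) (%k. upto CE (r k)) g (%k. stab E (ns k)) ps"
proof
 fix k x y c
 have sub: "C (ts N (ns k)) <= upto CE (r k)" for N k
  using mats_upto[of _ CE "ts N (ns k)"] by auto
 have subA: "A (ts N (ns k)) <= upto E (r k)" for N k
  using mats_upto[of _ E "ts N (ns k)"] by auto
 show "stab E (ns k) = mk_alg (ent ` upto E (r k)) (ent ` upto CE (r k))" by (rule stab_eq[OF valid])
 show PS: "upto E (r k) <= upto CE (r k)" for k by (rule upto_mono[OF E_sub_CE])
 show "0:upto CE (r k)" "x:upto CE (r k) ==> y:upto CE (r k) ==> x + y:upto CE (r k)"
  "x:upto CE (r k) ==> cscale c x:upto CE (r k)" by (rule CE.upto_closed, assumption?, assumption?)+
 show "x:upto CE (r k) ==> y:upto CE (r k) ==> x * y:upto CE (r k)"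
  by (rule CE.upto_closed(4)[OF _ upto_full])
 show "star x:upto CE (r k)" if "x:upto CE (r k)"
  using upto_C[OF that] star_algD(4)[OF star_alg_C] sub by blast
 note ch = smap_chom[OF stable]
 show h: "shom (upto CE (r k)) (g k)" by (rule chomD(1)[OF ch])
 show rg: "x:upto CE (r k) ==> g k x:upto CE (r (Suc k))" for x by (rule chomD(2)[OF ch])
 show "x:upto E (r k) ==> g k x:upto E (r (Suc k))" by (rule chomD(3)[OF ch])
 show "norm (g k x) <= norm x" if x: "x:upto CE (r k)"
 proof -
  obtain N where N: "x:C (ts N (ns k))" using upto_C[OF x] by blast
  show ?thesis by (rule shom_contractive[OF star_alg_C shom_subset[OF h sub] N])
 qed
 show "star_extension (stab E (ns k)) (stab E (ns (Suc k))) (ps k) (ent x) = ent (g k x)" if "x:upto CE (r k)"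
  unfolding stab_eq[OF valid]
 proof (rule star_extension_rep[OF h rg PS ps _ that])
  fix f x assume f: "shom (upto CE (r k)) f" "!!x. x:upto E (r k) ==> f x = g k x" and x: "x:upto CE (r k)"
  obtain N where N: "x:C (ts N (ns k))" using upto_C[OF x] by blast
  show "f x = g k x"
   by (rule shom_unique[OF shom_subset[OF f(1) sub] shom_subset[OF h sub] f(2)[OF subA[THEN subsetD]] N])
 qed
qed

lemma norm_unitm: "norm (unitm ks * x * unitm ks) <= norm (x :: 'h mat)"
proof -
 have "(norm (unitm ks :: 'h mat))\<^sup>2 = norm (unitm ks :: 'h mat)" using norm_star_mult_self[of "unitm ks"] by (metis star_unitm unitm_idem)
 hence u: "norm (unitm ks :: 'h mat) <= 1" by (auto simp: power2_eq_square)
 have "norm (unitm ks * x * unitm ks) <= norm (unitm ks :: 'h mat) * norm x * norm (unitm ks :: 'h mat)"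
  by (rule order_trans[OF norm_mult_ineq mult_right_mono[OF norm_mult_ineq]]) simp
 also have "... <= 1 * norm x * 1" using u by (intro mult_mono) auto
 finally show ?thesis by simp
qed

text \<open>Truncation to \<open>A\<^sub>k \<otimes> M\<^bsub>k+1\<^esub>\<close> inverts the inclusion into \<open>A\<^sub>k \<otimes> \<K>\<close> on coherent sequences.\<close>

lemma stable_limit_isomorphic:
 assumes ps: "!!k x. x:upto E (r k) ==> amplify (ns k) (ns (Suc k)) (ph k) (ent x) = ent (g k x)"
  and D: "dsys E F (%k. ts (Suc k) (ns k)) (%k. amplify (ns k) (ns (Suc k)) (ph k)) g"
  and gA: "!!k N. g k ` A (ts N (ns k)) <= A (ts N (ns (Suc k)))"
 shows "star_extendibly_isomorphic
   (limit_algebra E (%k. ts (Suc k) (ns k)) (%k. amplify (ns k) (ns (Suc k)) (ph k)))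
   (stable_limit_algebra E ns ph)"
  and "star_extendibly_isomorphic (stable_limit_algebra E ns ph)
   (limit_algebra E (%k. ts (Suc k) (ns k)) (%k. amplify (ns k) (ns (Suc k)) (ph k)))"
proof -
 let ?ns = "%k. ts (Suc k) (ns k)" and ?ps = "%k. amplify (ns k) (ns (Suc k)) (ph k)"
 interpret D: dsys E F ?ns ?ps g by (rule D)
 interpret X: lsys "%k. A (?ns k)" "%k. C (?ns k)" g "%k. elem E (?ns k)" ?ps by (rule D.elem_lsys)
 interpret Y: lsys "%k. upto E (r k)" "%k. upto CE (r k)" g "%k. stab E (ns k)" ?ps by (rule stab_lsys[OF ps])
 define U where "U y k = unitm (?ns k) * y k * unitm (?ns k)" for y :: "nat => 'h mat" and k
 have sub: "C (ts N (ns k)) <= upto CE (r k)" for N k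
  using mats_upto[of _ CE "ts N (ns k)"] by auto
 have subA: "A (ts N (ns k)) <= upto E (r k)" for N k
  using mats_upto[of _ E "ts N (ns k)"] by auto
 have gC: "g k x:C (ts N (ns (Suc k)))" if "x:C (ts N (ns k))" for k N x
  by (rule hom_range[OF chom_hom[OF smap_chom[OF stable] length_tensor] gA that])
 have Sq: "x:Y.Sq" if "x:X.Sq" for x using that sub by (auto simp: X.Sq_def Y.Sq_def)
 have coh: "Y.coh x" if "X.coh x" for x using that Sq by (simp add: X.coh_def Y.coh_def)
 have USq: "U y:X.Sq" if "y:Y.Sq" for y unfolding U_def X.Sq_def
  using CE.mats_closed(5)[OF CE.unitm_in upto_full[OF Y.SqD[OF that]] CE.unitm_in] by simp
 \<comment> \<open>At some stage k0 a coherent sequence has a fixed size N, which the connecting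
   maps preserve; from stage \<open>max k0 N\<close> on, truncation to size k+1 changes
   nothing.\<close>
 have Ueq: "EV k. U y k = y k" if y: "Y.coh y" for y
 proof -
  obtain k0 where k0: "!!k. k >= k0 ==> y (Suc k) = g k (y k)" using y by (auto simp: Y.coh_def eventually_sequentially)
  obtain N where N: "y k0:C (ts N (ns k0))" using upto_C[OF Y.SqD[OF Y.coh_Sq[OF y]]] by blast
  have "y k:C (ts N (ns k))" if "k0 <= k" for k
   using that by (induction k rule: dec_induct) (simp_all add: N k0 gC)
  hence "y k:C (?ns k)" if "max k0 N <= k" for k
   using that mats_tensor_mono[of N "Suc k" CE "ns k"] by auto
  hence "U y k = y k" if "max k0 N <= k" for k using that unitm_mats[of "y k" CE "?ns k"] by (simp add: U_def)
  thus ?thesis unfolding eventually_sequentially by blast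
 qed
 have Ucoh: "X.coh (U y)" if y: "Y.coh y" for y
 proof -
  obtain k1 where k1: "!!k. k >= k1 ==> U y k = y k" using Ueq[OF y] by (auto simp: eventually_sequentially)
  obtain k0 where k0: "!!k. k >= k0 ==> y (Suc k) = g k (y k)" using y by (auto simp: Y.coh_def eventually_sequentially)
  have "U y (Suc k) = g k (U y k)" if "max k0 k1 <= k" for k using k0[of k] k1[of k] k1[of "Suc k"] that by simp
  thus ?thesis unfolding X.coh_def eventually_sequentially using USq[OF Y.coh_Sq[OF y]] by blast
 qed
 interpret I: lsys_iso "%k. A (?ns k)" "%k. C (?ns k)" g "%k. elem E (?ns k)" ?ps
  "%k. upto E (r k)" "%k. upto CE (r k)" g "%k. stab E (ns k)" ?ps "%x. x" U
 proof unfold_locales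
  show "EV k. norm (U y k) <= ep" if "EV k. norm (y k) <= ep" for y ep
   using that by (rule eventually_mono) (unfold U_def, rule order_trans[OF norm_unitm])
  show "Y.acoh x" if "X.acoh x" for x
  proof -
   have "EV k. x k:upto E (r k)"
    using that subA unfolding X.acoh_def by (auto elim!: eventually_mono simp del: length_tensor)
   thus ?thesis using that coh by (simp add: X.acoh_def Y.acoh_def)
  qed
  show "X.acoh (U y)" if "Y.acoh y" for y
  proof -
   have "EV k. y k:upto E (r k)" using that by (simp add: Y.acoh_def)
   hence "EV k. U y k:A (?ns k)"
    by (rule eventually_mono) (unfold U_def, rule E.mats_closed(5)[OF E.unitm_in upto_full E.unitm_in])
   thus ?thesis using Ucoh that by (simp add: X.acoh_def Y.acoh_def)
  qed
  show "U (%k. y k - z k) k = U y k - U z k" for y z k by (simp add: U_def algebra_simps)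
  show "EV k. U x k = x k" if "X.coh x" for x by (rule Ueq[OF coh[OF that]])
 qed (use Sq coh USq Ucoh Ueq in auto)
 show 1: "star_extendibly_isomorphic (limit_algebra E ?ns ?ps) (stable_limit_algebra E ns ph)"
  unfolding limit_algebra_def stable_limit_algebra_def by (rule I.isomorphic)
 show "star_extendibly_isomorphic (stable_limit_algebra E ns ph) (limit_algebra E ?ns ?ps)"
  by (rule star_extendibly_isomorphic_sym[OF _ 1]) (unfold limit_algebra_def, rule X.star_closed_L)
qed

end

context dsys_pair
begin

text \<open>Commutation of the triangles extends from \<open>A\<close> to \<open>C\<close> because
  star-extensions are unique. The two families of crossover maps then act on sequences and invert
  each other eventually on coherent ones.\<close>

lemma limits_isomorphic:
 assumes I: "intertwining ns g ns' g' n m al bt"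
 shows "star_extendibly_isomorphic (limit_algebra E ns ph) (limit_algebra E ns' ph')"
proof -
 have nm: "n i < m i" "m i < n (Suc i)" and al: "hom (ns (n i)) (al i)" "al i ` A (ns (n i)) <= A (ns' (m i))"
  and bt: "hom (ns' (m i)) (bt i)" "bt i ` A (ns' (m i)) <= A (ns (n (Suc i)))"
  and btalA: "!!x. x:A (ns (n i)) ==> bt i (al i x) = S.cn (n i) (n (Suc i)) x"
  and albtA: "!!x. x:A (ns' (m i)) ==> al (Suc i) (bt i x) = S'.cn (m i) (m (Suc i)) x" for i
  using I by (simp_all add: intertwining_def)
 have mono: "strict_mono n" "strict_mono m" "strict_mono (%i. n (Suc i))"
  unfolding strict_mono_Suc_iff using order_less_trans[OF nm(1) nm(2)] order_less_trans[OF nm(2) nm(1)] by simp_all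
 have le: "n i <= n (Suc i)" "m i <= m (Suc i)" for i using mono(1,2) by (simp_all add: strict_mono_Suc_iff less_imp_le)
 note alC = hom_range[OF al] and btC = hom_range[OF bt]
 have btal: "bt i (al i x) = S.cn (n i) (n (Suc i)) x" if "x:C (ns (n i))" for i x
  by (rule shom_unique[OF shom_comp[OF homD(1)[OF al(1)] alC homD(1)[OF bt(1)]] homD(1)[OF S.cn_hom[OF le(1)]] btalA that])
 have albt: "al (Suc i) (bt i x) = S'.cn (m i) (m (Suc i)) x" if "x:C (ns' (m i))" for i x
  by (rule shom_unique[OF shom_comp[OF homD(1)[OF bt(1)] btC homD(1)[OF al(1)]] homD(1)[OF S'.cn_hom[OF le(2)]] albtA that])
 interpret X: lsys "%k. A (ns k)" "%k. C (ns k)" g "%k. elem E (ns k)" ph by (rule S.elem_lsys)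
 interpret Y: lsys "%k. A (ns' k)" "%k. C (ns' k)" g' "%k. elem E (ns' k)" ph' by (rule S'.elem_lsys)
 interpret T: lsys_map "%k. A (ns k)" "%k. C (ns k)" g "%k. elem E (ns k)" ph
  "%k. A (ns' k)" "%k. C (ns' k)" g' "%k. elem E (ns' k)" ph' n m al
 proof
  fix i x assume x: "x:C (ns (n i))"
  show "norm (al i x) <= norm x" by (rule shom_contractive[OF star_alg_C homD(1)[OF al(1)] x])
  show "al (Suc i) (S.cn (n i) (n (Suc i)) x) = S'.cn (m i) (m (Suc i)) (al i x)"
   using btal[OF x] albt[OF alC[OF x]] by simp
 qed (use mono homD(1)[OF al(1)] alC al(2)[unfolded image_subset_iff] in auto)
 \<comment> \<open>\<open>bt i\<close> ends at stage \<open>n (Suc i)\<close>, so the target stages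
   of the second map are shifted by one.\<close>
 interpret U: lsys_map "%k. A (ns' k)" "%k. C (ns' k)" g' "%k. elem E (ns' k)" ph'
  "%k. A (ns k)" "%k. C (ns k)" g "%k. elem E (ns k)" ph m "%i. n (Suc i)" bt
 proof
  fix i x assume x: "x:C (ns' (m i))"
  show "norm (bt i x) <= norm x" by (rule shom_contractive[OF star_alg_C homD(1)[OF bt(1)] x])
  show "bt (Suc i) (S'.cn (m i) (m (Suc i)) x) = S.cn (n (Suc i)) (n (Suc (Suc i))) (bt i x)"
   using albt[OF x] btal[OF btC[OF x]] by simp
 qed (use mono homD(1)[OF bt(1)] btC bt(2)[unfolded image_subset_iff] in auto)
 have UT: "EV k. U.T (T.T x) k = x k" if x: "X.coh x" for x
 proof -
  obtain k0 where k0: "!!k l. k0 <= k ==> k <= l ==> x l = S.cn k l (x k)" using X.coh_eventually[OF x] by blast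
  obtain p0 where p0: "p0 >= n (Suc 0)" "!!p. p >= p0 ==> k0 <= U.stage p" using U.stage_large by blast
  have "U.T (T.T x) p = x p" if p: "p >= p0" for p
  proof -
   define j where "j = U.stage p"
   have b0: "n (Suc 0) <= p" using p p0(1) by simp
   have j: "k0 <= n j" "n (Suc j) <= p"
    using order_trans[OF p0(2)[OF p] strict_mono_imp_increasing[OF mono(1)]] U.stage(1)[OF b0] by (simp_all add: j_def)
   have "U.T (T.T x) p = S.cn (n (Suc j)) p (S.cn (n j) (n (Suc j)) (x (n j)))"
    using U.T_after[OF b0] btal[OF X.SqD[OF X.coh_Sq[OF x]]] by (simp add: T.T_b flip: j_def)
   also have "... = x p" using k0[OF j(1) order_trans[OF le(1) j(2)]] by (simp only: conn_trans[OF le(1) j(2)])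
   finally show ?thesis .
  qed
  thus ?thesis unfolding eventually_sequentially by blast
 qed
 have TU: "EV k. T.T (U.T y) k = y k" if y: "Y.coh y" for y
 proof -
  obtain k0 where k0: "!!k l. k0 <= k ==> k <= l ==> y l = S'.cn k l (y k)" using Y.coh_eventually[OF y] by blast
  \<comment> \<open>Asking for \<open>Suc k0\<close> makes the stage a successor
    \<open>Suc j\<close>, so that \<open>al (Suc j)\<close> is preceded by
    \<open>bt j\<close>.\<close>
  obtain p0 where p0: "p0 >= m 0" "!!p. p >= p0 ==> Suc k0 <= T.stage p" using T.stage_large by blast
  have "T.T (U.T y) p = y p" if p: "p >= p0" for p
  proof -
   have b0: "m 0 <= p" using p p0(1) by simp
   obtain j where s: "T.stage p = Suc j" using p0(2)[OF p] by (cases "T.stage p") auto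
   have j: "k0 <= m j" "m (Suc j) <= p"
    using p0(2)[OF p] strict_mono_imp_increasing[OF mono(2), of j] T.stage(1)[OF b0] by (simp_all add: s)
   have "T.T (U.T y) p = S'.cn (m (Suc j)) p (S'.cn (m j) (m (Suc j)) (y (m j)))"
    using T.T_after[OF b0] albt[OF Y.SqD[OF Y.coh_Sq[OF y]]] by (simp add: U.T_b s)
   also have "... = y p" using k0[OF j(1) order_trans[OF le(2) j(2)]] by (simp only: conn_trans[OF le(2) j(2)])
   finally show ?thesis .
  qed
  thus ?thesis unfolding eventually_sequentially by blast
 qed
 interpret I: lsys_iso "%k. A (ns k)" "%k. C (ns k)" g "%k. elem E (ns k)" ph
  "%k. A (ns' k)" "%k. C (ns' k)" g' "%k. elem E (ns' k)" ph' T.T U.T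
  by unfold_locales (rule T.T_Sq T.T_hom T.T_contr T.T_coh T.T_acoh U.T_Sq U.T_hom U.T_contr U.T_coh U.T_acoh UT TU; assumption)+
 show ?thesis unfolding limit_algebra_def by (rule I.isomorphic)
qed

end

section \<open>Intertwinings from isomorphisms of the limits\<close>

locale lsys_fin = lsys +
 assumes fin: "star_alg (S k)"
begin

text \<open>\<open>cls (tail k x)\<close> is the image in the limit of \<open>x\<close> at stage \<open>k\<close>.\<close>

definition "tail k x l = (if l < k then 0 else cn k l x)"
abbreviation "io k x == cls (tail k x)"

lemma tail_Sq: "x:S k ==> tail k x:Sq"
 using cn_S closed(1) by (simp add: Sq_def tail_def)

lemma tail_coh: "x:S k ==> coh (tail k x)"
 unfolding coh_def eventually_sequentially using tail_Sq
 by (auto intro!: exI[of _ k] simp: tail_def conn_Suc not_less)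

lemma tail_clo: "x:S k ==> clo (tail k x)" by (rule coh_clo[OF tail_coh])

lemma cls_eventually: "EV l. x l = y l ==> cls x = cls y"
 by (rule cls_eqI, rule tendsto_eventually) (auto elim: eventually_mono)

lemma io_cn: "k <= l ==> io l (cn k l x) = io k x"
 by (rule cls_eventually) (auto simp: eventually_sequentially tail_def conn_trans intro!: exI[of _ l])

lemma io_ops:
 assumes "x:S k"
 shows "y:S k ==> io k (x + y) = addA L (io k x) (io k y)" "y:S k ==> io k (x * y) = mulA L (io k x) (io k y)"
  "io k (cscale c x) = scaleA L c (io k x)" "io k (star x) = starA L (io k x)"
proof -
 note c = tail_clo[OF assms] and h = shomD[OF cn_shom assms]
 have "tail k (cscale c x) = (%l. cscale c (tail k x l))" "tail k (star x) = (%l. star (tail k x l))"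
  using h(1,2) by (auto simp: tail_def fun_eq_iff not_less)
 thus "io k (cscale c x) = scaleA L c (io k x)" "io k (star x) = starA L (io k x)" using ops_L(3,4)[OF c c] by simp_all
 assume y: "y:S k"
 have "tail k (x + y) = (%l. tail k x l + tail k y l)" "tail k (x * y) = (%l. tail k x l * tail k y l)"
  using h(4,5)[OF _ y] by (auto simp: tail_def fun_eq_iff not_less)
 thus "io k (x + y) = addA L (io k x) (io k y)" "io k (x * y) = mulA L (io k x) (io k y)"
  using ops_L(1,2)[OF c tail_clo[OF y]] by simp_all
qed

lemma io_in: "x:S k ==> io k x:cstar L" "x:P k ==> io k x:alg L"
proof -
 show "x:S k ==> io k x:cstar L" using tail_clo unfolding cstar_L by blast
 assume x: "x:P k"
 hence "EV l. tail k x l:P l"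
  unfolding eventually_sequentially using cn_P by (intro exI[of _ k]) (simp add: tail_def)
 hence "acoh (tail k x)" using tail_coh[of x k] x PS unfolding acoh_def by blast
 thus "io k x:alg L" unfolding alg_L by blast
qed

text \<open>From some stage on, a coherent sequence is the tail generated by one of its own terms,
  and that term may be chosen in P.\<close>

lemma alg_lift: assumes "X:alg L" shows "EX m y. y:P m & X = io m y"
proof -
 obtain x where x: "X = cls x" "coh x" "EV l. x l:P l" using assms unfolding alg_L acoh_def by blast
 obtain k where k: "!!i l. k <= i ==> i <= l ==> x l = cn i l (x i)" using coh_eventually[OF x(2)] by blast
 obtain j where j: "!!l. j <= l ==> x l:P l" using x(3) by (auto simp: eventually_sequentially)
 let ?m = "max k j"
 have "x l = tail ?m (x ?m) l" if "?m <= l" for l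
  unfolding tail_def if_not_P[OF leD[OF that]] by (rule k) (use that in auto)
 hence "EV l. x l = tail ?m (x ?m) l" unfolding eventually_sequentially by blast
 from cls_eventually[OF this] show ?thesis
  unfolding x(1) by (intro exI[of _ ?m] exI[of _ "x ?m"] conjI j) simp_all
qed

text \<open>From some stage on, the maps out of the image of \<open>S k\<close> are injective, hence isometric.\<close>

lemma io_kernel: "EX l>=k. ALL x:S k. ALL y:S k. io k x = io k y --> cn k l x = cn k l y"
proof -
 note f = star_algD[OF fin[of k]]
 \<comment> \<open>The kernels of the maps out of stage k increase with the target stage and
   therefore stabilise, by finite dimension.\<close>
 define K where "K i = {x:S k. cn k (k + i) x = 0}" for i
 have h: "shom (S k) (cn k (k + i))" for i by (rule cn_shom) simp
 have sub: "subspace (K i)" for i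
  unfolding subspace_def K_def using f(3,6,8) shomD(7)[OF h f(3)] shomD(3,4)[OF h] by simp
 have inc: "K i <= K (Suc i)" for i
  unfolding K_def using shomD(7)[OF hom_g closed(1)] by (auto simp: conn_Suc)
 obtain i0 where i0: "!!i. K i <= K i0"
  using increasing_subspaces_stabilise[of "S k" K, OF f(1) sub _ inc] unfolding K_def by blast
 define l where "l = k + i0"
 have l: "k <= l" by (simp add: l_def)
 define B where "B = cn k l ` S k"
 note hl = shomD[OF cn_shom[OF l]]
 have fB: "fin_dim B" unfolding B_def by (rule fin_dim_image[OF f(1)]) (simp_all add: hl)
 have B: "star_alg B" unfolding star_alg_def
 proof (intro conjI fB ballI)
  fix u assume "u:B"
  then obtain x where x: "x:S k" "u = cn k l x" unfolding B_def by blast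
  show "star u:B" unfolding x(2) hl(1)[OF x(1), symmetric] B_def using closed(4)[OF x(1)] by blast
  fix v assume "v:B"
  then obtain y where y: "y:S k" "v = cn k l y" unfolding B_def by blast
  show "u * v:B" unfolding x(2) y(2) hl(5)[OF x(1) y(1), symmetric] B_def using closed(3)[OF x(1) y(1)] by blast
 qed
 \<comment> \<open>After stage l no further kernel appears on the image B of \<open>S k\<close>, and
   injective star-homomorphisms are isometric.\<close>
 have iso: "norm (cn k m x) = norm (cn k l x)" if x: "x:S k" and m: "l <= m" for x m
 proof -
  have sB: "shom B (cn l m)" by (rule shom_subset[OF cn_shom[OF m]]) (use cn_S[OF l] in \<open>auto simp: B_def\<close>)
  have "u = 0" if u: "u:B" "cn l m u = 0" for u
  proof -
   obtain y where y: "y:S k" "u = cn k l y" using u(1) unfolding B_def by blast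
   have "y:K (m - k)" using u(2) y l m by (simp add: K_def conn_trans)
   thus ?thesis using i0 y(2) by (auto simp: K_def l_def)
  qed
  from shom_isometric[OF B sB this, of "cn k l x"] show ?thesis using x by (simp add: B_def conn_trans[OF l m])
 qed
 have "cn k l x = cn k l y" if x: "x:S k" and y: "y:S k" and eq: "io k x = io k y" for x y
 proof -
  have d: "x - y:S k" by (rule minus_closed[OF x y])
  have dc: "cn k m (x - y) = cn k m x - cn k m y" if "k <= m" for m
   using shomD(4)[OF cn_shom[OF that] x, of "- y"] shomD(6)[OF cn_shom[OF that] y] minus_closed[OF closed(1) y] by simp
  have t: "(%m. tail k x m - tail k y m) ----> 0" by (rule cls_eqD[OF eq tail_Sq[OF y]])
  have ev: "EV m. norm (tail k x m - tail k y m) = norm (cn k l (x - y))"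
   unfolding eventually_sequentially
  proof (intro exI[of _ l] allI impI)
   fix m assume m: "l <= m"
   hence "tail k x m - tail k y m = cn k m (x - y)" using l dc[of m] by (simp add: tail_def)
   thus "norm (tail k x m - tail k y m) = norm (cn k l (x - y))" using iso[OF d m] by simp
  qed
  \<comment> \<open>The difference of the two tails is a null sequence whose norm is eventually
    constant, so this norm is zero.\<close>
  from Lim_transform_eventually[OF tendsto_norm_zero[OF t] ev] have "(%m::nat. norm (cn k l (x - y))) ----> 0" .
  hence "cn k l (x - y) = 0" by (simp add: LIMSEQ_const_iff)
  thus ?thesis using dc[OF l] by simp
 qed
 thus ?thesis using l by blast
qed

end

context dsys
begin

lemma elem_lsys_fin: "lsys_fin (%k. A (ns k)) (%k. C (ns k)) g (%k. elem E (ns k)) ph"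
 by (intro lsys_fin.intro elem_lsys lsys_fin_axioms.intro star_alg_C)

end

sublocale dsys \<subseteq> X: lsys_fin "\<lambda>k. A (ns k)" "\<lambda>k. C (ns k)" g "\<lambda>k. elem E (ns k)" ph
 by (rule elem_lsys_fin)

section \<open>Lifting an isomorphism of limits to finite stages\<close>

context dsys_pair
begin

definition lifts where
 "lifts p k m al \<longleftrightarrow> hom (ns k) al & al ` A (ns k) <= A (ns' m) & (ALL x:C (ns k). S'.X.io m (al x) = p (S.X.io k x))"

text \<open>p sends elements of \<open>A (ns k)\<close> into the algebraic limit, hence to elements
  of finite stages. Being represented at a finite stage is preserved by all the operations, so it
  holds on all of \<open>C (ns k)\<close>, and by dimension one stage suffices. After the stage
  given by \<open>io_kernel\<close> representatives are unique, which makes the lift a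
  homomorphism.\<close>

lemma exists_lift:
 assumes p: "star_hom S.X.L S'.X.L p" "p ` alg S.X.L <= alg S'.X.L"
 shows "EX m>=q. \<exists>al. lifts p k m al"
proof -
 \<comment> \<open>A relation rather than a function, because at a given stage the representative of
   an image in the limit need not be unique.\<close>
 define R where "R m x y \<longleftrightarrow> y:C (ns' m) & p (S.X.io k x) = S'.X.io m y" for m x y
 have pD: "p (starA S.X.L X) = starA S'.X.L (p X)" "p (scaleA S.X.L c X) = scaleA S'.X.L c (p X)"
  "Y:cstar S.X.L ==> p (addA S.X.L X Y) = addA S'.X.L (p X) (p Y)"
  "Y:cstar S.X.L ==> p (mulA S.X.L X Y) = mulA S'.X.L (p X) (p Y)"
  if "X:cstar S.X.L" for X Y c using p(1) that by (simp_all add: star_hom_def)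
 note cl = S'.X.closed
 have Rop: "R m (star x) (star y)" "R m (cscale c x) (cscale c y)" if "R m x y" "x:C (ns k)" for m x y c
  using that cl(4,5) S.X.io_ops(3,4)[OF that(2)] S'.X.io_ops(3,4)[of y m] pD(1,2)[OF S.X.io_in(1)[OF that(2)]]
  by (simp_all add: R_def)
 have Rop2: "R m (x + z) (y + w)" "R m (x * z) (y * w)" if "R m x y" "x:C (ns k)" "R m z w" "z:C (ns k)" for m x y z w
  using that cl(2,3) S.X.io_ops(1,2)[OF that(2,4)] S'.X.io_ops(1,2)[of y m w]
   pD(3,4)[OF S.X.io_in(1)[OF that(2)] S.X.io_in(1)[OF that(4)]]
  by (simp_all add: R_def)
 have Rup: "R l x (S'.cn m l y)" if "R m x y" "m <= l" for m l x y
  using that S'.X.io_cn S'.X.cn_S by (simp add: R_def)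
 have RA: "EX m. EX y:A (ns' m). R m x y" if x: "x:A (ns k)" for x
 proof -
  have "p (S.X.io k x):alg S'.X.L" using p(2) S.X.io_in(2)[OF x] by blast
  thus ?thesis using S'.X.alg_lift A_sub_C by (fastforce simp: R_def)
 qed
 have RC: "EX m y. R m x y" if "x:C (ns k)" for x
  using that
 proof (rule C_generated)
  show "EX m y. R m x y" if "x:A (ns k)" for x using RA[OF that] by blast
 next
  fix x z assume x: "x:C (ns k)" "z:C (ns k)" "EX m y. R m x y" "EX m y. R m z y"
  then obtain m u l w where R: "R m x u" "R l z w" by blast
  note c = Rup[OF R(1), of "max m l", simplified] x(1) Rup[OF R(2), of "max m l", simplified] x(2)
  show "EX m y. R m (x + z) y" "EX m y. R m (x * z) y" using Rop2[OF c] by blast+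
 next
  fix x c assume x: "x:C (ns k)" "EX m y. R m x y"
  thus "EX m y. R m (cscale c x) y" "EX m y. R m (star x) y" using Rop by blast+
 qed
 have R0: "R m 0 0" for m
 proof -
  obtain j y where y: "R j 0 y" using RC[OF CE.mats_closed(1)] by blast
  have "R j (cscale 0 0) (cscale 0 y)" by (rule Rop(2)[OF y CE.mats_closed(1)])
  hence "p (S.X.io k 0) = S'.X.io j 0" by (simp add: R_def)
  also have "... = S'.X.io (max j m) (S'.cn j (max j m) 0)" by (rule S'.X.io_cn[symmetric]) simp
  also have "... = S'.X.io (max j m) (S'.cn m (max j m) 0)"
   using shomD(7)[OF S'.X.cn_shom cl(1), of j "max j m"] shomD(7)[OF S'.X.cn_shom cl(1), of m "max j m"] by simp
  also have "... = S'.X.io m 0" by (rule S'.X.io_cn) simp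
  finally show ?thesis using cl(1) by (simp add: R_def)
 qed
 \<comment> \<open>The elements of G represented in H at stage m form subspaces that increase with
   m, so one of them is all of G. This is used once for the C*-algebras and once for the operator
   algebras.\<close>
 have stage: "EX j. ALL m>=j. ALL x:G. EX y:H m. R m x y"
  if G: "fin_dim G" "G <= C (ns k)" and H: "!!m. subspace (H m)" "!!m y. y:H m ==> g' m y:H (Suc m)"
   and ex: "!!x. x:G ==> EX m. EX y:H m. R m x y" for G H
 proof -
  define V where "V m = {x:G. EX y:H m. R m x y}" for m
  have sG: "subspace G" using G(1) by (simp add: fin_dim_def)
  have sub: "subspace (V m)" for m unfolding subspace_def
  proof (intro conjI ballI allI)
   show "0:V m" using subspace_0[OF sG] subspace_0[OF H(1)] R0 by (auto simp: V_def)
   fix x assume "x:V m"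
   then obtain u where x: "x:G" "u:H m" "R m x u" by (auto simp: V_def)
   have "R m (c *\<^sub>R x) (c *\<^sub>R u)" for c using Rop(2)[OF x(3), of "complex_of_real c"] x(1) G(2) by (auto simp: cscale_real)
   thus "c *\<^sub>R x:V m" for c using subspace_scale[OF sG x(1)] subspace_scale[OF H(1) x(2)] by (auto simp: V_def)
   fix z assume "z:V m"
   then obtain w where z: "z:G" "w:H m" "R m z w" by (auto simp: V_def)
   show "x + z:V m" using Rop2(1)[OF x(3) _ z(3)] x(1) z(1) G(2) subspace_add[OF sG x(1) z(1)]
     subspace_add[OF H(1) x(2) z(2)] by (auto simp: V_def)
  qed
  have inc: "V m <= V (Suc m)" for m
   using Rup[of m _ _ "Suc m"] H(2) by (fastforce simp: V_def conn_Suc)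
  obtain j where j: "!!m. V m <= V j"
   using increasing_subspaces_stabilise[of G V, OF G(1) sub _ inc] unfolding V_def by blast
  have mono: "V i <= V m" if "i <= m" for i m by (rule lift_Suc_mono_le[of V, OF inc that])
  have "x:V j" if "x:G" for x using ex[OF that] j that by (auto simp: V_def)
  thus ?thesis using mono unfolding V_def by blast
 qed
 obtain jC where jC: "!!m x. jC <= m ==> x:C (ns k) ==> EX y:C (ns' m). R m x y"
  using stage[of "C (ns k)" "%m. C (ns' m)", OF star_algD(1)[OF star_alg_C] subset_refl star_algD(2)[OF star_alg_C] S'.X.g_S]
   RC by (metis R_def)
 have "subspace (A (ns' m))" for m using fin_dim_A by (simp add: fin_dim_def)
 from stage[of "A (ns k)" "%m. A (ns' m)", OF fin_dim_A A_sub_C this S'.X.g_P RA]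
 obtain jA where jA: "!!m x. jA <= m ==> x:A (ns k) ==> EX y:A (ns' m). R m x y" by blast
 define m where "m = max q (max jC jA)"
 obtain l where l: "m <= l" and inj: "!!x y. x:C (ns' m) ==> y:C (ns' m) ==> S'.X.io m x = S'.X.io m y ==> S'.cn m l x = S'.cn m l y"
  using S'.X.io_kernel[of m] by blast
 \<comment> \<open>The choice is harmless: any two representatives at stage m have become equal at
   stage l.\<close>
 define al where "al x = S'.cn m l (SOME y. R m x y)" for x
 have al: "al x = S'.cn m l y" if "R m x y" for x y
 proof -
  define z where "z = (SOME y. R m x y)"
  have "R m x z" unfolding z_def using that by (rule someI)
  hence "S'.cn m l z = S'.cn m l y" using that by (intro inj) (simp_all add: R_def)
  thus ?thesis by (simp add: al_def z_def)
 qed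
 have mj: "jC <= m" "jA <= m" by (simp_all add: m_def)
 have ex: "EX y. R m x y" if "x:C (ns k)" for x using jC[OF mj(1) that] by blast
 note h = shomD[OF S'.X.cn_shom[OF l]]
 have sh: "shom (C (ns k)) al" unfolding shom_def
 proof (intro ballI conjI allI)
  fix x c assume x: "x:C (ns k)"
  then obtain y where y: "R m x y" using ex by blast
  hence yC: "y:C (ns' m)" by (simp add: R_def)
  show "al (star x) = star (al x)" "al (cscale c x) = cscale c (al x)"
   using al[OF Rop(1)[OF y x]] al[OF Rop(2)[OF y x]] al[OF y] h(1,2)[OF yC] by simp_all
  fix z assume z: "z:C (ns k)"
  then obtain w where w: "R m z w" using ex by blast
  hence wC: "w:C (ns' m)" by (simp add: R_def)
  show "al (x + z) = al x + al z" "al (x * z) = al x * al z"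
   using al[OF Rop2(1)[OF y x w z]] al[OF Rop2(2)[OF y x w z]] al[OF y] al[OF w] h(4,5)[OF yC wC] by simp_all
 qed
 have alC: "al x:C (ns' l) & S'.X.io l (al x) = p (S.X.io k x)" if "x:C (ns k)" for x
 proof -
  obtain y where y: "R m x y" using ex[OF \<open>x:C (ns k)\<close>] by blast
  show ?thesis using Rup[OF y l] unfolding al[OF y] by (simp add: R_def)
 qed
 have alA: "al x:A (ns' l)" if x: "x:A (ns k)" for x
 proof -
  obtain y where y: "y:A (ns' m)" "R m x y" using jA[OF mj(2) x] by blast
  show ?thesis unfolding al[OF y(2)] by (rule S'.X.cn_P[OF l y(1)])
 qed
 have "hom (ns k) al" unfolding hom_def using sh alC alA mats_full by blast
 hence "lifts p k l al" unfolding lifts_def using alC alA by blast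
 moreover have "q <= l" using l by (simp add: m_def)
 ultimately show ?thesis by blast
qed

text \<open>The composite of bt with a lift and the connecting map have the same image in the limit,
  hence they agree at the stage given by \<open>io_kernel\<close>. Here the triangle commutes
  exactly after a mere push-forward, without a unitary correction.\<close>

lemma exists_lift_after:
 assumes p: "star_hom S.X.L S'.X.L p" "p ` alg S.X.L <= alg S'.X.L"
  and bt: "!!y. y:C (ns' j) ==> bt y:C (ns k)" "!!y. y:C (ns' j) ==> p (S.X.io k (bt y)) = S'.X.io j y"
 shows "EX m>q. \<exists>al. lifts p k m al & (ALL y:A (ns' j). al (bt y) = S'.cn j m y)"
proof -
 obtain m al where m: "m >= max j (Suc q)" and "lifts p k m al" using exists_lift[OF p] by blast
 hence al: "hom (ns k) al" "al ` A (ns k) <= A (ns' m)" "!!x. x:C (ns k) ==> S'.X.io m (al x) = p (S.X.io k x)"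
  by (simp_all add: lifts_def)
 have jm: "j <= m" using m by simp
 obtain l where l: "m <= l" and inj: "!!x y. x:C (ns' m) ==> y:C (ns' m) ==> S'.X.io m x = S'.X.io m y ==> S'.cn m l x = S'.cn m l y"
  using S'.X.io_kernel[of m] by blast
 note alC = hom_range[OF al(1,2)]
 define al' where "al' x = S'.cn m l (al x)" for x
 have al'C: "al' x:C (ns' l)" if "x:C (ns k)" for x unfolding al'_def by (rule S'.X.cn_S[OF l alC[OF that]])
 have al'A: "al' x:A (ns' l)" if "x:A (ns k)" for x unfolding al'_def using S'.X.cn_P[OF l] al(2) that by blast
 have "shom (C (ns k)) al'" unfolding al'_def[abs_def] by (rule shom_comp[OF homD(1)[OF al(1)] alC S'.X.cn_shom[OF l]])
 hence "hom (ns k) al'" unfolding hom_def using al'C al'A mats_full by blast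
 moreover have "S'.X.io l (al' x) = p (S.X.io k x)" if "x:C (ns k)" for x
  unfolding al'_def S'.X.io_cn[OF l] by (rule al(3)[OF that])
 ultimately have "lifts p k l al'" unfolding lifts_def using al'A by blast
 moreover have "al' (bt y) = S'.cn j l y" if "y:A (ns' j)" for y
 proof -
  have y: "y:C (ns' j)" using that A_sub_C by blast
  have "S'.X.io m (al (bt y)) = S'.X.io m (S'.cn j m y)" using al(3)[OF bt(1)[OF y]] bt(2)[OF y] S'.X.io_cn[OF jm] by simp
  from inj[OF alC[OF bt(1)[OF y]] S'.X.cn_S[OF jm y] this] show ?thesis
   by (simp add: al'_def conn_trans[OF jm l])
 qed
 moreover have "q < l" using m l by simp
 ultimately show ?thesis by blast
qed

text \<open>The isomorphism and its inverse both preserve the algebraic limits, so lifts exist in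
  both directions and can be chosen alternately.\<close>

lemma intertwining_of_limits:
 assumes "star_extendibly_isomorphic (limit_algebra E ns ph) (limit_algebra E ns' ph')"
 shows "EX n m al bt. intertwining ns g ns' g' n m al bt"
proof -
 interpret R: dsys_pair E F ns' ph' g' ns ph g by unfold_locales
 obtain p where p: "star_hom S.X.L S'.X.L p" "bij_betw p (cstar S.X.L) (cstar S'.X.L)" "bij_betw p (alg S.X.L) (alg S'.X.L)"
  using star_extendibly_isomorphicE[OF assms[unfolded limit_algebra_def]] .
 let ?q = "inv_into (cstar S.X.L) p"
 have q: "star_hom S'.X.L S.X.L ?q" by (rule star_hom_inverse[OF S.X.star_closed_L p(1,2)])
 have pA: "p ` alg S.X.L <= alg S'.X.L" using p(3) by (simp add: bij_betw_def)
 have qA: "?q ` alg S'.X.L <= alg S.X.L"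
  using bij_betw_inv_into_alg[OF S.X.star_closed_L p(2,3)] by (simp add: bij_betw_def)
 let ?P = "%k m k' al bt. ALL x:A (ns k). bt (al x) = S.cn k k' x"
 let ?Q = "%m k m' bt al. ALL x:A (ns' m). al (bt x) = S'.cn m m' x"
 have "EX n m al bt. ALL i. n i < m i & m i < n (Suc i) & lifts p (n i) (m i) (al i) & R.lifts ?q (m i) (n (Suc i)) (bt i) \<and>
  ?P (n i) (m i) (n (Suc i)) (al i) (bt i) & ?Q (m i) (n (Suc i)) (m (Suc i)) (bt i) (al (Suc i))"
 proof (rule zigzag)
  obtain m al where "m >= 1" "lifts p 0 m al" using exists_lift[OF p(1) pA] by blast
  thus "EX m al. 0 < m & lifts p 0 m al" by (intro exI[of _ m] exI[of _ al]) simp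
 next
  fix k m al assume "lifts p k m al"
  hence al: "hom (ns k) al" "al ` A (ns k) <= A (ns' m)" "!!x. x:C (ns k) ==> S'.X.io m (al x) = p (S.X.io k x)"
   by (simp_all add: lifts_def)
  have "?q (S'.X.io m (al x)) = S.X.io k x" if "x:C (ns k)" for x
   unfolding al(3)[OF that] by (rule bij_betw_inv_into_left[OF p(2) S.X.io_in(1)[OF that]])
  from R.exists_lift_after[OF q qA hom_range[OF al(1,2)] this]
  show "EX k'>m. \<exists>bt. R.lifts ?q m k' bt & ?P k m k' al bt" by blast
 next
  fix m k bt assume "R.lifts ?q m k bt"
  hence bt: "hom (ns' m) bt" "bt ` A (ns' m) <= A (ns k)" "!!x. x:C (ns' m) ==> S.X.io k (bt x) = ?q (S'.X.io m x)"
   by (simp_all add: R.lifts_def)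
  have "p (S.X.io k (bt y)) = S'.X.io m y" if "y:C (ns' m)" for y
   unfolding bt(3)[OF that] by (rule bij_betw_inv_into_right[OF p(2) S'.X.io_in(1)[OF that]])
  from exists_lift_after[OF p(1) pA hom_range[OF bt(1,2)] this]
  show "EX m'>k. \<exists>al. lifts p k m' al & ?Q m k m' bt al" by blast
 qed
 then obtain n m al bt where *: "!!i. n i < m i & m i < n (Suc i) & lifts p (n i) (m i) (al i) & R.lifts ?q (m i) (n (Suc i)) (bt i) \<and>
  ?P (n i) (m i) (n (Suc i)) (al i) (bt i) & ?Q (m i) (n (Suc i)) (m (Suc i)) (bt i) (al (Suc i))" by blast
 hence "intertwining ns g ns' g' n m al bt" unfolding intertwining_def lifts_def R.lifts_def by simp
 thus ?thesis by blast
qed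

text \<open>Along the stages \<open>n i\<close> and \<open>m i\<close> the intertwining has the
  shape that \<open>functorial\<close> demands, one crossover in each direction per stage. The
  sequences it returns thin out the stages further, and the new crossover maps are old ones followed
  by connecting maps.\<close>

lemma tilde_of_intertwining:
 assumes fn: "functorial E F" and I: "intertwining ns g ns' g' n m al bt"
 shows "EX n m al bt. intertwining ns g ns' g' n m al bt & (ALL i t. t < S.r (n i) --> (%x. al i (mv 0 t x)):T1) \<and>
  (ALL i t. t < S'.r (m i) --> (%x. bt i (mv 0 t x)):T1)"
proof -
 have nm: "n i < m i" "m i < n (Suc i)" and al: "hom (ns (n i)) (al i)" "al i ` A (ns (n i)) <= A (ns' (m i))"
  and bt: "hom (ns' (m i)) (bt i)" "bt i ` A (ns' (m i)) <= A (ns (n (Suc i)))"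
  and btal: "!!x. x:A (ns (n i)) ==> bt i (al i x) = S.cn (n i) (n (Suc i)) x"
  and albt: "!!x. x:A (ns' (m i)) ==> al (Suc i) (bt i x) = S'.cn (m i) (m (Suc i)) x" for i
  using I by (simp_all add: intertwining_def)
 have mono: "strict_mono n" "strict_mono m"
  unfolding strict_mono_Suc_iff using order_less_trans[OF nm(1) nm(2)] order_less_trans[OF nm(2) nm(1)] by simp_all
 have le: "i <= j ==> n i <= n j" "i <= j ==> m i <= m j" for i j
  using mono by (simp_all add: strict_mono_less_eq)
 have alA: "al i x:A (ns' (m i))" if "x:A (ns (n i))" for i x using al(2) that by blast
 have btA: "bt i x:A (ns (n (Suc i)))" if "x:A (ns' (m i))" for i x using bt(2) that by blast
 \<comment> \<open>Crossover maps commute with connecting maps over several stages; this reduces the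
   new triangles to the old ones.\<close>
 have push: "S'.cn (m i) (m j) (al i x) = al j (S.cn (n i) (n j) x)" if ij: "i <= j" and x: "x:A (ns (n i))" for i j x
  using ij
 proof (induction j rule: dec_induct)
  case (step j)
  note l = le[OF step.hyps(1)] and l' = le[of j "Suc j", simplified]
  have y: "S.cn (n i) (n j) x:A (ns (n j))" using S.X.cn_P[OF l(1) x] .
  have "S'.cn (m i) (m (Suc j)) (al i x) = S'.cn (m j) (m (Suc j)) (al j (S.cn (n i) (n j) x))"
   using step.IH by (simp flip: conn_trans[OF l(2) l'(2)])
  also have "... = al (Suc j) (S.cn (n i) (n (Suc j)) x)"
   using albt[OF alA[OF y]] btal[OF y] conn_trans[OF l(1) l'(1)] by metis
  finally show ?case .
 qed simp
 have sys: "direct_system E F (%i. ms (a i)) (%i. elift (connecting h (a i) (a (Suc i))))" and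
  conn: "!!i j x. i <= j ==> connecting (%i. elift (connecting h (a i) (a (Suc i)))) i j (ent x) = ent (connecting h (a i) (a j) x)"
  if D: "dsys E F ms xi h" and a: "!!i. a i <= a (Suc i)" for ms xi h a
 proof -
  interpret D: dsys E F ms xi h by (rule D)
  show "direct_system E F (%i. ms (a i)) (%i. elift (connecting h (a i) (a (Suc i))))"
   unfolding direct_system_def tilde_iff[OF D.valid D.valid]
  proof (intro allI conjI D.valid exI)
   fix i
   show "rep_by (ms (a i)) (D.cn (a i) (a (Suc i))) (elift (D.cn (a i) (a (Suc i))))"
    by (rule rep_by_elift[OF D.cn_hom[OF a]])
   show "D.cn (a i) (a (Suc i)) ` A (ms (a i)) <= A (ms (a (Suc i)))" by (rule D.cn_A[OF a])
   show "t < length (ms (a i)) --> (%x. D.cn (a i) (a (Suc i)) (mv 0 t x)):T1" for t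
    using D.cn_stable[OF a] by (simp add: smap_def)
  qed
  fix i j x assume "i <= (j::nat)"
  thus "connecting (%i. elift (connecting h (a i) (a (Suc i)))) i j (ent x) = ent (connecting h (a i) (a j) x)"
  proof (induction j rule: dec_induct)
   case (step j)
   have "a i <= a j" by (rule lift_Suc_mono_le[of a, OF a step.hyps(1)])
   thus ?case using step by (simp add: conn_Suc conn_trans[OF _ a])
  qed simp
 qed
 let ?ps = "%i. elift (S.cn (n i) (n (Suc i)))" and ?ps' = "%i. elift (S'.cn (m i) (m (Suc i)))"
 have inc: "n i <= n (Suc i)" "m i <= m (Suc i)" for i using le by simp_all
 have sys1: "direct_system E F (%i. ns (n i)) ?ps" "direct_system E F (%i. ns' (m i)) ?ps'"
  by (rule sys[OF S.dsys_axioms], rule inc, rule sys[OF S'.dsys_axioms], rule inc)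
 have conn1: "connecting ?ps i j (ent x) = ent (S.cn (n i) (n j) x)" if "i <= j" for i j x
  by (rule conn[OF S.dsys_axioms _ that]) (rule inc)
 have conn2: "connecting ?ps' i j (ent x) = ent (S'.cn (m i) (m j) x)" if "i <= j" for i j x
  by (rule conn[OF S'.dsys_axioms _ that]) (rule inc)
 have "EX n' m'. ALL k. n' k <= m' k & m' k < n' (Suc k) \<and>
   connecting ?ps' (n' k) (m' k) o elift (al (n' k)):tilde_family E F (ns (n (n' k))) (ns' (m (m' k))) \<and>
   connecting ?ps (Suc (m' k)) (n' (Suc k)) o elift (bt (m' k)):tilde_family E F (ns' (m (m' k))) (ns (n (n' (Suc k))))"
 proof (rule fn[unfolded functorial_def, rule_format, of "%i. ns (n i)" ?ps "%i. ns' (m i)" ?ps' "%i. elift (al i)" "%i. elift (bt i)"],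
   intro conjI allI sys1 ballI)
  fix i
  show "star_extendible (elem E (ns (n i))) (elem E (ns' (m i))) (elift (al i))"
   "star_extendible (elem E (ns' (m i))) (elem E (ns (n (Suc i)))) (elift (bt i))"
   unfolding star_extendible_iff using rep_by_elift[OF al(1)] al(2) rep_by_elift[OF bt(1)] bt(2) by blast+
  show "elift (bt i) (elift (al i) x) = ?ps i x" if "x:alg (elem E (ns (n i)))" for x
   using that btal by (auto simp: elem_simps(1))
  show "elift (al (Suc i)) (elift (bt i) x) = ?ps' i x" if "x:alg (elem E (ns' (m i)))" for x
   using that albt by (auto simp: elem_simps(1))
 qed
 then obtain n' m' where t: "!!k. n' k <= m' k & m' k < n' (Suc k) \<and>
   connecting ?ps' (n' k) (m' k) o elift (al (n' k)):tilde_family E F (ns (n (n' k))) (ns' (m (m' k))) \<and>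
   connecting ?ps (Suc (m' k)) (n' (Suc k)) o elift (bt (m' k)):tilde_family E F (ns' (m (m' k))) (ns (n (n' (Suc k))))"
  by blast
 hence n': "n' k <= m' k" "Suc (m' k) <= n' (Suc k)" for k by (simp_all only: Suc_le_eq)
 note t1 = t[THEN conjunct2, THEN conjunct2, THEN conjunct1] and t2 = t[THEN conjunct2, THEN conjunct2, THEN conjunct2]
 define a where "a k x = S'.cn (m (n' k)) (m (m' k)) (al (n' k) x)" for k x
 define b where "b k x = S.cn (n (Suc (m' k))) (n (n' (Suc k))) (bt (m' k) x)" for k x
 \<comment> \<open>Membership in the tilde family speaks of some representing homomorphism h. It
   agrees with f on \<open>A ks\<close>, so the corners of f are equivalent to those of h and lie in
   \<open>T1\<close> as well.\<close>
 have tilde: "hom ks f & f ` A ks <= A ls & (ALL t<length ks. (%x. f (mv 0 t x)):T1)"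
  if T: "xi:tilde_family E F ks ls" and v: "valid_sizes ks" "valid_sizes ls" and f: "hom ks f"
   and eq: "!!x. x:A ks ==> xi (ent x) = ent (f x)" for xi ks ls f
 proof -
  obtain h where h: "rep_by ks h xi" "h ` A ks <= A ls" "!!t. t < length ks ==> (%x. h (mv 0 t x)):T1"
   using T unfolding tilde_iff[OF v] by blast
  have e: "h x = f x" if "x:A ks" for x using h(1) eq[OF that] that by (simp add: rep_by_def ent_inject)
  have "(%x. f (mv 0 t x)):T1" if t: "t < length ks" for t
  proof (rule T1_sim[OF h(3)[OF t] hom_comp_mv[OF f t]])
   show n: "1 <= ks ! t" using valid_sizesD[OF v(1) t] by simp
   have "mv 0 t x:A ks" if "x:A [1]" for x
    by (rule mv_mats[OF E.opr_axioms _ t]) (use mats_single_mono[OF n] that in blast)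
   thus "sim (A [1]) (%x. h (mv 0 t x)) (%x. f (mv 0 t x))"
    by (intro sim_cong[OF hom_sim_refl[OF T1_hom[OF h(3)[OF t]]]]) (simp_all add: e)
  qed
  thus ?thesis using f h(2) e by auto
 qed
 have up: "f ` A ks <= upto E (length ls)" if "f ` A ks <= A ls" for f ks ls using that mats_upto by blast
 have a: "hom (ns (n (n' k))) (a k) & a k ` A (ns (n (n' k))) <= A (ns' (m (m' k))) & (ALL t<S.r (n (n' k)). (%x. a k (mv 0 t x)):T1)" for k
 proof (rule tilde[OF t1 S.valid S'.valid])
  show "hom (ns (n (n' k))) (a k)" unfolding a_def[abs_def]
   by (rule chom_comp_hom[OF smap_chom[OF S'.cn_stable[OF le(2)[OF n'(1)]]] al(1) up[OF al(2)]])
 qed (simp add: a_def conn2[OF n'(1)])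
 have b: "hom (ns' (m (m' k))) (b k) & b k ` A (ns' (m (m' k))) <= A (ns (n (n' (Suc k)))) & (ALL t<S'.r (m (m' k)). (%x. b k (mv 0 t x)):T1)" for k
 proof (rule tilde[OF t2 S'.valid S.valid])
  show "hom (ns' (m (m' k))) (b k)" unfolding b_def[abs_def]
   by (rule chom_comp_hom[OF smap_chom[OF S.cn_stable[OF le(1)[OF n'(2)]]] bt(1) up[OF bt(2)]])
 qed (simp add: b_def conn1[OF n'(2)])
 have "intertwining ns g ns' g' (%k. n (n' k)) (%k. m (m' k)) a b" unfolding intertwining_def
 proof (intro allI conjI ballI)
  fix k
  show "n (n' k) < m (m' k)" using nm(1)[of "n' k"] le(2)[OF n'(1)[of k]] by simp
  show "m (m' k) < n (n' (Suc k))" using nm(2)[of "m' k"] le(1)[OF n'(2)[of k]] by simp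
  show "hom (ns (n (n' k))) (a k)" "a k ` A (ns (n (n' k))) <= A (ns' (m (m' k)))" using a by blast+
  show "hom (ns' (m (m' k))) (b k)" "b k ` A (ns' (m (m' k))) <= A (ns (n (n' (Suc k))))" using b by blast+
  note l = le(1)[OF n'(1)[of k]] and l' = le(1)[of "m' k" "Suc (m' k)", simplified] and l'' = le(1)[OF n'(2)[of k]]
  show "b k (a k x) = S.cn (n (n' k)) (n (n' (Suc k))) x" if x: "x:A (ns (n (n' k)))" for x
  proof -
   have y: "S.cn (n (n' k)) (n (m' k)) x:A (ns (n (m' k)))" by (rule S.X.cn_P[OF l x])
   show ?thesis unfolding a_def b_def push[OF n'(1) x] btal[OF y]
    by (simp only: conn_trans[OF l l'] conn_trans[OF order_trans[OF l l'] l''])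
  qed
  show "a (Suc k) (b k y) = S'.cn (m (m' k)) (m (m' (Suc k))) y" if y: "y:A (ns' (m (m' k)))" for y
  proof -
   note u = le(2)[of "m' k" "Suc (m' k)", simplified] and u' = le(2)[OF n'(2)[of k]] and u'' = le(2)[OF n'(1)[of "Suc k"]]
   show ?thesis unfolding a_def b_def push[OF n'(2) btA[OF y], symmetric] albt[OF y]
    by (simp only: conn_trans[OF u u'] conn_trans[OF order_trans[OF u u'] u''])
  qed
 qed
 thus ?thesis using a b by blast
qed

lemma module_iso_of_limits:
 assumes "functorial E F" "star_extendibly_isomorphic (limit_algebra E ns ph) (limit_algebra E ns' ph')"
 shows "\<exists>Ga. module_iso E F ns ph ns' ph' Ga & bij_betw Ga (dim_scale E F ns ph) (dim_scale E F ns' ph')"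
proof -
 obtain n0 m0 al0 bt0 where "intertwining ns g ns' g' n0 m0 al0 bt0" using intertwining_of_limits[OF assms(2)] by blast
 from tilde_of_intertwining[OF assms(1) this] obtain n m al bt where "intertwining ns g ns' g' n m al bt"
  "!!i t. t < S.r (n i) ==> (%x. al i (mv 0 t x)):T1" "!!i t. t < S'.r (m i) ==> (%x. bt i (mv 0 t x)):T1" by blast
 thus ?thesis by (rule module_iso_of_intertwining)
qed

lemma limits_of_module_iso:
 assumes "module_iso E F ns ph ns' ph' Ga" "bij_betw Ga (dim_scale E F ns ph) (dim_scale E F ns' ph')"
 shows "star_extendibly_isomorphic (limit_algebra E ns ph) (limit_algebra E ns' ph')"
 using intertwining_of_module_iso[OF assms] limits_isomorphic by blast

end

theorem theorem4p3:
  fixes E :: "('h::complex_hilbert \<Rightarrow>\<^sub>L 'h) set"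
    and F :: "'h family"
    and ns ns' :: "nat \<Rightarrow> nat list"
    and \<phi> \<phi>' :: "nat \<Rightarrow> 'h elt \<Rightarrow> 'h elt"
  assumes "unital_operator_algebra E" and "finitely_acting E"
    and "closed_family E F"
    and "direct_system E F ns \<phi>" and "direct_system E F ns' \<phi>'"
  shows
    "(\<forall>\<Gamma>. module_iso E F ns \<phi> ns' \<phi>' \<Gamma> \<longrightarrow>
        star_extendibly_isomorphic (stable_limit_algebra E ns \<phi>) (stable_limit_algebra E ns' \<phi>') \<and>
        (bij_betw \<Gamma> (dim_scale E F ns \<phi>) (dim_scale E F ns' \<phi>') \<longrightarrow>
           star_extendibly_isomorphic (limit_algebra E ns \<phi>) (limit_algebra E ns' \<phi>'))) \<and>
     (functorial E F \<longrightarrow>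
        (star_extendibly_isomorphic (stable_limit_algebra E ns \<phi>) (stable_limit_algebra E ns' \<phi>') \<longleftrightarrow>
           (\<exists>\<Gamma>. module_iso E F ns \<phi> ns' \<phi>' \<Gamma>)) \<and>
        (star_extendibly_isomorphic (limit_algebra E ns \<phi>) (limit_algebra E ns' \<phi>') \<longleftrightarrow>
           (\<exists>\<Gamma>. module_iso E F ns \<phi> ns' \<phi>' \<Gamma> \<and>
              bij_betw \<Gamma> (dim_scale E F ns \<phi>) (dim_scale E F ns' \<phi>'))))"
proof -
 interpret closed_fam E F
  using assms(1-3) by (intro closed_fam.intro fin_acting.intro closed_fam_axioms.intro)
 obtain g where g: "dsys E F ns \<phi> g"
  and gt: "dsys E F (%k. ts (Suc k) (ns k)) (%k. amplify (ns k) (ns (Suc k)) (\<phi> k)) g"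
  and gA: "!!k N. g k ` mats E (ts N (ns k)) <= mats E (ts N (ns (Suc k)))"
  and ga: "!!k x. x:upto E (length (ns k)) ==> amplify (ns k) (ns (Suc k)) (\<phi> k) (ent x) = ent (g k x)"
  using exists_dsys[OF assms(4)] by (elim exE conjE) blast
 obtain g' where g': "dsys E F ns' \<phi>' g'"
  and gt': "dsys E F (%k. ts (Suc k) (ns' k)) (%k. amplify (ns' k) (ns' (Suc k)) (\<phi>' k)) g'"
  and gA': "!!k N. g' k ` mats E (ts N (ns' k)) <= mats E (ts N (ns' (Suc k)))"
  and ga': "!!k x. x:upto E (length (ns' k)) ==> amplify (ns' k) (ns' (Suc k)) (\<phi>' k) (ent x) = ent (g' k x)"
  using exists_dsys[OF assms(5)] by (elim exE conjE) blast
 let ?t = "%ns k. ts (Suc k) (ns k)" and ?a = "%ns \<phi> k. amplify (ns k) (ns (Suc k)) (\<phi> k)"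
 have D: "dsys_pair E F ns \<phi> g ns' \<phi>' g'" using g g' closed_fam_axioms by (intro dsys_pair.intro)
 have Dt: "dsys_pair E F (?t ns) (?a ns \<phi>) g (?t ns') (?a ns' \<phi>') g'"
  using gt gt' closed_fam_axioms by (intro dsys_pair.intro)
 note s = dsys.stable_limit_isomorphic[OF g ga gt gA] and s' = dsys.stable_limit_isomorphic[OF g' ga' gt' gA']
 have len: "length (ts (Suc k) ks) = length ks" for k ks by simp
 note m = dim_module_sizes[OF g gt len] and m' = dim_module_sizes[OF g' gt' len]
 have sc: "dim_scale E F (?t ns) (?a ns \<phi>) = dim_module E F ns \<phi>" "dim_scale E F (?t ns') (?a ns' \<phi>') = dim_module E F ns' \<phi>'"
  using dim_scale_stable[OF g gt gA] dim_scale_stable[OF g' gt' gA'] m(1) m'(1) by simp_all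
 \<comment> \<open>The operations of the two pairs of systems are known to agree only on elements of
   the dimension modules, so \<open>\<Gamma> P\<close> must first be placed in one; hence the case
   distinction.\<close>
 have iso: "module_iso E F (?t ns) (?a ns \<phi>) (?t ns') (?a ns' \<phi>') \<Gamma> \<longleftrightarrow> module_iso E F ns \<phi> ns' \<phi>' \<Gamma>" for \<Gamma>
 proof (cases "bij_betw \<Gamma> (dim_module E F ns \<phi>) (dim_module E F ns' \<phi>')")
  case True
  have "\<Gamma> P:dim_module E F ns' \<phi>'" if "P:dim_module E F ns \<phi>" for P by (rule bij_betw_apply[OF True that])
  thus ?thesis unfolding module_iso_def m(1) m'(1) by (simp add: m(2,3) m'(2,3))
 qed (simp add: module_iso_def m(1) m'(1))
 have stable: "star_extendibly_isomorphic (stable_limit_algebra E ns \<phi>) (stable_limit_algebra E ns' \<phi>')"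
  if "module_iso E F ns \<phi> ns' \<phi>' \<Gamma>" for \<Gamma>
 proof -
  \<comment> \<open>For the stabilised systems the scales are the whole modules, so this bijection
    is part of \<open>module_iso\<close>.\<close>
  have "bij_betw \<Gamma> (dim_scale E F (?t ns) (?a ns \<phi>)) (dim_scale E F (?t ns') (?a ns' \<phi>'))"
   using that unfolding sc module_iso_def by simp
  note l = dsys_pair.limits_of_module_iso[OF Dt iso[THEN iffD2, OF that] this]
  show ?thesis by (rule star_extendibly_isomorphic_trans[OF s(2) star_extendibly_isomorphic_trans[OF l s'(1)]])
 qed
 have stable': "\<exists>\<Gamma>. module_iso E F ns \<phi> ns' \<phi>' \<Gamma>"
  if "functorial E F" "star_extendibly_isomorphic (stable_limit_algebra E ns \<phi>) (stable_limit_algebra E ns' \<phi>')"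
 proof -
  from star_extendibly_isomorphic_trans[OF s(1) star_extendibly_isomorphic_trans[OF that(2) s'(2)]]
  have "star_extendibly_isomorphic (limit_algebra E (?t ns) (?a ns \<phi>)) (limit_algebra E (?t ns') (?a ns' \<phi>'))" .
  from dsys_pair.module_iso_of_limits[OF Dt that(1) this] show ?thesis unfolding iso by (elim exE conjE) (rule exI)
 qed
 note L = dsys_pair.limits_of_module_iso[OF D] and L' = dsys_pair.module_iso_of_limits[OF D]
 show ?thesis
 proof (intro conjI allI impI iffI)
  fix \<Gamma> assume 1: "module_iso E F ns \<phi> ns' \<phi>' \<Gamma>"
  show "star_extendibly_isomorphic (stable_limit_algebra E ns \<phi>) (stable_limit_algebra E ns' \<phi>')" by (rule stable[OF 1])
  assume 2: "bij_betw \<Gamma> (dim_scale E F ns \<phi>) (dim_scale E F ns' \<phi>')"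
  show "star_extendibly_isomorphic (limit_algebra E ns \<phi>) (limit_algebra E ns' \<phi>')" by (rule L[OF 1 2])
 next
  assume f: "functorial E F"
  show "\<exists>\<Gamma>. module_iso E F ns \<phi> ns' \<phi>' \<Gamma>"
   if "star_extendibly_isomorphic (stable_limit_algebra E ns \<phi>) (stable_limit_algebra E ns' \<phi>')" by (rule stable'[OF f that])
  show "star_extendibly_isomorphic (stable_limit_algebra E ns \<phi>) (stable_limit_algebra E ns' \<phi>')"
   if "\<exists>\<Gamma>. module_iso E F ns \<phi> ns' \<phi>' \<Gamma>" using that by (elim exE) (rule stable)
  show "\<exists>\<Gamma>. module_iso E F ns \<phi> ns' \<phi>' \<Gamma> & bij_betw \<Gamma> (dim_scale E F ns \<phi>) (dim_scale E F ns' \<phi>')"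
   if "star_extendibly_isomorphic (limit_algebra E ns \<phi>) (limit_algebra E ns' \<phi>')" by (rule L'[OF f that])
  show "star_extendibly_isomorphic (limit_algebra E ns \<phi>) (limit_algebra E ns' \<phi>')"
   if "\<exists>\<Gamma>. module_iso E F ns \<phi> ns' \<phi>' \<Gamma> & bij_betw \<Gamma> (dim_scale E F ns \<phi>) (dim_scale E F ns' \<phi>')"
   using that by (elim exE conjE) (rule L)
 qed
qed

end
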